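(* Let $Y$ be a paracompact topological space and $\mathcal{X}$ a paratopological stack. Let $X$ be a classifying space for $\mathcal{X}$ with $\varphi\colon X\to\mathcal{X}$ weakly parashrinkable. Then $\mathrm{Map}(Y,X)$ is a classifying space for $\mathrm{Map}(Y,\mathcal{X})$; hence it represents the weak homotopy type of $\mathrm{Map}(Y,\mathcal{X})$.
   Context: All topological spaces are assumed compactly generated; $\mathsf{CGTop}$ is the category of compactly generated spaces, and all stacks are stacks (in groupoids) over $\mathsf{CGTop}$ for the topology of open covers. A morphism $f\colon\mathcal{X}\to\mathcal{Y}$ of stacks is representable if for every topological space $T$ and morphism $T\to\mathcal{Y}$ the fiber product $T\times_{\mathcal{Y}}\mathcal{X}$ is equivalent to a topological space. A representable morphism is a universal weak equivalence if every such base extension $T\times_{\mathcal{Y}}\mathcal{X}\to T$ is a weak equivalence of topological spaces. For a stack $\mathcal{X}$ with representable diagonal, a classifying space is a topological space $X$ equipped with a universal weak equivalence $\varphi\colon X\to\mathcal{X}$; the weak homotopy type of $\mathcal{X}$ is that of $X$. A stack $\mathcal{X}$ is paratopological if: (A1) every map $T\to\mathcal{X}$ from a topological space $T$ is representable (equivalently, the diagonal of $\mathcal{X}$ is representable); and (A2) there exists a morphism $X_0\to\mathcal{X}$ from a topological space $X_0$ such that for every morphism $T\to\mathcal{X}$ with $T$ paracompact, the base extension $T\times_{\mathcal{X}}X_0\to T$ is an epimorphism (i.e., admits local sections). The mapping stack $\mathrm{Map}(\mathcal{Y},\mathcal{X})$ is the stack $T\mapsto\mathrm{Hom}(T\times\mathcal{Y},\mathcal{X})$,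 where $\mathrm{Hom}$ is the groupoid of stack morphisms; for spaces it is represented by the usual mapping space (compact-open topology). A representable morphism $f\colon\mathcal{X}\to\mathcal{Y}$ is weakly parashrinkable if for every paracompact space $T$ and every morphism $p\colon T\to\mathcal{Y}$, the space $\mathrm{Map}_p(T,\mathcal{X})$ of lifts of $p$ to $\mathcal{X}$ (the fiber of $f_*\colon\mathrm{Map}(T,\mathcal{X})\to\mathrm{Map}(T,\mathcal{Y})$ over the point corresponding to $p$; equivalently, the space of sections of $T\times_{\mathcal{Y}}\mathcal{X}\to T$) is weakly contractible and non-empty. *)

theory Defs
  imports "HOL-Analysis.Analysis"
begin

section \<open>Universe and compactly generated spaces\<close>

text \<open>
  The type \<open>'u\<close> plays the role of a Grothendieck universe: a set is small if its cardinality is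
  strictly below that of \<open>'u\<close>, and the predicate below says that this cardinality is
  (strongly) inaccessible. Up to homeomorphism every small space lives on a subset of \<open>'u\<close>, so
  the site of small compactly generated spaces has as objects topologies of type \<open>'u topology\<close>.
\<close>

definition grothendieck_universe :: "'u itself \<Rightarrow> bool" where
  "grothendieck_universe _ \<longleftrightarrow>
     (UNIV :: nat set) \<prec> (UNIV :: 'u set) \<and>
     (\<forall>A :: 'u set. A \<prec> (UNIV :: 'u set) \<longrightarrow> Pow A \<prec> (UNIV :: 'u set)) \<and>
     (\<forall>(A :: 'u set) (F :: 'u \<Rightarrow> 'u set).
        A \<prec> (UNIV :: 'u set) \<longrightarrow> (\<forall>a\<in>A. F a \<prec> (UNIV :: 'u set)) \<longrightarrow>
        (\<Union>a\<in>A. F a) \<prec> (UNIV :: 'u set))"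

definition small :: "'u itself \<Rightarrow> 'a set \<Rightarrow> bool" where
  "small _ A \<longleftrightarrow> A \<prec> (UNIV :: 'u set)"

definition test_space :: "'u topology \<Rightarrow> bool" where
  "test_space K \<longleftrightarrow> small TYPE('u) (topspace K) \<and> compact_space K \<and> Hausdorff_space K"

text \<open>
  \<open>k_open\<close>: openness detected by continuous maps from compact Hausdorff spaces. No separation axiom
  is part of compact generation. (The library's \<open>k_space\<close> tests on compact subspaces that need
  not be Hausdorff, which is a different condition for non-Hausdorff spaces.)
\<close>

definition k_open :: "'u itself \<Rightarrow> 'a topology \<Rightarrow> 'a set \<Rightarrow> bool" where
  "k_open _ X U \<longleftrightarrow> U \<subseteq> topspace X \<and>
     (\<forall>(K :: 'u topology) u. test_space K \<longrightarrow> continuous_map K X u \<longrightarrow>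
        openin K {k \<in> topspace K. u k \<in> U})"

lemma istopology_k_open: "istopology (k_open TYPE('u) X)"
proof -
  have 1: "k_open TYPE('u) X (S \<inter> T)" if "k_open TYPE('u) X S" "k_open TYPE('u) X T" for S T
    unfolding k_open_def
  proof (intro conjI allI impI)
    show "S \<inter> T \<subseteq> topspace X" using that by (auto simp: k_open_def)
    fix K :: "'u topology" and u
    assume "test_space K" "continuous_map K X u"
    then have "openin K ({k \<in> topspace K. u k \<in> S} \<inter> {k \<in> topspace K. u k \<in> T})"
      using that by (intro openin_Int) (auto simp: k_open_def)
    moreover have "{k \<in> topspace K. u k \<in> S} \<inter> {k \<in> topspace K. u k \<in> T}
        = {k \<in> topspace K. u k \<in> S \<inter> T}" by auto
    ultimately show "openin K {k \<in> topspace K. u k \<in> S \<inter> T}" by simp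
  qed
  have 2: "k_open TYPE('u) X (\<Union>\<S>)" if "\<forall>S\<in>\<S>. k_open TYPE('u) X S" for \<S>
    unfolding k_open_def
  proof (intro conjI allI impI)
    show "\<Union>\<S> \<subseteq> topspace X" using that by (auto simp: k_open_def)
    fix K :: "'u topology" and u
    assume "test_space K" "continuous_map K X u"
    then have "openin K (\<Union>S\<in>\<S>. {k \<in> topspace K. u k \<in> S})"
      using that by (intro openin_Union) (auto simp: k_open_def)
    moreover have "(\<Union>S\<in>\<S>. {k \<in> topspace K. u k \<in> S}) = {k \<in> topspace K. u k \<in> \<Union>\<S>}"
      by auto
    ultimately show "openin K {k \<in> topspace K. u k \<in> \<Union>\<S>}" by simp
  qed
  show ?thesis unfolding istopology_def using 1 2 by blast
qed

definition kelleyfication :: "'u itself \<Rightarrow> 'a topology \<Rightarrow> 'a topology" where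
  "kelleyfication u X = topology (k_open u X)"

lemma openin_kelleyfication: "openin (kelleyfication TYPE('u) X) U \<longleftrightarrow> k_open TYPE('u) X U"
  by (simp add: kelleyfication_def istopology_k_open topology_inverse')

definition cg_space :: "'u itself \<Rightarrow> 'a topology \<Rightarrow> bool" where
  "cg_space u X \<longleftrightarrow> small u (topspace X) \<and> (\<forall>U. k_open u X U \<longrightarrow> openin X U)"

definition paracompact_space :: "'a topology \<Rightarrow> bool" where
  "paracompact_space X \<longleftrightarrow> Hausdorff_space X \<and>
     (\<forall>\<U>. (\<forall>U\<in>\<U>. openin X U) \<and> \<Union>\<U> = topspace X \<longrightarrow>
        (\<exists>\<V>. (\<forall>V\<in>\<V>. openin X V \<and> (\<exists>U\<in>\<U>. V \<subseteq> U)) \<and> \<Union>\<V> = topspace X \<and>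
             locally_finite_in X \<V>))"

definition cmaps :: "'a topology \<Rightarrow> 'b topology \<Rightarrow> ('a \<Rightarrow> 'b) set" where
  "cmaps X Y = {f \<in> extensional (topspace X). continuous_map X Y f}"

definition idmap :: "'a topology \<Rightarrow> 'a \<Rightarrow> 'a" where
  "idmap X = (\<lambda>x\<in>topspace X. x)"

text \<open>
  The compact-open topology is formed with compact subsets of the source; it is only applied below
  to Hausdorff (paracompact) sources. Its underlying set is \<open>cmaps Y X\<close> (take \<open>K = {}\<close>). As
  always in compactly generated spaces, limits and mapping spaces are made compactly generated.
\<close>

definition compact_open_topology :: "'a topology \<Rightarrow> 'b topology \<Rightarrow> ('a \<Rightarrow> 'b) topology" where
  "compact_open_topology Y X =
     topology_generated_by {{f \<in> cmaps Y X. f ` K \<subseteq> U} | K U. compactin Y K \<and> openin X U}"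

definition mapping_space :: "'u topology \<Rightarrow> 'b topology \<Rightarrow> ('u \<Rightarrow> 'b) topology" where
  "mapping_space Y X = kelleyfication TYPE('u) (compact_open_topology Y X)"

definition section_space :: "'z topology \<Rightarrow> 'u topology \<Rightarrow> ('z \<Rightarrow> 'u) \<Rightarrow> ('u \<Rightarrow> 'z) topology" where
  "section_space Z T q =
     kelleyfication TYPE('u)
       (subtopology (mapping_space T Z) {s. \<forall>t\<in>topspace T. q (s t) = t})"

definition admits_local_sections :: "'z topology \<Rightarrow> 't topology \<Rightarrow> ('z \<Rightarrow> 't) \<Rightarrow> bool" where
  "admits_local_sections Z T q \<longleftrightarrow>
     (\<forall>t\<in>topspace T. \<exists>U s. openin T U \<and> t \<in> U \<and> continuous_map (subtopology T U) Z s \<and>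
        (\<forall>x\<in>U. q (s x) = x))"


section \<open>Weak equivalences of spaces\<close>

definition unit_cube :: "nat \<Rightarrow> (nat \<Rightarrow> real) topology" where
  "unit_cube n = product_topology (\<lambda>_. top_of_set {0..1}) {..<n}"

definition based_at :: "nat \<Rightarrow> 'a \<Rightarrow> ((nat \<Rightarrow> real) \<Rightarrow> 'a) \<Rightarrow> bool" where
  "based_at n x g \<longleftrightarrow> (\<forall>t\<in>topspace (unit_cube n). (\<exists>i<n. t i = 0 \<or> t i = 1) \<longrightarrow> g t = x)"

definition spheroids :: "nat \<Rightarrow> 'a topology \<Rightarrow> 'a \<Rightarrow> ((nat \<Rightarrow> real) \<Rightarrow> 'a) set" where
  "spheroids n X x = {g. continuous_map (unit_cube n) X g \<and> based_at n x g}"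

definition spheroid_class ::
  "nat \<Rightarrow> 'a topology \<Rightarrow> 'a \<Rightarrow> ((nat \<Rightarrow> real) \<Rightarrow> 'a) \<Rightarrow> ((nat \<Rightarrow> real) \<Rightarrow> 'a) set" where
  "spheroid_class n X x g = {h. homotopic_with (based_at n x) (unit_cube n) X g h}"

definition homotopy_set :: "nat \<Rightarrow> 'a topology \<Rightarrow> 'a \<Rightarrow> ((nat \<Rightarrow> real) \<Rightarrow> 'a) set set" where
  "homotopy_set n X x = spheroid_class n X x ` spheroids n X x"

definition induced_pi ::
  "nat \<Rightarrow> 'b topology \<Rightarrow> ('a \<Rightarrow> 'b) \<Rightarrow> 'a \<Rightarrow> ((nat \<Rightarrow> real) \<Rightarrow> 'a) set \<Rightarrow> ((nat \<Rightarrow> real) \<Rightarrow> 'b) set"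
where
  "induced_pi n Y f x C = (\<Union>g\<in>C. spheroid_class n Y (f x) (f \<circ> g))"

definition induced_pi0 :: "'b topology \<Rightarrow> ('a \<Rightarrow> 'b) \<Rightarrow> 'a set \<Rightarrow> 'b set" where
  "induced_pi0 Y f C = (\<Union>c\<in>C. path_component_of_set Y (f c))"

text \<open>
  For \<open>n \<ge> 1\<close> the induced map of homotopy groups is always a homomorphism, so it is an
  isomorphism as soon as it is bijective; the group structure is therefore not needed here.
\<close>

definition weak_equivalence :: "'a topology \<Rightarrow> 'b topology \<Rightarrow> ('a \<Rightarrow> 'b) \<Rightarrow> bool" where
  "weak_equivalence X Y f \<longleftrightarrow> continuous_map X Y f \<and>
     bij_betw (induced_pi0 Y f) (path_components_of X) (path_components_of Y) \<and>
     (\<forall>x\<in>topspace X. \<forall>n\<ge>1.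
        bij_betw (induced_pi n Y f x) (homotopy_set n X x) (homotopy_set n Y (f x)))"

definition weakly_contractible :: "'a topology \<Rightarrow> bool" where
  "weakly_contractible X \<longleftrightarrow> weak_equivalence X (discrete_topology {()}) (\<lambda>_. ())"

text \<open>
  Two spaces have the same weak homotopy type iff they are joined by a zigzag of weak equivalences,
  equivalently (CW approximation) by a single span.
\<close>

definition same_weak_homotopy_type :: "'u itself \<Rightarrow> 'a topology \<Rightarrow> 'b topology \<Rightarrow> bool" where
  "same_weak_homotopy_type _ X Y \<longleftrightarrow>
     (\<exists>(W :: 'u topology) f g. cg_space TYPE('u) W \<and>
        weak_equivalence W X f \<and> weak_equivalence W Y g)"


section \<open>Categories fibered in groupoids over compactly generated spaces\<close>

text \<open>
  \<open>cmp \<X> b a\<close> is the composite of \<open>a\<close> followed by \<open>b\<close>. The projection to the site sends an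
  object \<open>x\<close> to the space \<open>base \<X> x\<close> and an arrow \<open>a\<close> to the map \<open>bmap \<X> a\<close>. The fibres may
  be large: \<open>'o\<close> and \<open>'m\<close> are arbitrary types. All functions are extensional, so that equality of
  maps, functors and transformations is equality in HOL.
\<close>

record ('u, 'o, 'm) fibcat =
  Ob :: "'o set"
  Ar :: "'m set"
  src :: "'m \<Rightarrow> 'o"
  tgt :: "'m \<Rightarrow> 'o"
  ident :: "'o \<Rightarrow> 'm"
  cmp :: "'m \<Rightarrow> 'm \<Rightarrow> 'm"
  base :: "'o \<Rightarrow> 'u topology"
  bmap :: "'m \<Rightarrow> 'u \<Rightarrow> 'u"

definition is_category :: "('u, 'o, 'm) fibcat \<Rightarrow> bool" where
  "is_category \<X> \<longleftrightarrow>
     (\<forall>a\<in>Ar \<X>. src \<X> a \<in> Ob \<X> \<and> tgt \<X> a \<in> Ob \<X>) \<and>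
     (\<forall>x\<in>Ob \<X>. ident \<X> x \<in> Ar \<X> \<and> src \<X> (ident \<X> x) = x \<and> tgt \<X> (ident \<X> x) = x) \<and>
     (\<forall>a\<in>Ar \<X>. \<forall>b\<in>Ar \<X>. src \<X> b = tgt \<X> a \<longrightarrow>
        cmp \<X> b a \<in> Ar \<X> \<and> src \<X> (cmp \<X> b a) = src \<X> a \<and> tgt \<X> (cmp \<X> b a) = tgt \<X> b) \<and>
     (\<forall>a\<in>Ar \<X>. cmp \<X> a (ident \<X> (src \<X> a)) = a \<and> cmp \<X> (ident \<X> (tgt \<X> a)) a = a) \<and>
     (\<forall>a\<in>Ar \<X>. \<forall>b\<in>Ar \<X>. \<forall>c\<in>Ar \<X>. src \<X> b = tgt \<X> a \<longrightarrow> src \<X> c = tgt \<X> b \<longrightarrow>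
        cmp \<X> c (cmp \<X> b a) = cmp \<X> (cmp \<X> c b) a)"

definition projects_to_site :: "('u, 'o, 'm) fibcat \<Rightarrow> bool" where
  "projects_to_site \<X> \<longleftrightarrow>
     (\<forall>x\<in>Ob \<X>. cg_space TYPE('u) (base \<X> x) \<and> bmap \<X> (ident \<X> x) = idmap (base \<X> x)) \<and>
     (\<forall>a\<in>Ar \<X>. bmap \<X> a \<in> cmaps (base \<X> (src \<X> a)) (base \<X> (tgt \<X> a))) \<and>
     (\<forall>a\<in>Ar \<X>. \<forall>b\<in>Ar \<X>. src \<X> b = tgt \<X> a \<longrightarrow>
        bmap \<X> (cmp \<X> b a) = compose (topspace (base \<X> (src \<X> a))) (bmap \<X> b) (bmap \<X> a))"

definition fibered_in_groupoids :: "('u, 'o, 'm) fibcat \<Rightarrow> bool" where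
  "fibered_in_groupoids \<X> \<longleftrightarrow> is_category \<X> \<and> projects_to_site \<X> \<and>
     (\<forall>x\<in>Ob \<X>. \<forall>T f. cg_space TYPE('u) T \<longrightarrow> f \<in> cmaps T (base \<X> x) \<longrightarrow>
        (\<exists>a\<in>Ar \<X>. tgt \<X> a = x \<and> base \<X> (src \<X> a) = T \<and> bmap \<X> a = f)) \<and>
     (\<forall>a\<in>Ar \<X>. \<forall>b\<in>Ar \<X>. \<forall>g. tgt \<X> b = tgt \<X> a \<longrightarrow>
        g \<in> cmaps (base \<X> (src \<X> b)) (base \<X> (src \<X> a)) \<longrightarrow>
        compose (topspace (base \<X> (src \<X> b))) (bmap \<X> a) g = bmap \<X> b \<longrightarrow>
        (\<exists>!c. c \<in> Ar \<X> \<and> src \<X> c = src \<X> b \<and> tgt \<X> c = src \<X> a \<and> bmap \<X> c = g \<and>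
              cmp \<X> a c = b))"

type_synonym ('o, 'm, 'p, 'n) fibfun = "('o \<Rightarrow> 'p) \<times> ('m \<Rightarrow> 'n)"

definition fib_morphism ::
  "('u, 'o, 'm) fibcat \<Rightarrow> ('u, 'p, 'n) fibcat \<Rightarrow> ('o, 'm, 'p, 'n) fibfun \<Rightarrow> bool" where
  "fib_morphism \<X> \<Y> F \<longleftrightarrow>
     fst F \<in> extensional (Ob \<X>) \<and> snd F \<in> extensional (Ar \<X>) \<and>
     (\<forall>x\<in>Ob \<X>. fst F x \<in> Ob \<Y> \<and> base \<Y> (fst F x) = base \<X> x \<and>
        snd F (ident \<X> x) = ident \<Y> (fst F x)) \<and>
     (\<forall>a\<in>Ar \<X>. snd F a \<in> Ar \<Y> \<and> src \<Y> (snd F a) = fst F (src \<X> a) \<and>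
        tgt \<Y> (snd F a) = fst F (tgt \<X> a) \<and> bmap \<Y> (snd F a) = bmap \<X> a) \<and>
     (\<forall>a\<in>Ar \<X>. \<forall>b\<in>Ar \<X>. src \<X> b = tgt \<X> a \<longrightarrow>
        snd F (cmp \<X> b a) = cmp \<Y> (snd F b) (snd F a))"

definition fib_id :: "('u, 'o, 'm) fibcat \<Rightarrow> ('o, 'm, 'o, 'm) fibfun" where
  "fib_id \<X> = (\<lambda>x\<in>Ob \<X>. x, \<lambda>a\<in>Ar \<X>. a)"

text \<open>The first argument of \<open>fib_comp\<close> is the source of the composite.\<close>

definition fib_comp ::
  "('u, 'o, 'm) fibcat \<Rightarrow> ('p, 'n, 'q, 'k) fibfun \<Rightarrow> ('o, 'm, 'p, 'n) fibfun \<Rightarrow>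
   ('o, 'm, 'q, 'k) fibfun" where
  "fib_comp \<X> G F = (\<lambda>x\<in>Ob \<X>. fst G (fst F x), \<lambda>a\<in>Ar \<X>. snd G (snd F a))"

text \<open>
  Transformations over the identity of the site. When the target is fibered in groupoids they are
  invertible.
\<close>

definition two_morphism ::
  "('u, 'o, 'm) fibcat \<Rightarrow> ('u, 'p, 'n) fibcat \<Rightarrow>
   ('o, 'm, 'p, 'n) fibfun \<Rightarrow> ('o, 'm, 'p, 'n) fibfun \<Rightarrow> ('o \<Rightarrow> 'n) \<Rightarrow> bool" where
  "two_morphism \<X> \<Y> F G \<eta> \<longleftrightarrow> \<eta> \<in> extensional (Ob \<X>) \<and>
     (\<forall>x\<in>Ob \<X>. \<eta> x \<in> Ar \<Y> \<and> src \<Y> (\<eta> x) = fst F x \<and> tgt \<Y> (\<eta> x) = fst G x \<and>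
        bmap \<Y> (\<eta> x) = idmap (base \<X> x)) \<and>
     (\<forall>a\<in>Ar \<X>. cmp \<Y> (\<eta> (tgt \<X> a)) (snd F a) = cmp \<Y> (snd G a) (\<eta> (src \<X> a)))"

definition isomorphic_morphisms ::
  "('u, 'o, 'm) fibcat \<Rightarrow> ('u, 'p, 'n) fibcat \<Rightarrow>
   ('o, 'm, 'p, 'n) fibfun \<Rightarrow> ('o, 'm, 'p, 'n) fibfun \<Rightarrow> bool" where
  "isomorphic_morphisms \<X> \<Y> F G \<longleftrightarrow> (\<exists>\<eta>. two_morphism \<X> \<Y> F G \<eta>)"

definition fib_equivalence ::
  "('u, 'o, 'm) fibcat \<Rightarrow> ('u, 'p, 'n) fibcat \<Rightarrow> ('o, 'm, 'p, 'n) fibfun \<Rightarrow> bool" where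
  "fib_equivalence \<X> \<Y> F \<longleftrightarrow> fib_morphism \<X> \<Y> F \<and>
     (\<exists>G. fib_morphism \<Y> \<X> G \<and>
        isomorphic_morphisms \<X> \<X> (fib_comp \<X> G F) (fib_id \<X>) \<and>
        isomorphic_morphisms \<Y> \<Y> (fib_comp \<Y> F G) (fib_id \<Y>))"


subsection \<open>Spaces as fibered categories, and stacks\<close>

text \<open>
  The slice category of the site over \<open>Z\<close>. An object is a pair of a space \<open>T\<close> and a map from \<open>T\<close> to
  \<open>Z\<close>. The points of \<open>Z\<close> may be of any type, so this also applies to mapping spaces.
\<close>

type_synonym ('u, 'a) sobj = "'u topology \<times> ('u \<Rightarrow> 'a)"
type_synonym ('u, 'a) sarr = "('u, 'a) sobj \<times> ('u \<Rightarrow> 'u) \<times> ('u, 'a) sobj"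

definition space_stack :: "'a topology \<Rightarrow> ('u, ('u, 'a) sobj, ('u, 'a) sarr) fibcat" where
  "space_stack Z = \<lparr>
     Ob = {(T, f). cg_space TYPE('u) T \<and> f \<in> cmaps T Z},
     Ar = {((T, f), h, (S, g)). cg_space TYPE('u) T \<and> f \<in> cmaps T Z \<and>
             cg_space TYPE('u) S \<and> g \<in> cmaps S Z \<and> h \<in> cmaps T S \<and>
             compose (topspace T) g h = f},
     src = (\<lambda>(x, h, y). x),
     tgt = (\<lambda>(x, h, y). y),
     ident = (\<lambda>x. (x, idmap (fst x), x)),
     cmp = (\<lambda>(y, k, z) (x, h, y'). (x, compose (topspace (fst x)) k h, z)),
     base = fst,
     bmap = (\<lambda>(x, h, y). h)\<rparr>"

definition space_morphism ::
  "'a topology \<Rightarrow> ('a \<Rightarrow> 'b) \<Rightarrow> (('u, 'a) sobj, ('u, 'a) sarr, ('u, 'b) sobj, ('u, 'b) sarr) fibfun"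
where
  "space_morphism Z q =
     (let F = \<lambda>(T, f). (T, compose (topspace T) q f) in
      (\<lambda>x\<in>Ob (space_stack Z). F x, \<lambda>a\<in>Ar (space_stack Z). case a of (x, h, y) \<Rightarrow> (F x, h, F y)))"

definition full_subfib :: "('u, 'o, 'm) fibcat \<Rightarrow> 'o set \<Rightarrow> ('u, 'o, 'm) fibcat" where
  "full_subfib \<X> P =
     \<X>\<lparr>Ob := Ob \<X> \<inter> P, Ar := {a \<in> Ar \<X>. src \<X> a \<in> P \<and> tgt \<X> a \<in> P}\<rparr>"

definition cover_sieve ::
  "'u topology \<Rightarrow> 'u set set \<Rightarrow> ('u, ('u, 'u) sobj, ('u, 'u) sarr) fibcat" where
  "cover_sieve T \<U> = full_subfib (space_stack T) {(S, f). \<exists>U\<in>\<U>. f ` topspace S \<subseteq> U}"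

definition open_cover :: "'u topology \<Rightarrow> 'u set set \<Rightarrow> bool" where
  "open_cover T \<U> \<longleftrightarrow> (\<forall>U\<in>\<U>. openin T U) \<and> \<Union>\<U> = topspace T"

definition fib_restrict ::
  "('u, 'o, 'm) fibcat \<Rightarrow> ('o, 'm, 'p, 'n) fibfun \<Rightarrow> ('o, 'm, 'p, 'n) fibfun" where
  "fib_restrict \<R> F = (restrict (fst F) (Ob \<R>), restrict (snd F) (Ar \<R>))"

text \<open>
  Descent in Giraud's form: for the covering sieve \<open>\<R>\<close> generated by an open cover of \<open>T\<close>,
  restriction from morphisms out of \<open>T\<close> to morphisms out of \<open>\<R>\<close> is an equivalence of groupoids.
  The two clauses are full faithfulness and essential surjectivity.
\<close>

definition is_stack :: "('u, 'o, 'm) fibcat \<Rightarrow> bool" where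
  "is_stack \<X> \<longleftrightarrow> fibered_in_groupoids \<X> \<and>
     (\<forall>(T :: 'u topology) \<U>. cg_space TYPE('u) T \<longrightarrow> open_cover T \<U> \<longrightarrow>
        (let \<R> = cover_sieve T \<U> in
           (\<forall>F G \<eta>. fib_morphism (space_stack T) \<X> F \<longrightarrow> fib_morphism (space_stack T) \<X> G \<longrightarrow>
              two_morphism \<R> \<X> (fib_restrict \<R> F) (fib_restrict \<R> G) \<eta> \<longrightarrow>
              (\<exists>!\<theta>. two_morphism (space_stack T) \<X> F G \<theta> \<and> restrict \<theta> (Ob \<R>) = \<eta>)) \<and>
           (\<forall>H. fib_morphism \<R> \<X> H \<longrightarrow>
              (\<exists>F. fib_morphism (space_stack T) \<X> F \<and>
                 isomorphic_morphisms \<R> \<X> (fib_restrict \<R> F) H))))"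


subsection \<open>Products and fiber products\<close>

definition fib_prod ::
  "('u, 'o, 'm) fibcat \<Rightarrow> ('u, 'p, 'n) fibcat \<Rightarrow> ('u, 'o \<times> 'p, 'm \<times> 'n) fibcat" where
  "fib_prod \<X> \<Y> = \<lparr>
     Ob = {(x, y). x \<in> Ob \<X> \<and> y \<in> Ob \<Y> \<and> base \<X> x = base \<Y> y},
     Ar = {(a, b). a \<in> Ar \<X> \<and> b \<in> Ar \<Y> \<and> bmap \<X> a = bmap \<Y> b \<and>
             base \<X> (src \<X> a) = base \<Y> (src \<Y> b) \<and> base \<X> (tgt \<X> a) = base \<Y> (tgt \<Y> b)},
     src = (\<lambda>(a, b). (src \<X> a, src \<Y> b)),
     tgt = (\<lambda>(a, b). (tgt \<X> a, tgt \<Y> b)),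
     ident = (\<lambda>(x, y). (ident \<X> x, ident \<Y> y)),
     cmp = (\<lambda>(a', b') (a, b). (cmp \<X> a' a, cmp \<Y> b' b)),
     base = (\<lambda>(x, y). base \<X> x),
     bmap = (\<lambda>(a, b). bmap \<X> a)\<rparr>"

definition diagonal :: "('u, 'o, 'm) fibcat \<Rightarrow> ('o, 'm, 'o \<times> 'o, 'm \<times> 'm) fibfun" where
  "diagonal \<X> = (\<lambda>x\<in>Ob \<X>. (x, x), \<lambda>a\<in>Ar \<X>. (a, a))"

text \<open>The 2-categorical fiber product of \<open>F\<close> and \<open>G\<close> with common target \<open>\<Z>\<close>.\<close>

definition fiber_product ::
  "('u, 'o, 'm) fibcat \<Rightarrow> ('u, 'p, 'n) fibcat \<Rightarrow> ('u, 'q, 'k) fibcat \<Rightarrow>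
   ('o, 'm, 'q, 'k) fibfun \<Rightarrow> ('p, 'n, 'q, 'k) fibfun \<Rightarrow>
   ('u, 'o \<times> 'p \<times> 'k, ('o \<times> 'p \<times> 'k) \<times> ('m \<times> 'n) \<times> ('o \<times> 'p \<times> 'k)) fibcat" where
  "fiber_product \<X> \<Y> \<Z> F G =
     (let obj = {(x, y, \<alpha>). x \<in> Ob \<X> \<and> y \<in> Ob \<Y> \<and> base \<X> x = base \<Y> y \<and>
                   \<alpha> \<in> Ar \<Z> \<and> src \<Z> \<alpha> = fst F x \<and> tgt \<Z> \<alpha> = fst G y \<and>
                   bmap \<Z> \<alpha> = idmap (base \<X> x)} in
      \<lparr>Ob = obj,
       Ar = {((x, y, \<alpha>), (a, b), (x', y', \<alpha>')).
               (x, y, \<alpha>) \<in> obj \<and> (x', y', \<alpha>') \<in> obj \<and>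
               a \<in> Ar \<X> \<and> src \<X> a = x \<and> tgt \<X> a = x' \<and>
               b \<in> Ar \<Y> \<and> src \<Y> b = y \<and> tgt \<Y> b = y' \<and> bmap \<X> a = bmap \<Y> b \<and>
               cmp \<Z> \<alpha>' (snd F a) = cmp \<Z> (snd G b) \<alpha>},
       src = (\<lambda>(p, ab, p'). p),
       tgt = (\<lambda>(p, ab, p'). p'),
       ident = (\<lambda>(x, y, \<alpha>). ((x, y, \<alpha>), (ident \<X> x, ident \<Y> y), (x, y, \<alpha>))),
       cmp = (\<lambda>(p', (a', b'), p'') (p, (a, b), p0). (p, (cmp \<X> a' a, cmp \<Y> b' b), p'')),
       base = (\<lambda>(x, y, \<alpha>). base \<X> x),
       bmap = (\<lambda>(p, (a, b), p'). bmap \<X> a)\<rparr>)"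

definition fiber_product_fst ::
  "('u, 'o \<times> 'p \<times> 'k, ('o \<times> 'p \<times> 'k) \<times> ('m \<times> 'n) \<times> ('o \<times> 'p \<times> 'k)) fibcat \<Rightarrow>
   ('o \<times> 'p \<times> 'k, ('o \<times> 'p \<times> 'k) \<times> ('m \<times> 'n) \<times> ('o \<times> 'p \<times> 'k), 'o, 'm) fibfun" where
  "fiber_product_fst \<P> = (\<lambda>(x, y, \<alpha>)\<in>Ob \<P>. x, \<lambda>(p, (a, b), p')\<in>Ar \<P>. a)"


subsection \<open>Representable morphisms and classifying spaces\<close>

text \<open>
  \<open>base_extension \<X> \<Y> F T p Z q\<close>: the fiber product of \<open>p : T \<rightarrow> \<Y>\<close> and \<open>F : \<X> \<rightarrow> \<Y>\<close> is equivalent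
  to the space \<open>Z\<close>, in such a way that its projection to \<open>T\<close> becomes the map \<open>q : Z \<rightarrow> T\<close>.
\<close>

definition base_extension ::
  "('u, 'o, 'm) fibcat \<Rightarrow> ('u, 'p, 'n) fibcat \<Rightarrow> ('o, 'm, 'p, 'n) fibfun \<Rightarrow>
   'u topology \<Rightarrow> (('u, 'u) sobj, ('u, 'u) sarr, 'p, 'n) fibfun \<Rightarrow>
   'u topology \<Rightarrow> ('u \<Rightarrow> 'u) \<Rightarrow> bool" where
  "base_extension \<X> \<Y> F T p Z q \<longleftrightarrow>
     cg_space TYPE('u) Z \<and> continuous_map Z T q \<and>
     (let \<P> = fiber_product (space_stack T) \<X> \<Y> p F in
      \<exists>E. fib_equivalence (space_stack Z) \<P> E \<and>
          isomorphic_morphisms (space_stack Z) (space_stack T)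
            (fib_comp (space_stack Z) (fiber_product_fst \<P>) E) (space_morphism Z q))"

definition representable ::
  "('u, 'o, 'm) fibcat \<Rightarrow> ('u, 'p, 'n) fibcat \<Rightarrow> ('o, 'm, 'p, 'n) fibfun \<Rightarrow> bool" where
  "representable \<X> \<Y> F \<longleftrightarrow> fib_morphism \<X> \<Y> F \<and>
     (\<forall>(T :: 'u topology) p. cg_space TYPE('u) T \<longrightarrow> fib_morphism (space_stack T) \<Y> p \<longrightarrow>
        (\<exists>Z q. base_extension \<X> \<Y> F T p Z q))"

definition universal_weak_equivalence ::
  "('u, 'o, 'm) fibcat \<Rightarrow> ('u, 'p, 'n) fibcat \<Rightarrow> ('o, 'm, 'p, 'n) fibfun \<Rightarrow> bool" where
  "universal_weak_equivalence \<X> \<Y> F \<longleftrightarrow> representable \<X> \<Y> F \<and>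
     (\<forall>(T :: 'u topology) p Z q.
        cg_space TYPE('u) T \<longrightarrow> fib_morphism (space_stack T) \<Y> p \<longrightarrow>
        base_extension \<X> \<Y> F T p Z q \<longrightarrow> weak_equivalence Z T q)"

definition weakly_parashrinkable ::
  "('u, 'o, 'm) fibcat \<Rightarrow> ('u, 'p, 'n) fibcat \<Rightarrow> ('o, 'm, 'p, 'n) fibfun \<Rightarrow> bool" where
  "weakly_parashrinkable \<X> \<Y> F \<longleftrightarrow> representable \<X> \<Y> F \<and>
     (\<forall>(T :: 'u topology) p Z q.
        cg_space TYPE('u) T \<longrightarrow> paracompact_space T \<longrightarrow> fib_morphism (space_stack T) \<Y> p \<longrightarrow>
        base_extension \<X> \<Y> F T p Z q \<longrightarrow>
        weakly_contractible (section_space Z T q) \<and> topspace (section_space Z T q) \<noteq> {})"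

definition paratopological :: "('u, 'o, 'm) fibcat \<Rightarrow> bool" where
  "paratopological \<X> \<longleftrightarrow> is_stack \<X> \<and>
     (\<forall>(T :: 'u topology) f. cg_space TYPE('u) T \<longrightarrow> fib_morphism (space_stack T) \<X> f \<longrightarrow>
        representable (space_stack T) \<X> f) \<and>
     (\<exists>(X\<^sub>0 :: 'u topology) a. cg_space TYPE('u) X\<^sub>0 \<and> fib_morphism (space_stack X\<^sub>0) \<X> a \<and>
        (\<forall>(T :: 'u topology) p Z q.
           cg_space TYPE('u) T \<longrightarrow> paracompact_space T \<longrightarrow> fib_morphism (space_stack T) \<X> p \<longrightarrow>
           base_extension (space_stack X\<^sub>0) \<X> a T p Z q \<longrightarrow> admits_local_sections Z T q))"

definition has_representable_diagonal :: "('u, 'o, 'm) fibcat \<Rightarrow> bool" where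
  "has_representable_diagonal \<X> \<longleftrightarrow> representable \<X> (fib_prod \<X> \<X>) (diagonal \<X>)"

definition classifying_space ::
  "('u, 'o, 'm) fibcat \<Rightarrow> 'a topology \<Rightarrow> (('u, 'a) sobj, ('u, 'a) sarr, 'o, 'm) fibfun \<Rightarrow> bool" where
  "classifying_space \<X> X \<phi> \<longleftrightarrow> is_stack \<X> \<and> has_representable_diagonal \<X> \<and>
     cg_space TYPE('u) X \<and> universal_weak_equivalence (space_stack X) \<X> \<phi>"

definition represents_weak_homotopy_type :: "('u, 'o, 'm) fibcat \<Rightarrow> 'a topology \<Rightarrow> bool" where
  "represents_weak_homotopy_type \<X> Z \<longleftrightarrow>
     (\<exists>(X :: 'u topology) \<phi>. classifying_space \<X> X \<phi>) \<and>
     (\<forall>(X :: 'u topology) \<phi>. classifying_space \<X> X \<phi> \<longrightarrow>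
        same_weak_homotopy_type TYPE('u) Z X)"


subsection \<open>Mapping stacks\<close>

definition prod_with_id ::
  "'u topology \<Rightarrow> ('u \<Rightarrow> 'u) \<Rightarrow> ('u, 'p, 'n) fibcat \<Rightarrow>
   (('u, 'u) sobj \<times> 'p, ('u, 'u) sarr \<times> 'n, ('u, 'u) sobj \<times> 'p, ('u, 'u) sarr \<times> 'n) fibfun" where
  "prod_with_id T h \<Y> =
     (\<lambda>(x, y)\<in>Ob (fib_prod (space_stack T) \<Y>). (fst (space_morphism T h) x, y),
      \<lambda>(a, b)\<in>Ar (fib_prod (space_stack T) \<Y>). (snd (space_morphism T h) a, b))"

text \<open>
  An object over \<open>T\<close> is a morphism \<open>F : T \<times> \<Y> \<rightarrow> \<X>\<close>; an arrow over \<open>h : T \<rightarrow> S\<close> from \<open>F\<close> to \<open>G\<close> is a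
  transformation from \<open>F\<close> to \<open>G \<circ> (h \<times> id)\<close>.
\<close>

type_synonym ('u, 'p, 'n, 'o, 'm) mobj =
  "'u topology \<times> (('u, 'u) sobj \<times> 'p, ('u, 'u) sarr \<times> 'n, 'o, 'm) fibfun"
type_synonym ('u, 'p, 'n, 'o, 'm) marr =
  "('u, 'p, 'n, 'o, 'm) mobj \<times> (('u \<Rightarrow> 'u) \<times> (('u, 'u) sobj \<times> 'p \<Rightarrow> 'm)) \<times>
   ('u, 'p, 'n, 'o, 'm) mobj"

definition map_stack ::
  "('u, 'p, 'n) fibcat \<Rightarrow> ('u, 'o, 'm) fibcat \<Rightarrow>
   ('u, ('u, 'p, 'n, 'o, 'm) mobj, ('u, 'p, 'n, 'o, 'm) marr) fibcat" where
  "map_stack \<Y> \<X> =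
     (let obj = {(T, F). cg_space TYPE('u) T \<and> fib_morphism (fib_prod (space_stack T) \<Y>) \<X> F} in
      \<lparr>Ob = obj,
       Ar = {((T, F), (h, \<eta>), (S, G)). (T, F) \<in> obj \<and> (S, G) \<in> obj \<and> h \<in> cmaps T S \<and>
               two_morphism (fib_prod (space_stack T) \<Y>) \<X> F
                 (fib_comp (fib_prod (space_stack T) \<Y>) G (prod_with_id T h \<Y>)) \<eta>},
       src = (\<lambda>(x, a, y). x),
       tgt = (\<lambda>(x, a, y). y),
       ident = (\<lambda>(T, F). ((T, F),
                 (idmap T, \<lambda>x\<in>Ob (fib_prod (space_stack T) \<Y>). ident \<X> (fst F x)), (T, F))),
       cmp = (\<lambda>(y, (k, \<theta>), z) ((T, F), (h, \<eta>), y').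
                ((T, F),
                 (compose (topspace T) k h,
                  \<lambda>x\<in>Ob (fib_prod (space_stack T) \<Y>).
                    cmp \<X> (\<theta> (fst (prod_with_id T h \<Y>) x)) (\<eta> x)),
                 z)),
       base = fst,
       bmap = (\<lambda>(x, (h, \<eta>), y). h)\<rparr>)"

definition map_postcomp ::
  "('u, 'p, 'n) fibcat \<Rightarrow> ('u, 'o, 'm) fibcat \<Rightarrow> ('o, 'm, 'q, 'k) fibfun \<Rightarrow>
   (('u, 'p, 'n, 'o, 'm) mobj, ('u, 'p, 'n, 'o, 'm) marr,
    ('u, 'p, 'n, 'q, 'k) mobj, ('u, 'p, 'n, 'q, 'k) marr) fibfun" where
  "map_postcomp \<Y> \<X> \<Phi> =
     (let P = \<lambda>(T, F). (T, fib_comp (fib_prod (space_stack T) \<Y>) \<Phi> F) in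
      (\<lambda>x\<in>Ob (map_stack \<Y> \<X>). P x,
       \<lambda>a\<in>Ar (map_stack \<Y> \<X>). case a of (x, (h, \<eta>), y) \<Rightarrow>
         (P x, (h, \<lambda>u\<in>Ob (fib_prod (space_stack (fst x)) \<Y>). snd \<Phi> (\<eta> u)), P y)))"

text \<open>
  The exponential law: a map \<open>f : T \<rightarrow> Map(Y, X)\<close> gives the morphism \<open>T \<times> Y \<rightarrow> X\<close> sending
  \<open>(a : S \<rightarrow> T, b : S \<rightarrow> Y)\<close> to \<open>s \<mapsto> f (a s) (b s)\<close>. This identifies the mapping
  stack of two spaces with the mapping space.
\<close>

definition uncurried ::
  "'u topology \<Rightarrow> 'u topology \<Rightarrow> ('u \<Rightarrow> 'u \<Rightarrow> 'a) \<Rightarrow>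
   (('u, 'u) sobj \<times> ('u, 'u) sobj, ('u, 'u) sarr \<times> ('u, 'u) sarr, ('u, 'a) sobj, ('u, 'a) sarr) fibfun"
where
  "uncurried Y T f =
     (let \<P> = fib_prod (space_stack T) (space_stack Y);
          V = \<lambda>((S, a), (S', b)). (S, \<lambda>s\<in>topspace S. f (a s) (b s)) in
      (\<lambda>x\<in>Ob \<P>. V x, \<lambda>e\<in>Ar \<P>. (V (src \<P> e), bmap \<P> e, V (tgt \<P> e))))"

definition exponential_law ::
  "'u topology \<Rightarrow> 'a topology \<Rightarrow>
   (('u, 'u \<Rightarrow> 'a) sobj, ('u, 'u \<Rightarrow> 'a) sarr,
    ('u, ('u, 'u) sobj, ('u, 'u) sarr, ('u, 'a) sobj, ('u, 'a) sarr) mobj,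
    ('u, ('u, 'u) sobj, ('u, 'u) sarr, ('u, 'a) sobj, ('u, 'a) sarr) marr) fibfun" where
  "exponential_law Y X =
     (let J = \<lambda>(T, f). (T, uncurried Y T f) in
      (\<lambda>x\<in>Ob (space_stack (mapping_space Y X)). J x,
       \<lambda>a\<in>Ar (space_stack (mapping_space Y X)). case a of (x, h, y) \<Rightarrow>
         (J x,
          (h, \<lambda>u\<in>Ob (fib_prod (space_stack (fst x)) (space_stack Y)).
                ident (space_stack X) (fst (uncurried Y (fst x) (snd x)) u)),
          J y)))"

text \<open>The morphism from \<open>Map(Y, X)\<close> to the mapping stack of \<open>Y\<close> and \<open>\<X>\<close> induced by \<open>\<phi> : X \<rightarrow> \<X>\<close>.\<close>

definition map_pushforward ::
  "'u topology \<Rightarrow> 'a topology \<Rightarrow> (('u, 'a) sobj, ('u, 'a) sarr, 'o, 'm) fibfun \<Rightarrow>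
   (('u, 'u \<Rightarrow> 'a) sobj, ('u, 'u \<Rightarrow> 'a) sarr,
    ('u, ('u, 'u) sobj, ('u, 'u) sarr, 'o, 'm) mobj,
    ('u, ('u, 'u) sobj, ('u, 'u) sarr, 'o, 'm) marr) fibfun" where
  "map_pushforward Y X \<phi> =
     fib_comp (space_stack (mapping_space Y X))
       (map_postcomp (space_stack Y) (space_stack X) \<phi>) (exponential_law Y X)"

end

theory Submission
  imports Defs
begin

text \<open>
  An object over \<open>T\<close> of the mapping stack is a morphism \<open>T \<times> Y \<rightarrow> \<X>\<close>, that is (Yoneda) an object of \<open>\<X>\<close>
  over the space \<open>T \<times> Y\<close>. So the mapping stack is a power of \<open>\<X>\<close> by \<open>Y\<close>, the mapping space is one of \<open>X\<close>
  by the exponential law, and pushforward along \<open>\<phi>\<close> is \<open>\<phi>\<close> itself over \<open>T \<times> Y\<close>. The proof deals with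
  arbitrary powers (\<open>is_power\<close>).

  Descent: functors from \<open>T\<close> to the power are functors from \<open>T \<times> Y\<close> to \<open>\<X>\<close>, likewise for covering sieves,
  and a cover of \<open>T\<close> induces one of \<open>T \<times> Y\<close> (\<open>stack_power\<close>).

  Representability: a fibered category is a space iff it has a terminal object, so a morphism is
  representable iff it admits a universal arrow to every object (\<open>representable_iff\<close>). If \<open>I \<rightarrow> T \<times> Y\<close> lies
  below a universal arrow for \<open>\<X>\<close>, the Weil restriction \<open>Z \<rightarrow> T\<close>, whose points over \<open>t\<close> are the sections of
  \<open>I\<close> over \<open>{t} \<times> Y\<close>, lies below one for the power (\<open>power_universal_arrow\<close>). This applies to the
  diagonal and to \<open>\<phi>\<close>.

  Weak equivalence: \<open>Z \<rightarrow> T\<close> is one as soon as maps from cubes to \<open>T\<close> lift to \<open>Z\<close> and any two lifts over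
  the boundary of a cube are homotopic over \<open>T\<close> (\<open>weak_equivalence_lifting\<close>). For \<open>a : K \<rightarrow> T\<close> with \<open>K\<close> compact,
  the lifts of \<open>a\<close> are the sections over \<open>K \<times> Y\<close> of a base extension of \<open>\<phi>\<close>. As \<open>K \<times> Y\<close> is paracompact,
  parashrinkability makes their space nonempty and path connected.

  Weak homotopy type: a copy of the mapping space with points in the universe is a classifying
  space too, and two classifying spaces are weakly equivalent to their fiber product over the stack.
\<close>

section \<open>Small sets and copies of spaces inside the universe\<close>

lemma small_lepoll: "A \<lesssim> B \<Longrightarrow> small TYPE('u) B \<Longrightarrow> small TYPE('u) A"
  unfolding small_def by (rule lesspoll_trans1)

lemma small_subset: "A \<subseteq> B \<Longrightarrow> small TYPE('u) B \<Longrightarrow> small TYPE('u) A"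
  by (rule small_lepoll[OF subset_imp_lepoll])

lemma small_image: "small TYPE('u) A \<Longrightarrow> small TYPE('u) (f ` A)"
  by (rule small_lepoll[OF image_lepoll])

definition uenc :: "'a set \<Rightarrow> 'a \<Rightarrow> 'u" where
  "uenc A = (SOME e. inj_on e A)"

lemma inj_on_uenc:
  assumes "small TYPE('u) (A :: 'a set)"
  shows "inj_on (uenc A :: 'a \<Rightarrow> 'u) A"
proof -
  have "A \<lesssim> (UNIV :: 'u set)" using assms unfolding small_def by (simp add: lesspoll_imp_lepoll)
  then have "\<exists>e :: 'a \<Rightarrow> 'u. inj_on e A" by (auto simp: lepoll_def)
  then show ?thesis unfolding uenc_def by (rule someI_ex)
qed

definition udec :: "'a set \<Rightarrow> 'u \<Rightarrow> 'a" where
  "udec A = inv_into A (uenc A)"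

lemma udec_uenc: "small TYPE('u) A \<Longrightarrow> a \<in> A \<Longrightarrow> udec A (uenc A a :: 'u) = a"
  by (simp add: udec_def inj_on_uenc)

lemma uenc_udec: "x \<in> uenc A ` A \<Longrightarrow> uenc A (udec A x) = x"
  by (simp add: udec_def f_inv_into_f)

lemma udec_in: "x \<in> uenc A ` A \<Longrightarrow> udec A x \<in> A"
  by (simp add: udec_def inv_into_into)

text \<open>Products and mapping spaces become objects of the site only after such a copy.\<close>

definition ucopy :: "'a topology \<Rightarrow> 'u topology" where
  "ucopy X = pullback_topology (uenc (topspace X) ` topspace X) (udec (topspace X)) X"

lemma topspace_ucopy: "topspace (ucopy X :: 'u topology) = uenc (topspace X) ` topspace X"
  by (auto simp: ucopy_def topspace_pullback_topology udec_in)

lemma continuous_map_udec: "continuous_map (ucopy X :: 'u topology) X (udec (topspace X))"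
  unfolding ucopy_def
  using continuous_map_pullback[OF continuous_map_id] by (simp add: comp_def)

lemma continuous_map_uenc:
  assumes "small TYPE('u) (topspace X)"
  shows "continuous_map X (ucopy X :: 'u topology) (uenc (topspace X))"
  unfolding ucopy_def
proof (rule continuous_map_pullback')
  show "continuous_map X X (udec (topspace X) \<circ> (uenc (topspace X) :: _ \<Rightarrow> 'u))"
    by (rule continuous_map_eq[OF continuous_map_id]) (simp add: udec_uenc[OF assms])
qed auto

lemma homeomorphic_maps_ucopy:
  assumes "small TYPE('u) (topspace X)"
  shows "homeomorphic_maps X (ucopy X :: 'u topology) (uenc (topspace X)) (udec (topspace X))"
  unfolding homeomorphic_maps_def
  using assms by (auto simp: continuous_map_udec continuous_map_uenc udec_uenc uenc_udec topspace_ucopy)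

lemma homeomorphic_ucopy:
  assumes "small TYPE('u) (topspace X)"
  shows "X homeomorphic_space (ucopy X :: 'u topology)"
  using homeomorphic_maps_ucopy[OF assms] homeomorphic_space_def by blast

lemma small_ucopy: "small TYPE('u) (topspace X) \<Longrightarrow> small TYPE('u) (topspace (ucopy X :: 'u topology))"
  by (simp add: topspace_ucopy small_image)

locale universe =
  fixes u :: "'u itself"
  assumes gu: "grothendieck_universe TYPE('u)"
begin

lemma universe_limit: "small TYPE('u) A \<Longrightarrow> small TYPE('u) (Pow A)" for A :: "'u set"
  using gu unfolding grothendieck_universe_def small_def by simp

lemma universe_Union:
  fixes A :: "'u set" and F :: "'u \<Rightarrow> 'u set"
  assumes "small TYPE('u) A" "\<And>a. a \<in> A \<Longrightarrow> small TYPE('u) (F a)"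
  shows "small TYPE('u) (\<Union>a\<in>A. F a)"
  using gu assms unfolding grothendieck_universe_def small_def by simp

lemma infinite_universe: "infinite (UNIV :: 'u set)"
proof -
  have "(UNIV :: nat set) \<prec> (UNIV :: 'u set)" using gu by (simp add: grothendieck_universe_def)
  then have "(UNIV :: nat set) \<lesssim> (UNIV :: 'u set)" by (rule lesspoll_imp_lepoll)
  then obtain f :: "nat \<Rightarrow> 'u" where "inj f" by (auto simp: lepoll_def)
  then show ?thesis using finite_subset[of "range f" UNIV] finite_imageD[of f UNIV] by auto
qed

lemma small_nat: "small TYPE('u) (UNIV :: nat set)"
  using gu unfolding grothendieck_universe_def small_def by simp

lemma small_finite: "finite A \<Longrightarrow> small TYPE('u) A"
  unfolding small_def using infinite_universe by (simp add: finite_lesspoll_infinite)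

lemma small_Pow:
  fixes A :: "'a set"
  assumes A: "small TYPE('u) A"
  shows "small TYPE('u) (Pow A)"
proof -
  let ?B = "(uenc A :: 'a \<Rightarrow> 'u) ` A"
  have "small TYPE('u) ?B" using A by (rule small_image)
  then have "small TYPE('u) (Pow ?B)" by (rule universe_limit)
  moreover have "Pow A \<lesssim> Pow ?B"
  proof -
    have "inj_on (image (uenc A :: 'a \<Rightarrow> 'u)) (Pow A)"
      using inj_on_uenc[OF A] by (rule inj_on_image_Pow)
    moreover have "image (uenc A :: 'a \<Rightarrow> 'u) ` Pow A \<subseteq> Pow ?B" by auto
    ultimately show ?thesis unfolding lepoll_def by blast
  qed
  ultimately show ?thesis by (rule small_lepoll[rotated])
qed

lemma small_Times:
  fixes A :: "'a set" and B :: "'b set"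
  assumes A: "small TYPE('u) A" and B: "small TYPE('u) B"
  shows "small TYPE('u) (A \<times> B)"
proof -
  have "(UNIV :: 'u set) \<times> (UNIV :: 'u set) \<lesssim> (UNIV :: 'u set)"
  proof -
    have "ordIso2 (card_of ((UNIV :: 'u set) \<times> (UNIV :: 'u set))) (card_of (UNIV :: 'u set))"
      using infinite_universe by (rule card_of_Times_same_infinite)
    then have "(UNIV :: 'u set) \<times> (UNIV :: 'u set) \<approx> (UNIV :: 'u set)"
      by (simp add: eqpoll_iff_card_of_ordIso)
    then show ?thesis by (rule eqpoll_imp_lepoll)
  qed
  then obtain p :: "'u \<times> 'u \<Rightarrow> 'u" where p: "inj p" unfolding lepoll_def by auto
  let ?a = "uenc A :: 'a \<Rightarrow> 'u" and ?b = "uenc B :: 'b \<Rightarrow> 'u"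
  let ?F = "\<lambda>x. (\<lambda>y. p (x, ?b y)) ` B"
  have "small TYPE('u) (?a ` A)" using A by (rule small_image)
  then have "small TYPE('u) (\<Union>x\<in>?a ` A. ?F x)"
    by (rule universe_Union) (rule small_image[OF B])
  moreover have "A \<times> B \<lesssim> (\<Union>x\<in>?a ` A. ?F x)"
  proof -
    have "inj_on (\<lambda>(x, y). p (?a x, ?b y)) (A \<times> B)"
    proof (rule inj_onI, clarify)
      fix x y x' y' assume xy: "x \<in> A" "y \<in> B" "x' \<in> A" "y' \<in> B" "p (?a x, ?b y) = p (?a x', ?b y')"
      then have "?a x = ?a x'" "?b y = ?b y'" using injD[OF p] by blast+
      then show "x = x' \<and> y = y'"
        using inj_onD[OF inj_on_uenc[OF A]] inj_onD[OF inj_on_uenc[OF B]] xy by simp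
    qed
    moreover have "(\<lambda>(x, y). p (?a x, ?b y)) ` (A \<times> B) \<subseteq> (\<Union>x\<in>?a ` A. ?F x)" by auto
    ultimately show ?thesis unfolding lepoll_def by blast
  qed
  ultimately show ?thesis by (rule small_lepoll[rotated])
qed

lemma small_PiE:
  fixes A :: "'a set" and B :: "'b set"
  assumes A: "small TYPE('u) A" and B: "small TYPE('u) B"
  shows "small TYPE('u) (A \<rightarrow>\<^sub>E B)"
proof -
  let ?g = "\<lambda>f. {(x, y). x \<in> A \<and> y = f x}"
  have "inj_on ?g (A \<rightarrow>\<^sub>E B)"
  proof (rule inj_onI)
    fix f g assume f: "f \<in> A \<rightarrow>\<^sub>E B" and g: "g \<in> A \<rightarrow>\<^sub>E B" and eq: "?g f = ?g g"
    show "f = g"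
    proof (rule PiE_ext[OF f g])
      fix x assume "x \<in> A"
      then have "(x, f x) \<in> ?g f" by simp
      then have "(x, f x) \<in> ?g g" unfolding eq .
      then show "f x = g x" by simp
    qed
  qed
  moreover have "?g ` (A \<rightarrow>\<^sub>E B) \<subseteq> Pow (A \<times> B)" by auto
  ultimately have "(A \<rightarrow>\<^sub>E B) \<lesssim> Pow (A \<times> B)" unfolding lepoll_def by blast
  then show ?thesis by (rule small_lepoll) (intro small_Pow small_Times A B)
qed

lemma small_real: "small TYPE('u) (UNIV :: real set)"
proof -
  have "small TYPE('u) (Pow (UNIV :: nat set))" using small_nat by (rule small_Pow)
  moreover have "(UNIV :: real set) \<lesssim> Pow (UNIV :: nat set)"
    using nat_sets_eqpoll_reals by (metis Pow_UNIV eqpoll_imp_lepoll eqpoll_sym)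
  ultimately show ?thesis by (rule small_lepoll[rotated])
qed

end

section \<open>Compactly generated spaces\<close>

lemma topspace_kelleyfication [simp]: "topspace (kelleyfication TYPE('u) X) = topspace X"
proof -
  have "k_open TYPE('u) X (topspace X)"
    unfolding k_open_def
  proof (intro conjI allI impI)
    fix K :: "'u topology" and v assume "continuous_map K X v"
    then have "{k \<in> topspace K. v k \<in> topspace X} = topspace K"
      using continuous_map_image_subset_topspace by fastforce
    then show "openin K {k \<in> topspace K. v k \<in> topspace X}" by simp
  qed simp
  then have "topspace X \<subseteq> topspace (kelleyfication TYPE('u) X)"
    by (simp add: openin_kelleyfication openin_subset)
  moreover have "topspace (kelleyfication TYPE('u) X) \<subseteq> topspace X"
    using openin_topspace[of "kelleyfication TYPE('u) X"]
    unfolding openin_kelleyfication k_open_def by blast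
  ultimately show ?thesis by blast
qed

lemma k_openD:
  fixes K :: "'u topology"
  assumes "k_open TYPE('u) X U" "test_space K" "continuous_map K X v"
  shows "openin K {k \<in> topspace K. v k \<in> U}"
  using assms unfolding k_open_def by blast

lemma openin_imp_k_open: "openin X U \<Longrightarrow> k_open TYPE('u) X U"
  unfolding k_open_def by (auto dest: openin_subset intro: openin_continuous_map_preimage)

lemma continuous_map_kelleyfication_id: "continuous_map (kelleyfication TYPE('u) X) X id"
  unfolding continuous_map_def
proof (intro conjI allI impI)
  fix U assume U: "openin X U"
  then have "{x \<in> topspace (kelleyfication TYPE('u) X). id x \<in> U} = U" using openin_subset[OF U] by auto
  then show "openin (kelleyfication TYPE('u) X) {x \<in> topspace (kelleyfication TYPE('u) X). id x \<in> U}"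
    using openin_imp_k_open[OF U] by (simp add: openin_kelleyfication)
qed simp

lemma continuous_map_into_kelleyfication_D:
  "continuous_map Z (kelleyfication TYPE('u) X) f \<Longrightarrow> continuous_map Z X f"
  using continuous_map_compose[OF _ continuous_map_kelleyfication_id, of Z X f] by simp

lemma continuous_map_test_kelleyfication:
  fixes K :: "'u topology"
  assumes "test_space K" "continuous_map K X v"
  shows "continuous_map K (kelleyfication TYPE('u) X) v"
  unfolding continuous_map_def
  using assms continuous_map_image_subset_topspace[OF assms(2)]
  by (auto simp: openin_kelleyfication intro: k_openD)

lemma cg_space_kelleyfication:
  assumes "small TYPE('u) (topspace X)"
  shows "cg_space TYPE('u) (kelleyfication TYPE('u) X)"
  unfolding cg_space_def
proof (intro conjI allI impI)
  show "small TYPE('u) (topspace (kelleyfication TYPE('u) X))" using assms by simp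
  fix U assume U: "k_open TYPE('u) (kelleyfication TYPE('u) X) U"
  have "k_open TYPE('u) X U"
    unfolding k_open_def
  proof (intro conjI allI impI)
    show "U \<subseteq> topspace X" using U unfolding k_open_def by simp
    fix K :: "'u topology" and v assume "test_space K" "continuous_map K X v"
    then show "openin K {k \<in> topspace K. v k \<in> U}"
      by (intro k_openD[OF U] continuous_map_test_kelleyfication)
  qed
  then show "openin (kelleyfication TYPE('u) X) U" by (simp add: openin_kelleyfication)
qed

text \<open>
  Continuity on a compactly generated space is tested on compact Hausdorff spaces.
\<close>

lemma cg_continuous_mapI:
  assumes S: "cg_space TYPE('u) S" and f: "f \<in> topspace S \<rightarrow> topspace X"
    and test: "\<And>(K :: 'u topology) v. test_space K \<Longrightarrow> continuous_map K S v \<Longrightarrow>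
      continuous_map K X (f \<circ> v)"
  shows "continuous_map S X f"
  unfolding continuous_map_def
proof (intro conjI allI impI)
  show "f \<in> topspace S \<rightarrow> topspace X" by (rule f)
  fix U assume U: "openin X U"
  have "k_open TYPE('u) S {x \<in> topspace S. f x \<in> U}"
    unfolding k_open_def
  proof (intro conjI allI impI)
    fix K :: "'u topology" and v assume K: "test_space K" and v: "continuous_map K S v"
    have "openin K {k \<in> topspace K. (f \<circ> v) k \<in> U}"
      using test[OF K v] U by (rule openin_continuous_map_preimage)
    moreover have "{k \<in> topspace K. v k \<in> {x \<in> topspace S. f x \<in> U}} = {k \<in> topspace K. (f \<circ> v) k \<in> U}"
      using continuous_map_image_subset_topspace[OF v] by auto
    ultimately show "openin K {k \<in> topspace K. v k \<in> {x \<in> topspace S. f x \<in> U}}" by simp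
  qed auto
  then show "openin S {x \<in> topspace S. f x \<in> U}" using S unfolding cg_space_def by blast
qed

lemma continuous_map_into_kelleyfication:
  assumes S: "cg_space TYPE('u) S" and f: "continuous_map S X f"
  shows "continuous_map S (kelleyfication TYPE('u) X) f"
proof (rule cg_continuous_mapI[OF S])
  show "f \<in> topspace S \<rightarrow> topspace (kelleyfication TYPE('u) X)"
    using continuous_map_image_subset_topspace[OF f] by auto
  fix K :: "'u topology" and v assume "test_space K" "continuous_map K S v"
  then show "continuous_map K (kelleyfication TYPE('u) X) (f \<circ> v)"
    using f by (intro continuous_map_test_kelleyfication continuous_map_compose)
qed

lemma cg_space_homeomorphic:
  assumes f: "homeomorphic_maps X Y f g" and X: "cg_space TYPE('u) X"
  shows "cg_space TYPE('u) Y"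
  unfolding cg_space_def
proof (intro conjI allI impI)
  have fc: "continuous_map X Y f" and gc: "continuous_map Y X g"
    and gf: "\<And>x. x \<in> topspace X \<Longrightarrow> g (f x) = x" and fg: "\<And>y. y \<in> topspace Y \<Longrightarrow> f (g y) = y"
    using f unfolding homeomorphic_maps_def by auto
  have "topspace Y \<subseteq> f ` topspace X"
    using fg continuous_map_image_subset_topspace[OF gc] by force
  then show "small TYPE('u) (topspace Y)"
    using X small_subset small_image unfolding cg_space_def by metis
  fix U assume U: "k_open TYPE('u) Y U"
  have "continuous_map Y (kelleyfication TYPE('u) Y) id"
  proof -
    have "continuous_map Y (kelleyfication TYPE('u) Y) (f \<circ> g)"
      using gc continuous_map_into_kelleyfication[OF X fc] by (rule continuous_map_compose)
    then show ?thesis by (rule continuous_map_eq) (simp add: fg)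
  qed
  moreover have "openin (kelleyfication TYPE('u) Y) U" using U by (simp add: openin_kelleyfication)
  ultimately have "openin Y {y \<in> topspace Y. id y \<in> U}" by (rule openin_continuous_map_preimage)
  moreover have "{y \<in> topspace Y. id y \<in> U} = U" using U unfolding k_open_def by auto
  ultimately show "openin Y U" by simp
qed

lemma cg_space_ucopy:
  "cg_space TYPE('u) X \<Longrightarrow> cg_space TYPE('u) (ucopy X :: 'u topology)"
  by (rule cg_space_homeomorphic[OF homeomorphic_maps_ucopy]) (auto simp: cg_space_def)

lemma test_space_ucopy:
  assumes "small TYPE('u) (topspace K)" "compact_space K" "Hausdorff_space K"
  shows "test_space (ucopy K :: 'u topology)"
  unfolding test_space_def
  using homeomorphic_ucopy[OF assms(1)] assms
  by (auto simp: small_ucopy dest: homeomorphic_compact_space homeomorphic_Hausdorff_space)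

lemma test_space_imp_cg: 
  fixes K :: "'u topology"
  assumes K: "test_space K" 
  shows "cg_space TYPE('u) K"
  unfolding cg_space_def
proof (intro conjI allI impI)
  show "small TYPE('u) (topspace K)" using K by (simp add: test_space_def)
  fix U assume U: "k_open TYPE('u) K U"
  then have "openin K {k \<in> topspace K. id k \<in> U}" using K by (rule k_openD) simp
  moreover have "{k \<in> topspace K. id k \<in> U} = U" using U unfolding k_open_def by auto
  ultimately show "openin K U" by simp
qed

lemma compact_Hausdorff_imp_cg:
  assumes "small TYPE('u) (topspace K)" "compact_space K" "Hausdorff_space K"
  shows "cg_space TYPE('u) K"
  using cg_space_homeomorphic[OF _ test_space_imp_cg[OF test_space_ucopy[OF assms]]]
    homeomorphic_maps_ucopy[OF assms(1)] homeomorphic_maps_sym by blast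

lemma paracompact_imp_Hausdorff: "paracompact_space X \<Longrightarrow> Hausdorff_space X"
  by (simp add: paracompact_space_def)

lemma compact_Hausdorff_small_neighbourhood:
  assumes "compact_space K" "Hausdorff_space K" "openin K W" "k \<in> W"
  obtains V N where "openin K V" "compactin K N" "k \<in> V" "V \<subseteq> N" "N \<subseteq> W"
proof -
  have "neighbourhood_base_of (compactin K) K"
    using assms(1,2) locally_compact_space_neighbourhood_base compact_imp_locally_compact_space by blast
  then show thesis using assms(3,4) that unfolding neighbourhood_base_of by metis
qed


section \<open>Products\<close>

text \<open>
  Binary products in the site, with pairing \<open>kpt\<close> and projections \<open>kpr1\<close>, \<open>kpr2\<close>.
\<close>

definition kprod :: "'a topology \<Rightarrow> 'b topology \<Rightarrow> 'u topology" where
  "kprod T Y = ucopy (kelleyfication TYPE('u) (prod_topology T Y))"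

definition kpt :: "'a topology \<Rightarrow> 'b topology \<Rightarrow> 'a \<Rightarrow> 'b \<Rightarrow> 'u" where
  "kpt T Y t y = uenc (topspace T \<times> topspace Y) (t, y)"

definition kpr1 :: "'a topology \<Rightarrow> 'b topology \<Rightarrow> 'u \<Rightarrow> 'a" where
  "kpr1 T Y = (\<lambda>p\<in>topspace (kprod T Y). fst (udec (topspace T \<times> topspace Y) p))"

definition kpr2 :: "'a topology \<Rightarrow> 'b topology \<Rightarrow> 'u \<Rightarrow> 'b" where
  "kpr2 T Y = (\<lambda>p\<in>topspace (kprod T Y). snd (udec (topspace T \<times> topspace Y) p))"

definition ktimes :: "'a topology \<Rightarrow> 'b topology \<Rightarrow> 'c topology \<Rightarrow> ('a \<Rightarrow> 'b) \<Rightarrow> 'u \<Rightarrow> 'u" where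
  "ktimes T S Y h = (\<lambda>p\<in>topspace (kprod T Y). kpt S Y (h (kpr1 T Y p)) (kpr2 T Y p))"

context universe begin

lemma cg_small: "cg_space TYPE('u) X \<Longrightarrow> small TYPE('u) (topspace X)"
  by (simp add: cg_space_def)

lemma cg_kprod:
  assumes "cg_space TYPE('u) T" "cg_space TYPE('u) Y"
  shows "cg_space TYPE('u) (kprod T Y :: 'u topology)"
  unfolding kprod_def using assms
  by (intro cg_space_ucopy cg_space_kelleyfication) (simp add: small_Times cg_small)

lemma topspace_kprod:
  "topspace (kprod T Y :: 'u topology) = (\<lambda>(t, y). kpt T Y t y) ` (topspace T \<times> topspace Y)"
  by (auto simp: kprod_def topspace_ucopy kpt_def)

context
  fixes T :: "'a topology" and Y :: "'b topology"
  assumes T: "cg_space TYPE('u) T" and Y: "cg_space TYPE('u) Y"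
begin

lemma small_TY: "small TYPE('u) (topspace T \<times> topspace Y)"
  using T Y by (simp add: small_Times cg_small)

lemma kpt_in: "t \<in> topspace T \<Longrightarrow> y \<in> topspace Y \<Longrightarrow> kpt T Y t y \<in> topspace (kprod T Y :: 'u topology)"
  by (auto simp: topspace_kprod)

lemma kpr1_kpt [simp]: "t \<in> topspace T \<Longrightarrow> y \<in> topspace Y \<Longrightarrow> kpr1 T Y (kpt T Y t y :: 'u) = t"
  using kpt_in by (simp add: kpr1_def kpt_def udec_uenc[OF small_TY])

lemma kpr2_kpt [simp]: "t \<in> topspace T \<Longrightarrow> y \<in> topspace Y \<Longrightarrow> kpr2 T Y (kpt T Y t y :: 'u) = y"
  using kpt_in by (simp add: kpr2_def kpt_def udec_uenc[OF small_TY])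

lemma kprod_cases:
  assumes "p \<in> topspace (kprod T Y :: 'u topology)"
  obtains t y where "t \<in> topspace T" "y \<in> topspace Y" "p = kpt T Y t y"
  using assms by (auto simp: topspace_kprod)

lemma kpt_kpr: "p \<in> topspace (kprod T Y :: 'u topology) \<Longrightarrow> kpt T Y (kpr1 T Y p) (kpr2 T Y p) = p"
  by (elim kprod_cases) simp

lemma kpr1_in: "p \<in> topspace (kprod T Y :: 'u topology) \<Longrightarrow> kpr1 T Y p \<in> topspace T"
  by (elim kprod_cases) simp

lemma kpr2_in: "p \<in> topspace (kprod T Y :: 'u topology) \<Longrightarrow> kpr2 T Y p \<in> topspace Y"
  by (elim kprod_cases) simp

lemma kpr1_cmap: "kpr1 T Y \<in> cmaps (kprod T Y :: 'u topology) T"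
proof -
  have "continuous_map (kprod T Y :: 'u topology) (kelleyfication TYPE('u) (prod_topology T Y))
      (udec (topspace T \<times> topspace Y))"
    unfolding kprod_def using continuous_map_udec[of "kelleyfication TYPE('u) (prod_topology T Y)"] by simp
  then have "continuous_map (kprod T Y :: 'u topology) (prod_topology T Y) (udec (topspace T \<times> topspace Y))"
    by (rule continuous_map_into_kelleyfication_D)
  then have "continuous_map (kprod T Y :: 'u topology) T (fst \<circ> udec (topspace T \<times> topspace Y))"
    by (simp add: continuous_map_pairwise)
  then have "continuous_map (kprod T Y :: 'u topology) T (kpr1 T Y)"
    by (rule continuous_map_eq) (simp add: kpr1_def)
  then show ?thesis by (simp add: cmaps_def kpr1_def)
qed

lemma kpr2_cmap: "kpr2 T Y \<in> cmaps (kprod T Y :: 'u topology) Y"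
proof -
  have "continuous_map (kprod T Y :: 'u topology) (kelleyfication TYPE('u) (prod_topology T Y))
      (udec (topspace T \<times> topspace Y))"
    unfolding kprod_def using continuous_map_udec[of "kelleyfication TYPE('u) (prod_topology T Y)"] by simp
  then have "continuous_map (kprod T Y :: 'u topology) (prod_topology T Y) (udec (topspace T \<times> topspace Y))"
    by (rule continuous_map_into_kelleyfication_D)
  then have "continuous_map (kprod T Y :: 'u topology) Y (snd \<circ> udec (topspace T \<times> topspace Y))"
    by (simp add: continuous_map_pairwise)
  then have "continuous_map (kprod T Y :: 'u topology) Y (kpr2 T Y)"
    by (rule continuous_map_eq) (simp add: kpr2_def)
  then show ?thesis by (simp add: cmaps_def kpr2_def)
qed

lemma continuous_map_kpt:
  assumes S: "cg_space TYPE('u) S" and a: "continuous_map S T a" and b: "continuous_map S Y b"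
  shows "continuous_map S (kprod T Y :: 'u topology) (\<lambda>s. kpt T Y (a s) (b s))"
proof -
  let ?k = "kelleyfication TYPE('u) (prod_topology T Y)"
  have "continuous_map S (prod_topology T Y) (\<lambda>s. (a s, b s))"
    using a b by (simp add: continuous_map_pairwise comp_def)
  then have "continuous_map S ?k (\<lambda>s. (a s, b s))" by (rule continuous_map_into_kelleyfication[OF S])
  moreover have "continuous_map ?k (kprod T Y :: 'u topology) (uenc (topspace T \<times> topspace Y))"
    unfolding kprod_def using continuous_map_uenc[of ?k] small_TY by simp
  ultimately have "continuous_map S (kprod T Y :: 'u topology) (uenc (topspace T \<times> topspace Y) \<circ> (\<lambda>s. (a s, b s)))"
    by (rule continuous_map_compose)
  then show ?thesis by (simp add: comp_def kpt_def)
qed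

lemma continuous_map_kpt_point:
  "t \<in> topspace T \<Longrightarrow> continuous_map Y (kprod T Y :: 'u topology) (kpt T Y t)"
  using continuous_map_kpt[OF Y, of "\<lambda>_. t" id] by simp

end

lemma ktimes_cmap:
  assumes T: "cg_space TYPE('u) T" and S: "cg_space TYPE('u) S" and Y: "cg_space TYPE('u) Y"
    and h: "h \<in> cmaps T S"
  shows "ktimes T S Y h \<in> cmaps (kprod T Y :: 'u topology) (kprod S Y :: 'u topology)"
proof -
  have "continuous_map (kprod T Y :: 'u topology) S (h \<circ> kpr1 T Y)"
    using h kpr1_cmap[OF T Y] by (auto simp: cmaps_def intro: continuous_map_compose)
  then have "continuous_map (kprod T Y :: 'u topology) (kprod S Y :: 'u topology)
      (\<lambda>p. kpt S Y ((h \<circ> kpr1 T Y) p) (kpr2 T Y p))"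
    using kpr2_cmap[OF T Y] by (intro continuous_map_kpt[OF S Y cg_kprod[OF T Y]]) (auto simp: cmaps_def comp_def)
  then have "continuous_map (kprod T Y :: 'u topology) (kprod S Y :: 'u topology) (ktimes T S Y h)"
    by (rule continuous_map_eq) (simp add: ktimes_def)
  then show ?thesis by (simp add: cmaps_def ktimes_def)
qed

end

lemma cmaps_image: "f \<in> cmaps X Y \<Longrightarrow> x \<in> topspace X \<Longrightarrow> f x \<in> topspace Y"
  unfolding cmaps_def by (auto dest: continuous_map_image_subset_topspace)

lemma cmaps_ext: "f \<in> cmaps X Y \<Longrightarrow> g \<in> cmaps X Z \<Longrightarrow> (\<And>x. x \<in> topspace X \<Longrightarrow> f x = g x) \<Longrightarrow> f = g"
  unfolding cmaps_def by (auto intro: extensionalityI)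

lemma compose_cmaps: "f \<in> cmaps X Y \<Longrightarrow> g \<in> cmaps Y Z \<Longrightarrow> compose (topspace X) g f \<in> cmaps X Z"
  unfolding cmaps_def by (auto simp: compose_def restrict_def extensional_def intro: continuous_map_eq[OF continuous_map_compose])

lemma idmap_cmaps: "idmap X \<in> cmaps X X"
  unfolding cmaps_def idmap_def by (auto intro: continuous_map_eq[OF continuous_map_id])

lemma restrict_cmaps: "continuous_map X Y f \<Longrightarrow> restrict f (topspace X) \<in> cmaps X Y"
  unfolding cmaps_def by (auto intro: continuous_map_eq)

section \<open>Mapping spaces and the exponential law\<close>

definition kuncurry :: "'a topology \<Rightarrow> 'u topology \<Rightarrow> ('a \<Rightarrow> 'u \<Rightarrow> 'b) \<Rightarrow> 'u \<Rightarrow> 'b" where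
  "kuncurry S Y f = (\<lambda>p\<in>topspace (kprod S Y). f (kpr1 S Y p) (kpr2 S Y p))"

definition kcurry :: "'a topology \<Rightarrow> 'u topology \<Rightarrow> ('u \<Rightarrow> 'b) \<Rightarrow> 'a \<Rightarrow> 'u \<Rightarrow> 'b" where
  "kcurry S Y g = (\<lambda>s\<in>topspace S. \<lambda>y\<in>topspace Y. g (kpt S Y s y))"

lemma topspace_compact_open: "topspace (compact_open_topology Y X) = cmaps Y X"
proof -
  have "cmaps Y X = {f \<in> cmaps Y X. f ` {} \<subseteq> {}}" by simp
  then have "cmaps Y X \<in> {{f \<in> cmaps Y X. f ` K \<subseteq> U} | K U. compactin Y K \<and> openin X U}"
    using compactin_empty openin_empty by blast
  then show ?thesis
    unfolding compact_open_topology_def topology_generated_by_topspace by blast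
qed

lemma topspace_mapping_space [simp]: "topspace (mapping_space Y X) = cmaps Y X"
  by (simp add: mapping_space_def topspace_compact_open)

lemma continuous_map_compact_openI:
  assumes "\<And>t. t \<in> topspace T \<Longrightarrow> f t \<in> cmaps Y X"
    and "\<And>K U t. compactin Y K \<Longrightarrow> openin X U \<Longrightarrow> t \<in> topspace T \<Longrightarrow> f t ` K \<subseteq> U \<Longrightarrow>
       \<exists>V. openin T V \<and> t \<in> V \<and> (\<forall>t'\<in>V. f t' ` K \<subseteq> U)"
  shows "continuous_map T (compact_open_topology Y X) f"
  unfolding compact_open_topology_def continuous_on_generated_topo_iff
proof (intro conjI allI impI)
  show "f ` topspace T \<subseteq> \<Union> {{f \<in> cmaps Y X. f ` K \<subseteq> U} |K U. compactin Y K \<and> openin X U}"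
    using assms(1) topspace_compact_open[of Y X]
    unfolding compact_open_topology_def topology_generated_by_topspace by blast
  fix W assume "W \<in> {{f \<in> cmaps Y X. f ` K \<subseteq> U} |K U. compactin Y K \<and> openin X U}"
  then obtain K U where KU: "compactin Y K" "openin X U" and W: "W = {f \<in> cmaps Y X. f ` K \<subseteq> U}" by blast
  show "openin T (f -` W \<inter> topspace T)"
  proof (subst openin_subopen, intro ballI)
    fix t assume t: "t \<in> f -` W \<inter> topspace T"
    then obtain V where V: "openin T V" "t \<in> V" "\<forall>t'\<in>V. f t' ` K \<subseteq> U"
      using assms(2)[OF KU, of t] W by blast
    then have "V \<subseteq> f -` W \<inter> topspace T" using assms(1) openin_subset[OF V(1)] unfolding W by blast
    then show "\<exists>V. openin T V \<and> t \<in> V \<and> V \<subseteq> f -` W \<inter> topspace T" using V by blast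
  qed
qed

lemma openin_compact_open_subbasis:
  "compactin Y K \<Longrightarrow> openin X U \<Longrightarrow> openin (compact_open_topology Y X) {f \<in> cmaps Y X. f ` K \<subseteq> U}"
  unfolding compact_open_topology_def by (rule topology_generated_by_Basis) blast

context universe begin

lemma small_cmaps:
  assumes "small TYPE('u) (topspace Y)" "small TYPE('u) (topspace X)"
  shows "small TYPE('u) (cmaps Y X)"
proof -
  have "cmaps Y X \<subseteq> topspace Y \<rightarrow>\<^sub>E topspace X"
    by (auto simp: cmaps_def PiE_def continuous_map_def)
  then show ?thesis using small_PiE[OF assms] by (rule small_subset)
qed

lemma cg_mapping_space:
  fixes Y :: "'u topology"
  assumes "cg_space TYPE('u) Y" "cg_space TYPE('u) X"
  shows "cg_space TYPE('u) (mapping_space Y X)"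
  unfolding mapping_space_def
  using assms by (intro cg_space_kelleyfication) (simp add: topspace_compact_open small_cmaps cg_small)

text \<open>
  For compact \<open>L \<rightarrow> S\<close> and \<open>K \<subseteq> Y\<close> the ordinary product \<open>L \<times> K\<close> is compactly generated, so \<open>g\<close> is continuous on
  it and the tube lemma applies. Hausdorffness of \<open>Y\<close> makes \<open>K\<close> a test space.
\<close>

lemma kcurry_cmap:
  fixes Y :: "'u topology"
  assumes S: "cg_space TYPE('u) S" and Y: "cg_space TYPE('u) Y" and Y2: "Hausdorff_space Y"
    and g: "g \<in> cmaps (kprod S Y :: 'u topology) X"
  shows "kcurry S Y g \<in> cmaps S (mapping_space Y X)"
proof -
  have gc: "continuous_map (kprod S Y :: 'u topology) X g" using g by (simp add: cmaps_def)
  have pt: "kcurry S Y g s \<in> cmaps Y X" if "s \<in> topspace S" for s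
  proof -
    have "continuous_map Y X (g \<circ> kpt S Y s)"
      using continuous_map_kpt_point[OF S Y that] gc by (rule continuous_map_compose)
    then show ?thesis using that by (auto simp: cmaps_def kcurry_def intro: continuous_map_eq)
  qed
  have "continuous_map S (mapping_space Y X) (kcurry S Y g)"
  proof (rule cg_continuous_mapI[OF S])
    show "kcurry S Y g \<in> topspace S \<rightarrow> topspace (mapping_space Y X)" using pt by simp
    fix L :: "'u topology" and v assume L: "test_space L" and v: "continuous_map L S v"
    have vS: "v l \<in> topspace S" if "l \<in> topspace L" for l
      using that continuous_map_image_subset_topspace[OF v] by blast
    have "continuous_map L (compact_open_topology Y X) (kcurry S Y g \<circ> v)"
    proof (rule continuous_map_compact_openI)
      fix l assume "l \<in> topspace L"
      then show "(kcurry S Y g \<circ> v) l \<in> cmaps Y X" using vS pt by simp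
    next
      fix K U l
      assume K: "compactin Y K" and U: "openin X U" and l: "l \<in> topspace L"
        and lK: "(kcurry S Y g \<circ> v) l ` K \<subseteq> U"
      have KY: "K \<subseteq> topspace Y" using K by (rule compactin_subset_topspace)
      let ?LK = "prod_topology L (subtopology Y K)"
      have L': "compact_space L" "Hausdorff_space L" "small TYPE('u) (topspace L)"
        using L by (auto simp: test_space_def)
      have "small TYPE('u) K" using KY cg_small[OF Y] by (rule small_subset)
      then have "cg_space TYPE('u) ?LK"
        using L' Y Y2 K KY
        by (intro compact_Hausdorff_imp_cg)
           (auto simp: compact_space_prod_topology Hausdorff_space_prod_topology cg_small
             compact_space_subtopology Hausdorff_space_subtopology Int_absorb1 intro!: small_Times)
      then have "continuous_map ?LK (kprod S Y :: 'u topology) (\<lambda>z. kpt S Y ((v \<circ> fst) z) (snd z))"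
        using v by (intro continuous_map_kpt[OF S Y] continuous_map_compose[OF continuous_map_fst])
          (auto intro: continuous_map_into_fulltopology continuous_map_snd simp: continuous_map_in_subtopology[symmetric])
      from continuous_map_compose[OF this gc]
      have "openin ?LK {z \<in> topspace ?LK. (g \<circ> (\<lambda>z. kpt S Y ((v \<circ> fst) z) (snd z))) z \<in> U}" (is "openin _ ?W")
        using U by (rule openin_continuous_map_preimage)
      moreover have "compactin (subtopology Y K) K" using K by (simp add: compactin_subtopology)
      moreover have "{l} \<times> K \<subseteq> ?W"
        using lK l KY vS by (auto simp: kcurry_def image_subset_iff Int_absorb1)
      ultimately obtain V V' where V: "openin L V" "l \<in> V" "K \<subseteq> V'" "V \<times> V' \<subseteq> ?W"
        using tube_lemma_right[of L "subtopology Y K" ?W K l] l by blast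
      have "(kcurry S Y g \<circ> v) l' ` K \<subseteq> U" if "l' \<in> V" for l'
      proof -
        have "l' \<in> topspace L" using that V(1) openin_subset by blast
        moreover have "{l'} \<times> K \<subseteq> ?W" using V that by blast
        ultimately show ?thesis using KY vS by (auto simp: kcurry_def image_subset_iff)
      qed
      then show "\<exists>V. openin L V \<and> l \<in> V \<and> (\<forall>t'\<in>V. (kcurry S Y g \<circ> v) t' ` K \<subseteq> U)"
        using V by blast
    qed
    then show "continuous_map L (mapping_space Y X) (kcurry S Y g \<circ> v)"
      unfolding mapping_space_def by (rule continuous_map_into_kelleyfication[OF test_space_imp_cg[OF L]])
  qed
  then show ?thesis by (simp add: cmaps_def kcurry_def)
qed

lemma kuncurry_cmap:
  fixes Y :: "'u topology"
  assumes S: "cg_space TYPE('u) S" and Y: "cg_space TYPE('u) Y"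
    and f: "f \<in> cmaps S (mapping_space Y X)"
  shows "kuncurry S Y f \<in> cmaps (kprod S Y :: 'u topology) X"
proof -
  have fc: "continuous_map S (compact_open_topology Y X) f"
    using f continuous_map_into_kelleyfication_D unfolding cmaps_def mapping_space_def by blast
  have fY: "f s \<in> cmaps Y X" if "s \<in> topspace S" for s
    using cmaps_image[OF f that] by simp
  have "continuous_map (kprod S Y :: 'u topology) X (kuncurry S Y f)"
  proof (rule cg_continuous_mapI[OF cg_kprod[OF S Y]])
    show "kuncurry S Y f \<in> topspace (kprod S Y :: 'u topology) \<rightarrow> topspace X"
      using cmaps_image[OF fY] kpr1_in[OF S Y] kpr2_in[OF S Y] by (auto simp: kuncurry_def)
    fix L :: "'u topology" and v
    assume L: "test_space L" and v: "continuous_map L (kprod S Y :: 'u topology) v"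
    let ?a = "kpr1 S Y \<circ> v" and ?b = "kpr2 S Y \<circ> v"
    have a: "continuous_map L S ?a" and b: "continuous_map L Y ?b"
      using v kpr1_cmap[OF S Y] kpr2_cmap[OF S Y] by (auto simp: cmaps_def intro: continuous_map_compose)
    have aS: "?a l \<in> topspace S" and bY: "?b l \<in> topspace Y" if "l \<in> topspace L" for l
      using that continuous_map_image_subset_topspace[OF a] continuous_map_image_subset_topspace[OF b] by auto
    have ev: "(kuncurry S Y f \<circ> v) l = f (?a l) (?b l)" if "l \<in> topspace L" for l
      using that continuous_map_image_subset_topspace[OF v] by (auto simp: kuncurry_def)
    show "continuous_map L X (kuncurry S Y f \<circ> v)"
      unfolding continuous_map_def
    proof (intro conjI allI impI)
      show "kuncurry S Y f \<circ> v \<in> topspace L \<rightarrow> topspace X"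
        using ev cmaps_image[OF fY[OF aS] bY] by simp
      fix U assume U: "openin X U"
      show "openin L {l \<in> topspace L. (kuncurry S Y f \<circ> v) l \<in> U}"
      proof (subst openin_subopen, intro ballI)
        fix l assume "l \<in> {l \<in> topspace L. (kuncurry S Y f \<circ> v) l \<in> U}"
        then have l: "l \<in> topspace L" and lU: "f (?a l) (?b l) \<in> U" using ev by auto
        have "continuous_map L X (f (?a l) \<circ> ?b)"
          using b fY[OF aS[OF l]] by (auto simp: cmaps_def intro: continuous_map_compose)
        from openin_continuous_map_preimage[OF this U]
        obtain V N where N: "openin L V" "compactin L N" "l \<in> V" "V \<subseteq> N"
            "N \<subseteq> {x \<in> topspace L. (f (?a l) \<circ> ?b) x \<in> U}"
          using compact_Hausdorff_small_neighbourhood[of L _ l] L l lU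
          unfolding test_space_def by (metis (no_types, lifting) comp_apply mem_Collect_eq)
        have "compactin Y (?b ` N)" using N(2) b by (rule image_compactin)
        from openin_continuous_map_preimage[OF continuous_map_compose[OF a fc] openin_compact_open_subbasis[OF this U]]
        have O: "openin L {x \<in> topspace L. (f \<circ> ?a) x \<in> {f \<in> cmaps Y X. f ` (?b ` N) \<subseteq> U}}" (is "openin L ?O") .
        have "l \<in> ?O" using N(5) l fY[OF aS[OF l]] by auto
        moreover have "?O \<inter> V \<subseteq> {l \<in> topspace L. (kuncurry S Y f \<circ> v) l \<in> U}"
        proof
          fix x assume x: "x \<in> ?O \<inter> V"
          then have "?b x \<in> ?b ` N" using N(4) by blast
          then have "f (?a x) (?b x) \<in> U" using x by auto
          then show "x \<in> {l \<in> topspace L. (kuncurry S Y f \<circ> v) l \<in> U}" using x ev by simp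
        qed
        ultimately show "\<exists>T. openin L T \<and> l \<in> T \<and> T \<subseteq> {l \<in> topspace L. (kuncurry S Y f \<circ> v) l \<in> U}"
          using O N(1,3) by (intro exI[of _ "?O \<inter> V"]) auto
      qed
    qed
  qed
  then show ?thesis by (simp add: cmaps_def kuncurry_def)
qed

lemma kuncurry_kcurry:
  fixes Y :: "'u topology"
  assumes S: "cg_space TYPE('u) S" and Y: "cg_space TYPE('u) Y" and g: "g \<in> extensional (topspace (kprod S Y :: 'u topology))"
  shows "kuncurry S Y (kcurry S Y g) = g"
  using g by (auto simp: kuncurry_def kcurry_def kpr1_in[OF S Y] kpr2_in[OF S Y] kpt_kpr[OF S Y]
    extensional_def intro!: ext)

section \<open>Products of a compact space with a paracompact space\<close>

text \<open>
  By the tube lemma, openness at \<open>(k, y)\<close> reduces to openness in \<open>Y\<close>, tested on compact spaces.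
\<close>

lemma cg_compact_prod:
  fixes K Y :: "'u topology"
  assumes K: "test_space K" and Y: "cg_space TYPE('u) Y"
  shows "cg_space TYPE('u) (prod_topology K Y)"
  unfolding cg_space_def
proof (intro conjI allI impI)
  have K': "compact_space K" "Hausdorff_space K" "small TYPE('u) (topspace K)"
    using K by (auto simp: test_space_def)
  show "small TYPE('u) (topspace (prod_topology K Y))" using K' Y by (simp add: small_Times cg_small)
  fix W assume W: "k_open TYPE('u) (prod_topology K Y) W"
  show "openin (prod_topology K Y) W"
  proof (subst openin_subopen, intro ballI)
    fix z assume z: "z \<in> W"
    obtain k y where ky: "z = (k, y)" by (cases z)
    have kK: "k \<in> topspace K" and yY: "y \<in> topspace Y"
      using z ky W unfolding k_open_def by auto
    have "continuous_map K (prod_topology K Y) (\<lambda>x. (x, y))"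
      using yY by (simp add: continuous_map_pairwise comp_def)
    then have O: "openin K {x \<in> topspace K. (x, y) \<in> W}" by (rule k_openD[OF W K])
    obtain V N where N: "openin K V" "compactin K N" "k \<in> V" "V \<subseteq> N" "N \<subseteq> {x \<in> topspace K. (x, y) \<in> W}"
      by (rule compact_Hausdorff_small_neighbourhood[OF K'(1,2) O, of k]) (use z ky kK in auto)
    have NK: "N \<subseteq> topspace K" using N by blast
    let ?Q = "{y' \<in> topspace Y. N \<times> {y'} \<subseteq> W}"
    have "k_open TYPE('u) Y ?Q"
      unfolding k_open_def
    proof (intro conjI allI impI)
      fix L :: "'u topology" and v assume L: "test_space L" and v: "continuous_map L Y v"
      have L': "compact_space L" "Hausdorff_space L" "small TYPE('u) (topspace L)"
        using L by (auto simp: test_space_def)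
      let ?KL = "prod_topology K L"
      have KL: "cg_space TYPE('u) ?KL"
        using K' L' by (intro compact_Hausdorff_imp_cg)
          (auto simp: compact_space_prod_topology Hausdorff_space_prod_topology intro!: small_Times)
      have vY: "v l \<in> topspace Y" if "l \<in> topspace L" for l
        using that continuous_map_image_subset_topspace[OF v] by auto
      have "continuous_map ?KL (prod_topology K Y) (\<lambda>x. (fst x, (v \<circ> snd) x))"
        using v by (auto simp: continuous_map_pairwise comp_def
          intro: continuous_map_compose[OF continuous_map_snd, unfolded comp_def] continuous_map_fst)
      then have "continuous_map ?KL (kelleyfication TYPE('u) (prod_topology K Y)) (\<lambda>x. (fst x, (v \<circ> snd) x))"
        by (rule continuous_map_into_kelleyfication[OF KL])
      moreover have "openin (kelleyfication TYPE('u) (prod_topology K Y)) W"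
        using W by (simp add: openin_kelleyfication)
      ultimately have O: "openin ?KL {x \<in> topspace ?KL. (fst x, (v \<circ> snd) x) \<in> W}" (is "openin _ ?P")
        by (rule openin_continuous_map_preimage)
      show "openin L {l \<in> topspace L. v l \<in> ?Q}"
      proof (subst openin_subopen, intro ballI)
        fix l assume l: "l \<in> {l \<in> topspace L. v l \<in> ?Q}"
        then have "N \<times> {l} \<subseteq> ?P" using NK by auto
        then obtain A B where AB: "openin L B" "N \<subseteq> A" "l \<in> B" "A \<times> B \<subseteq> ?P"
          using tube_lemma_left[OF O N(2), of l] l by blast
        have "B \<subseteq> {l \<in> topspace L. v l \<in> ?Q}"
        proof
          fix x assume x: "x \<in> B"
          then have xL: "x \<in> topspace L" using openin_subset[OF AB(1)] by blast
          have "N \<times> {v x} \<subseteq> W"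
          proof
            fix p assume "p \<in> N \<times> {v x}"
            then obtain m where m: "p = (m, v x)" "m \<in> N" by blast
            then have "(m, x) \<in> ?P" using AB(2,4) x by blast
            then show "p \<in> W" using m by simp
          qed
          then show "x \<in> {l \<in> topspace L. v l \<in> ?Q}" using xL vY by simp
        qed
        then show "\<exists>T. openin L T \<and> l \<in> T \<and> T \<subseteq> {l \<in> topspace L. v l \<in> ?Q}" using AB by blast
      qed
    qed blast
    then have "openin Y ?Q" using Y unfolding cg_space_def by blast
    then have "openin (prod_topology K Y) (V \<times> ?Q)" using N(1) by (simp add: openin_prod_Times_iff)
    moreover have "z \<in> V \<times> ?Q" using ky N yY by auto
    moreover have "V \<times> ?Q \<subseteq> W" using N(4) by auto
    ultimately show "\<exists>T. openin (prod_topology K Y) T \<and> z \<in> T \<and> T \<subseteq> W" by blast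
  qed
qed

end

lemma paracompact_prod_compact:
  assumes K: "compact_space K" "Hausdorff_space K" and Y: "paracompact_space Y"
  shows "paracompact_space (prod_topology K Y)"
  unfolding paracompact_space_def
proof (intro conjI allI impI)
  show "Hausdorff_space (prod_topology K Y)"
    using K paracompact_imp_Hausdorff[OF Y] by (simp add: Hausdorff_space_prod_topology)
  fix \<U> assume U: "(\<forall>U\<in>\<U>. openin (prod_topology K Y) U) \<and> \<Union>\<U> = topspace (prod_topology K Y)"
  \<comment> \<open>Each slice \<open>K \<times> {y}\<close> has a tube that finitely many members of the cover fill.\<close>
  have "\<exists>V \<F>. openin Y V \<and> y \<in> V \<and> finite \<F> \<and> \<F> \<subseteq> \<U> \<and> topspace K \<times> V \<subseteq> \<Union>\<F>" if y: "y \<in> topspace Y" for y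
  proof -
    have "compactin (prod_topology K Y) (topspace K \<times> {y})"
      using K(1) y by (simp add: compactin_Times compact_space_def)
    then obtain \<F> where F: "finite \<F>" "\<F> \<subseteq> \<U>" "topspace K \<times> {y} \<subseteq> \<Union>\<F>"
      using U y unfolding compactin_def
      by (metis (no_types, lifting) SigmaE Sigma_mono empty_subsetI insert_subset order_refl topspace_prod_topology)
    have "openin (prod_topology K Y) (\<Union>\<F>)" using F U by blast
    from tube_lemma_left[OF this _ y F(3)] K(1)
    obtain A B where "openin Y B" "topspace K \<subseteq> A" "y \<in> B" "A \<times> B \<subseteq> \<Union>\<F>"
      by (auto simp: compact_space_def)
    then show ?thesis using F by (intro exI[of _ B] exI[of _ \<F>]) blast
  qed
  then obtain V F where VF: "\<And>y. y \<in> topspace Y \<Longrightarrow> openin Y (V y) \<and> y \<in> V y \<and> finite (F y) \<and> F y \<subseteq> \<U> \<and>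
      topspace K \<times> V y \<subseteq> \<Union>(F y)" by metis
  have "(\<forall>W\<in>V ` topspace Y. openin Y W) \<and> \<Union>(V ` topspace Y) = topspace Y"
  proof (intro conjI ballI)
    show "\<Union>(V ` topspace Y) = topspace Y"
      using VF openin_subset by (intro equalityI) (blast, blast)
  qed (use VF in blast)
  then obtain \<W> where W: "\<forall>W\<in>\<W>. openin Y W \<and> (\<exists>U\<in>V ` topspace Y. W \<subseteq> U)" "\<Union>\<W> = topspace Y"
      "locally_finite_in Y \<W>"
    using Y unfolding paracompact_space_def by meson
  then have "\<forall>W\<in>\<W>. \<exists>y. y \<in> topspace Y \<and> W \<subseteq> V y" by blast
  then obtain c where c: "\<And>W. W \<in> \<W> \<Longrightarrow> c W \<in> topspace Y \<and> W \<subseteq> V (c W)" by metis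
  let ?N = "{(topspace K \<times> W) \<inter> U | W U. W \<in> \<W> \<and> U \<in> F (c W)}"
  show "\<exists>\<V>. (\<forall>V\<in>\<V>. openin (prod_topology K Y) V \<and> (\<exists>U\<in>\<U>. V \<subseteq> U)) \<and>
      \<Union>\<V> = topspace (prod_topology K Y) \<and> locally_finite_in (prod_topology K Y) \<V>"
  proof (intro exI[of _ ?N] conjI ballI)
    fix A assume "A \<in> ?N"
    then obtain W U' where A: "A = (topspace K \<times> W) \<inter> U'" "W \<in> \<W>" "U' \<in> F (c W)" by blast
    then have U': "U' \<in> \<U>" using VF[of "c W"] c[OF A(2)] by blast
    then show "openin (prod_topology K Y) A"
      using A W(1) U by (auto simp: openin_prod_Times_iff intro!: openin_Int)
    show "\<exists>U\<in>\<U>. A \<subseteq> U" using U' A by blast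
  next
    show un: "\<Union>?N = topspace (prod_topology K Y)"
    proof (intro equalityI subsetI)
      fix z assume "z \<in> \<Union>?N"
      then show "z \<in> topspace (prod_topology K Y)" using W(2) by auto
    next
      fix z assume z: "z \<in> topspace (prod_topology K Y)"
      then obtain k y where ky: "z = (k, y)" "k \<in> topspace K" "y \<in> topspace Y" by auto
      then obtain w where w: "w \<in> \<W>" "y \<in> w" using W(2) by blast
      then have "z \<in> topspace K \<times> V (c w)" using c ky by blast
      moreover have "topspace K \<times> V (c w) \<subseteq> \<Union>(F (c w))" using VF[of "c w"] c[OF w(1)] by (simp only: simp_thms)
      ultimately obtain U' where "U' \<in> F (c w)" "z \<in> U'" by blast
      then show "z \<in> \<Union>?N" using w ky by blast
    qed
    show "locally_finite_in (prod_topology K Y) ?N"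
      unfolding locally_finite_in_def
    proof (intro conjI ballI)
      show "\<Union>?N \<subseteq> topspace (prod_topology K Y)" using un by simp
      fix z assume z: "z \<in> topspace (prod_topology K Y)"
      then obtain k y where ky: "z = (k, y)" "k \<in> topspace K" "y \<in> topspace Y" by auto
      then obtain Q where Q: "openin Y Q" "y \<in> Q" "finite {W \<in> \<W>. W \<inter> Q \<noteq> {}}"
        using W(3) unfolding locally_finite_in_def by blast
      have "{A \<in> ?N. A \<inter> (topspace K \<times> Q) \<noteq> {}} \<subseteq>
          (\<Union>W\<in>{W \<in> \<W>. W \<inter> Q \<noteq> {}}. (\<lambda>U. (topspace K \<times> W) \<inter> U) ` F (c W))"
      proof
        fix A assume "A \<in> {A \<in> ?N. A \<inter> (topspace K \<times> Q) \<noteq> {}}"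
        then obtain w U' where A: "A = (topspace K \<times> w) \<inter> U'" "w \<in> \<W>" "U' \<in> F (c w)"
          and ne: "A \<inter> (topspace K \<times> Q) \<noteq> {}" by blast
        then have "w \<inter> Q \<noteq> {}" by blast
        then show "A \<in> (\<Union>W\<in>{W \<in> \<W>. W \<inter> Q \<noteq> {}}. (\<lambda>U. (topspace K \<times> W) \<inter> U) ` F (c W))"
          using A by blast
      qed
      moreover have "finite (\<Union>W\<in>{W \<in> \<W>. W \<inter> Q \<noteq> {}}. (\<lambda>U. (topspace K \<times> W) \<inter> U) ` F (c W))"
      proof (rule finite_UN_I[OF Q(3)])
        fix w assume "w \<in> {W \<in> \<W>. W \<inter> Q \<noteq> {}}"
        then have "finite (F (c w))" using VF[of "c w"] c[of w] by simp
        then show "finite ((\<lambda>U. (topspace K \<times> w) \<inter> U) ` F (c w))" by simp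
      qed
      ultimately have "finite {A \<in> ?N. A \<inter> (topspace K \<times> Q) \<noteq> {}}" by (rule finite_subset)
      then show "\<exists>V. openin (prod_topology K Y) V \<and> z \<in> V \<and> finite {U \<in> ?N. U \<inter> V \<noteq> {}}"
        using Q ky by (intro exI[of _ "topspace K \<times> Q"]) (auto simp: openin_prod_Times_iff)
    qed
  qed
qed

lemma paracompact_space_homeomorphic:
  assumes f: "homeomorphic_maps X Y f g" and X: "paracompact_space X"
  shows "paracompact_space Y"
  unfolding paracompact_space_def
proof (intro conjI allI impI)
  have fc: "continuous_map X Y f" and gc: "continuous_map Y X g"
    and gf: "\<And>x. x \<in> topspace X \<Longrightarrow> g (f x) = x" and fg: "\<And>y. y \<in> topspace Y \<Longrightarrow> f (g y) = y"
    using f unfolding homeomorphic_maps_def by auto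
  have gX: "g y \<in> topspace X" if "y \<in> topspace Y" for y
    using that continuous_map_image_subset_topspace[OF gc] by auto
  have fY: "f x \<in> topspace Y" if "x \<in> topspace X" for x
    using that continuous_map_image_subset_topspace[OF fc] by auto
  show "Hausdorff_space Y"
    using paracompact_imp_Hausdorff[OF X] f homeomorphic_Hausdorff_space homeomorphic_space_def by blast
  fix \<U> assume U: "(\<forall>U\<in>\<U>. openin Y U) \<and> \<Union>\<U> = topspace Y"
  let ?pre = "\<lambda>U. {x \<in> topspace X. f x \<in> U}" and ?pre' = "\<lambda>V. {y \<in> topspace Y. g y \<in> V}"
  have op: "openin Y (?pre' V)" if "openin X V" for V using gc that by (rule openin_continuous_map_preimage)
  have "(\<forall>V\<in>?pre ` \<U>. openin X V) \<and> \<Union>(?pre ` \<U>) = topspace X"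
  proof (intro conjI ballI)
    fix V assume "V \<in> ?pre ` \<U>"
    then show "openin X V" using U openin_continuous_map_preimage[OF fc] by blast
  next
    show "\<Union>(?pre ` \<U>) = topspace X" using U fY by (intro equalityI subsetI) (blast, fastforce)
  qed
  then obtain \<V> where V: "\<forall>V\<in>\<V>. openin X V \<and> (\<exists>U\<in>?pre ` \<U>. V \<subseteq> U)" "\<Union>\<V> = topspace X" "locally_finite_in X \<V>"
    using X unfolding paracompact_space_def by meson
  show "\<exists>\<V>. (\<forall>V\<in>\<V>. openin Y V \<and> (\<exists>U\<in>\<U>. V \<subseteq> U)) \<and> \<Union>\<V> = topspace Y \<and> locally_finite_in Y \<V>"
  proof (intro exI[of _ "?pre' ` \<V>"] conjI ballI)
    fix W assume "W \<in> ?pre' ` \<V>"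
    then obtain V0 where V0: "V0 \<in> \<V>" "W = ?pre' V0" by blast
    then show "openin Y W" using V(1) op by blast
    obtain U0 where "U0 \<in> \<U>" "V0 \<subseteq> ?pre U0" using V(1) V0(1) by blast
    then show "\<exists>U\<in>\<U>. W \<subseteq> U" using V0(2) fg by (intro bexI[of _ U0]) auto
  next
    show "\<Union>(?pre' ` \<V>) = topspace Y" using V(2) gX by auto
    show "locally_finite_in Y (?pre' ` \<V>)"
      unfolding locally_finite_in_def
    proof (intro conjI ballI)
      fix y assume y: "y \<in> topspace Y"
      obtain Q where Q: "openin X Q" "g y \<in> Q" "finite {V \<in> \<V>. V \<inter> Q \<noteq> {}}"
        using V(3) gX[OF y] unfolding locally_finite_in_def by blast
      have "{W \<in> ?pre' ` \<V>. W \<inter> ?pre' Q \<noteq> {}} \<subseteq> ?pre' ` {V \<in> \<V>. V \<inter> Q \<noteq> {}}" by blast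
      then have "finite {W \<in> ?pre' ` \<V>. W \<inter> ?pre' Q \<noteq> {}}" using Q(3) finite_subset by blast
      then show "\<exists>Va. openin Y Va \<and> y \<in> Va \<and> finite {U \<in> ?pre' ` \<V>. U \<inter> Va \<noteq> {}}"
        using op[OF Q(1)] Q(2) y by (intro exI[of _ "?pre' Q"]) auto
    qed auto
  qed
qed

context universe begin

lemma paracompact_kprod:
  fixes K Y :: "'u topology"
  assumes K: "test_space K" and Y: "cg_space TYPE('u) Y" "paracompact_space Y"
  shows "paracompact_space (kprod K Y :: 'u topology)"
proof -
  have K': "compact_space K" "Hausdorff_space K" using K by (auto simp: test_space_def)
  have "kelleyfication TYPE('u) (prod_topology K Y) = prod_topology K Y"
    unfolding topology_eq openin_kelleyfication
    using cg_compact_prod[OF K Y(1)] openin_imp_k_open unfolding cg_space_def by blast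
  then have "kprod K Y = (ucopy (prod_topology K Y) :: 'u topology)" by (simp add: kprod_def)
  moreover have "small TYPE('u) (topspace (prod_topology K Y))"
    using cg_compact_prod[OF K Y(1)] by (rule cg_small)
  ultimately show ?thesis
    using paracompact_space_homeomorphic[OF homeomorphic_maps_ucopy paracompact_prod_compact[OF K' Y(2)]] by simp
qed

end

section \<open>Lifting criterion for weak equivalences\<close>

definition cube_boundary :: "nat \<Rightarrow> (nat \<Rightarrow> real) set" where
  "cube_boundary n = {x \<in> topspace (unit_cube n). \<exists>i<n. x i = 0 \<or> x i = 1}"

text \<open>
  The next two properties say that the space of lifts along \<open>q\<close> of a map from \<open>K\<close> is nonempty, respectively
  path connected if nonempty.
\<close>

definition lifts_over :: "'z topology \<Rightarrow> 't topology \<Rightarrow> ('z \<Rightarrow> 't) \<Rightarrow> 'k topology \<Rightarrow> bool" where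
  "lifts_over Z T q K \<longleftrightarrow>
     (\<forall>a. continuous_map K T a \<longrightarrow>
        (\<exists>z. continuous_map K Z z \<and> (\<forall>x\<in>topspace K. q (z x) = a x)))"

definition lifts_connected_over :: "'z topology \<Rightarrow> 't topology \<Rightarrow> ('z \<Rightarrow> 't) \<Rightarrow> 'k topology \<Rightarrow> bool" where
  "lifts_connected_over Z T q K \<longleftrightarrow>
     (\<forall>z\<^sub>0 z\<^sub>1. continuous_map K Z z\<^sub>0 \<longrightarrow> continuous_map K Z z\<^sub>1 \<longrightarrow>
        (\<forall>x\<in>topspace K. q (z\<^sub>0 x) = q (z\<^sub>1 x)) \<longrightarrow>
        (\<exists>H. continuous_map (prod_topology K (top_of_set {0..1::real})) Z H \<and>
           (\<forall>x\<in>topspace K. H (x, 0) = z\<^sub>0 x \<and> H (x, 1) = z\<^sub>1 x \<and> (\<forall>t\<in>{0..1}. q (H (x, t)) = q (z\<^sub>0 x)))))"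

definition cube_norm :: "nat \<Rightarrow> (nat \<Rightarrow> real) \<Rightarrow> real" where
  "cube_norm n x = Max (insert 0 ((\<lambda>i. \<bar>2 * x i - 1\<bar>) ` {..<n}))"

text \<open>
  Expansion by the factor \<open>1 + s\<close> about the centre, followed by radial retraction onto the cube. At \<open>s = 1\<close>
  it maps the collar of norm at least \<open>1/2\<close> to the boundary.
\<close>

definition cube_blowup :: "nat \<Rightarrow> real \<Rightarrow> (nat \<Rightarrow> real) \<Rightarrow> nat \<Rightarrow> real" where
  "cube_blowup n s x = (\<lambda>i\<in>{..<n}. 1/2 + (x i - 1/2) * ((1 + s) / max 1 ((1 + s) * cube_norm n x)))"

lemma topspace_unit_cube: "topspace (unit_cube n) = {..<n} \<rightarrow>\<^sub>E {0..1}"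
  by (simp add: unit_cube_def)

lemma cube_norm_ge: "i < n \<Longrightarrow> \<bar>2 * x i - 1\<bar> \<le> cube_norm n x"
  unfolding cube_norm_def by (intro Max_ge) auto

lemma cube_norm_attained: "cube_norm n x = 0 \<or> (\<exists>i<n. cube_norm n x = \<bar>2 * x i - 1\<bar>)"
  using Max_in[of "insert 0 ((\<lambda>i. \<bar>2 * x i - 1\<bar>) ` {..<n})"] unfolding cube_norm_def by auto

lemma cube_norm_le_1: 
  assumes "x \<in> topspace (unit_cube n)"
  shows "cube_norm n x \<le> 1"
proof -
  have "\<bar>2 * x i - 1\<bar> \<le> 1" if "i < n" for i
  proof -
    have "x i \<in> {0..1}" using assms that unfolding topspace_unit_cube by blast
    then show ?thesis by (simp add: abs_if)
  qed
  then show ?thesis unfolding cube_norm_def by (subst Max_le_iff) auto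
qed

lemma cube_norm_boundary: 
  assumes "x \<in> cube_boundary n"
  shows "cube_norm n x = 1"
proof -
  obtain i where "i < n" "x i = 0 \<or> x i = 1" and x: "x \<in> topspace (unit_cube n)"
    using assms unfolding cube_boundary_def by auto
  then have "1 \<le> cube_norm n x" using cube_norm_ge[of i n x] by auto
  then show ?thesis using cube_norm_le_1[OF x] by simp
qed

lemma continuous_map_Max_image:
  assumes "finite A" "\<And>i. i \<in> A \<Longrightarrow> continuous_map X euclideanreal (\<lambda>x. f x i)"
  shows "continuous_map X euclideanreal (\<lambda>x. Max (insert (0::real) (f x ` A)))"
  using assms
proof (induction A)
  case empty
  then show ?case by simp
next
  case (insert a A)
  have "Max (insert 0 (f x ` insert a A)) = max (f x a) (Max (insert 0 (f x ` A)))" for x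
    using insert(1) by (simp add: insert_commute[of 0] del: Max_insert) (subst Max_insert, auto)
  moreover have "continuous_map X euclideanreal (\<lambda>x. max (f x a) (Max (insert 0 (f x ` A))))"
    using insert by (intro continuous_map_real_max) auto
  ultimately show ?case by (simp only:)
qed

lemma continuous_map_cube_coordinate: "i < n \<Longrightarrow> continuous_map (unit_cube n) euclideanreal (\<lambda>x. x i)"
  unfolding unit_cube_def
  using continuous_map_product_projection[of i "{..<n}" "\<lambda>_. top_of_set {0..1::real}"]
  by (auto intro: continuous_map_into_fulltopology)

lemma continuous_map_cube_norm: "continuous_map (unit_cube n) euclideanreal (cube_norm n)"
  unfolding cube_norm_def
  by (intro continuous_map_Max_image[where f = "\<lambda>x i. \<bar>2 * x i - 1\<bar>"] continuous_intros continuous_map_cube_coordinate) auto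

lemma continuous_map_into_unit_cubeI:
  assumes "\<And>i. i < n \<Longrightarrow> continuous_map X euclideanreal (\<lambda>x. f x i)"
    and "\<And>x i. x \<in> topspace X \<Longrightarrow> i < n \<Longrightarrow> f x i \<in> {0..1}"
    and "\<And>x. x \<in> topspace X \<Longrightarrow> f x \<in> extensional {..<n}"
  shows "continuous_map X (unit_cube n) f"
  unfolding unit_cube_def continuous_map_componentwise
  using assms by (auto simp: continuous_map_in_subtopology image_subset_iff)

lemma cube_blowup_in:
  assumes x: "x \<in> topspace (unit_cube n)" and s: "0 \<le> s" 
  shows "i < n \<Longrightarrow> cube_blowup n s x i \<in> {0..1}"
proof -
  assume i: "i < n"
  let ?m = "max 1 ((1 + s) * cube_norm n x)"
  have "\<bar>(x i - 1/2) * ((1 + s) / ?m)\<bar> = \<bar>2 * x i - 1\<bar> * (1 + s) / ?m / 2"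
  proof -
    have "(x i - 1/2) * ((1 + s) / ?m) = ((2 * x i - 1) * (1 + s)) / (2 * ?m)" by (simp add: field_simps)
    then show ?thesis using s by (simp add: abs_mult)
  qed
  also have "\<dots> \<le> ((1 + s) * cube_norm n x) / ?m / 2"
    using cube_norm_ge[OF i, of x] s by (intro divide_right_mono) (auto simp: mult.commute intro: mult_right_mono)
  also have "\<dots> \<le> 1/2"
    using divide_le_eq_1_pos[of ?m "(1 + s) * cube_norm n x"] by simp
  finally have "\<bar>(x i - 1/2) * ((1 + s) / ?m)\<bar> \<le> 1/2" .
  then have "0 \<le> 1/2 + (x i - 1/2) * ((1 + s) / ?m) \<and> 1/2 + (x i - 1/2) * ((1 + s) / ?m) \<le> 1"
    unfolding abs_le_iff by linarith
  then show ?thesis using i by (simp add: cube_blowup_def)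
qed

lemma cube_blowup_boundary: 
  assumes "x \<in> cube_boundary n" "0 \<le> s"
  shows "cube_blowup n s x = x"
proof -
  have x: "x \<in> {..<n} \<rightarrow>\<^sub>E {0..1}" using assms(1) by (simp add: cube_boundary_def topspace_unit_cube)
  have "cube_blowup n s x i = x i" for i
    using cube_norm_boundary[OF assms(1)] assms(2) PiE_arb[OF x, of i] by (auto simp: cube_blowup_def max_def)
  then show ?thesis by blast
qed

lemma cube_blowup_0: 
  assumes x: "x \<in> topspace (unit_cube n)"
  shows "cube_blowup n 0 x = x"
proof -
  have x': "x \<in> {..<n} \<rightarrow>\<^sub>E {0..1}" using x by (simp add: topspace_unit_cube)
  have "cube_blowup n 0 x i = x i" for i
    using cube_norm_le_1[OF x] PiE_arb[OF x', of i] by (auto simp: cube_blowup_def max_def)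
  then show ?thesis by blast
qed

lemma cube_blowup_1_boundary:
  assumes x: "x \<in> topspace (unit_cube n)" and N: "1/2 \<le> cube_norm n x"
  shows "cube_blowup n 1 x \<in> cube_boundary n"
proof -
  obtain i where i: "i < n" and Ni: "cube_norm n x = \<bar>2 * x i - 1\<bar>"
    using cube_norm_attained[of n x] N by auto
  have "cube_blowup n 1 x i = 1/2 + (x i - 1/2) / \<bar>2 * x i - 1\<bar>"
    using N i Ni by (auto simp: cube_blowup_def max_def)
  also have "\<dots> = 0 \<or> \<dots> = 1" using N Ni by (auto simp: abs_if field_simps split: if_splits)
  finally have "cube_blowup n 1 x i = 0 \<or> cube_blowup n 1 x i = 1" .
  moreover have "cube_blowup n 1 x \<in> topspace (unit_cube n)"
    using cube_blowup_in[OF x, of 1] by (auto simp: topspace_unit_cube PiE_iff) (auto simp: cube_blowup_def)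
  ultimately show ?thesis using i by (auto simp: cube_boundary_def)
qed

lemma continuous_map_cube_blowup:
  "continuous_map (prod_topology (top_of_set {0..1::real}) (unit_cube n)) (unit_cube n) (\<lambda>(s, x). cube_blowup n s x)"
  (is "continuous_map ?P _ _")
proof (rule continuous_map_into_unit_cubeI)
  have s: "continuous_map ?P euclideanreal fst"
    using continuous_map_fst by (auto intro: continuous_map_into_fulltopology)
  have N: "continuous_map ?P euclideanreal (\<lambda>z. cube_norm n (snd z))"
    using continuous_map_compose[OF continuous_map_snd continuous_map_cube_norm] by (simp add: comp_def)
  fix i assume i: "i < n"
  have c: "continuous_map ?P euclideanreal (\<lambda>z. snd z i)"
    using continuous_map_compose[OF continuous_map_snd continuous_map_cube_coordinate[OF i]] by (simp add: comp_def)
  have "continuous_map ?P euclideanreal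
      (\<lambda>z. 1/2 + (snd z i - 1/2) * ((1 + fst z) / max 1 ((1 + fst z) * cube_norm n (snd z))))"
    by (intro continuous_map_add continuous_map_real_mult continuous_map_diff continuous_map_real_divide
      continuous_map_real_max c s N) auto
  then show "continuous_map ?P euclideanreal (\<lambda>z. (case z of (s, x) \<Rightarrow> cube_blowup n s x) i)"
    using i by (simp add: cube_blowup_def case_prod_beta)
qed (use cube_blowup_in in \<open>auto simp: cube_blowup_def\<close>)

text \<open>
  Only the composite of \<open>a\<close> with the blow-up is lifted: by a lift of \<open>a\<close> on the inner cube, and on the collar,
  which is blown up into the boundary, by the vertical homotopy from that lift to \<open>b\<close>.
\<close>

lemma lift_with_boundary:
  assumes L1: "lifts_over Z T q (unit_cube n)"
    and L2: "lifts_connected_over Z T q (subtopology (unit_cube n) (cube_boundary n))"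
    and a: "continuous_map (unit_cube n) T a"
    and b: "continuous_map (subtopology (unit_cube n) (cube_boundary n)) Z b"
    and ba: "\<And>x. x \<in> cube_boundary n \<Longrightarrow> q (b x) = a x"
  shows "\<exists>g. continuous_map (unit_cube n) Z g \<and> (\<forall>x\<in>cube_boundary n. g x = b x) \<and>
     (\<forall>x\<in>topspace (unit_cube n). q (g x) = a (cube_blowup n 1 x))"
proof -
  let ?I = "unit_cube n" and ?B = "subtopology (unit_cube n) (cube_boundary n)"
  have tB: "topspace ?B = cube_boundary n" by (auto simp: cube_boundary_def)
  obtain g0 where g0: "continuous_map ?I Z g0" "\<And>x. x \<in> topspace ?I \<Longrightarrow> q (g0 x) = a x"
    using L1 a unfolding lifts_over_def by blast
  have "continuous_map ?B Z g0" using g0(1) by (rule continuous_map_from_subtopology)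
  moreover have "\<forall>x\<in>topspace ?B. q (g0 x) = q (b x)" using g0(2) ba by (auto simp: cube_boundary_def)
  ultimately obtain H where H: "continuous_map (prod_topology ?B (top_of_set {0..1::real})) Z H"
      "\<And>x. x \<in> cube_boundary n \<Longrightarrow> H (x, 0) = g0 x \<and> H (x, 1) = b x"
      "\<And>x t. x \<in> cube_boundary n \<Longrightarrow> t \<in> {0..1} \<Longrightarrow> q (H (x, t)) = q (g0 x)"
  proof -
    assume that: "\<And>H. continuous_map (prod_topology ?B (top_of_set {0..1::real})) Z H \<Longrightarrow>
      (\<And>x. x \<in> cube_boundary n \<Longrightarrow> H (x, 0) = g0 x \<and> H (x, 1) = b x) \<Longrightarrow>
      (\<And>x t. x \<in> cube_boundary n \<Longrightarrow> t \<in> {0..1} \<Longrightarrow> q (H (x, t)) = q (g0 x)) \<Longrightarrow> thesis"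
    assume g0': "continuous_map ?B Z g0" "\<forall>x\<in>topspace ?B. q (g0 x) = q (b x)"
    obtain H where "continuous_map (prod_topology ?B (top_of_set {0..1::real})) Z H \<and>
        (\<forall>x\<in>topspace ?B. H (x, 0) = g0 x \<and> H (x, 1) = b x \<and> (\<forall>t\<in>{0..1}. q (H (x, t)) = q (g0 x)))"
      using L2[unfolded lifts_connected_over_def, rule_format, OF g0'(1) b g0'(2)[rule_format]] ..
    then show thesis unfolding tB by (intro that[of H]) simp_all
  qed
  let ?r = "cube_blowup n 1"
  have r: "continuous_map ?I ?I ?r"
    using continuous_map_o_Pair[OF continuous_map_cube_blowup, of 1] by (simp add: comp_def)
  let ?g = "\<lambda>x. if cube_norm n x \<le> 1/2 then g0 (?r x) else H (?r x, 2 * cube_norm n x - 1)"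
  have "continuous_map ?I Z ?g"
  proof (rule continuous_map_cases_le)
    show "continuous_map (subtopology ?I {x \<in> topspace ?I. cube_norm n x \<le> 1/2}) Z (\<lambda>x. g0 (?r x))"
      using continuous_map_compose[OF r g0(1)] by (auto simp: comp_def intro: continuous_map_from_subtopology)
    let ?C = "subtopology ?I {x \<in> topspace ?I. 1/2 \<le> cube_norm n x}"
    have "continuous_map ?C ?B ?r"
      using r cube_blowup_1_boundary by (auto simp: continuous_map_in_subtopology intro: continuous_map_from_subtopology)
    moreover have "continuous_map ?C (top_of_set {0..1::real}) (\<lambda>x. 2 * cube_norm n x - 1)"
      using cube_norm_le_1
      by (auto simp: continuous_map_in_subtopology
        intro!: continuous_map_from_subtopology continuous_intros continuous_map_real_mult_left continuous_map_cube_norm)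
    ultimately have "continuous_map ?C (prod_topology ?B (top_of_set {0..1::real})) (\<lambda>x. (?r x, 2 * cube_norm n x - 1))"
      by (simp add: continuous_map_pairwise comp_def)
    from continuous_map_compose[OF this H(1)]
    show "continuous_map ?C Z (\<lambda>x. H (?r x, 2 * cube_norm n x - 1))" by (simp add: comp_def)
    fix x assume x: "x \<in> topspace ?I" and N: "cube_norm n x = 1/2"
    have "?r x \<in> cube_boundary n" using x N by (intro cube_blowup_1_boundary) simp_all
    then show "g0 (?r x) = H (?r x, 2 * cube_norm n x - 1)" using H(2) by (simp add: N)
  qed (auto intro: continuous_map_cube_norm)
  moreover have "?g x = b x" if "x \<in> cube_boundary n" for x
    using cube_norm_boundary[OF that] cube_blowup_boundary[OF that] H(2)[OF that] by simp
  moreover have "q (?g x) = a (?r x)" if x: "x \<in> topspace ?I" for x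
  proof (cases "cube_norm n x \<le> 1/2")
    case True
    then show ?thesis using g0(2) continuous_map_image_subset_topspace[OF r] x by auto
  next
    case False
    then have "?r x \<in> cube_boundary n" using cube_blowup_1_boundary[OF x] by simp
    moreover have "2 * cube_norm n x - 1 \<in> {0..1}" using False cube_norm_le_1[OF x] by simp
    ultimately show ?thesis using H(3) False g0(2) by (auto simp: cube_boundary_def)
  qed
  ultimately show ?thesis by blast
qed

text \<open>
  A homotopy is a map on a cube of one dimension more, and its lift is prescribed on the boundary.
\<close>

lemma lift_homotopy:
  assumes L1: "lifts_over Z T q (unit_cube (Suc n))"
    and L2: "lifts_connected_over Z T q (subtopology (unit_cube (Suc n)) (cube_boundary (Suc n)))"
    and h: "continuous_map (prod_topology (top_of_set {0..1::real}) (unit_cube n)) T h"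
    and g1: "continuous_map (unit_cube n) Z g1" and g2: "continuous_map (unit_cube n) Z g2"
    and h0: "\<And>x. x \<in> topspace (unit_cube n) \<Longrightarrow> h (0, x) = q (g1 x)"
    and h1: "\<And>x. x \<in> topspace (unit_cube n) \<Longrightarrow> h (1, x) = q (g2 x)"
    and hb: "\<And>x t. x \<in> cube_boundary n \<Longrightarrow> t \<in> {0..1} \<Longrightarrow> h (t, x) = q (g1 x)"
    and gb: "\<And>x. x \<in> cube_boundary n \<Longrightarrow> g1 x = g2 x"
  shows "\<exists>k. continuous_map (prod_topology (top_of_set {0..1::real}) (unit_cube n)) Z k \<and>
     (\<forall>x\<in>topspace (unit_cube n). k (0, x) = g1 x \<and> k (1, x) = g2 x) \<and>
     (\<forall>x\<in>cube_boundary n. \<forall>t\<in>{0..1}. k (t, x) = g1 x)"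
proof -
  let ?I = "unit_cube n" and ?J = "unit_cube (Suc n)"
  let ?B = "subtopology ?J (cube_boundary (Suc n))"
  let ?P = "prod_topology (top_of_set {0..1::real}) ?I"
  let ?u = "\<lambda>x :: nat \<Rightarrow> real. restrict x {..<n}"
  have u: "continuous_map ?J ?I ?u"
    by (rule continuous_map_into_unit_cubeI)
       (auto simp: topspace_unit_cube PiE_iff intro: continuous_map_cube_coordinate)
  have uin: "?u x \<in> topspace ?I" if "x \<in> topspace ?J" for x
    using that by (auto simp: topspace_unit_cube PiE_iff)
  have xn: "x n \<in> {0..1}" if "x \<in> topspace ?J" for x :: "nat \<Rightarrow> real"
    using that by (auto simp: topspace_unit_cube PiE_iff)
  have "continuous_map ?J (top_of_set {0..1::real}) (\<lambda>x. x n)"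
    using xn by (auto simp: continuous_map_in_subtopology intro: continuous_map_cube_coordinate)
  then have "continuous_map ?J ?P (\<lambda>x. (x n, ?u x))" using u by (simp add: continuous_map_pairwise comp_def)
  from continuous_map_compose[OF this h] have a: "continuous_map ?J T (\<lambda>x. h (x n, ?u x))" by (simp add: comp_def)
  have side: "?u x \<in> cube_boundary n" if x: "x \<in> cube_boundary (Suc n)" "x n \<noteq> 0" "x n \<noteq> 1" for x
  proof -
    obtain i where "i < Suc n" "x i = 0 \<or> x i = 1" using x(1) unfolding cube_boundary_def by blast
    moreover from this have "i \<noteq> n" using x by auto
    ultimately have "i < n" "?u x i = 0 \<or> ?u x i = 1" by auto
    then show ?thesis using uin x(1) unfolding cube_boundary_def by blast
  qed
  \<comment> \<open>\<open>g1\<close> and \<open>g2\<close> agree on the sides, so the height of the cut does not matter.\<close>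
  let ?b = "\<lambda>x. if x n \<le> 1/2 then g1 (?u x) else g2 (?u x)"
  have b: "continuous_map ?B Z ?b"
  proof (rule continuous_map_cases_le)
    show "continuous_map (subtopology ?B {x \<in> topspace ?B. x n \<le> 1/2}) Z (\<lambda>x. g1 (?u x))"
      using continuous_map_compose[OF u g1] by (auto simp: comp_def intro: continuous_map_from_subtopology)
    show "continuous_map (subtopology ?B {x \<in> topspace ?B. 1/2 \<le> x n}) Z (\<lambda>x. g2 (?u x))"
      using continuous_map_compose[OF u g2] by (auto simp: comp_def intro: continuous_map_from_subtopology)
    fix x assume "x \<in> topspace ?B" "x n = 1/2"
    then show "g1 (?u x) = g2 (?u x)" using side gb by simp
  qed (auto intro: continuous_map_from_subtopology continuous_map_cube_coordinate)
  have ba: "q (?b x) = h (x n, ?u x)" if x: "x \<in> cube_boundary (Suc n)" for x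
  proof -
    have x': "x \<in> topspace ?J" using x by (simp add: cube_boundary_def)
    consider "x n = 0" | "x n = 1" | "x n \<noteq> 0" "x n \<noteq> 1" by blast
    then show ?thesis
    proof cases
      case 3
      then show ?thesis using side[OF x 3] hb gb xn[OF x'] by simp
    qed (use h0 h1 uin[OF x'] in auto)
  qed
  obtain g where g: "continuous_map ?J Z g" "\<And>x. x \<in> cube_boundary (Suc n) \<Longrightarrow> g x = ?b x"
    using lift_with_boundary[OF L1 L2 a b ba] by blast
  let ?v = "\<lambda>z :: real \<times> (nat \<Rightarrow> real). (snd z)(n := fst z)"
  have v: "continuous_map ?P ?J ?v"
  proof (rule continuous_map_into_unit_cubeI)
    fix i assume i: "i < Suc n"
    show "continuous_map ?P euclideanreal (\<lambda>x. ?v x i)"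
    proof (cases "i = n")
      case True
      have "continuous_map ?P euclideanreal fst"
        using continuous_map_fst by (auto intro: continuous_map_into_fulltopology)
      then show ?thesis using True by simp
    next
      case False
      then have "continuous_map ?I euclideanreal (\<lambda>x. x i)" using i by (intro continuous_map_cube_coordinate) simp
      from continuous_map_compose[OF continuous_map_snd this] show ?thesis using False by (simp add: comp_def)
    qed
  next
    fix z i assume "z \<in> topspace ?P" and i: "i < Suc n"
    then have "fst z \<in> {0..1}" "\<And>j. j < n \<Longrightarrow> snd z j \<in> {0..1}"
      by (simp_all add: topspace_unit_cube PiE_iff mem_Times_iff)
    then show "?v z i \<in> {0..1}" using i by (cases "i = n") simp_all
  next
    fix z assume "z \<in> topspace ?P"
    then have "snd z \<in> extensional {..<n}" by (simp add: topspace_unit_cube PiE_iff mem_Times_iff)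
    then show "?v z \<in> extensional {..<Suc n}" by (simp add: extensional_def)
  qed
  have uv: "?u (?v (t, x)) = x" if "x \<in> topspace ?I" for t x
    using that by (simp add: topspace_unit_cube PiE_iff extensional_def restrict_def fun_eq_iff)
  have vin: "?v (t, x) \<in> topspace ?J" if "x \<in> topspace ?I" "t \<in> {0..1}" for t x
  proof -
    have "(t, x) \<in> topspace ?P" using that by simp
    then have "?v (t, x) \<in> ?v ` topspace ?P" by (rule imageI)
    then show ?thesis using continuous_map_image_subset_topspace[OF v] by (rule rev_subsetD)
  qed
  show ?thesis
  proof (intro exI[of _ "g \<circ> ?v"] conjI ballI)
    show "continuous_map ?P Z (g \<circ> ?v)" using v g(1) by (rule continuous_map_compose)
  next
    fix x assume x: "x \<in> topspace ?I"
    have "?v (0, x) \<in> cube_boundary (Suc n)" "?v (1, x) \<in> cube_boundary (Suc n)"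
      using vin[OF x] by (auto simp: cube_boundary_def intro!: exI[of _ n])
    then show "(g \<circ> ?v) (0, x) = g1 x" "(g \<circ> ?v) (1, x) = g2 x"
      using g(2) uv[OF x, of 0] uv[OF x, of 1] by simp_all
  next
    fix x and t :: real assume x: "x \<in> cube_boundary n" and t: "t \<in> {0..1}"
    then obtain i where i: "i < n" "x i = 0 \<or> x i = 1" and xI: "x \<in> topspace ?I" by (auto simp: cube_boundary_def)
    have "?v (t, x) \<in> cube_boundary (Suc n)"
      using vin[OF xI t] i by (auto simp: cube_boundary_def intro!: exI[of _ i])
    then show "(g \<circ> ?v) (t, x) = g1 x" using g(2) uv[OF xI, of t] gb[OF x] by simp
  qed
qed

lemma based_at_cong:
  "(\<And>x. x \<in> topspace (unit_cube n) \<Longrightarrow> h x = k x) \<Longrightarrow> based_at n p h \<longleftrightarrow> based_at n p k"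
  unfolding based_at_def by simp

lemma based_at_boundary: "based_at n p h \<longleftrightarrow> (\<forall>x\<in>cube_boundary n. h x = p)"
  unfolding based_at_def cube_boundary_def by blast

lemma homotopic_based:
  "homotopic_with (based_at n p) (unit_cube n) X f g \<longleftrightarrow>
     (\<exists>h. continuous_map (prod_topology (top_of_set {0..1::real}) (unit_cube n)) X h \<and>
        (\<forall>x\<in>topspace (unit_cube n). h (0, x) = f x) \<and> (\<forall>x\<in>topspace (unit_cube n). h (1, x) = g x) \<and>
        (\<forall>t\<in>{0..1}. based_at n p (\<lambda>x. h (t, x))))"
  by (rule homotopic_with) (rule based_at_cong)

lemma spheroid_class_eq_iff:
  assumes "g \<in> spheroids n X x" "h \<in> spheroids n X x"
  shows "spheroid_class n X x g = spheroid_class n X x h \<longleftrightarrow> homotopic_with (based_at n x) (unit_cube n) X g h"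
proof
  assume "spheroid_class n X x g = spheroid_class n X x h"
  moreover have "h \<in> spheroid_class n X x h"
    using assms(2) by (simp add: spheroid_class_def spheroids_def)
  ultimately have "h \<in> spheroid_class n X x g" by simp
  then show "homotopic_with (based_at n x) (unit_cube n) X g h" by (simp add: spheroid_class_def)
next
  assume "homotopic_with (based_at n x) (unit_cube n) X g h"
  then show "spheroid_class n X x g = spheroid_class n X x h"
    unfolding spheroid_class_def by (blast intro: homotopic_with_trans homotopic_with_symD)
qed

lemma spheroids_compose:
  "g \<in> spheroids n X x \<Longrightarrow> continuous_map X Y f \<Longrightarrow> f \<circ> g \<in> spheroids n Y (f x)"
  by (auto simp: spheroids_def based_at_def intro: continuous_map_compose)

lemma induced_pi_class:
  assumes g: "g \<in> spheroids n X x" and f: "continuous_map X Y f"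
  shows "induced_pi n Y f x (spheroid_class n X x g) = spheroid_class n Y (f x) (f \<circ> g)"
proof -
  have "spheroid_class n Y (f x) (f \<circ> h) = spheroid_class n Y (f x) (f \<circ> g)"
    if h: "h \<in> spheroid_class n X x g" for h
  proof -
    have gh: "homotopic_with (based_at n x) (unit_cube n) X g h" using h by (simp add: spheroid_class_def)
    then have "h \<in> spheroids n X x"
      using homotopic_with_imp_continuous_maps[OF gh] homotopic_with_imp_property[OF gh] by (simp add: spheroids_def)
    moreover have "homotopic_with (based_at n (f x)) (unit_cube n) Y (f \<circ> g) (f \<circ> h)"
      using gh f by (rule homotopic_with_compose_continuous_map_left) (auto simp: based_at_def)
    ultimately show ?thesis
      using spheroid_class_eq_iff[OF spheroids_compose[OF g f] spheroids_compose[OF _ f]] by metis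
  qed
  moreover have "g \<in> spheroid_class n X x g" using g by (simp add: spheroid_class_def spheroids_def)
  ultimately show ?thesis unfolding induced_pi_def by blast
qed

lemma induced_pi0_component:
  fixes X :: "'a topology"
  assumes x: "x \<in> topspace X" and f: "continuous_map X Y f"
  shows "induced_pi0 Y f (path_component_of_set X x) = path_component_of_set Y (f x)"
proof -
  have "path_component_of_set Y (f c) = path_component_of_set Y (f x)" if pc: "path_component_of X x c" for c
  proof -
    obtain p :: "real \<Rightarrow> 'a" where p: "pathin X p" "p 0 = x" "p 1 = c"
      using pc unfolding path_component_of_def by blast
    have "pathin Y (f \<circ> p)" using p(1) f by (rule pathin_compose)
    then have "path_component_of Y (f x) (f c)" using p unfolding path_component_of_def by (metis comp_apply)
    then show ?thesis using path_component_of_equiv by metis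
  qed
  moreover have "path_component_of X x x" using x by (simp add: path_component_of_refl)
  ultimately show ?thesis unfolding induced_pi0_def by blast
qed

text \<open>
  Surjectivity on homotopy comes from lifting spheroids with constant boundary, up to the blow-up, and
  injectivity from lifting homotopies.
\<close>

theorem weak_equivalence_lifting:
  fixes Z :: "'a topology" and T :: "'b topology"
  assumes q: "continuous_map Z T q"
    and L1: "\<And>n. lifts_over Z T q (unit_cube n)"
    and L2: "\<And>n. lifts_connected_over Z T q (subtopology (unit_cube n) (cube_boundary n))"
  shows "weak_equivalence Z T q"
  unfolding weak_equivalence_def
proof (intro conjI ballI allI impI)
  show "continuous_map Z T q" by (rule q)
  have qT: "q z \<in> topspace T" if "z \<in> topspace Z" for z
    using continuous_map_image_subset_topspace[OF q] that by blast
  have pt: "topspace (unit_cube 0) = {\<lambda>_. undefined}" by (simp add: topspace_unit_cube)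
  show "bij_betw (induced_pi0 T q) (path_components_of Z) (path_components_of T)"
    unfolding bij_betw_def
  proof
    show "inj_on (induced_pi0 T q) (path_components_of Z)"
    proof (rule inj_onI)
      fix C D assume "C \<in> path_components_of Z" "D \<in> path_components_of Z"
        and eq: "induced_pi0 T q C = induced_pi0 T q D"
      then obtain z z' where z: "z \<in> topspace Z" "C = path_component_of_set Z z"
        and z': "z' \<in> topspace Z" "D = path_component_of_set Z z'" by (auto simp: path_components_of_def)
      have "path_component_of_set T (q z) = path_component_of_set T (q z')"
        using eq z z' induced_pi0_component[OF _ q] by simp
      then have "path_component_of T (q z) (q z')"
        using path_component_of_refl[of T "q z'"] qT z'(1) by blast
      then obtain p :: "real \<Rightarrow> 'b" where p: "continuous_map (top_of_set {0..1::real}) T p" "p 0 = q z" "p 1 = q z'"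
        unfolding path_component_of_def pathin_def by blast
      have "continuous_map (prod_topology (top_of_set {0..1::real}) (unit_cube 0)) T (p \<circ> fst)"
        using continuous_map_fst p(1) by (rule continuous_map_compose)
      from lift_homotopy[OF L1 L2 this, of "\<lambda>_. z" "\<lambda>_. z'"]
      obtain k where k: "continuous_map (prod_topology (top_of_set {0..1::real}) (unit_cube 0)) Z k"
          "k (0, \<lambda>_. undefined) = z" "k (1, \<lambda>_. undefined) = z'"
        using z(1) z'(1) p by (auto simp: cube_boundary_def pt)
      have "continuous_map (top_of_set {0..1::real}) Z (k \<circ> (\<lambda>t. (t, \<lambda>_. undefined)))"
        using k(1) by (intro continuous_map_compose[OF _ k(1)]) (simp add: continuous_map_pairwise comp_def pt)
      then have "path_component_of Z z z'" using k(2,3) unfolding path_component_of_def pathin_def by force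
      then show "C = D" using z z' path_component_of_equiv by metis
    qed
    show "induced_pi0 T q ` path_components_of Z = path_components_of T"
    proof (intro equalityI subsetI)
      fix C assume "C \<in> induced_pi0 T q ` path_components_of Z"
      then show "C \<in> path_components_of T"
        using induced_pi0_component[OF _ q] qT by (auto simp: path_components_of_def)
    next
      fix C assume "C \<in> path_components_of T"
      then obtain t where t: "t \<in> topspace T" "C = path_component_of_set T t" by (auto simp: path_components_of_def)
      then have "continuous_map (unit_cube 0) T (\<lambda>_. t)" by simp
      then obtain z where "continuous_map (unit_cube 0) Z z" "\<forall>x\<in>topspace (unit_cube 0). q (z x) = t"
        using L1[of 0] unfolding lifts_over_def by blast
      then have "z (\<lambda>_. undefined) \<in> topspace Z" "q (z (\<lambda>_. undefined)) = t"
        using continuous_map_image_subset_topspace pt by (blast, simp add: pt)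
      then show "C \<in> induced_pi0 T q ` path_components_of Z"
        using t induced_pi0_component[OF _ q] by (force simp: path_components_of_def)
    qed
  qed
next
  fix z and n :: nat assume z: "z \<in> topspace Z"
  show "bij_betw (induced_pi n T q z) (homotopy_set n Z z) (homotopy_set n T (q z))"
    unfolding bij_betw_def
  proof
    show "inj_on (induced_pi n T q z) (homotopy_set n Z z)"
    proof (rule inj_onI)
      fix C D assume "C \<in> homotopy_set n Z z" "D \<in> homotopy_set n Z z"
        and eq: "induced_pi n T q z C = induced_pi n T q z D"
      then obtain g1 g2 where g1: "g1 \<in> spheroids n Z z" "C = spheroid_class n Z z g1"
        and g2: "g2 \<in> spheroids n Z z" "D = spheroid_class n Z z g2" by (auto simp: homotopy_set_def)
      have "homotopic_with (based_at n (q z)) (unit_cube n) T (q \<circ> g1) (q \<circ> g2)"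
        using eq g1 g2 induced_pi_class[OF _ q] spheroid_class_eq_iff[OF spheroids_compose[OF _ q] spheroids_compose[OF _ q]]
        by metis
      then obtain h where h: "continuous_map (prod_topology (top_of_set {0..1::real}) (unit_cube n)) T h"
          "\<And>x. x \<in> topspace (unit_cube n) \<Longrightarrow> h (0, x) = q (g1 x)"
          "\<And>x. x \<in> topspace (unit_cube n) \<Longrightarrow> h (1, x) = q (g2 x)"
          "\<And>t. t \<in> {0..1} \<Longrightarrow> based_at n (q z) (\<lambda>x. h (t, x))"
        unfolding homotopic_based by auto
      have gc: "continuous_map (unit_cube n) Z g1" "continuous_map (unit_cube n) Z g2"
        and gb: "\<And>x. x \<in> cube_boundary n \<Longrightarrow> g1 x = z" "\<And>x. x \<in> cube_boundary n \<Longrightarrow> g2 x = z"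
        using g1 g2 by (auto simp: spheroids_def based_at_boundary)
      obtain k where "continuous_map (prod_topology (top_of_set {0..1::real}) (unit_cube n)) Z k"
          "\<forall>x\<in>topspace (unit_cube n). k (0, x) = g1 x \<and> k (1, x) = g2 x"
          "\<forall>x\<in>cube_boundary n. \<forall>t\<in>{0..1}. k (t, x) = g1 x"
        using lift_homotopy[OF L1 L2 h(1) gc h(2,3)] h(4) gb unfolding based_at_boundary by metis
      then have "homotopic_with (based_at n z) (unit_cube n) Z g1 g2"
        unfolding homotopic_based based_at_boundary using gb by (intro exI[of _ k]) simp
      then show "C = D" using g1 g2 spheroid_class_eq_iff by metis
    qed
    show "induced_pi n T q z ` homotopy_set n Z z = homotopy_set n T (q z)"
    proof (intro equalityI subsetI)
      fix C assume "C \<in> induced_pi n T q z ` homotopy_set n Z z"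
      then show "C \<in> homotopy_set n T (q z)"
        using induced_pi_class[OF _ q] spheroids_compose[OF _ q] by (auto simp: homotopy_set_def)
    next
      fix C assume "C \<in> homotopy_set n T (q z)"
      then obtain a where a: "a \<in> spheroids n T (q z)" "C = spheroid_class n T (q z) a" by (auto simp: homotopy_set_def)
      then have ac: "continuous_map (unit_cube n) T a" and ab: "\<And>x. x \<in> cube_boundary n \<Longrightarrow> a x = q z"
        by (auto simp: spheroids_def based_at_boundary)
      obtain g where g: "continuous_map (unit_cube n) Z g" "\<And>x. x \<in> cube_boundary n \<Longrightarrow> g x = z"
          "\<And>x. x \<in> topspace (unit_cube n) \<Longrightarrow> q (g x) = a (cube_blowup n 1 x)"
        using lift_with_boundary[OF L1 L2 ac, of "\<lambda>_. z"] ab z by auto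
      have gs: "g \<in> spheroids n Z z" using g by (simp add: spheroids_def based_at_boundary)
      have "homotopic_with (based_at n (q z)) (unit_cube n) T a (q \<circ> g)"
        unfolding homotopic_based based_at_boundary
      proof (intro exI[of _ "a \<circ> (\<lambda>(s, x). cube_blowup n s x)"] conjI ballI)
        show "continuous_map (prod_topology (top_of_set {0..1::real}) (unit_cube n)) T (a \<circ> (\<lambda>(s, x). cube_blowup n s x))"
          using continuous_map_cube_blowup ac by (rule continuous_map_compose)
      qed (use g(3) ab cube_blowup_0 cube_blowup_boundary in auto)
      then have "spheroid_class n T (q z) a = spheroid_class n T (q z) (q \<circ> g)"
        using spheroid_class_eq_iff[OF a(1) spheroids_compose[OF gs q]] by blast
      then have "C = induced_pi n T q z (spheroid_class n Z z g)" using a(2) induced_pi_class[OF gs q] by simp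
      then show "C \<in> induced_pi n T q z ` homotopy_set n Z z" using gs by (auto simp: homotopy_set_def)
    qed
  qed
qed

lemma bij_betw_eqI: "bij_betw f A B \<Longrightarrow> (\<And>a. a \<in> A \<Longrightarrow> f a = g a) \<Longrightarrow> bij_betw g A B"
  using bij_betw_cong[of A f g B] by simp

lemma weak_equivalence_homeomorphism:
  assumes "homeomorphic_maps X Y f g"
  shows "weak_equivalence X Y f"
proof (rule weak_equivalence_lifting)
  have fc: "continuous_map X Y f" and gc: "continuous_map Y X g"
    and gf: "\<And>x. x \<in> topspace X \<Longrightarrow> g (f x) = x" and fg: "\<And>y. y \<in> topspace Y \<Longrightarrow> f (g y) = y"
    using assms unfolding homeomorphic_maps_def by auto
  show "continuous_map X Y f" by (rule fc)
  show "lifts_over X Y f (unit_cube n)" for n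
    unfolding lifts_over_def
  proof (intro allI impI)
    fix a assume a: "continuous_map (unit_cube n) Y a"
    then have "f ((g \<circ> a) x) = a x" if "x \<in> topspace (unit_cube n)" for x
      using fg continuous_map_image_subset_topspace[OF a] that by auto
    then show "\<exists>z. continuous_map (unit_cube n) X z \<and> (\<forall>x\<in>topspace (unit_cube n). f (z x) = a x)"
      using continuous_map_compose[OF a gc] by blast
  qed
  show "lifts_connected_over X Y f (subtopology (unit_cube n) (cube_boundary n))" (is "lifts_connected_over X Y f ?K") for n
    unfolding lifts_connected_over_def
  proof (intro allI impI)
    fix z0 z1 assume z0: "continuous_map ?K X z0" and z1: "continuous_map ?K X z1"
      and eq: "\<forall>x\<in>topspace ?K. f (z0 x) = f (z1 x)"
    have "z0 x = z1 x" if "x \<in> topspace ?K" for x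
    proof -
      have "z0 x \<in> topspace X" "z1 x \<in> topspace X"
        using that continuous_map_image_subset_topspace[OF z0] continuous_map_image_subset_topspace[OF z1] by blast+
      then show ?thesis using gf eq that by metis
    qed
    then show "\<exists>H. continuous_map (prod_topology ?K (top_of_set {0..1::real})) X H \<and>
        (\<forall>x\<in>topspace ?K. H (x, 0) = z0 x \<and> H (x, 1) = z1 x \<and> (\<forall>t\<in>{0..1}. f (H (x, t)) = f (z0 x)))"
      using continuous_map_compose[OF continuous_map_fst z0] by (intro exI[of _ "z0 \<circ> fst"]) auto
  qed
qed

lemma weak_equivalence_compose:
  assumes f: "weak_equivalence X Y f" and g: "weak_equivalence Y Z g" and h: "\<And>x. x \<in> topspace X \<Longrightarrow> g (f x) = h x"
  shows "weak_equivalence X Z h"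
proof -
  have fc: "continuous_map X Y f" and gc: "continuous_map Y Z g" using f g by (auto simp: weak_equivalence_def)
  have hc: "continuous_map X Z h" using continuous_map_compose[OF fc gc] by (rule continuous_map_eq) (simp add: h)
  have fY: "f x \<in> topspace Y" if "x \<in> topspace X" for x using continuous_map_image_subset_topspace[OF fc] that by blast
  show ?thesis
    unfolding weak_equivalence_def
  proof (intro conjI ballI allI impI)
    have "bij_betw (induced_pi0 Z g \<circ> induced_pi0 Y f) (path_components_of X) (path_components_of Z)"
      using f g by (auto simp: weak_equivalence_def intro: bij_betw_trans)
    moreover have "(induced_pi0 Z g \<circ> induced_pi0 Y f) C = induced_pi0 Z h C" if "C \<in> path_components_of X" for C
      using that fY induced_pi0_component[OF _ fc] induced_pi0_component[OF _ gc] induced_pi0_component[OF _ hc]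
      by (auto simp: path_components_of_def h)
    ultimately show "bij_betw (induced_pi0 Z h) (path_components_of X) (path_components_of Z)" by (rule bij_betw_eqI)
  next
    fix x and n :: nat assume x: "x \<in> topspace X" and n: "1 \<le> n"
    have "bij_betw (induced_pi n Y f x) (homotopy_set n X x) (homotopy_set n Y (f x))"
      and "bij_betw (induced_pi n Z g (f x)) (homotopy_set n Y (f x)) (homotopy_set n Z (h x))"
      using f g x n fY by (simp_all add: weak_equivalence_def flip: h)
    then have bij: "bij_betw (induced_pi n Z g (f x) \<circ> induced_pi n Y f x) (homotopy_set n X x) (homotopy_set n Z (h x))"
      by (rule bij_betw_trans)
    have "(induced_pi n Z g (f x) \<circ> induced_pi n Y f x) C = induced_pi n Z h x C" if C: "C \<in> homotopy_set n X x" for C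
    proof -
      obtain s where s: "s \<in> spheroids n X x" "C = spheroid_class n X x s" using C by (auto simp: homotopy_set_def)
      have sX: "s t \<in> topspace X" if "t \<in> topspace (unit_cube n)" for t
        using s(1) that continuous_map_image_subset_topspace by (fastforce simp: spheroids_def)
      note fs = spheroids_compose[OF s(1) fc] and hs = spheroids_compose[OF s(1) hc]
      have gfs: "g \<circ> (f \<circ> s) \<in> spheroids n Z (h x)" using spheroids_compose[OF fs gc] by (simp add: h[OF x])
      have "homotopic_with (based_at n (h x)) (unit_cube n) Z (g \<circ> (f \<circ> s)) (h \<circ> s)"
        using gfs hs h sX by (intro homotopic_with_equal) (auto simp: spheroids_def)
      then show ?thesis
        using spheroid_class_eq_iff[OF gfs hs] induced_pi_class[OF s(1) fc] induced_pi_class[OF fs gc] induced_pi_class[OF s(1) hc]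
        by (simp add: s(2) h[OF x])
    qed
    with bij show "bij_betw (induced_pi n Z h x) (homotopy_set n X x) (homotopy_set n Z (h x))" by (rule bij_betw_eqI)
  qed (rule hc)
qed

lemma weakly_contractible_imp_path_connected:
  assumes "weakly_contractible X"
  shows "path_connected_space X"
proof -
  have "bij_betw (induced_pi0 (discrete_topology {()}) (\<lambda>_. ())) (path_components_of X) (path_components_of (discrete_topology {()}))"
    using assms by (simp add: weakly_contractible_def weak_equivalence_def)
  then have inj: "inj_on (induced_pi0 (discrete_topology {()}) (\<lambda>_. ())) (path_components_of X)" by (simp add: bij_betw_def)
  have "path_component_of X x y" if x: "x \<in> topspace X" and y: "y \<in> topspace X" for x y
  proof -
    have "induced_pi0 (discrete_topology {()}) (\<lambda>_. ()) (path_component_of_set X x) =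
        induced_pi0 (discrete_topology {()}) (\<lambda>_. ()) (path_component_of_set X y)"
      using x y by (simp add: induced_pi0_component)
    then have "path_component_of_set X x = path_component_of_set X y"
      using inj x y by (auto simp: inj_on_def path_components_of_def)
    then show ?thesis using path_component_of_refl[of X y] y by blast
  qed
  then show ?thesis by (simp add: path_connected_space_iff_path_component)
qed

lemma ex1_unique: "\<exists>!x. P x \<Longrightarrow> P a \<Longrightarrow> P b \<Longrightarrow> a = b"
  by blast

abbreviation cg :: "'u topology \<Rightarrow> bool" where
  "cg T \<equiv> cg_space TYPE('u) T"

section \<open>Weil restriction along a product projection\<close>

text \<open>
  \<open>Z\<close> represents the functor sending \<open>h : S \<rightarrow> T\<close> to the lifts of \<open>h \<times> Y\<close> along \<open>q : I \<rightarrow> T \<times> Y\<close>.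
\<close>

definition weil_restriction ::
  "'u topology \<Rightarrow> 'u topology \<Rightarrow> 'u topology \<Rightarrow> ('u \<Rightarrow> 'u) \<Rightarrow> 'u topology \<Rightarrow> ('u \<Rightarrow> 'u) \<Rightarrow> ('u \<Rightarrow> 'u) \<Rightarrow> bool"
where
  "weil_restriction T Y I q Z r ev \<longleftrightarrow>
     cg Z \<and> r \<in> cmaps Z T \<and> ev \<in> cmaps (kprod Z Y) I \<and>
     compose (topspace (kprod Z Y :: 'u topology)) q ev = ktimes Z T Y r \<and>
     (\<forall>(S :: 'u topology) h c. cg S \<longrightarrow> h \<in> cmaps S T \<longrightarrow> c \<in> cmaps (kprod S Y) I \<longrightarrow>
        compose (topspace (kprod S Y :: 'u topology)) q c = ktimes S T Y h \<longrightarrow>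
        (\<exists>!k. k \<in> cmaps S Z \<and> compose (topspace S) r k = h \<and>
              compose (topspace (kprod S Y :: 'u topology)) ev (ktimes S Z Y k) = c))"

context universe begin

lemma ktimes_kpt:
  assumes "cg_space TYPE('u) T" "cg_space TYPE('u) Y" "t \<in> topspace T" "y \<in> topspace Y"
  shows "ktimes T S Y h (kpt T Y t y :: 'u) = kpt S Y (h t) y"
  using assms by (simp add: ktimes_def kpt_in)

lemma kprod_eqI:
  assumes "cg_space TYPE('u) S" "cg_space TYPE('u) Y"
    and "f \<in> extensional (topspace (kprod S Y :: 'u topology))" "g \<in> extensional (topspace (kprod S Y :: 'u topology))"
    and "\<And>s y. s \<in> topspace S \<Longrightarrow> y \<in> topspace Y \<Longrightarrow> f (kpt S Y s y :: 'u) = g (kpt S Y s y)"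
  shows "f = g"
proof (rule extensionalityI[OF assms(3,4)])
  fix p assume "p \<in> topspace (kprod S Y :: 'u topology)"
  then show "f p = g p" using kprod_cases[OF assms(1,2)] assms(5) by metis
qed

lemma compose_kpt:
  assumes "cg_space TYPE('u) S" "cg_space TYPE('u) Y" "s \<in> topspace S" "y \<in> topspace Y"
  shows "compose (topspace (kprod S Y :: 'u topology)) f g (kpt S Y s y) = f (g (kpt S Y s y))"
  using assms by (simp add: compose_def kpt_in)

lemma ktimes_extensional: "ktimes T S Y h \<in> extensional (topspace (kprod T Y :: 'u topology))"
  by (simp add: ktimes_def)

text \<open>
  The points of the Weil restriction over \<open>t\<close> are the sections of \<open>q\<close> over \<open>{t} \<times> Y\<close>.
\<close>

lemma weil_restriction_exists:
  fixes T Y I :: "'u topology"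
  assumes T: "cg T" and Y: "cg Y" "Hausdorff_space Y" and I: "cg I"
    and q: "q \<in> cmaps I (kprod T Y)"
  shows "\<exists>Z r ev. weil_restriction T Y I q Z r ev"
proof -
  let ?M = "mapping_space Y I"
  define D where "D = {(t, s). t \<in> topspace T \<and> s \<in> cmaps Y I \<and> (\<forall>y\<in>topspace Y. q (s y) = kpt T Y t y)}"
  let ?Z1 = "subtopology (prod_topology T ?M) D"
  let ?Z0 = "kelleyfication TYPE('u) ?Z1"
  define Z :: "'u topology" where "Z = ucopy ?Z0"
  have tZ0: "topspace ?Z0 = D" by (auto simp: D_def)
  have M: "cg_space TYPE('u) ?M" using Y(1) I by (rule cg_mapping_space)
  have smD: "small TYPE('u) D"
    by (rule small_subset[of _ "topspace T \<times> topspace ?M"]) (use cg_small[OF M] in \<open>auto simp: D_def intro!: small_Times cg_small T\<close>)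
  have Z0: "cg_space TYPE('u) ?Z0" using smD tZ0 by (intro cg_space_kelleyfication) simp
  have Z: "cg Z" unfolding Z_def using Z0 by (rule cg_space_ucopy)
  define dec where "dec = (udec D :: 'u \<Rightarrow> _)"
  define enc where "enc = (uenc D :: _ \<Rightarrow> 'u)"
  have dc: "continuous_map Z ?Z1 dec"
    using continuous_map_udec[of ?Z0] unfolding Z_def dec_def tZ0 by (rule continuous_map_into_kelleyfication_D)
  have dD: "dec z \<in> D" if "z \<in> topspace Z" for z
    using continuous_map_image_subset_topspace[OF dc] that by auto
  have ec: "continuous_map ?Z0 Z enc"
    using continuous_map_uenc[of ?Z0] smD unfolding Z_def enc_def tZ0 by blast
  have de: "dec (enc d) = d" if "d \<in> D" for d using smD that by (simp add: dec_def enc_def udec_uenc)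
  have ed: "enc (dec z) = z" if "z \<in> topspace Z" for z
    using that uenc_udec[of z D] unfolding Z_def topspace_ucopy tZ0 dec_def enc_def by simp
  define r where "r = (\<lambda>z\<in>topspace Z. fst (dec z))"
  define s where "s = (\<lambda>z\<in>topspace Z. snd (dec z))"
  define ev :: "'u \<Rightarrow> 'u" where "ev = kuncurry Z Y s"
  have dcp: "continuous_map Z (prod_topology T ?M) dec" using dc by (simp add: continuous_map_in_subtopology)
  have r: "r \<in> cmaps Z T"
    unfolding r_def using continuous_map_compose[OF dcp continuous_map_fst] by (intro restrict_cmaps) (simp add: comp_def)
  have s: "s \<in> cmaps Z ?M"
    unfolding s_def using continuous_map_compose[OF dcp continuous_map_snd] by (intro restrict_cmaps) (simp add: comp_def)
  have ev: "ev \<in> cmaps (kprod Z Y) I" unfolding ev_def using kuncurry_cmap[OF Z Y(1) s] .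
  have evk: "ev (kpt Z Y z y) = snd (dec z) y" if "z \<in> topspace Z" "y \<in> topspace Y" for z y
    using that Z Y(1) by (simp add: ev_def kuncurry_def kpt_in kpr1_kpt kpr2_kpt s_def)
  have Dq: "q (snd (dec z) y) = kpt T Y (fst (dec z)) y" if "z \<in> topspace Z" "y \<in> topspace Y" for z y
    using dD[OF that(1)] that(2) unfolding D_def by (auto simp: case_prod_beta)
  have "weil_restriction T Y I q Z r ev"
    unfolding weil_restriction_def
  proof (intro conjI allI impI)
    show "compose (topspace (kprod Z Y :: 'u topology)) q ev = ktimes Z T Y r"
      by (rule kprod_eqI[OF Z Y(1)])
        (simp_all add: ktimes_extensional compose_kpt[OF Z Y(1)] ktimes_kpt[OF Z Y(1)] evk Dq r_def)
  next
    fix S :: "'u topology" and h and c :: "'u \<Rightarrow> 'u"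
    assume S: "cg S" and h: "h \<in> cmaps S T" and c: "c \<in> cmaps (kprod S Y) I"
      and qc: "compose (topspace (kprod S Y :: 'u topology)) q c = ktimes S T Y h"
    have qcp: "q (c (kpt S Y x y)) = kpt T Y (h x) y" if "x \<in> topspace S" "y \<in> topspace Y" for x y
      using fun_cong[OF qc, of "kpt S Y x y"] that by (simp add: compose_kpt[OF S Y(1)] ktimes_kpt[OF S Y(1)])
    have cc: "kcurry S Y c \<in> cmaps S ?M" using kcurry_cmap[OF S Y c] .
    let ?k0 = "\<lambda>x. (h x, kcurry S Y c x)"
    have k0D: "?k0 x \<in> D" if "x \<in> topspace S" for x
      using cmaps_image[OF h that] cmaps_image[OF cc that] qcp that by (auto simp: D_def kcurry_def)
    have "continuous_map S ?Z1 ?k0"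
      using h cc k0D by (auto simp: cmaps_def continuous_map_in_subtopology continuous_map_pairwise comp_def)
    then have "continuous_map S ?Z0 ?k0" by (rule continuous_map_into_kelleyfication[OF S])
    from continuous_map_compose[OF this ec] have k0: "continuous_map S Z (\<lambda>x. enc (?k0 x))" by (simp add: comp_def)
    define k where "k = (\<lambda>x\<in>topspace S. enc (?k0 x))"
    have k: "k \<in> cmaps S Z" unfolding k_def using k0 by (rule restrict_cmaps)
    have kZ: "k x \<in> topspace Z" and dk: "dec (k x) = ?k0 x" if "x \<in> topspace S" for x
      using cmaps_image[OF k that] de[OF k0D[OF that]] that by (simp_all add: k_def)
    show "\<exists>!k. k \<in> cmaps S Z \<and> compose (topspace S) r k = h \<and>
          compose (topspace (kprod S Y :: 'u topology)) ev (ktimes S Z Y k) = c"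
    proof (rule ex1I[of _ k])
      have "compose (topspace S) r k = h"
        by (rule cmaps_ext[OF compose_cmaps[OF k r] h]) (simp add: compose_def r_def kZ dk)
      moreover have "compose (topspace (kprod S Y :: 'u topology)) ev (ktimes S Z Y k) = c"
        by (rule kprod_eqI[OF S Y(1)])
          (use c in \<open>simp_all add: cmaps_def compose_kpt[OF S Y(1)] ktimes_kpt[OF S Y(1)] evk kZ dk kcurry_def\<close>)
      ultimately show "k \<in> cmaps S Z \<and> compose (topspace S) r k = h \<and>
          compose (topspace (kprod S Y :: 'u topology)) ev (ktimes S Z Y k) = c" using k by blast
    next
      fix k' assume k': "k' \<in> cmaps S Z \<and> compose (topspace S) r k' = h \<and>
          compose (topspace (kprod S Y :: 'u topology)) ev (ktimes S Z Y k') = c"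
      show "k' = k"
      proof (rule cmaps_ext[OF conjunct1[OF k'] k])
        fix x assume x: "x \<in> topspace S"
        have k'Z: "k' x \<in> topspace Z" using cmaps_image[OF conjunct1[OF k'] x] .
        have "compose (topspace S) r k' x = h x" using k' by simp
        then have 1: "fst (dec (k' x)) = h x" using x k'Z by (simp add: compose_def r_def)
        have "snd (dec (k' x)) y = c (kpt S Y x y)" if "y \<in> topspace Y" for y
        proof -
          have "compose (topspace (kprod S Y :: 'u topology)) ev (ktimes S Z Y k') (kpt S Y x y) = c (kpt S Y x y)"
            using k' by simp
          then show ?thesis using x that k'Z by (simp add: compose_kpt[OF S Y(1)] ktimes_kpt[OF S Y(1)] evk)
        qed
        moreover have "snd (dec (k' x)) \<in> extensional (topspace Y)"
          using dD[OF k'Z] by (auto simp: D_def cmaps_def)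
        ultimately have 2: "snd (dec (k' x)) = kcurry S Y c x"
          using x by (intro extensionalityI[of _ "topspace Y"]) (auto simp: kcurry_def)
        have "dec (k' x) = dec (k x)" using 1 2 dk[OF x] by (simp add: prod_eq_iff)
        then show "k' x = k x" using ed[OF k'Z] ed[OF kZ[OF x]] by metis
      qed
    qed
  qed (use Z r ev in auto)
  then show ?thesis by blast
qed

lemma cg_interval: "cg_space TYPE('u) (top_of_set {0..1::real})"
proof (rule compact_Hausdorff_imp_cg)
  show "small TYPE('u) (topspace (top_of_set {0..1::real}))" using small_real by (rule small_subset[rotated]) simp
qed (auto simp: compact_space_subtopology Hausdorff_space_subtopology)

lemma topspace_section_space:
  "topspace (section_space Z T q) = {s \<in> cmaps T Z. \<forall>t\<in>topspace T. q (s t) = t}"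
  by (auto simp: section_space_def)

text \<open>
  \<open>J\<close> plays the base change of \<open>I\<close> along \<open>a \<times> Y\<close>: lifts of \<open>a \<times> Y\<close> to \<open>I\<close> come from sections of \<open>J\<close>, which form a
  nonempty path connected space.
\<close>

definition lift_model ::
  "'u topology \<Rightarrow> 'u topology \<Rightarrow> 'u topology \<Rightarrow> ('u \<Rightarrow> 'u) \<Rightarrow> 'u topology \<Rightarrow> ('u \<Rightarrow> 'u) \<Rightarrow>
   'u topology \<Rightarrow> ('u \<Rightarrow> 'u) \<Rightarrow> ('u \<Rightarrow> 'u) \<Rightarrow> bool" where
  "lift_model T Y I q K a J qJ j \<longleftrightarrow>
     cg J \<and> qJ \<in> cmaps J (kprod K Y) \<and> j \<in> cmaps J I \<and>
     compose (topspace J) q j = compose (topspace J) (ktimes K T Y a) qJ \<and>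
     (\<forall>c\<in>cmaps (kprod K Y :: 'u topology) I. compose (topspace (kprod K Y :: 'u topology)) q c = ktimes K T Y a \<longrightarrow>
        (\<exists>\<sigma>\<in>cmaps (kprod K Y) J. compose (topspace (kprod K Y :: 'u topology)) qJ \<sigma> = idmap (kprod K Y) \<and>
           compose (topspace (kprod K Y :: 'u topology)) j \<sigma> = c)) \<and>
     topspace (section_space J (kprod K Y) qJ) \<noteq> {} \<and>
     path_connected_space (section_space J (kprod K Y) qJ)"

context
  fixes T Y I Z :: "'u topology" and q r ev
  assumes W: "weil_restriction T Y I q Z r ev"
    and T: "cg T" and Y: "cg Y" "paracompact_space Y"
begin

lemma weil_facts:
  "cg Z" "r \<in> cmaps Z T" "ev \<in> cmaps (kprod Z Y) I"
  "compose (topspace (kprod Z Y :: 'u topology)) q ev = ktimes Z T Y r"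
  using W by (auto simp: weil_restriction_def)

lemma weil_unique:
  fixes S :: "'u topology"
  assumes "cg S" "h \<in> cmaps S T" "c \<in> cmaps (kprod S Y) I"
    "compose (topspace (kprod S Y :: 'u topology)) q c = ktimes S T Y h"
  shows "\<exists>!k. k \<in> cmaps S Z \<and> compose (topspace S) r k = h \<and>
     compose (topspace (kprod S Y :: 'u topology)) ev (ktimes S Z Y k) = c"
  by (rule W[unfolded weil_restriction_def, THEN conjunct2, THEN conjunct2, THEN conjunct2, THEN conjunct2,
    rule_format, OF assms])

lemma weil_lift_exists:
  assumes K: "cg K" and a: "a \<in> cmaps K T" and J: "lift_model T Y I q K a J qJ j"
  shows "\<exists>z\<in>cmaps K Z. compose (topspace K) r z = a"
proof -
  let ?P = "kprod K Y :: 'u topology"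
  have qJ: "qJ \<in> cmaps J ?P" and j: "j \<in> cmaps J I"
    and qj: "compose (topspace J) q j = compose (topspace J) (ktimes K T Y a) qJ"
    using J by (simp_all add: lift_model_def)
  obtain \<sigma> where s: "\<sigma> \<in> cmaps ?P J" "\<And>p. p \<in> topspace ?P \<Longrightarrow> qJ (\<sigma> p) = p"
  proof -
    assume that: "\<And>\<sigma>. \<sigma> \<in> cmaps ?P J \<Longrightarrow> (\<And>p. p \<in> topspace ?P \<Longrightarrow> qJ (\<sigma> p) = p) \<Longrightarrow> thesis"
    have "topspace (section_space J ?P qJ) \<noteq> {}" using J by (simp add: lift_model_def)
    then show thesis using that unfolding topspace_section_space by blast
  qed
  have c: "compose (topspace ?P) j \<sigma> \<in> cmaps ?P I" using s(1) j by (rule compose_cmaps)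
  have "compose (topspace ?P) q (compose (topspace ?P) j \<sigma>) = ktimes K T Y a"
  proof (rule extensionalityI[of _ "topspace ?P"])
    fix p assume p: "p \<in> topspace ?P"
    have "compose (topspace J) q j (\<sigma> p) = compose (topspace J) (ktimes K T Y a) qJ (\<sigma> p)" using qj by simp
    then show "compose (topspace ?P) q (compose (topspace ?P) j \<sigma>) p = ktimes K T Y a p"
      using p cmaps_image[OF s(1) p] s(2)[OF p] by (simp add: compose_def)
  qed (simp_all add: ktimes_extensional)
  from ex1_implies_ex[OF weil_unique[OF K a c this]] show ?thesis by blast
qed

text \<open>
  A path of sections over \<open>K \<times> Y\<close> is by currying a map on \<open>(K \<times> [0, 1]) \<times> Y\<close>, which the universal property
  of \<open>Z\<close> turns into a homotopy; uniqueness identifies its ends.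
\<close>

lemma weil_lift_homotopy:
  assumes K: "test_space K" and a: "a \<in> cmaps K T" and J: "lift_model T Y I q K a J qJ j"
    and z: "z\<^sub>0 \<in> cmaps K Z" "z\<^sub>1 \<in> cmaps K Z"
    and rz: "compose (topspace K) r z\<^sub>0 = a" "compose (topspace K) r z\<^sub>1 = a"
  shows "\<exists>H. continuous_map (prod_topology K (top_of_set {0..1::real})) Z H \<and>
    (\<forall>x\<in>topspace K. H (x, 0) = z\<^sub>0 x \<and> H (x, 1) = z\<^sub>1 x \<and> (\<forall>t\<in>{0..1}. r (H (x, t)) = a x))"
proof -
  let ?P = "kprod K Y :: 'u topology" and ?U = "top_of_set {0..1::real}"
  let ?K' = "kprod K ?U :: 'u topology"
  have Kc: "cg K" using K by (rule test_space_imp_cg)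
  have P: "cg ?P" using Kc Y(1) by (rule cg_kprod)
  have K': "cg ?K'" using Kc cg_interval by (rule cg_kprod)
  have Jc: "cg J" and qJ: "qJ \<in> cmaps J ?P" and j: "j \<in> cmaps J I"
    and qj: "compose (topspace J) q j = compose (topspace J) (ktimes K T Y a) qJ"
    using J by (simp_all add: lift_model_def)
  have qjp: "q (j x) = ktimes K T Y a (qJ x)" if "x \<in> topspace J" for x
    using fun_cong[OF qj, of x] that by (simp add: compose_def)
  have sec: "\<exists>\<sigma>. \<sigma> \<in> topspace (section_space J ?P qJ) \<and>
      compose (topspace ?P) j \<sigma> = compose (topspace ?P) ev (ktimes K Z Y z)"
    if z: "z \<in> cmaps K Z" and rz: "compose (topspace K) r z = a" for z
  proof -
    have c: "compose (topspace ?P) ev (ktimes K Z Y z) \<in> cmaps ?P I"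
      using ktimes_cmap[OF Kc weil_facts(1) Y(1) z] weil_facts(3) by (rule compose_cmaps)
    have "q (ev (kpt Z Y (z x) y)) = kpt T Y (a x) y" if "x \<in> topspace K" "y \<in> topspace Y" for x y
    proof -
      have zx: "z x \<in> topspace Z" using cmaps_image[OF z that(1)] .
      have "r (z x) = a x" using fun_cong[OF rz, of x] that by (simp add: compose_def)
      then show ?thesis
        using fun_cong[OF weil_facts(4), of "kpt Z Y (z x) y"] zx that
        by (simp add: compose_kpt[OF weil_facts(1) Y(1)] ktimes_kpt[OF weil_facts(1) Y(1)])
    qed
    then have "compose (topspace ?P) q (compose (topspace ?P) ev (ktimes K Z Y z)) = ktimes K T Y a"
      by (intro kprod_eqI[OF Kc Y(1)]) (simp_all add: ktimes_extensional compose_kpt[OF Kc Y(1)] ktimes_kpt[OF Kc Y(1)])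
    then obtain \<sigma> where s: "\<sigma> \<in> cmaps ?P J" "compose (topspace ?P) qJ \<sigma> = idmap ?P"
        "compose (topspace ?P) j \<sigma> = compose (topspace ?P) ev (ktimes K Z Y z)"
      using J c unfolding lift_model_def by blast
    have "qJ (\<sigma> p) = p" if "p \<in> topspace ?P" for p
      using fun_cong[OF s(2), of p] that by (simp add: compose_def idmap_def)
    then show ?thesis using s by (auto simp: topspace_section_space)
  qed
  obtain \<sigma>0 where s0: "\<sigma>0 \<in> topspace (section_space J ?P qJ)"
      "compose (topspace ?P) j \<sigma>0 = compose (topspace ?P) ev (ktimes K Z Y z\<^sub>0)" using sec[OF z(1) rz(1)] by blast
  obtain \<sigma>1 where s1: "\<sigma>1 \<in> topspace (section_space J ?P qJ)"
      "compose (topspace ?P) j \<sigma>1 = compose (topspace ?P) ev (ktimes K Z Y z\<^sub>1)" using sec[OF z(2) rz(2)] by blast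
  have "path_connected_space (section_space J ?P qJ)" using J by (simp add: lift_model_def)
  then obtain \<gamma> :: "real \<Rightarrow> 'u \<Rightarrow> 'u" where g: "pathin (section_space J ?P qJ) \<gamma>" "\<gamma> 0 = \<sigma>0" "\<gamma> 1 = \<sigma>1"
    using s0(1) s1(1) unfolding path_connected_space_def by blast
  have gc: "continuous_map ?U (section_space J ?P qJ) \<gamma>" using g(1) by (simp add: pathin_def)
  have gs: "\<gamma> t \<in> topspace (section_space J ?P qJ)" if "t \<in> {0..1}" for t
    using continuous_map_image_subset_topspace[OF gc] that by auto
  have "continuous_map ?U (mapping_space ?P J) \<gamma>"
    using continuous_map_into_kelleyfication_D[OF gc[unfolded section_space_def]]
    by (simp add: continuous_map_in_subtopology)
  then have f: "restrict \<gamma> {0..1} \<in> cmaps ?U (mapping_space ?P J)" using restrict_cmaps by fastforce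
  let ?f = "kuncurry ?U ?P (restrict \<gamma> {0..1})"
  have fc: "?f \<in> cmaps (kprod ?U ?P :: 'u topology) J" using kuncurry_cmap[OF cg_interval P f] .
  have fk: "?f (kpt ?U ?P t p) = \<gamma> t p" if "t \<in> {0..1}" "p \<in> topspace ?P" for t p
    using that by (simp add: kuncurry_def kpt_in[OF cg_interval P] kpr1_kpt[OF cg_interval P] kpr2_kpt[OF cg_interval P])
  let ?Q = "kprod ?K' Y :: 'u topology"
  have Q: "cg ?Q" using K' Y(1) by (rule cg_kprod)
  let ?x = "\<lambda>p. kpr1 K ?U (kpr1 ?K' Y p)" and ?t = "\<lambda>p. kpr2 K ?U (kpr1 ?K' Y p)"
  have pr: "continuous_map ?Q ?K' (kpr1 ?K' Y)" "continuous_map ?Q Y (kpr2 ?K' Y)"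
      "continuous_map ?K' K (kpr1 K ?U)" "continuous_map ?K' ?U (kpr2 K ?U)"
    using kpr1_cmap[OF K' Y(1)] kpr2_cmap[OF K' Y(1)] kpr1_cmap[OF Kc cg_interval] kpr2_cmap[OF Kc cg_interval]
    by (simp_all add: cmaps_def)
  have "continuous_map ?Q K ?x" "continuous_map ?Q ?U ?t"
    using continuous_map_compose[OF pr(1) pr(3)] continuous_map_compose[OF pr(1) pr(4)] by (simp_all add: comp_def)
  then have "continuous_map ?Q (kprod ?U ?P :: 'u topology) (\<lambda>p. kpt ?U ?P (?t p) (kpt K Y (?x p) (kpr2 ?K' Y p)))"
    using pr(2) by (intro continuous_map_kpt[OF cg_interval P Q] continuous_map_kpt[OF Kc Y(1) Q])
  then have "continuous_map ?Q J (?f \<circ> (\<lambda>p. kpt ?U ?P (?t p) (kpt K Y (?x p) (kpr2 ?K' Y p))))"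
    using fc by (auto simp: cmaps_def intro: continuous_map_compose)
  then have c0: "continuous_map ?Q I (j \<circ> (?f \<circ> (\<lambda>p. kpt ?U ?P (?t p) (kpt K Y (?x p) (kpr2 ?K' Y p)))))"
    using j by (auto simp: cmaps_def intro: continuous_map_compose)
  define c where "c = restrict (j \<circ> (?f \<circ> (\<lambda>p. kpt ?U ?P (?t p) (kpt K Y (?x p) (kpr2 ?K' Y p))))) (topspace ?Q)"
  have c: "c \<in> cmaps ?Q I" unfolding c_def using c0 by (rule restrict_cmaps)
  have kU: "kpt K ?U x t \<in> topspace ?K'" if "x \<in> topspace K" "t \<in> {0..1}" for x t
    using that by (simp add: kpt_in[OF Kc cg_interval])
  have ck: "c (kpt ?K' Y (kpt K ?U x t) y) = j (\<gamma> t (kpt K Y x y))"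
    if "x \<in> topspace K" "t \<in> {0..1}" "y \<in> topspace Y" for x t y
    using that kU[OF that(1,2)] fk[OF that(2) kpt_in[OF Kc Y(1) that(1,3)]]
    by (simp add: c_def kpt_in[OF K' Y(1)] kpr1_kpt[OF K' Y(1)] kpr2_kpt[OF K' Y(1)]
      kpr1_kpt[OF Kc cg_interval] kpr2_kpt[OF Kc cg_interval])
  let ?a = "compose (topspace ?K') a (kpr1 K ?U)"
  have a': "?a \<in> cmaps ?K' T" using kpr1_cmap[OF Kc cg_interval] a by (rule compose_cmaps)
  have "compose (topspace ?Q) q c = ktimes ?K' T Y ?a"
  proof (rule kprod_eqI[OF K' Y(1)])
    fix s y assume s: "s \<in> topspace ?K'" and y: "y \<in> topspace Y"
    obtain x t where xt: "x \<in> topspace K" "t \<in> {0..1}" "s = kpt K ?U x t"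
      using kprod_cases[OF Kc cg_interval s] by auto
    have p: "kpt K Y x y \<in> topspace ?P" using kpt_in[OF Kc Y(1) xt(1) y] .
    have gJ: "\<gamma> t (kpt K Y x y) \<in> topspace J" "qJ (\<gamma> t (kpt K Y x y)) = kpt K Y x y"
      using gs[OF xt(2)] p cmaps_image by (auto simp: topspace_section_space)
    have "q (c (kpt ?K' Y s y)) = kpt T Y (a x) y"
      using ck[OF xt(1,2) y] qjp[OF gJ(1)] gJ(2) xt y by (simp add: ktimes_kpt[OF Kc Y(1)])
    then show "compose (topspace ?Q) q c (kpt ?K' Y s y) = ktimes ?K' T Y ?a (kpt ?K' Y s y)"
      using s y xt by (simp add: compose_kpt[OF K' Y(1)] ktimes_kpt[OF K' Y(1)] compose_def kpt_in[OF K' Y(1)] kpr1_kpt[OF Kc cg_interval])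
  qed (simp_all add: ktimes_extensional)
  from ex1_implies_ex[OF weil_unique[OF K' a' c this]]
  obtain k where k: "k \<in> cmaps ?K' Z" "compose (topspace ?K') r k = ?a"
      "compose (topspace ?Q) ev (ktimes ?K' Z Y k) = c" by blast
  have kcg: "cg_space TYPE('u) (prod_topology K ?U)"
    using K cg_small[OF cg_interval]
    by (intro compact_Hausdorff_imp_cg)
      (auto simp: test_space_def compact_space_prod_topology Hausdorff_space_prod_topology
        compact_space_subtopology Hausdorff_space_subtopology small_Times)
  define H where "H = (\<lambda>z. k (kpt K ?U (fst z) (snd z)))"
  have "continuous_map (prod_topology K ?U) ?K' (\<lambda>z. kpt K ?U (fst z) (snd z))"
    by (intro continuous_map_kpt[OF Kc cg_interval kcg] continuous_map_fst continuous_map_snd)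
  moreover have "continuous_map ?K' Z k" using k(1) by (simp add: cmaps_def)
  ultimately have "continuous_map (prod_topology K ?U) Z (k \<circ> (\<lambda>z. kpt K ?U (fst z) (snd z)))"
    by (rule continuous_map_compose)
  then have Hc: "continuous_map (prod_topology K ?U) Z H" by (simp add: H_def comp_def)
  have rH: "r (H (x, t)) = a x" if "x \<in> topspace K" "t \<in> {0..1}" for x t
    using fun_cong[OF k(2), of "kpt K ?U x t"] kU[OF that] that by (simp add: H_def compose_def kpr1_kpt[OF Kc cg_interval])
  have evH: "ev (kpt Z Y (H (x, t)) y) = j (\<gamma> t (kpt K Y x y))"
    if "x \<in> topspace K" "t \<in> {0..1}" "y \<in> topspace Y" for x t y
    using fun_cong[OF k(3), of "kpt ?K' Y (kpt K ?U x t) y"] kU[OF that(1,2)] that ck[OF that]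
    by (simp add: H_def compose_kpt[OF K' Y(1)] ktimes_kpt[OF K' Y(1)])
  have endpoint: "H (x, t) = z x"
    if t: "t \<in> {0..1}" and z: "z \<in> cmaps K Z" and rz: "compose (topspace K) r z = a" 
      and st: "compose (topspace ?P) j (\<gamma> t) = compose (topspace ?P) ev (ktimes K Z Y z)" and x: "x \<in> topspace K" for t z x
  proof -
    let ?z' = "\<lambda>x\<in>topspace K. H (x, t)"
    have "continuous_map K (prod_topology K ?U) (\<lambda>x. (x, t))" using t by (simp add: continuous_map_pairwise comp_def)
    from continuous_map_compose[OF this Hc] have z': "?z' \<in> cmaps K Z" by (intro restrict_cmaps) (simp add: comp_def)
    have 1: "compose (topspace K) r ?z' = a"
      by (rule cmaps_ext[OF compose_cmaps[OF z' weil_facts(2)] a]) (simp add: compose_def rH[OF _ t])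
    have 2: "compose (topspace ?P) ev (ktimes K Z Y ?z') = compose (topspace ?P) j (\<gamma> t)"
      by (rule kprod_eqI[OF Kc Y(1)]) (simp_all add: compose_kpt[OF Kc Y(1)] ktimes_kpt[OF Kc Y(1)] evH[OF _ t])
    have c': "compose (topspace ?P) j (\<gamma> t) \<in> cmaps ?P I"
      using gs[OF t] j by (intro compose_cmaps) (simp_all add: topspace_section_space)
    have "compose (topspace ?P) q (compose (topspace ?P) j (\<gamma> t)) = ktimes K T Y a"
    proof (rule kprod_eqI[OF Kc Y(1)])
      fix x y assume xy: "x \<in> topspace K" "y \<in> topspace Y"
      have p: "kpt K Y x y \<in> topspace ?P" using kpt_in[OF Kc Y(1) xy] .
      have "\<gamma> t (kpt K Y x y) \<in> topspace J" "qJ (\<gamma> t (kpt K Y x y)) = kpt K Y x y"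
        using gs[OF t] p cmaps_image by (auto simp: topspace_section_space)
      then show "compose (topspace ?P) q (compose (topspace ?P) j (\<gamma> t)) (kpt K Y x y) = ktimes K T Y a (kpt K Y x y)"
        using xy qjp by (simp add: compose_kpt[OF Kc Y(1)])
    qed (simp_all add: ktimes_extensional)
    from weil_unique[OF Kc a c' this] have "?z' = z" by (rule ex1_unique) (use z' 1 2 z rz st in simp_all)
    then show ?thesis using x by (metis restrict_apply')
  qed
  show ?thesis
    using Hc rH endpoint[of 0 z\<^sub>0] endpoint[of 1 z\<^sub>1] s0(2) s1(2) g(2,3) z rz by (intro exI[of _ H]) auto
qed

lemma weil_weak_equivalence:
  assumes J: "\<And>K a. test_space K \<Longrightarrow> a \<in> cmaps K T \<Longrightarrow> \<exists>J qJ j. lift_model T Y I q K a J qJ j"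
  shows "weak_equivalence Z T r"
proof (rule weak_equivalence_lifting)
  show rc: "continuous_map Z T r" using weil_facts(2) by (simp add: cmaps_def)
  have cube: "small TYPE('u) (topspace (unit_cube n))" "compact_space (unit_cube n)" "Hausdorff_space (unit_cube n)" for n
  proof -
    have "small TYPE('u) ({..<n} \<rightarrow>\<^sub>E (UNIV :: real set))" by (intro small_PiE small_finite small_real) simp
    then show "small TYPE('u) (topspace (unit_cube n))"
      by (rule small_subset[rotated]) (auto simp: topspace_unit_cube PiE_iff)
  qed (auto simp: unit_cube_def compact_space_product_topology Hausdorff_space_product_topology
      compact_space_subtopology Hausdorff_space_subtopology)
  have copy: "homeomorphic_maps K (ucopy K :: 'u topology) (uenc (topspace K)) (udec (topspace K))"
      "test_space (ucopy K :: 'u topology)"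
    if "small TYPE('u) (topspace K)" "compact_space K" "Hausdorff_space K" for K :: "(nat \<Rightarrow> real) topology"
    using homeomorphic_maps_ucopy[OF that(1)] test_space_ucopy[OF that] by auto
  show "lifts_over Z T r (unit_cube n)" for n
    unfolding lifts_over_def
  proof (intro allI impI)
    fix a assume a: "continuous_map (unit_cube n) T a"
    let ?K = "ucopy (unit_cube n) :: 'u topology"
    let ?e = "uenc (topspace (unit_cube n)) :: _ \<Rightarrow> 'u" and ?d = "udec (topspace (unit_cube n)) :: 'u \<Rightarrow> _"
    have e: "continuous_map (unit_cube n) ?K ?e" and d: "continuous_map ?K (unit_cube n) ?d"
      and de: "\<And>x. x \<in> topspace (unit_cube n) \<Longrightarrow> ?d (?e x) = x"
      using copy(1)[OF cube] by (auto simp: homeomorphic_maps_def)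
    have K: "test_space ?K" using copy(2)[OF cube] .
    let ?a = "restrict (a \<circ> ?d) (topspace ?K)"
    have a': "?a \<in> cmaps ?K T" using d a by (intro restrict_cmaps continuous_map_compose)
    obtain J qJ j where "lift_model T Y I q ?K ?a J qJ j" using J[OF K a'] by blast
    then obtain z where z: "z \<in> cmaps ?K Z" "compose (topspace ?K) r z = ?a"
      using weil_lift_exists[OF test_space_imp_cg[OF K] a'] by blast
    have "r (z (?e x)) = a x" if x: "x \<in> topspace (unit_cube n)" for x
    proof -
      have "?e x \<in> topspace ?K" using continuous_map_image_subset_topspace[OF e] x by blast
      then show ?thesis using fun_cong[OF z(2), of "?e x"] de[OF x] by (simp add: compose_def)
    qed
    moreover have "continuous_map (unit_cube n) Z (z \<circ> ?e)"
      using e z(1) by (auto simp: cmaps_def intro: continuous_map_compose)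
    ultimately show "\<exists>z. continuous_map (unit_cube n) Z z \<and> (\<forall>x\<in>topspace (unit_cube n). r (z x) = a x)"
      by (intro exI[of _ "z \<circ> ?e"]) simp
  qed
  show "lifts_connected_over Z T r (subtopology (unit_cube n) (cube_boundary n))" (is "lifts_connected_over Z T r ?B") for n
    unfolding lifts_connected_over_def
  proof (intro allI impI)
    have "cube_boundary n = (\<Union>i<n. {x \<in> topspace (unit_cube n). x i \<in> {0, 1}})"
      by (auto simp: cube_boundary_def)
    moreover have "closedin (unit_cube n) {x \<in> topspace (unit_cube n). x i \<in> {0, 1}}" if "i < n" for i
      using continuous_map_cube_coordinate[OF that] by (rule closedin_continuous_map_preimage) (simp add: closed_insert)
    ultimately have "closedin (unit_cube n) (cube_boundary n)" by (auto intro!: closedin_Union)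
    then have "compact_space ?B" using cube(2) by (simp add: closedin_compact_space compact_space_subtopology)
    moreover have "small TYPE('u) (topspace ?B)" using cube(1)[of n] by (rule small_subset[rotated]) simp
    moreover have "Hausdorff_space ?B" using cube(3) by (rule Hausdorff_space_subtopology)
    ultimately have B: "small TYPE('u) (topspace ?B)" "compact_space ?B" "Hausdorff_space ?B" by blast+
    fix z0 z1 assume z0: "continuous_map ?B Z z0" and z1: "continuous_map ?B Z z1"
      and eq: "\<forall>x\<in>topspace ?B. r (z0 x) = r (z1 x)"
    let ?K = "ucopy ?B :: 'u topology"
    let ?e = "uenc (topspace ?B) :: _ \<Rightarrow> 'u" and ?d = "udec (topspace ?B) :: 'u \<Rightarrow> _"
    have e: "continuous_map ?B ?K ?e" and d: "continuous_map ?K ?B ?d"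
      and de: "\<And>x. x \<in> topspace ?B \<Longrightarrow> ?d (?e x) = x"
      using copy(1)[OF B] by (auto simp: homeomorphic_maps_def)
    have K: "test_space ?K" using copy(2)[OF B] .
    let ?z0 = "restrict (z0 \<circ> ?d) (topspace ?K)" and ?z1 = "restrict (z1 \<circ> ?d) (topspace ?K)"
    have z0': "?z0 \<in> cmaps ?K Z" and z1': "?z1 \<in> cmaps ?K Z"
      using d z0 z1 by (auto intro!: restrict_cmaps continuous_map_compose)
    let ?a = "compose (topspace ?K) r ?z0"
    have a': "?a \<in> cmaps ?K T" using z0' weil_facts(2) by (rule compose_cmaps)
    have dB: "?d x \<in> topspace ?B" if "x \<in> topspace ?K" for x using continuous_map_image_subset_topspace[OF d] that by blast
    have "compose (topspace ?K) r ?z1 = ?a" using eq dB by (auto simp: compose_def fun_eq_iff)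
    moreover obtain J qJ j where "lift_model T Y I q ?K ?a J qJ j" using J[OF K a'] by blast
    ultimately obtain H where H: "continuous_map (prod_topology ?K (top_of_set {0..1::real})) Z H"
        "\<And>x. x \<in> topspace ?K \<Longrightarrow> H (x, 0) = ?z0 x \<and> H (x, 1) = ?z1 x \<and> (\<forall>t\<in>{0..1}. r (H (x, t)) = ?a x)"
      using weil_lift_homotopy[OF K a' _ z0' z1' refl] by blast
    have eK: "?e x \<in> topspace ?K" if "x \<in> topspace ?B" for x using continuous_map_image_subset_topspace[OF e] that by blast
    have "continuous_map (prod_topology ?B (top_of_set {0..1::real})) (prod_topology ?K (top_of_set {0..1::real})) (\<lambda>x. (?e (fst x), snd x))"
      using continuous_map_compose[OF continuous_map_fst e] by (simp add: continuous_map_pairwise comp_def continuous_map_snd)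
    from continuous_map_compose[OF this H(1)]
    have "continuous_map (prod_topology ?B (top_of_set {0..1::real})) Z (\<lambda>x. H (?e (fst x), snd x))" by (simp add: comp_def)
    then show "\<exists>H. continuous_map (prod_topology ?B (top_of_set {0..1::real})) Z H \<and>
        (\<forall>x\<in>topspace ?B. H (x, 0) = z0 x \<and> H (x, 1) = z1 x \<and> (\<forall>t\<in>{0..1}. r (H (x, t)) = r (z0 x)))"
      using H(2)[OF eK] de eK by (intro exI[of _ "\<lambda>x. H (?e (fst x), snd x)"]) (simp add: compose_def)
  qed
qed

end

end

section \<open>Categories over the site\<close>

text \<open>Sources of functors and powers enter only with this part of being fibered.\<close>

definition sitecat :: "('u, 'o, 'm) fibcat \<Rightarrow> bool" where
  "sitecat \<X> \<longleftrightarrow> is_category \<X> \<and> projects_to_site \<X>"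

definition arr :: "('u, 'o, 'm) fibcat \<Rightarrow> 'o \<Rightarrow> 'o \<Rightarrow> ('u \<Rightarrow> 'u) \<Rightarrow> 'm \<Rightarrow> bool" where
  "arr \<X> x y h a \<longleftrightarrow> a \<in> Ar \<X> \<and> src \<X> a = x \<and> tgt \<X> a = y \<and> bmap \<X> a = h"

definition compmap :: "'a topology \<Rightarrow> ('b \<Rightarrow> 'c) \<Rightarrow> ('a \<Rightarrow> 'b) \<Rightarrow> 'a \<Rightarrow> 'c" where
  "compmap T g f = compose (topspace T) g f"

lemma arrI: "a \<in> Ar \<X> \<Longrightarrow> arr \<X> (src \<X> a) (tgt \<X> a) (bmap \<X> a) a"
  by (simp add: arr_def)

lemma arrD: "arr \<X> x y h a \<Longrightarrow> a \<in> Ar \<X>" "arr \<X> x y h a \<Longrightarrow> src \<X> a = x"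
  "arr \<X> x y h a \<Longrightarrow> tgt \<X> a = y" "arr \<X> x y h a \<Longrightarrow> bmap \<X> a = h"
  by (simp_all add: arr_def)

lemma fibered_sitecat: "fibered_in_groupoids \<X> \<Longrightarrow> sitecat \<X>"
  by (simp add: fibered_in_groupoids_def sitecat_def)

lemma cg_base: "sitecat (\<X> :: ('u, 'o, 'm) fibcat) \<Longrightarrow> x \<in> Ob \<X> \<Longrightarrow> cg (base \<X> x)"
  by (simp add: sitecat_def projects_to_site_def)

lemma arr_ob: "sitecat \<X> \<Longrightarrow> arr \<X> x y h a \<Longrightarrow> x \<in> Ob \<X>"
  "sitecat \<X> \<Longrightarrow> arr \<X> x y h a \<Longrightarrow> y \<in> Ob \<X>"
  by (auto simp: sitecat_def is_category_def arr_def)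

lemma arr_bmap: "sitecat \<X> \<Longrightarrow> arr \<X> x y h a \<Longrightarrow> h \<in> cmaps (base \<X> x) (base \<X> y)"
  by (auto simp: sitecat_def projects_to_site_def arr_def)

lemma arr_ident: "sitecat \<X> \<Longrightarrow> x \<in> Ob \<X> \<Longrightarrow> arr \<X> x x (idmap (base \<X> x)) (ident \<X> x)"
  by (simp add: sitecat_def is_category_def projects_to_site_def arr_def)

lemma arr_cmp:
  "sitecat \<X> \<Longrightarrow> arr \<X> x y h a \<Longrightarrow> arr \<X> y z k b \<Longrightarrow> arr \<X> x z (compmap (base \<X> x) k h) (cmp \<X> b a)"
  by (simp add: sitecat_def is_category_def projects_to_site_def arr_def compmap_def)

lemma cmp_assoc:
  "sitecat \<X> \<Longrightarrow> arr \<X> x y h a \<Longrightarrow> arr \<X> y z k b \<Longrightarrow> arr \<X> z w l c \<Longrightarrow>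
     cmp \<X> c (cmp \<X> b a) = cmp \<X> (cmp \<X> c b) a"
  by (simp add: sitecat_def is_category_def arr_def)

lemma cmp_ident_right: "sitecat \<X> \<Longrightarrow> arr \<X> x y h a \<Longrightarrow> cmp \<X> a (ident \<X> x) = a"
  by (auto simp: sitecat_def is_category_def arr_def)

lemma cmp_ident_left: "sitecat \<X> \<Longrightarrow> arr \<X> x y h a \<Longrightarrow> cmp \<X> (ident \<X> y) a = a"
  by (auto simp: sitecat_def is_category_def arr_def)

lemma compmap_cmaps: "f \<in> cmaps T S \<Longrightarrow> g \<in> cmaps S Z \<Longrightarrow> compmap T g f \<in> cmaps T Z"
  unfolding compmap_def by (rule compose_cmaps)

lemma compmap_apply: "t \<in> topspace T \<Longrightarrow> compmap T g f t = g (f t)"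
  by (simp add: compmap_def compose_def)

lemma compmap_extensional: "compmap T g f \<in> extensional (topspace T)"
  by (simp add: compmap_def)

lemma compmap_idmap_left: "f \<in> cmaps T S \<Longrightarrow> compmap T (idmap S) f = f"
  by (rule cmaps_ext[OF compmap_cmaps[OF _ idmap_cmaps]]) (auto simp: compmap_apply idmap_def dest: cmaps_image)

lemma compmap_idmap_right: "f \<in> cmaps T S \<Longrightarrow> compmap T f (idmap T) = f"
  by (rule cmaps_ext[OF compmap_cmaps[OF idmap_cmaps]]) (auto simp: compmap_apply idmap_def)

lemma compmap_assoc: "f \<in> cmaps T S \<Longrightarrow> compmap T h (compmap T g f) = compmap T (compmap S h g) f"
  by (auto simp: compmap_def compose_def fun_eq_iff dest: cmaps_image)

lemma fib_lift:
  fixes \<X> :: "('u, 'o, 'm) fibcat"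
  assumes "fibered_in_groupoids \<X>" "x \<in> Ob \<X>" "cg T" "f \<in> cmaps T (base \<X> x)"
  shows "\<exists>w a. arr \<X> w x f a \<and> base \<X> w = T"
  using assms unfolding fibered_in_groupoids_def arr_def by blast

lemma fib_factor:
  assumes X: "fibered_in_groupoids \<X>" and a: "arr \<X> x z h a" and b: "arr \<X> y z k b"
    and g: "g \<in> cmaps (base \<X> y) (base \<X> x)" and k: "compmap (base \<X> y) h g = k"
  shows "\<exists>!c. arr \<X> y x g c \<and> cmp \<X> a c = b"
proof -
  have "\<exists>!c. c \<in> Ar \<X> \<and> src \<X> c = src \<X> b \<and> tgt \<X> c = src \<X> a \<and> bmap \<X> c = g \<and> cmp \<X> a c = b"
    using X[unfolded fibered_in_groupoids_def, THEN conjunct2, THEN conjunct2, THEN conjunct2, rule_format, of a b g]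
      a b g k unfolding arr_def compmap_def by simp
  then show ?thesis using a b unfolding arr_def by (simp only: conj_assoc)
qed

lemma fib_cancel:
  assumes X: "fibered_in_groupoids \<X>" and a: "arr \<X> x z h a"
    and c: "arr \<X> y x g c" and c': "arr \<X> y x g c'" and eq: "cmp \<X> a c = cmp \<X> a c'"
  shows "c = c'"
proof -
  note S = fibered_sitecat[OF X]
  show ?thesis
    by (rule ex1_unique[OF fib_factor[OF X a arr_cmp[OF S c a] arr_bmap[OF S c] refl]]) (use c c' eq in simp_all)
qed

lemma fib_inverse:
  assumes X: "fibered_in_groupoids \<X>" and a: "arr \<X> x y (idmap (base \<X> x)) a" and bs: "base \<X> y = base \<X> x"
  shows "\<exists>b. arr \<X> y x (idmap (base \<X> x)) b \<and> cmp \<X> a b = ident \<X> y \<and> cmp \<X> b a = ident \<X> x"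
proof -
  note S = fibered_sitecat[OF X]
  have y: "y \<in> Ob \<X>" and x: "x \<in> Ob \<X>" using arr_ob[OF S a] by auto
  have 1: "idmap (base \<X> x) \<in> cmaps (base \<X> y) (base \<X> x)" using bs idmap_cmaps by metis
  have 2: "compmap (base \<X> y) (idmap (base \<X> x)) (idmap (base \<X> x)) = idmap (base \<X> y)"
    using compmap_idmap_left[OF idmap_cmaps] bs by metis
  obtain b where b: "arr \<X> y x (idmap (base \<X> x)) b" "cmp \<X> a b = ident \<X> y"
    using ex1_implies_ex[OF fib_factor[OF X a arr_ident[OF S y] 1 2]] by blast
  have ba: "arr \<X> x x (idmap (base \<X> x)) (cmp \<X> b a)"
    using arr_cmp[OF S a b(1)] compmap_idmap_left[OF idmap_cmaps] by metis
  have "cmp \<X> a (cmp \<X> b a) = cmp \<X> a (ident \<X> x)"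
    using cmp_assoc[OF S a b(1) a] b(2) cmp_ident_left[OF S a] cmp_ident_right[OF S a] by simp
  from fib_cancel[OF X a ba arr_ident[OF S x] this] show ?thesis using b by blast
qed

lemma fib_cancel_right:
  assumes X: "fibered_in_groupoids \<X>" and a: "arr \<X> x y (idmap (base \<X> x)) a" and bs: "base \<X> y = base \<X> x"
    and b: "arr \<X> y z h b" and b': "arr \<X> y z h' b'" and eq: "cmp \<X> b a = cmp \<X> b' a"
  shows "b = b'"
proof -
  note S = fibered_sitecat[OF X]
  obtain c where c: "arr \<X> y x (idmap (base \<X> x)) c" "cmp \<X> a c = ident \<X> y"
    using fib_inverse[OF X a bs] by blast
  have 1: "cmp \<X> (cmp \<X> b a) c = b" "cmp \<X> (cmp \<X> b' a) c = b'"
    using cmp_assoc[OF S c(1) a b, symmetric] cmp_assoc[OF S c(1) a b', symmetric] c(2) cmp_ident_right[OF S b] cmp_ident_right[OF S b'] by simp_all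
  show ?thesis using 1(1)[unfolded eq] 1(2) by (rule trans[OF sym])
qed

subsection \<open>Functors and transformations\<close>

lemma paste_squares:
  assumes S: "sitecat \<X>" and arr: "arr \<X> x y i f" "arr \<X> y y' j b" "arr \<X> y' y'' k d" "arr \<X> x x' l a" "arr \<X> x' x'' m c"
      "arr \<X> x' y' n g" "arr \<X> x'' y'' o' h"
    and eq: "cmp \<X> b f = cmp \<X> g a" "cmp \<X> d g = cmp \<X> h c"
  shows "cmp \<X> (cmp \<X> d b) f = cmp \<X> h (cmp \<X> c a)"
  using cmp_assoc[OF S arr(1,2,3)] cmp_assoc[OF S arr(4,6,3)] cmp_assoc[OF S arr(4,5,7)] eq by simp

lemma inverse_square:
  assumes S: "sitecat \<X>" and a: "arr \<X> x y i \<alpha>" "arr \<X> y x i' \<alpha>'" "cmp \<X> \<alpha>' \<alpha> = ident \<X> x"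
    and d: "arr \<X> z w j \<delta>" "arr \<X> w z j' \<delta>'" "cmp \<X> \<delta> \<delta>' = ident \<X> w"
    and f: "arr \<X> z x k f" and g: "arr \<X> w y l g" and eq: "cmp \<X> \<alpha> f = cmp \<X> g \<delta>"
  shows "cmp \<X> \<alpha>' g = cmp \<X> f \<delta>'"
proof -
  note fd = arr_cmp[OF S d(2) f]
  have "g = cmp \<X> (cmp \<X> g \<delta>) \<delta>'" using cmp_assoc[OF S d(2,1) g] d(3) cmp_ident_right[OF S g] by simp
  also have "\<dots> = cmp \<X> \<alpha> (cmp \<X> f \<delta>')" using cmp_assoc[OF S d(2) f a(1)] eq by simp
  finally have "cmp \<X> \<alpha>' g = cmp \<X> \<alpha>' (cmp \<X> \<alpha> (cmp \<X> f \<delta>'))" by simp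
  then show ?thesis using cmp_assoc[OF S fd a(1,2)] a(3) cmp_ident_left[OF S fd] by simp
qed

lemma fm_ob: "fib_morphism \<X> \<Y> F \<Longrightarrow> x \<in> Ob \<X> \<Longrightarrow> fst F x \<in> Ob \<Y>"
  by (simp add: fib_morphism_def)

lemma fm_base: "fib_morphism \<X> \<Y> F \<Longrightarrow> x \<in> Ob \<X> \<Longrightarrow> base \<Y> (fst F x) = base \<X> x"
  by (simp add: fib_morphism_def)

lemma fm_ident: "fib_morphism \<X> \<Y> F \<Longrightarrow> x \<in> Ob \<X> \<Longrightarrow> snd F (ident \<X> x) = ident \<Y> (fst F x)"
  by (simp add: fib_morphism_def)

lemma fm_arr: "fib_morphism \<X> \<Y> F \<Longrightarrow> arr \<X> x y h a \<Longrightarrow> arr \<Y> (fst F x) (fst F y) h (snd F a)"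
  by (auto simp: fib_morphism_def arr_def)

lemma fm_cmp: "fib_morphism \<X> \<Y> F \<Longrightarrow> arr \<X> x y h a \<Longrightarrow> arr \<X> y z k b \<Longrightarrow>
    snd F (cmp \<X> b a) = cmp \<Y> (snd F b) (snd F a)"
  by (simp add: fib_morphism_def arr_def)

lemma fib_morphismI:
  assumes S: "sitecat \<X>"
    and "fst F \<in> extensional (Ob \<X>)" "snd F \<in> extensional (Ar \<X>)"
    and "\<And>x. x \<in> Ob \<X> \<Longrightarrow> fst F x \<in> Ob \<Y> \<and> base \<Y> (fst F x) = base \<X> x \<and> snd F (ident \<X> x) = ident \<Y> (fst F x)"
    and "\<And>x y h a. arr \<X> x y h a \<Longrightarrow> arr \<Y> (fst F x) (fst F y) h (snd F a)"
    and "\<And>x y z h k a b. arr \<X> x y h a \<Longrightarrow> arr \<X> y z k b \<Longrightarrow> snd F (cmp \<X> b a) = cmp \<Y> (snd F b) (snd F a)"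
  shows "fib_morphism \<X> \<Y> F"
  unfolding fib_morphism_def
proof (intro conjI ballI impI)
  fix a assume "a \<in> Ar \<X>"
  from assms(5)[OF arrI[OF this]] show "snd F a \<in> Ar \<Y>" "src \<Y> (snd F a) = fst F (src \<X> a)"
    "tgt \<Y> (snd F a) = fst F (tgt \<X> a)" "bmap \<Y> (snd F a) = bmap \<X> a"
    by (simp_all add: arr_def)
next
  fix a b assume "a \<in> Ar \<X>" "b \<in> Ar \<X>" "src \<X> b = tgt \<X> a"
  then show "snd F (cmp \<X> b a) = cmp \<Y> (snd F b) (snd F a)"
    using assms(6)[of "src \<X> a" "tgt \<X> a" "bmap \<X> a" a "tgt \<X> b" "bmap \<X> b" b] by (simp add: arr_def)
qed (use assms in auto)

lemma fib_comp_simps: "x \<in> Ob \<X> \<Longrightarrow> fst (fib_comp \<X> G F) x = fst G (fst F x)"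
  "a \<in> Ar \<X> \<Longrightarrow> snd (fib_comp \<X> G F) a = snd G (snd F a)"
  by (simp_all add: fib_comp_def)

lemma fib_morphism_comp:
  assumes S: "sitecat \<X>" and F: "fib_morphism \<X> \<Y> F" and G: "fib_morphism \<Y> \<Z> G"
  shows "fib_morphism \<X> \<Z> (fib_comp \<X> G F)"
proof (rule fib_morphismI[OF S])
  fix x assume x: "x \<in> Ob \<X>"
  show "fst (fib_comp \<X> G F) x \<in> Ob \<Z> \<and> base \<Z> (fst (fib_comp \<X> G F) x) = base \<X> x \<and>
      snd (fib_comp \<X> G F) (ident \<X> x) = ident \<Z> (fst (fib_comp \<X> G F) x)"
    using x arrD(1)[OF arr_ident[OF S x]] fm_ob[OF F x] fm_ob[OF G fm_ob[OF F x]]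
    by (simp add: fib_comp_simps fm_base[OF G] fm_base[OF F] fm_ident[OF F] fm_ident[OF G])
next
  fix x y h a assume a: "arr \<X> x y h a"
  show "arr \<Z> (fst (fib_comp \<X> G F) x) (fst (fib_comp \<X> G F) y) h (snd (fib_comp \<X> G F) a)"
    using fm_arr[OF G fm_arr[OF F a]] arr_ob[OF S a] arrD(1)[OF a] by (simp add: fib_comp_simps)
next
  fix x y z h k a b assume a: "arr \<X> x y h a" and b: "arr \<X> y z k b"
  show "snd (fib_comp \<X> G F) (cmp \<X> b a) = cmp \<Z> (snd (fib_comp \<X> G F) b) (snd (fib_comp \<X> G F) a)"
    using arrD(1)[OF a] arrD(1)[OF b] arrD(1)[OF arr_cmp[OF S a b]] fm_cmp[OF F a b]
      fm_cmp[OF G fm_arr[OF F a] fm_arr[OF F b]] by (simp add: fib_comp_simps)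
qed (simp_all add: fib_comp_def)

lemma tm_arr: "two_morphism \<X> \<Y> F G \<eta> \<Longrightarrow> x \<in> Ob \<X> \<Longrightarrow> arr \<Y> (fst F x) (fst G x) (idmap (base \<X> x)) (\<eta> x)"
  by (simp add: two_morphism_def arr_def)

lemma tm_natural: "two_morphism \<X> \<Y> F G \<eta> \<Longrightarrow> arr \<X> x y h a \<Longrightarrow> cmp \<Y> (\<eta> y) (snd F a) = cmp \<Y> (snd G a) (\<eta> x)"
  by (auto simp: two_morphism_def arr_def)

lemma tm_extensional: "two_morphism \<X> \<Y> F G \<eta> \<Longrightarrow> \<eta> \<in> extensional (Ob \<X>)"
  by (simp add: two_morphism_def)

lemma two_morphismI:
  assumes "\<eta> \<in> extensional (Ob \<X>)"
    and "\<And>x. x \<in> Ob \<X> \<Longrightarrow> arr \<Y> (fst F x) (fst G x) (idmap (base \<X> x)) (\<eta> x)"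
    and "\<And>x y h a. arr \<X> x y h a \<Longrightarrow> cmp \<Y> (\<eta> y) (snd F a) = cmp \<Y> (snd G a) (\<eta> x)"
  shows "two_morphism \<X> \<Y> F G \<eta>"
  unfolding two_morphism_def using assms(1,2) assms(3)[OF arrI] by (simp add: arr_def)

text \<open>
  Pulling back a functor along arrows \<open>\<kappa> w : L w \<rightarrow> Q w\<close> that are natural on the site: since
  every arrow is cartesian, the pullbacks \<open>L w\<close> form a functor in exactly one way.
\<close>

lemma pulled_functor:
  assumes D: "sitecat \<D>" and X: "fibered_in_groupoids \<X>"
    and Qid: "\<And>w. w \<in> Ob \<D> \<Longrightarrow> Qa (ident \<D> w) = ident \<X> (Qo w)"
    and Qarr: "\<And>w w' h a. arr \<D> w w' h a \<Longrightarrow> arr \<X> (Qo w) (Qo w') (B a) (Qa a)"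
    and Qcmp: "\<And>w w' w'' h k a b. arr \<D> w w' h a \<Longrightarrow> arr \<D> w' w'' k b \<Longrightarrow> Qa (cmp \<D> b a) = cmp \<X> (Qa b) (Qa a)"
    and kap: "\<And>w. w \<in> Ob \<D> \<Longrightarrow> arr \<X> (L w) (Qo w) (k w) (\<kappa> w)"
    and Lb: "\<And>w. w \<in> Ob \<D> \<Longrightarrow> base \<X> (L w) = base \<D> w"
    and nat: "\<And>w w' h a. arr \<D> w w' h a \<Longrightarrow> compmap (base \<D> w) (k w') h = compmap (base \<D> w) (B a) (k w)"
  shows "\<exists>F. fib_morphism \<D> \<X> F \<and> fst F = restrict L (Ob \<D>) \<and>
    (\<forall>w w' h a. arr \<D> w w' h a \<longrightarrow> cmp \<X> (\<kappa> w') (snd F a) = cmp \<X> (Qa a) (\<kappa> w))"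
proof -
  note S = fibered_sitecat[OF X]
  have ex: "\<exists>!c. arr \<X> (L w) (L w') h c \<and> cmp \<X> (\<kappa> w') c = cmp \<X> (Qa a) (\<kappa> w)" if a: "arr \<D> w w' h a" for w w' h a
  proof -
    have w: "w \<in> Ob \<D>" "w' \<in> Ob \<D>" using arr_ob[OF D a] by auto
    have "arr \<X> (L w) (Qo w') (compmap (base \<D> w) (B a) (k w)) (cmp \<X> (Qa a) (\<kappa> w))"
      using arr_cmp[OF S kap[OF w(1)] Qarr[OF a]] by (simp add: Lb[OF w(1)])
    from fib_factor[OF X kap[OF w(2)] this, of h] show ?thesis
      using arr_bmap[OF D a] nat[OF a] by (simp add: Lb[OF w(1)] Lb[OF w(2)])
  qed
  define Fa where "Fa = (\<lambda>a\<in>Ar \<D>. THE c. arr \<X> (L (src \<D> a)) (L (tgt \<D> a)) (bmap \<D> a) c \<and>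
      cmp \<X> (\<kappa> (tgt \<D> a)) c = cmp \<X> (Qa a) (\<kappa> (src \<D> a)))"
  have Fa: "arr \<X> (L w) (L w') h (Fa a) \<and> cmp \<X> (\<kappa> w') (Fa a) = cmp \<X> (Qa a) (\<kappa> w)" if a: "arr \<D> w w' h a" for w w' h a
    using theI'[OF ex[OF a]] arrD[OF a] by (simp add: Fa_def)
  let ?F = "(restrict L (Ob \<D>), Fa)"
  have "fib_morphism \<D> \<X> ?F"
  proof (rule fib_morphismI[OF D])
    fix w assume w: "w \<in> Ob \<D>"
    have Lw: "L w \<in> Ob \<X>" using arr_ob(1)[OF S kap[OF w]] .
    note i = arr_ident[OF D w]
    have "cmp \<X> (\<kappa> w) (ident \<X> (L w)) = cmp \<X> (Qa (ident \<D> w)) (\<kappa> w)"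
      by (simp add: Qid[OF w] cmp_ident_left[OF S kap[OF w]] cmp_ident_right[OF S kap[OF w]])
    then have e: "cmp \<X> (\<kappa> w) (Fa (ident \<D> w)) = cmp \<X> (\<kappa> w) (ident \<X> (L w))"
      using conjunct2[OF Fa[OF i]] by (simp only:)
    have "Fa (ident \<D> w) = ident \<X> (L w)"
      by (rule fib_cancel[OF X kap[OF w] conjunct1[OF Fa[OF i]] arr_ident[OF S Lw, unfolded Lb[OF w]] e])
    then show "fst ?F w \<in> Ob \<X> \<and> base \<X> (fst ?F w) = base \<D> w \<and> snd ?F (ident \<D> w) = ident \<X> (fst ?F w)"
      using w Lw Lb by simp
  next
    fix w w' h a assume a: "arr \<D> w w' h a"
    then show "arr \<X> (fst ?F w) (fst ?F w') h (snd ?F a)" using Fa[OF a] arr_ob[OF D a] by simp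
  next
    fix w w' w'' h k' a b assume a: "arr \<D> w w' h a" and b: "arr \<D> w' w'' k' b"
    have w: "w \<in> Ob \<D>" "w' \<in> Ob \<D>" "w'' \<in> Ob \<D>" using arr_ob[OF D a] arr_ob[OF D b] by auto
    note ab = arr_cmp[OF D a b]
    note Fa' = conjunct1[OF Fa[OF a]] and Fb' = conjunct1[OF Fa[OF b]]
    have e: "cmp \<X> (\<kappa> w'') (Fa (cmp \<D> b a)) = cmp \<X> (\<kappa> w'') (cmp \<X> (Fa b) (Fa a))"
      using cmp_assoc[OF S Fa' Fb' kap[OF w(3)]] Fa[OF b] cmp_assoc[OF S Fa' kap[OF w(2)] Qarr[OF b]] Fa[OF a]
        cmp_assoc[OF S kap[OF w(1)] Qarr[OF a] Qarr[OF b]] Fa[OF ab] Qcmp[OF a b] by simp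
    have "Fa (cmp \<D> b a) = cmp \<X> (Fa b) (Fa a)"
      by (rule fib_cancel[OF X kap[OF w(3)] conjunct1[OF Fa[OF ab]] arr_cmp[OF S Fa' Fb', unfolded Lb[OF w(1)]] e])
    then show "snd ?F (cmp \<D> b a) = cmp \<X> (snd ?F b) (snd ?F a)" by simp
  qed (simp_all add: Fa_def)
  then show ?thesis using Fa by (intro exI[of _ ?F]) simp
qed

text \<open>
  Components are obtained by factoring through the arrows \<open>\<kappa>G w\<close>, and naturality by cancelling them.
\<close>

lemma pulled_transformation:
  assumes D: "sitecat \<D>" and X: "fibered_in_groupoids \<X>"
    and F: "fib_morphism \<D> \<X> F" and G: "fib_morphism \<D> \<X> G"
    and kF: "\<And>w. w \<in> Ob \<D> \<Longrightarrow> arr \<X> (fst F w) (A w) (k w) (\<kappa>F w)"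
    and kG: "\<And>w. w \<in> Ob \<D> \<Longrightarrow> arr \<X> (fst G w) (C w) (k w) (\<kappa>G w)"
    and Aa: "\<And>w w' h a. arr \<D> w w' h a \<Longrightarrow> arr \<X> (A w) (A w') (B a) (Aa a) \<and> cmp \<X> (\<kappa>F w') (snd F a) = cmp \<X> (Aa a) (\<kappa>F w)"
    and Ca: "\<And>w w' h a. arr \<D> w w' h a \<Longrightarrow> arr \<X> (C w) (C w') (B a) (Ca a) \<and> cmp \<X> (\<kappa>G w') (snd G a) = cmp \<X> (Ca a) (\<kappa>G w)"
    and t: "\<And>w. w \<in> Ob \<D> \<Longrightarrow> arr \<X> (A w) (C w) (idmap (base \<X> (A w))) (t w)" 
    and nat: "\<And>w w' h a. arr \<D> w w' h a \<Longrightarrow> cmp \<X> (t w') (Aa a) = cmp \<X> (Ca a) (t w)"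
  shows "\<exists>!\<theta>. two_morphism \<D> \<X> F G \<theta> \<and> (\<forall>w\<in>Ob \<D>. cmp \<X> (\<kappa>G w) (\<theta> w) = cmp \<X> (t w) (\<kappa>F w))"
proof -
  note S = fibered_sitecat[OF X]
  have ex: "\<exists>!c. arr \<X> (fst F w) (fst G w) (idmap (base \<D> w)) c \<and> cmp \<X> (\<kappa>G w) c = cmp \<X> (t w) (\<kappa>F w)" if w: "w \<in> Ob \<D>" for w
  proof -
    have kw: "k w \<in> cmaps (base \<D> w) (base \<X> (A w))"
      using arr_bmap[OF S kF[OF w]] by (simp add: fm_base[OF F w])
    have "arr \<X> (fst F w) (C w) (k w) (cmp \<X> (t w) (\<kappa>F w))"
      using arr_cmp[OF S kF[OF w] t[OF w]] compmap_idmap_left[OF kw] by (simp add: fm_base[OF F w])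
    from fib_factor[OF X kG[OF w] this, of "idmap (base \<D> w)"] show ?thesis
      using compmap_idmap_right[OF kw] idmap_cmaps[of "base \<D> w"] by (simp add: fm_base[OF F w] fm_base[OF G w])
  qed
  define \<theta> where "\<theta> = (\<lambda>w\<in>Ob \<D>. THE c. arr \<X> (fst F w) (fst G w) (idmap (base \<D> w)) c \<and> cmp \<X> (\<kappa>G w) c = cmp \<X> (t w) (\<kappa>F w))"
  have th: "arr \<X> (fst F w) (fst G w) (idmap (base \<D> w)) (\<theta> w) \<and> cmp \<X> (\<kappa>G w) (\<theta> w) = cmp \<X> (t w) (\<kappa>F w)" if w: "w \<in> Ob \<D>" for w
    using theI'[OF ex[OF w]] w by (simp add: \<theta>_def)
  have "two_morphism \<D> \<X> F G \<theta>"
  proof (rule two_morphismI)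
    fix w w' h a assume a: "arr \<D> w w' h a"
    have w: "w \<in> Ob \<D>" "w' \<in> Ob \<D>" using arr_ob[OF D a] by auto
    note t1 = conjunct1[OF th[OF w(1)]] and t2 = conjunct1[OF th[OF w(2)]]
    note Fa = fm_arr[OF F a] and Ga = fm_arr[OF G a]
    note Aa' = conjunct1[OF Aa[OF a]] and Ca' = conjunct1[OF Ca[OF a]]
    have "cmp \<X> (cmp \<X> (\<kappa>G w') (\<theta> w')) (snd F a) = cmp \<X> (cmp \<X> (t w') (\<kappa>F w')) (snd F a)" using th[OF w(2)] by simp
    also have "\<dots> = cmp \<X> (Ca a) (cmp \<X> (\<kappa>G w) (\<theta> w))"
      using paste_squares[OF S Fa kF[OF w(2)] t[OF w(2)] kF[OF w(1)] t[OF w(1)] Aa' Ca'] Aa[OF a] nat[OF a] th[OF w(1)] by simp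
    also have "\<dots> = cmp \<X> (\<kappa>G w') (cmp \<X> (snd G a) (\<theta> w))"
      using cmp_assoc[OF S t1 kG[OF w(1)] Ca'] cmp_assoc[OF S t1 Ga kG[OF w(2)]] Ca[OF a] by simp
    finally have eq: "cmp \<X> (\<kappa>G w') (cmp \<X> (\<theta> w') (snd F a)) = cmp \<X> (\<kappa>G w') (cmp \<X> (snd G a) (\<theta> w))"
      using cmp_assoc[OF S Fa t2 kG[OF w(2)]] by simp
    have h: "h \<in> cmaps (base \<D> w) (base \<D> w')" using arr_bmap[OF D a] .
    show "cmp \<X> (\<theta> w') (snd F a) = cmp \<X> (snd G a) (\<theta> w)"
      by (rule fib_cancel[OF X kG[OF w(2)] _ _ eq, of "fst F w" h])
        (use arr_cmp[OF S Fa t2] arr_cmp[OF S t1 Ga] compmap_idmap_left[OF h] compmap_idmap_right[OF h]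
         in \<open>simp_all add: fm_base[OF F w(1)]\<close>)
  qed (use th in \<open>auto simp: \<theta>_def\<close>)
  show ?thesis
  proof (rule ex1I[of _ \<theta>])
    show "two_morphism \<D> \<X> F G \<theta> \<and> (\<forall>w\<in>Ob \<D>. cmp \<X> (\<kappa>G w) (\<theta> w) = cmp \<X> (t w) (\<kappa>F w))"
      using \<open>two_morphism \<D> \<X> F G \<theta>\<close> th by simp
  next
    fix \<theta>' assume t': "two_morphism \<D> \<X> F G \<theta>' \<and> (\<forall>w\<in>Ob \<D>. cmp \<X> (\<kappa>G w) (\<theta>' w) = cmp \<X> (t w) (\<kappa>F w))"
    show "\<theta>' = \<theta>"
    proof (rule extensionalityI[of _ "Ob \<D>"])
      fix w assume w: "w \<in> Ob \<D>"
      show "\<theta>' w = \<theta> w"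
        by (rule ex1_unique[OF ex[OF w]]) (use t' w tm_arr[OF conjunct1[OF t'] w] th[OF w] in simp_all)
    qed (use t' in \<open>auto simp: \<theta>_def tm_extensional\<close>)
  qed
qed

subsection \<open>Terminal objects and the Yoneda lemma\<close>

definition terminal :: "('u, 'o, 'm) fibcat \<Rightarrow> 'o \<Rightarrow> bool" where
  "terminal \<D> d \<longleftrightarrow> d \<in> Ob \<D> \<and> (\<forall>w\<in>Ob \<D>. \<exists>!a. a \<in> Ar \<D> \<and> src \<D> a = w \<and> tgt \<D> a = d)"

definition bang :: "('u, 'o, 'm) fibcat \<Rightarrow> 'o \<Rightarrow> 'o \<Rightarrow> 'm" where
  "bang \<D> d w = (THE a. a \<in> Ar \<D> \<and> src \<D> a = w \<and> tgt \<D> a = d)"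

lemma terminal_ob: "terminal \<D> d \<Longrightarrow> d \<in> Ob \<D>"
  by (simp add: terminal_def)

lemma bang_arr:
  assumes "terminal \<D> d" "w \<in> Ob \<D>"
  shows "arr \<D> w d (bmap \<D> (bang \<D> d w)) (bang \<D> d w)"
proof -
  have "\<exists>!a. a \<in> Ar \<D> \<and> src \<D> a = w \<and> tgt \<D> a = d" using assms by (simp add: terminal_def)
  from theI'[OF this] show ?thesis by (simp add: arr_def bang_def)
qed

lemma bang_unique:
  assumes "terminal \<D> d" "sitecat \<D>" "arr \<D> w d h a"
  shows "a = bang \<D> d w"
proof -
  have w: "w \<in> Ob \<D>" using arr_ob(1)[OF assms(2,3)] .
  then have "\<exists>!a. a \<in> Ar \<D> \<and> src \<D> a = w \<and> tgt \<D> a = d" using assms by (simp add: terminal_def)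
  then show ?thesis by (rule ex1_unique) (use assms(3) bang_arr[OF assms(1) w] in \<open>simp_all add: arr_def\<close>)
qed

text \<open>
  Pull \<open>x\<close> back along the arrows to \<open>d\<close>; at \<open>d\<close> itself the choice \<open>x\<close> makes the equation strict.
\<close>

lemma yoneda_functor:
  assumes D: "sitecat \<D>" and d: "terminal \<D> d" and X: "fibered_in_groupoids \<X>"
    and x: "x \<in> Ob \<X>" "base \<X> x = base \<D> d"
  shows "\<exists>F. fib_morphism \<D> \<X> F \<and> fst F d = x"
proof -
  note S = fibered_sitecat[OF X]
  have "\<exists>l \<kappa>. arr \<X> l x (bmap \<D> (bang \<D> d w)) \<kappa> \<and> base \<X> l = base \<D> w \<and> (w = d \<longrightarrow> l = x)" if w: "w \<in> Ob \<D>" for w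
  proof (cases "w = d")
    case True
    have "bang \<D> d w = ident \<D> d" using bang_unique[OF d D arr_ident[OF D terminal_ob[OF d]]] True by simp
    then have "bmap \<D> (bang \<D> d w) = idmap (base \<X> x)"
      using arrD(4)[OF arr_ident[OF D terminal_ob[OF d]]] x by simp
    then show ?thesis using arr_ident[OF S x(1)] x True by auto
  next
    case False
    have "bmap \<D> (bang \<D> d w) \<in> cmaps (base \<D> w) (base \<X> x)"
      using arr_bmap[OF D bang_arr[OF d w]] x by simp
    from fib_lift[OF X x(1) cg_base[OF D w] this] show ?thesis using False by blast
  qed
  then obtain L \<kappa> where L: "\<And>w. w \<in> Ob \<D> \<Longrightarrow> arr \<X> (L w) x (bmap \<D> (bang \<D> d w)) (\<kappa> w)"
      "\<And>w. w \<in> Ob \<D> \<Longrightarrow> base \<X> (L w) = base \<D> w" "L d = x"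
    using terminal_ob[OF d] by metis
  have "\<exists>F. fib_morphism \<D> \<X> F \<and> fst F = restrict L (Ob \<D>) \<and>
    (\<forall>w w' h a. arr \<D> w w' h a \<longrightarrow> cmp \<X> (\<kappa> w') (snd F a) = cmp \<X> ((\<lambda>_. ident \<X> x) a) (\<kappa> w))"
  proof (rule pulled_functor[OF D X, where Qo = "\<lambda>_. x" and B = "\<lambda>_. idmap (base \<X> x)" and k = "\<lambda>w. bmap \<D> (bang \<D> d w)"])
    show "ident \<X> x = cmp \<X> (ident \<X> x) (ident \<X> x)" using cmp_ident_left[OF S arr_ident[OF S x(1)]] by simp
    fix w w' h a assume a: "arr \<D> w w' h a"
    have w: "w \<in> Ob \<D>" "w' \<in> Ob \<D>" using arr_ob[OF D a] by auto
    note b = bang_arr[OF d w(2)]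
    have "cmp \<D> (bang \<D> d w') a = bang \<D> d w" using bang_unique[OF d D arr_cmp[OF D a b]] .
    then have "compmap (base \<D> w) (bmap \<D> (bang \<D> d w')) h = bmap \<D> (bang \<D> d w)"
      using arrD(4)[OF arr_cmp[OF D a b]] by simp
    also have "\<dots> = compmap (base \<D> w) (idmap (base \<X> x)) (bmap \<D> (bang \<D> d w))"
      using compmap_idmap_left[OF arr_bmap[OF D bang_arr[OF d w(1)]]] x by simp
    finally show "compmap (base \<D> w) (bmap \<D> (bang \<D> d w')) h = compmap (base \<D> w) (idmap (base \<X> x)) (bmap \<D> (bang \<D> d w))" .
  qed (use L arr_ident[OF S x(1)] in auto)
  then obtain F where "fib_morphism \<D> \<X> F" "fst F = restrict L (Ob \<D>)" by blast
  then show ?thesis using L(3) terminal_ob[OF d] by (intro exI[of _ F]) simp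
qed

lemma yoneda_transformation:
  assumes D: "sitecat \<D>" and d: "terminal \<D> d" and X: "fibered_in_groupoids \<X>"
    and F: "fib_morphism \<D> \<X> F" and G: "fib_morphism \<D> \<X> G"
    and g: "arr \<X> (fst F d) (fst G d) (idmap (base \<D> d)) \<gamma>"
  shows "\<exists>!\<theta>. two_morphism \<D> \<X> F G \<theta> \<and> \<theta> d = \<gamma>"
proof -
  note S = fibered_sitecat[OF X] and dO = terminal_ob[OF d]
  note id = arr_ident[OF D dO]
  have bd: "bang \<D> d d = ident \<D> d" using bang_unique[OF d D id] by simp
  let ?P = "\<lambda>\<theta>. two_morphism \<D> \<X> F G \<theta> \<and>
      (\<forall>w\<in>Ob \<D>. cmp \<X> (snd G (bang \<D> d w)) (\<theta> w) = cmp \<X> \<gamma> (snd F (bang \<D> d w)))"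
  have Fd: "base \<X> (fst F d) = base \<D> d" "base \<X> (fst G d) = base \<D> d" using fm_base[OF F dO] fm_base[OF G dO] by auto
  have FO: "fst F d \<in> Ob \<X>" "fst G d \<in> Ob \<X>" using fm_ob[OF F dO] fm_ob[OF G dO] by auto
  have tri: "cmp \<D> (bang \<D> d w') a = bang \<D> d w" if a: "arr \<D> w w' h a" for w w' h a
    using bang_unique[OF d D arr_cmp[OF D a bang_arr[OF d arr_ob(2)[OF D a]]]] .
  have "\<exists>!\<theta>. ?P \<theta>"
  proof (rule pulled_transformation[OF D X F G, where A = "\<lambda>_. fst F d" and C = "\<lambda>_. fst G d"
        and B = "\<lambda>_. idmap (base \<D> d)" and Aa = "\<lambda>_. ident \<X> (fst F d)" and Ca = "\<lambda>_. ident \<X> (fst G d)"])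
    fix w assume w: "w \<in> Ob \<D>"
    show "arr \<X> (fst F w) (fst F d) (bmap \<D> (bang \<D> d w)) (snd F (bang \<D> d w))" by (rule fm_arr[OF F bang_arr[OF d w]])
    show "arr \<X> (fst G w) (fst G d) (bmap \<D> (bang \<D> d w)) (snd G (bang \<D> d w))" by (rule fm_arr[OF G bang_arr[OF d w]])
    show "arr \<X> (fst F d) (fst G d) (idmap (base \<X> (fst F d))) \<gamma>" using g Fd by simp
  next
    fix w w' h a assume a: "arr \<D> w w' h a"
    have w: "w \<in> Ob \<D>" "w' \<in> Ob \<D>" using arr_ob[OF D a] by auto
    note b = bang_arr[OF d w(1)] bang_arr[OF d w(2)]
    show "arr \<X> (fst F d) (fst F d) (idmap (base \<D> d)) (ident \<X> (fst F d)) \<and>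
        cmp \<X> (snd F (bang \<D> d w')) (snd F a) = cmp \<X> (ident \<X> (fst F d)) (snd F (bang \<D> d w))"
      using fm_cmp[OF F a b(2)] tri[OF a] cmp_ident_left[OF S fm_arr[OF F b(1)]] arr_ident[OF S FO(1)] Fd by simp
    show "arr \<X> (fst G d) (fst G d) (idmap (base \<D> d)) (ident \<X> (fst G d)) \<and>
        cmp \<X> (snd G (bang \<D> d w')) (snd G a) = cmp \<X> (ident \<X> (fst G d)) (snd G (bang \<D> d w))"
      using fm_cmp[OF G a b(2)] tri[OF a] cmp_ident_left[OF S fm_arr[OF G b(1)]] arr_ident[OF S FO(2)] Fd by simp
    show "cmp \<X> \<gamma> (ident \<X> (fst F d)) = cmp \<X> (ident \<X> (fst G d)) \<gamma>"
      using cmp_ident_left[OF S g] cmp_ident_right[OF S g] by simp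
  qed
  moreover have "?P \<theta> \<longleftrightarrow> two_morphism \<D> \<X> F G \<theta> \<and> \<theta> d = \<gamma>" for \<theta>
  proof
    assume t: "?P \<theta>"
    note td = tm_arr[OF conjunct1[OF t] dO]
    have "cmp \<X> (snd G (bang \<D> d d)) (\<theta> d) = cmp \<X> \<gamma> (snd F (bang \<D> d d))" using t dO by blast
    then have "\<theta> d = \<gamma>" using cmp_ident_left[OF S td] cmp_ident_right[OF S g] by (simp add: bd fm_ident[OF F dO] fm_ident[OF G dO])
    then show "two_morphism \<D> \<X> F G \<theta> \<and> \<theta> d = \<gamma>" using t by blast
  next
    assume t: "two_morphism \<D> \<X> F G \<theta> \<and> \<theta> d = \<gamma>"
    then show "?P \<theta>" using tm_natural[OF conjunct1[OF t] bang_arr[OF d]] by metis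
  qed
  ultimately show ?thesis by simp
qed

subsection \<open>Spaces as stacks\<close>

lemma space_stack_Ob: "x \<in> Ob (space_stack Z :: ('u, _, _) fibcat) \<longleftrightarrow> cg (fst x) \<and> snd x \<in> cmaps (fst x) Z"
  by (cases x) (simp add: space_stack_def)

lemma space_stack_base [simp]: "base (space_stack Z) x = fst x"
  by (simp add: space_stack_def)

lemma space_stack_ident: "ident (space_stack Z) x = (x, idmap (fst x), x)"
  by (simp add: space_stack_def)

lemma space_stack_cmp: "cmp (space_stack Z) (y', k, z) (x, h, y) = (x, compmap (fst x) k h, z)"
  by (simp add: space_stack_def compmap_def)

lemma space_stack_arr:
  "arr (space_stack Z :: ('u, _, _) fibcat) x y h a \<longleftrightarrow>
     a = (x, h, y) \<and> x \<in> Ob (space_stack Z :: ('u, _, _) fibcat) \<and> y \<in> Ob (space_stack Z :: ('u, _, _) fibcat) \<and>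
     h \<in> cmaps (fst x) (fst y) \<and> compmap (fst x) (snd y) h = snd x"
  by (cases a; cases x; cases y) (auto simp: arr_def space_stack_def compmap_def)

lemma space_stack_Ar:
  "(x, h, y) \<in> Ar (space_stack Z :: ('u, _, _) fibcat) \<longleftrightarrow>
     x \<in> Ob (space_stack Z :: ('u, _, _) fibcat) \<and> y \<in> Ob (space_stack Z :: ('u, _, _) fibcat) \<and>
     h \<in> cmaps (fst x) (fst y) \<and> compmap (fst x) (snd y) h = snd x"
  by (cases x; cases y) (auto simp: space_stack_def compmap_def)

lemma space_stack_src_tgt [simp]: "src (space_stack Z) (x, h, y) = x" "tgt (space_stack Z) (x, h, y) = y"
  "bmap (space_stack Z) (x, h, y) = h"
  by (simp_all add: space_stack_def)

lemma sitecatI: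
  fixes \<X> :: "('u, 'o, 'm) fibcat"
  assumes ob: "\<And>a. a \<in> Ar \<X> \<Longrightarrow> src \<X> a \<in> Ob \<X> \<and> tgt \<X> a \<in> Ob \<X> \<and> bmap \<X> a \<in> cmaps (base \<X> (src \<X> a)) (base \<X> (tgt \<X> a))"
    and id: "\<And>x. x \<in> Ob \<X> \<Longrightarrow> cg (base \<X> x) \<and> arr \<X> x x (idmap (base \<X> x)) (ident \<X> x)"
    and cmp: "\<And>x y z h k a b. arr \<X> x y h a \<Longrightarrow> arr \<X> y z k b \<Longrightarrow> arr \<X> x z (compmap (base \<X> x) k h) (cmp \<X> b a)"
    and assoc: "\<And>x y z w h k l a b c. arr \<X> x y h a \<Longrightarrow> arr \<X> y z k b \<Longrightarrow> arr \<X> z w l c \<Longrightarrow>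
       cmp \<X> c (cmp \<X> b a) = cmp \<X> (cmp \<X> c b) a"
    and unit: "\<And>x y h a. arr \<X> x y h a \<Longrightarrow> cmp \<X> a (ident \<X> x) = a \<and> cmp \<X> (ident \<X> y) a = a"
  shows "sitecat \<X>"
  unfolding sitecat_def is_category_def projects_to_site_def
proof (intro conjI ballI impI)
  fix a assume a: "a \<in> Ar \<X>"
  show "cmp \<X> a (ident \<X> (src \<X> a)) = a" "cmp \<X> (ident \<X> (tgt \<X> a)) a = a" using unit[OF arrI[OF a]] by auto
  fix b assume b: "b \<in> Ar \<X>" and ba: "src \<X> b = tgt \<X> a"
  from cmp[OF arrI[OF a], of "tgt \<X> b" "bmap \<X> b" b]
  have c: "arr \<X> (src \<X> a) (tgt \<X> b) (compmap (base \<X> (src \<X> a)) (bmap \<X> b) (bmap \<X> a)) (cmp \<X> b a)"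
    using b ba by (simp add: arr_def)
  show "cmp \<X> b a \<in> Ar \<X>" "src \<X> (cmp \<X> b a) = src \<X> a" "tgt \<X> (cmp \<X> b a) = tgt \<X> b"
    "bmap \<X> (cmp \<X> b a) = compose (topspace (base \<X> (src \<X> a))) (bmap \<X> b) (bmap \<X> a)"
    using c by (simp_all add: arr_def compmap_def)
  fix c assume "c \<in> Ar \<X>" "src \<X> c = tgt \<X> b"
  then show "cmp \<X> c (cmp \<X> b a) = cmp \<X> (cmp \<X> c b) a"
    using assoc[OF arrI[OF a], of "tgt \<X> b" "bmap \<X> b" b "tgt \<X> c" "bmap \<X> c" c] b ba by (simp add: arr_def)
qed (use ob id in \<open>auto simp: arr_def\<close>)

lemma fibered_in_groupoidsI:
  fixes \<X> :: "('u, 'o, 'm) fibcat"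
  assumes S: "sitecat \<X>"
    and lift: "\<And>x T f. x \<in> Ob \<X> \<Longrightarrow> cg T \<Longrightarrow> f \<in> cmaps T (base \<X> x) \<Longrightarrow> \<exists>w a. arr \<X> w x f a \<and> base \<X> w = T"
    and factor: "\<And>x y z h k g a b. arr \<X> x z h a \<Longrightarrow> arr \<X> y z k b \<Longrightarrow> g \<in> cmaps (base \<X> y) (base \<X> x) \<Longrightarrow>
       compmap (base \<X> y) h g = k \<Longrightarrow> \<exists>!c. arr \<X> y x g c \<and> cmp \<X> a c = b"
  shows "fibered_in_groupoids \<X>"
  unfolding fibered_in_groupoids_def
proof (intro conjI ballI allI impI)
  show "is_category \<X>" "projects_to_site \<X>" using S by (simp_all add: sitecat_def)
next
  fix x and T :: "'u topology" and f
  assume "x \<in> Ob \<X>" "cg T" "f \<in> cmaps T (base \<X> x)"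
  from lift[OF this] show "\<exists>a\<in>Ar \<X>. tgt \<X> a = x \<and> base \<X> (src \<X> a) = T \<and> bmap \<X> a = f"
    by (auto simp: arr_def)
next
  fix a b g assume a: "a \<in> Ar \<X>" and b: "b \<in> Ar \<X>" and t: "tgt \<X> b = tgt \<X> a"
    and g: "g \<in> cmaps (base \<X> (src \<X> b)) (base \<X> (src \<X> a))"
    and eq: "compose (topspace (base \<X> (src \<X> b))) (bmap \<X> a) g = bmap \<X> b"
  have "arr \<X> (src \<X> b) (tgt \<X> a) (bmap \<X> b) b" using b t by (simp add: arr_def)
  from factor[OF arrI[OF a] this g] eq
  show "\<exists>!c. c \<in> Ar \<X> \<and> src \<X> c = src \<X> b \<and> tgt \<X> c = src \<X> a \<and> bmap \<X> c = g \<and> cmp \<X> a c = b"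
    by (simp add: arr_def compmap_def)
qed

lemma sitecat_space_stack: "sitecat (space_stack Z :: ('u, _, _) fibcat)"
proof (rule sitecatI)
  fix a :: "('u, 'a) sarr" assume "a \<in> Ar (space_stack Z :: ('u, _, _) fibcat)"
  then show "src (space_stack Z) a \<in> Ob (space_stack Z :: ('u, _, _) fibcat) \<and> tgt (space_stack Z) a \<in> Ob (space_stack Z :: ('u, _, _) fibcat) \<and>
      bmap (space_stack Z) a \<in> cmaps (base (space_stack Z) (src (space_stack Z) a)) (base (space_stack Z) (tgt (space_stack Z) a))"
    by (cases a) (simp add: space_stack_Ar)
next
  fix x :: "('u, 'a) sobj" assume "x \<in> Ob (space_stack Z :: ('u, _, _) fibcat)"
  then show "cg (base (space_stack Z) x) \<and> arr (space_stack Z) x x (idmap (base (space_stack Z) x)) (ident (space_stack Z) x)"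
    using compmap_idmap_right[of "snd x" "fst x" Z] by (auto simp: space_stack_arr space_stack_ident idmap_cmaps space_stack_Ob)
next
  fix x y z :: "('u, 'a) sobj" and h k a b
  assume "arr (space_stack Z) x y h a" "arr (space_stack Z) y z k b"
  then show "arr (space_stack Z) x z (compmap (base (space_stack Z) x) k h) (cmp (space_stack Z) b a)"
    by (auto simp: space_stack_arr space_stack_cmp compmap_assoc intro: compmap_cmaps)
next
  fix x y z w :: "('u, 'a) sobj" and h k l a b c
  assume "arr (space_stack Z) x y h a" "arr (space_stack Z) y z k b" "arr (space_stack Z) z w l c"
  then show "cmp (space_stack Z) c (cmp (space_stack Z) b a) = cmp (space_stack Z) (cmp (space_stack Z) c b) a"
    by (auto simp: space_stack_arr space_stack_cmp compmap_assoc)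
next
  fix x y :: "('u, 'a) sobj" and h a
  assume "arr (space_stack Z) x y h a"
  then show "cmp (space_stack Z) a (ident (space_stack Z) x) = a \<and> cmp (space_stack Z) (ident (space_stack Z) y) a = a"
    by (auto simp: space_stack_arr space_stack_cmp space_stack_ident compmap_idmap_left compmap_idmap_right)
qed

lemma fibered_space_stack: "fibered_in_groupoids (space_stack Z :: ('u, _, _) fibcat)"
proof (rule fibered_in_groupoidsI[OF sitecat_space_stack])
  fix x :: "('u, 'a) sobj" and T :: "'u topology" and f
  assume x: "x \<in> Ob (space_stack Z :: ('u, _, _) fibcat)" and T: "cg T" and f: "f \<in> cmaps T (base (space_stack Z) x)"
  let ?w = "(T, compmap T (snd x) f)"
  have "arr (space_stack Z) ?w x f (?w, f, x)"
    using x T f by (auto simp: space_stack_arr space_stack_Ob intro: compmap_cmaps)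
  then show "\<exists>w a. arr (space_stack Z) w x f a \<and> base (space_stack Z) w = T" by fastforce
next
  fix x y z :: "('u, 'a) sobj" and h k g a b
  assume a: "arr (space_stack Z) x z h a" and b: "arr (space_stack Z) y z k b"
    and g: "g \<in> cmaps (base (space_stack Z) y) (base (space_stack Z) x)"
    and eq: "compmap (base (space_stack Z) y) h g = k"
  have gx: "compmap (fst y) (snd x) g = snd y"
    using a b g eq by (auto simp: space_stack_arr compmap_assoc)
  show "\<exists>!c. arr (space_stack Z) y x g c \<and> cmp (space_stack Z) a c = b"
  proof (rule ex1I[of _ "(y, g, x)"])
    show "arr (space_stack Z) y x g (y, g, x) \<and> cmp (space_stack Z) a (y, g, x) = b"
      using a b g eq gx by (auto simp: space_stack_arr space_stack_cmp)
  qed (auto simp: space_stack_arr)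
qed

lemma terminal_space_stack:
  assumes "cg (T :: 'u topology)"
  shows "terminal (space_stack T) (T, idmap T)"
  unfolding terminal_def
proof (intro conjI ballI)
  show d: "(T, idmap T) \<in> Ob (space_stack T)" using assms by (simp add: space_stack_Ob idmap_cmaps)
  fix w :: "('u, 'u) sobj" assume w: "w \<in> Ob (space_stack T)"
  have "a \<in> Ar (space_stack T) \<and> src (space_stack T) a = w \<and> tgt (space_stack T) a = (T, idmap T) \<longleftrightarrow>
      a = (w, snd w, (T, idmap T))" for a
  proof (cases a)
    case (fields x h y)
    have "snd w \<in> cmaps (fst w) T" using w by (simp add: space_stack_Ob)
    then show ?thesis using fields w d by (auto simp: space_stack_Ar compmap_idmap_left)
  qed
  then show "\<exists>!a. a \<in> Ar (space_stack T) \<and> src (space_stack T) a = w \<and> tgt (space_stack T) a = (T, idmap T)" by simp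
qed

lemma bang_space_stack:
  assumes "cg (T :: 'u topology)" "w \<in> Ob (space_stack T)"
  shows "bang (space_stack T) (T, idmap T) w = (w, snd w, (T, idmap T))"
  using bang_arr[OF terminal_space_stack[OF assms(1)] assms(2)] assms(2)
  by (auto simp: space_stack_arr compmap_idmap_left)

section \<open>Representable morphisms as right adjoints\<close>

text \<open>
  A terminal object of the comma category of \<open>F\<close> over \<open>x\<close>, where arrows may lie over any map of spaces.
\<close>

definition universal_arrow ::
  "('u, 'o, 'm) fibcat \<Rightarrow> ('u, 'p, 'n) fibcat \<Rightarrow> ('o, 'm, 'p, 'n) fibfun \<Rightarrow> 'p \<Rightarrow> 'o \<Rightarrow> 'n \<Rightarrow> bool" where
  "universal_arrow \<W> \<X> F x w \<beta> \<longleftrightarrow>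
     w \<in> Ob \<W> \<and> arr \<X> (fst F w) x (bmap \<X> \<beta>) \<beta> \<and>
     (\<forall>w' k b'. w' \<in> Ob \<W> \<longrightarrow> arr \<X> (fst F w') x k b' \<longrightarrow>
        (\<exists>!b. b \<in> Ar \<W> \<and> src \<W> b = w' \<and> tgt \<W> b = w \<and> cmp \<X> \<beta> (snd F b) = b'))"

lemma universal_arrowD:
  assumes "universal_arrow \<W> \<X> F x w \<beta>"
  shows "w \<in> Ob \<W>" "arr \<X> (fst F w) x (bmap \<X> \<beta>) \<beta>"
  using assms by (simp_all add: universal_arrow_def)

lemma universal_arrow_ex1:
  assumes "universal_arrow \<W> \<X> F x w \<beta>" "w' \<in> Ob \<W>" "arr \<X> (fst F w') x k b'"
  shows "\<exists>!b. b \<in> Ar \<W> \<and> src \<W> b = w' \<and> tgt \<W> b = w \<and> cmp \<X> \<beta> (snd F b) = b'"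
  by (rule assms(1)[unfolded universal_arrow_def, THEN conjunct2, THEN conjunct2, rule_format, OF assms(2,3)])

lemma universal_arrow_factor:
  assumes "universal_arrow \<W> \<X> F x w \<beta>" "w' \<in> Ob \<W>" "arr \<X> (fst F w') x k b'"
  obtains b where "arr \<W> w' w (bmap \<W> b) b" "cmp \<X> \<beta> (snd F b) = b'"
  using ex1_implies_ex[OF universal_arrow_ex1[OF assms]] by (auto simp: arr_def)

lemma universal_arrow_eq:
  assumes "universal_arrow \<W> \<X> F x w \<beta>" "sitecat \<W>" "sitecat \<X>" "fib_morphism \<W> \<X> F"
    and b: "arr \<W> w' w h b" "arr \<W> w' w h' b'" "cmp \<X> \<beta> (snd F b) = cmp \<X> \<beta> (snd F b')"
  shows "b = b'"
proof (rule ex1_unique[OF universal_arrow_ex1[OF assms(1)]])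
  show "w' \<in> Ob \<W>" using arr_ob(1)[OF assms(2) b(1)] .
  show "arr \<X> (fst F w') x (compmap (base \<X> (fst F w')) (bmap \<X> \<beta>) h) (cmp \<X> \<beta> (snd F b))"
    using arr_cmp[OF assms(3) fm_arr[OF assms(4) b(1)] universal_arrowD(2)[OF assms(1)]] .
qed (use b in \<open>simp_all add: arr_def\<close>)

lemma universal_arrow_bmap:
  assumes U: "universal_arrow \<W> \<X> F x w \<beta>" and S: "sitecat \<X>" and F: "fib_morphism \<W> \<X> F" and W: "sitecat \<W>"
    and b: "arr \<W> w' w h b" and b': "arr \<X> (fst F w') x k b'" and e: "cmp \<X> \<beta> (snd F b) = b'"
  shows "compmap (base \<W> w') (bmap \<X> \<beta>) h = k"
  using arr_cmp[OF S fm_arr[OF F b] universal_arrowD(2)[OF U]] b' e fm_base[OF F arr_ob(1)[OF W b]]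
  by (simp add: arr_def)

text \<open>Two universal arrows differ by an isomorphism, hence by a homeomorphism of the bases.\<close>

lemma universal_arrow_homeomorphic:
  assumes U: "universal_arrow \<W> \<X> F x w \<beta>" and V: "universal_arrow \<W> \<X> F x v \<gamma>"
    and W: "sitecat \<W>" and S: "sitecat \<X>" and F: "fib_morphism \<W> \<X> F"
  shows "\<exists>i j. homeomorphic_maps (base \<W> v) (base \<W> w) i j \<and> compmap (base \<W> v) (bmap \<X> \<beta>) i = bmap \<X> \<gamma>"
proof -
  note w = universal_arrowD[OF U] and v = universal_arrowD[OF V]
  obtain i where i: "arr \<W> v w (bmap \<W> i) i" "cmp \<X> \<beta> (snd F i) = \<gamma>"
    using universal_arrow_factor[OF U v] by blast
  obtain j where j: "arr \<W> w v (bmap \<W> j) j" "cmp \<X> \<gamma> (snd F j) = \<beta>"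
    using universal_arrow_factor[OF V w] by blast
  have "cmp \<X> \<beta> (snd F (cmp \<W> i j)) = cmp \<X> \<beta> (snd F (ident \<W> w))"
    using cmp_assoc[OF S fm_arr[OF F j(1)] fm_arr[OF F i(1)] w(2)] i(2) j(2)
    by (simp add: fm_cmp[OF F j(1) i(1)] fm_ident[OF F w(1)] cmp_ident_right[OF S w(2)])
  then have ij: "cmp \<W> i j = ident \<W> w"
    by (rule universal_arrow_eq[OF U W S F arr_cmp[OF W j(1) i(1)] arr_ident[OF W w(1)]])
  have "cmp \<X> \<gamma> (snd F (cmp \<W> j i)) = cmp \<X> \<gamma> (snd F (ident \<W> v))"
    using cmp_assoc[OF S fm_arr[OF F i(1)] fm_arr[OF F j(1)] v(2)] i(2) j(2)
    by (simp add: fm_cmp[OF F i(1) j(1)] fm_ident[OF F v(1)] cmp_ident_right[OF S v(2)])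
  then have ji: "cmp \<W> j i = ident \<W> v"
    by (rule universal_arrow_eq[OF V W S F arr_cmp[OF W i(1) j(1)] arr_ident[OF W v(1)]])
  have ij': "compmap (base \<W> w) (bmap \<W> i) (bmap \<W> j) = idmap (base \<W> w)"
    using arr_cmp[OF W j(1) i(1)] arr_ident[OF W w(1)] ij by (simp add: arr_def)
  have ji': "compmap (base \<W> v) (bmap \<W> j) (bmap \<W> i) = idmap (base \<W> v)"
    using arr_cmp[OF W i(1) j(1)] arr_ident[OF W v(1)] ji by (simp add: arr_def)
  have ic: "bmap \<W> i \<in> cmaps (base \<W> v) (base \<W> w)" and jc: "bmap \<W> j \<in> cmaps (base \<W> w) (base \<W> v)"
    using arr_bmap[OF W i(1)] arr_bmap[OF W j(1)] by auto
  have "bmap \<W> i (bmap \<W> j y) = y" if "y \<in> topspace (base \<W> w)" for y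
    using fun_cong[OF ij', of y] that by (simp add: compmap_apply idmap_def)
  moreover have "bmap \<W> j (bmap \<W> i y) = y" if "y \<in> topspace (base \<W> v)" for y
    using fun_cong[OF ji', of y] that by (simp add: compmap_apply idmap_def)
  ultimately have "homeomorphic_maps (base \<W> v) (base \<W> w) (bmap \<W> i) (bmap \<W> j)"
    using ic jc by (simp add: homeomorphic_maps_def cmaps_def)
  moreover have "compmap (base \<W> v) (bmap \<X> \<beta>) (bmap \<W> i) = bmap \<X> \<gamma>"
    by (rule universal_arrow_bmap[OF U S F W i(1) v(2) i(2)])
  ultimately show ?thesis by blast
qed

lemma fiber_product_Ob:
  "(z, y, \<alpha>) \<in> Ob (fiber_product \<W> \<X> \<Y> p F) \<longleftrightarrow>
     z \<in> Ob \<W> \<and> y \<in> Ob \<X> \<and> base \<X> y = base \<W> z \<and> arr \<Y> (fst p z) (fst F y) (idmap (base \<W> z)) \<alpha>"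
  by (auto simp: fiber_product_def Let_def arr_def)

lemma fiber_product_base [simp]: "base (fiber_product \<W> \<X> \<Y> p F) (z, y, \<alpha>) = base \<W> z"
  by (simp add: fiber_product_def Let_def)

lemma fiber_product_arr:
  "arr (fiber_product \<W> \<X> \<Y> p F) (z, y, \<alpha>) (z', y', \<alpha>') h e \<longleftrightarrow>
     (\<exists>a b. e = ((z, y, \<alpha>), (a, b), (z', y', \<alpha>')) \<and>
        (z, y, \<alpha>) \<in> Ob (fiber_product \<W> \<X> \<Y> p F) \<and> (z', y', \<alpha>') \<in> Ob (fiber_product \<W> \<X> \<Y> p F) \<and>
        arr \<W> z z' h a \<and> arr \<X> y y' h b \<and> cmp \<Y> \<alpha>' (snd p a) = cmp \<Y> (snd F b) \<alpha>)"
  by (cases e) (auto simp: fiber_product_def Let_def arr_def)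

lemma fiber_product_cmp:
  "cmp (fiber_product \<W> \<X> \<Y> p F) (s', (a', b'), s'') (s, (a, b), t) = (s, (cmp \<W> a' a, cmp \<X> b' b), s'')"
  by (simp add: fiber_product_def Let_def)

lemma fiber_product_ident:
  "ident (fiber_product \<W> \<X> \<Y> p F) (z, y, \<alpha>) = ((z, y, \<alpha>), (ident \<W> z, ident \<X> y), (z, y, \<alpha>))"
  by (simp add: fiber_product_def Let_def)

lemma fiber_product_Ar:
  assumes "e \<in> Ar (fiber_product \<W> \<X> \<Y> p F)"
  obtains z y \<alpha> z' y' \<alpha>' where "arr (fiber_product \<W> \<X> \<Y> p F) (z, y, \<alpha>) (z', y', \<alpha>') (bmap (fiber_product \<W> \<X> \<Y> p F) e) e"
proof -
  obtain z y \<alpha> z' y' \<alpha>' where "src (fiber_product \<W> \<X> \<Y> p F) e = (z, y, \<alpha>)" "tgt (fiber_product \<W> \<X> \<Y> p F) e = (z', y', \<alpha>')"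
    by (metis prod_cases3)
  then show thesis using arrI[OF assms] that by metis
qed

context
  fixes \<W> :: "('u, 'w, 'l) fibcat" and \<X> :: "('u, 'o, 'm) fibcat" and \<Y> :: "('u, 'p, 'n) fibcat"
    and p :: "('w, 'l, 'p, 'n) fibfun" and F :: "('o, 'm, 'p, 'n) fibfun"
  assumes W: "fibered_in_groupoids \<W>" and X: "fibered_in_groupoids \<X>" and Y: "fibered_in_groupoids \<Y>"
    and p: "fib_morphism \<W> \<Y> p" and F: "fib_morphism \<X> \<Y> F"
begin

private abbreviation "\<P> \<equiv> fiber_product \<W> \<X> \<Y> p F"

lemma fiber_product_cmp_arr:
  assumes e: "arr \<P> (z, y, \<alpha>) (z', y', \<alpha>') h e" and f: "arr \<P> (z', y', \<alpha>') (z'', y'', \<alpha>'') k f"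
  shows "arr \<P> (z, y, \<alpha>) (z'', y'', \<alpha>'') (compmap (base \<W> z) k h) (cmp \<P> f e)"
proof -
  note SW = fibered_sitecat[OF W] and SX = fibered_sitecat[OF X] and SY = fibered_sitecat[OF Y]
  obtain a b where e': "e = ((z, y, \<alpha>), (a, b), (z', y', \<alpha>'))" "(z, y, \<alpha>) \<in> Ob \<P>" "(z', y', \<alpha>') \<in> Ob \<P>"
    "arr \<W> z z' h a" "arr \<X> y y' h b" "cmp \<Y> \<alpha>' (snd p a) = cmp \<Y> (snd F b) \<alpha>"
    using e unfolding fiber_product_arr by blast
  obtain c d where f': "f = ((z', y', \<alpha>'), (c, d), (z'', y'', \<alpha>''))" "(z'', y'', \<alpha>'') \<in> Ob \<P>"
    "arr \<W> z' z'' k c" "arr \<X> y' y'' k d" "cmp \<Y> \<alpha>'' (snd p c) = cmp \<Y> (snd F d) \<alpha>'"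
    using f unfolding fiber_product_arr by blast
  have al: "arr \<Y> (fst p z) (fst F y) (idmap (base \<W> z)) \<alpha>" "arr \<Y> (fst p z') (fst F y') (idmap (base \<W> z')) \<alpha>'"
      "arr \<Y> (fst p z'') (fst F y'') (idmap (base \<W> z'')) \<alpha>''" "base \<X> y = base \<W> z"
    using e'(2,3) f'(2) by (simp_all add: fiber_product_Ob)
  note pa = fm_arr[OF p e'(4)] and pc = fm_arr[OF p f'(3)] and Fb = fm_arr[OF F e'(5)] and Fd = fm_arr[OF F f'(4)]
  have "cmp \<Y> \<alpha>'' (snd p (cmp \<W> c a)) = cmp \<Y> (cmp \<Y> \<alpha>'' (snd p c)) (snd p a)"
    using cmp_assoc[OF SY pa pc al(3)] fm_cmp[OF p e'(4) f'(3)] by simp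
  also have "\<dots> = cmp \<Y> (snd F d) (cmp \<Y> \<alpha>' (snd p a))"
    using cmp_assoc[OF SY pa al(2) Fd] f'(5) by simp
  also have "\<dots> = cmp \<Y> (snd F (cmp \<X> d b)) \<alpha>"
    using cmp_assoc[OF SY al(1) Fb Fd] fm_cmp[OF F e'(5) f'(4)] e'(6) by simp
  finally have "cmp \<Y> \<alpha>'' (snd p (cmp \<W> c a)) = cmp \<Y> (snd F (cmp \<X> d b)) \<alpha>" .
  moreover have "arr \<X> y y'' (compmap (base \<W> z) k h) (cmp \<X> d b)"
    using arr_cmp[OF SX e'(5) f'(4)] al(4) by simp
  ultimately show ?thesis
    using arr_cmp[OF SW e'(4) f'(3)] e'(1,2) f'(1,2) unfolding fiber_product_arr by (simp add: fiber_product_cmp)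
qed

lemma sitecat_fiber_product: "sitecat \<P>"
proof (rule sitecatI)
  note SW = fibered_sitecat[OF W] and SX = fibered_sitecat[OF X] and SY = fibered_sitecat[OF Y]
  fix e assume "e \<in> Ar \<P>"
  then obtain z y \<alpha> z' y' \<alpha>' where e: "arr \<P> (z, y, \<alpha>) (z', y', \<alpha>') (bmap \<P> e) e" by (rule fiber_product_Ar)
  then obtain a b where "(z, y, \<alpha>) \<in> Ob \<P>" "(z', y', \<alpha>') \<in> Ob \<P>" "arr \<W> z z' (bmap \<P> e) a"
    unfolding fiber_product_arr by blast
  then show "src \<P> e \<in> Ob \<P> \<and> tgt \<P> e \<in> Ob \<P> \<and> bmap \<P> e \<in> cmaps (base \<P> (src \<P> e)) (base \<P> (tgt \<P> e))"
    using arrD(2,3)[OF e] arr_bmap[OF SW] by simp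
next
  note SW = fibered_sitecat[OF W] and SX = fibered_sitecat[OF X] and SY = fibered_sitecat[OF Y]
  fix s assume s: "s \<in> Ob \<P>"
  obtain z y \<alpha> where [simp]: "s = (z, y, \<alpha>)" by (cases s)
  have s': "z \<in> Ob \<W>" "y \<in> Ob \<X>" "base \<X> y = base \<W> z" "arr \<Y> (fst p z) (fst F y) (idmap (base \<W> z)) \<alpha>"
    using s by (simp_all add: fiber_product_Ob)
  have "arr \<P> s s (idmap (base \<W> z)) (ident \<P> s)"
    using s arr_ident[OF SW s'(1)] arr_ident[OF SX s'(2)] s'(3) cmp_ident_left[OF SY s'(4)] cmp_ident_right[OF SY s'(4)]
    by (simp add: fiber_product_arr fiber_product_ident fm_ident[OF p s'(1)] fm_ident[OF F s'(2)])
  then show "cg (base \<P> s) \<and> arr \<P> s s (idmap (base \<P> s)) (ident \<P> s)"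
    using cg_base[OF SW s'(1)] by simp
next
  fix s t r h k e f assume "arr \<P> s t h e" "arr \<P> t r k f"
  then show "arr \<P> s r (compmap (base \<P> s) k h) (cmp \<P> f e)"
    using fiber_product_cmp_arr by (cases s; cases t; cases r) simp
next
  fix s t r q h k l e f g assume e: "arr \<P> s t h e" and f: "arr \<P> t r k f" and g: "arr \<P> r q l g"
  show "cmp \<P> g (cmp \<P> f e) = cmp \<P> (cmp \<P> g f) e"
    using e f g
    by (cases s; cases t; cases r; cases q)
      (auto simp: fiber_product_arr fiber_product_cmp
        cmp_assoc[OF fibered_sitecat[OF W]] cmp_assoc[OF fibered_sitecat[OF X]])
next
  fix s t h e assume "arr \<P> s t h e"
  then show "cmp \<P> e (ident \<P> s) = e \<and> cmp \<P> (ident \<P> t) e = e"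
    by (cases s; cases t)
      (auto simp: fiber_product_arr fiber_product_cmp fiber_product_ident
        cmp_ident_left[OF fibered_sitecat[OF W]] cmp_ident_left[OF fibered_sitecat[OF X]]
        cmp_ident_right[OF fibered_sitecat[OF W]] cmp_ident_right[OF fibered_sitecat[OF X]])
qed

lemma fibered_fiber_product: "fibered_in_groupoids \<P>"
proof (rule fibered_in_groupoidsI[OF sitecat_fiber_product])
  note SW = fibered_sitecat[OF W] and SX = fibered_sitecat[OF X] and SY = fibered_sitecat[OF Y]
  fix s and T :: "'u topology" and f assume s: "s \<in> Ob \<P>" and T: "cg T" and f: "f \<in> cmaps T (base \<P> s)"
  obtain z y \<alpha> where [simp]: "s = (z, y, \<alpha>)" by (cases s)
  have s': "z \<in> Ob \<W>" "y \<in> Ob \<X>" "base \<X> y = base \<W> z" "arr \<Y> (fst p z) (fst F y) (idmap (base \<W> z)) \<alpha>"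
    using s by (simp_all add: fiber_product_Ob)
  have f': "f \<in> cmaps T (base \<W> z)" "f \<in> cmaps T (base \<X> y)" using f s' by simp_all
  obtain z' a where a: "arr \<W> z' z f a" "base \<W> z' = T" using fib_lift[OF W s'(1) T f'(1)] by blast
  obtain y' b where b: "arr \<X> y' y f b" "base \<X> y' = T" using fib_lift[OF X s'(2) T f'(2)] by blast
  have z': "z' \<in> Ob \<W>" and y': "y' \<in> Ob \<X>" using arr_ob(1)[OF SW a(1)] arr_ob(1)[OF SX b(1)] .
  have "arr \<Y> (fst p z') (fst F y) f (cmp \<Y> \<alpha> (snd p a))"
    using arr_cmp[OF SY fm_arr[OF p a(1)] s'(4)] compmap_idmap_left[OF f'(1)] by (simp add: fm_base[OF p z'] a(2))
  from fib_factor[OF Y fm_arr[OF F b(1)] this, of "idmap T"]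
  obtain \<alpha>' where al': "arr \<Y> (fst p z') (fst F y') (idmap T) \<alpha>'" "cmp \<Y> (snd F b) \<alpha>' = cmp \<Y> \<alpha> (snd p a)"
    using compmap_idmap_right[OF f'(1)] idmap_cmaps[of T]
    by (auto simp: fm_base[OF p z'] fm_base[OF F y'] a(2) b(2) dest: ex1_implies_ex)
  have "(z', y', \<alpha>') \<in> Ob \<P>" using z' y' a b al' by (simp add: fiber_product_Ob)
  then have "arr \<P> (z', y', \<alpha>') s f ((z', y', \<alpha>'), (a, b), s)"
    using s a b al' by (simp add: fiber_product_arr)
  then show "\<exists>w a. arr \<P> w s f a \<and> base \<P> w = T" using a(2) by fastforce
next
  note SW = fibered_sitecat[OF W] and SX = fibered_sitecat[OF X] and SY = fibered_sitecat[OF Y]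
  fix s t r h k g e f assume e: "arr \<P> s r h e" and f: "arr \<P> t r k f"
    and g: "g \<in> cmaps (base \<P> t) (base \<P> s)" and eq: "compmap (base \<P> t) h g = k"
  obtain z y \<alpha> where [simp]: "s = (z, y, \<alpha>)" by (cases s)
  obtain z' y' \<alpha>' where [simp]: "t = (z', y', \<alpha>')" by (cases t)
  obtain z'' y'' \<alpha>'' where [simp]: "r = (z'', y'', \<alpha>'')" by (cases r)
  obtain a b where e': "e = (s, (a, b), r)" "s \<in> Ob \<P>" "r \<in> Ob \<P>"
    "arr \<W> z z'' h a" "arr \<X> y y'' h b" "cmp \<Y> \<alpha>'' (snd p a) = cmp \<Y> (snd F b) \<alpha>"
    using e by (auto simp: fiber_product_arr)
  obtain c d where f': "f = (t, (c, d), r)" "t \<in> Ob \<P>"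
    "arr \<W> z' z'' k c" "arr \<X> y' y'' k d" "cmp \<Y> \<alpha>'' (snd p c) = cmp \<Y> (snd F d) \<alpha>'"
    using f by (auto simp: fiber_product_arr)
  have al: "arr \<Y> (fst p z) (fst F y) (idmap (base \<W> z)) \<alpha>" "arr \<Y> (fst p z') (fst F y') (idmap (base \<W> z')) \<alpha>'"
      "arr \<Y> (fst p z'') (fst F y'') (idmap (base \<W> z'')) \<alpha>''" "base \<X> y = base \<W> z" "base \<X> y' = base \<W> z'"
    using e'(2,3) f'(2) by (simp_all add: fiber_product_Ob)
  have gW: "g \<in> cmaps (base \<W> z') (base \<W> z)" "compmap (base \<W> z') h g = k"
    and gX: "g \<in> cmaps (base \<X> y') (base \<X> y)" "compmap (base \<X> y') h g = k" using g eq al by simp_all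
  note c1 = fib_factor[OF W e'(4) f'(3) gW] and d1 = fib_factor[OF X e'(5) f'(4) gX]
  obtain m where m: "arr \<W> z' z g m" "cmp \<W> a m = c" using ex1_implies_ex[OF c1] by blast
  obtain n where n: "arr \<X> y' y g n" "cmp \<X> b n = d" using ex1_implies_ex[OF d1] by blast
  have mz: "z' \<in> Ob \<W>" and nz: "y' \<in> Ob \<X>" using arr_ob(1)[OF SW m(1)] arr_ob(1)[OF SX n(1)] .
  note pa = fm_arr[OF p e'(4)] and pm = fm_arr[OF p m(1)] and Fb = fm_arr[OF F e'(5)] and Fn = fm_arr[OF F n(1)]
  have "cmp \<Y> (snd F b) (cmp \<Y> \<alpha> (snd p m)) = cmp \<Y> (cmp \<Y> \<alpha>'' (snd p a)) (snd p m)"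
    using cmp_assoc[OF SY pm al(1) Fb] e'(6) by simp
  also have "\<dots> = cmp \<Y> \<alpha>'' (snd p c)"
    using cmp_assoc[OF SY pm pa al(3)] fm_cmp[OF p m(1) e'(4)] m(2) by simp
  also have "\<dots> = cmp \<Y> (cmp \<Y> (snd F b) (snd F n)) \<alpha>'"
    using f'(5) fm_cmp[OF F n(1) e'(5)] n(2) by simp
  also have "\<dots> = cmp \<Y> (snd F b) (cmp \<Y> (snd F n) \<alpha>')"
    using cmp_assoc[OF SY al(2) Fn Fb] by simp
  finally have E: "cmp \<Y> (snd F b) (cmp \<Y> \<alpha> (snd p m)) = cmp \<Y> (snd F b) (cmp \<Y> (snd F n) \<alpha>')" .
  have A1: "arr \<Y> (fst p z') (fst F y) g (cmp \<Y> \<alpha> (snd p m))"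
    using arr_cmp[OF SY pm al(1)] compmap_idmap_left[OF gW(1)] by (simp add: fm_base[OF p mz])
  have A2: "arr \<Y> (fst p z') (fst F y) g (cmp \<Y> (snd F n) \<alpha>')"
    using arr_cmp[OF SY al(2) Fn] compmap_idmap_right[OF gW(1)] by (simp add: fm_base[OF p mz])
  have N: "cmp \<Y> \<alpha> (snd p m) = cmp \<Y> (snd F n) \<alpha>'" by (rule fib_cancel[OF Y Fb A1 A2 E])
  show "\<exists>!c. arr \<P> t s g c \<and> cmp \<P> e c = f"
  proof (rule ex1I[of _ "(t, (m, n), s)"])
    show "arr \<P> t s g (t, (m, n), s) \<and> cmp \<P> e (t, (m, n), s) = f"
      using e'(1,2) f'(1,2) m n N by (simp add: fiber_product_arr fiber_product_cmp)
  next
    fix v assume v: "arr \<P> t s g v \<and> cmp \<P> e v = f"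
    then obtain m' n' where v': "v = (t, (m', n'), s)" "arr \<W> z' z g m'" "arr \<X> y' y g n'" by (auto simp: fiber_product_arr)
    then have "cmp \<W> a m' = c" "cmp \<X> b n' = d" using v e'(1) f'(1) by (simp_all add: fiber_product_cmp)
    then have "m' = m" "n' = n"
      using ex1_unique[OF c1, of m' m] ex1_unique[OF d1, of n' n] v'(2,3) m n by simp_all
    then show "v = (t, (m, n), s)" using v' by simp
  qed
qed

lemma fiber_product_fst_morphism: "fib_morphism \<P> \<W> (fiber_product_fst \<P>)"
proof (rule fib_morphismI[OF sitecat_fiber_product])
  fix s assume s: "s \<in> Ob \<P>"
  obtain z y \<alpha> where [simp]: "s = (z, y, \<alpha>)" by (cases s)
  have "ident \<P> s \<in> Ar \<P>" using arrD(1)[OF arr_ident[OF sitecat_fiber_product s]] .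
  moreover have "z \<in> Ob \<W>" using s by (simp add: fiber_product_Ob)
  ultimately show "fst (fiber_product_fst \<P>) s \<in> Ob \<W> \<and> base \<W> (fst (fiber_product_fst \<P>) s) = base \<P> s \<and>
      snd (fiber_product_fst \<P>) (ident \<P> s) = ident \<W> (fst (fiber_product_fst \<P>) s)"
    using s by (simp add: fiber_product_fst_def fiber_product_ident)
next
  fix s t h e assume e: "arr \<P> s t h e"
  have st: "s \<in> Ob \<P>" "t \<in> Ob \<P>" "e \<in> Ar \<P>" using arr_ob[OF sitecat_fiber_product e] arrD(1)[OF e] by auto
  obtain z y \<alpha> where [simp]: "s = (z, y, \<alpha>)" by (cases s)
  obtain z' y' \<alpha>' where [simp]: "t = (z', y', \<alpha>')" by (cases t)
  obtain a b where "e = (s, (a, b), t)" "arr \<W> z z' h a" using e by (auto simp: fiber_product_arr)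
  then show "arr \<W> (fst (fiber_product_fst \<P>) s) (fst (fiber_product_fst \<P>) t) h (snd (fiber_product_fst \<P>) e)"
    using st by (simp add: fiber_product_fst_def)
next
  fix s t r h k e f assume e: "arr \<P> s t h e" and f: "arr \<P> t r k f"
  have A: "e \<in> Ar \<P>" "f \<in> Ar \<P>" "cmp \<P> f e \<in> Ar \<P>"
    using arrD(1)[OF e] arrD(1)[OF f] arrD(1)[OF arr_cmp[OF sitecat_fiber_product e f]] .
  obtain a b where e': "e = (s, (a, b), t)" using e by (cases s; cases t) (auto simp: fiber_product_arr)
  obtain c d where f': "f = (t, (c, d), r)" using f by (cases t; cases r) (auto simp: fiber_product_arr)
  show "snd (fiber_product_fst \<P>) (cmp \<P> f e) = cmp \<W> (snd (fiber_product_fst \<P>) f) (snd (fiber_product_fst \<P>) e)"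
    using A by (simp add: fiber_product_fst_def e' f' fiber_product_cmp)
qed (simp_all add: fiber_product_fst_def)

text \<open>The fiber product is symmetric, by inverting the isomorphism that is part of its objects.\<close>

lemma terminal_fiber_product_swap:
  assumes t: "terminal \<P> (z, y, \<alpha>)"
  shows "\<exists>\<alpha>'. terminal (fiber_product \<X> \<W> \<Y> F p) (y, z, \<alpha>')"
proof -
  let ?R = "fiber_product \<X> \<W> \<Y> F p"
  note SY = fibered_sitecat[OF Y]
  have o: "z \<in> Ob \<W>" "y \<in> Ob \<X>" "base \<X> y = base \<W> z" and a: "arr \<Y> (fst p z) (fst F y) (idmap (base \<W> z)) \<alpha>"
    using terminal_ob[OF t] by (simp_all add: fiber_product_Ob)
  have "arr \<Y> (fst p z) (fst F y) (idmap (base \<Y> (fst p z))) \<alpha>" using a fm_base[OF p o(1)] by simp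
  from fib_inverse[OF Y this] obtain \<alpha>' where a': "arr \<Y> (fst F y) (fst p z) (idmap (base \<W> z)) \<alpha>'"
    "cmp \<Y> \<alpha> \<alpha>' = ident \<Y> (fst F y)" "cmp \<Y> \<alpha>' \<alpha> = ident \<Y> (fst p z)"
    using fm_base[OF p o(1)] fm_base[OF F o(2)] o(3) by auto
  have yz: "(y, z, \<alpha>') \<in> Ob ?R" using o a'(1) by (simp add: fiber_product_Ob)
  have "terminal ?R (y, z, \<alpha>')"
    unfolding terminal_def
  proof (intro conjI ballI yz)
    fix w assume w: "w \<in> Ob ?R"
    obtain y1 z1 \<delta>' where we: "w = (y1, z1, \<delta>')" by (cases w)
    have o1: "y1 \<in> Ob \<X>" "z1 \<in> Ob \<W>" "base \<W> z1 = base \<X> y1" and d': "arr \<Y> (fst F y1) (fst p z1) (idmap (base \<X> y1)) \<delta>'"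
      using w by (simp_all add: we fiber_product_Ob)
    have "arr \<Y> (fst F y1) (fst p z1) (idmap (base \<Y> (fst F y1))) \<delta>'" using d' fm_base[OF F o1(1)] by simp
    from fib_inverse[OF Y this] obtain \<delta> where d: "arr \<Y> (fst p z1) (fst F y1) (idmap (base \<W> z1)) \<delta>"
      "cmp \<Y> \<delta>' \<delta> = ident \<Y> (fst p z1)" "cmp \<Y> \<delta> \<delta>' = ident \<Y> (fst F y1)"
      using fm_base[OF p o1(2)] fm_base[OF F o1(1)] o1(3) by auto
    have v: "(z1, y1, \<delta>) \<in> Ob \<P>" using o1 d(1) by (simp add: fiber_product_Ob)
    have fwd: "cmp \<Y> \<alpha>' (snd F c) = cmp \<Y> (snd p b) \<delta>'"
      if "arr \<W> z1 z h b" "arr \<X> y1 y h c" "cmp \<Y> \<alpha> (snd p b) = cmp \<Y> (snd F c) \<delta>" for h b c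
      by (rule inverse_square[OF SY a a'(1,3) d(1) d' d(3) fm_arr[OF p that(1)] fm_arr[OF F that(2)] that(3)])
    have bwd: "cmp \<Y> \<alpha> (snd p b) = cmp \<Y> (snd F c) \<delta>"
      if "arr \<W> z1 z h b" "arr \<X> y1 y h c" "cmp \<Y> \<alpha>' (snd F c) = cmp \<Y> (snd p b) \<delta>'" for h b c
      by (rule inverse_square[OF SY a'(1) a a'(2) d' d(1,2) fm_arr[OF F that(2)] fm_arr[OF p that(1)] that(3)])
    have iff: "arr \<P> (z1, y1, \<delta>) (z, y, \<alpha>) h ((z1, y1, \<delta>), (b, c), (z, y, \<alpha>)) \<longleftrightarrow>
        arr ?R w (y, z, \<alpha>') h (w, (c, b), (y, z, \<alpha>'))" for h b c
    proof -
      have "arr \<P> (z1, y1, \<delta>) (z, y, \<alpha>) h ((z1, y1, \<delta>), (b, c), (z, y, \<alpha>)) \<longleftrightarrow>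
          arr \<W> z1 z h b \<and> arr \<X> y1 y h c \<and> cmp \<Y> \<alpha> (snd p b) = cmp \<Y> (snd F c) \<delta>"
        using v terminal_ob[OF t] by (simp add: fiber_product_arr)
      moreover have "arr ?R w (y, z, \<alpha>') h (w, (c, b), (y, z, \<alpha>')) \<longleftrightarrow>
          arr \<X> y1 y h c \<and> arr \<W> z1 z h b \<and> cmp \<Y> \<alpha>' (snd F c) = cmp \<Y> (snd p b) \<delta>'"
        using w yz by (simp add: fiber_product_arr we)
      ultimately show ?thesis using fwd[of h b c] bwd[of h b c] by blast
    qed
    have ex: "\<exists>!e. e \<in> Ar \<P> \<and> src \<P> e = (z1, y1, \<delta>) \<and> tgt \<P> e = (z, y, \<alpha>)" using t v unfolding terminal_def by blast
    have "arr \<P> (z1, y1, \<delta>) (z, y, \<alpha>) (bmap \<P> (bang \<P> (z, y, \<alpha>) (z1, y1, \<delta>))) (bang \<P> (z, y, \<alpha>) (z1, y1, \<delta>))"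
      by (rule bang_arr[OF t v])
    then obtain h b c where e: "arr \<P> (z1, y1, \<delta>) (z, y, \<alpha>) h ((z1, y1, \<delta>), (b, c), (z, y, \<alpha>))"
      unfolding fiber_product_arr by blast
    show "\<exists>!e. e \<in> Ar ?R \<and> src ?R e = w \<and> tgt ?R e = (y, z, \<alpha>')"
    proof (rule ex1I[of _ "(w, (c, b), (y, z, \<alpha>'))"])
      show "(w, (c, b), (y, z, \<alpha>')) \<in> Ar ?R \<and> src ?R (w, (c, b), (y, z, \<alpha>')) = w \<and> tgt ?R (w, (c, b), (y, z, \<alpha>')) = (y, z, \<alpha>')"
        using e unfolding iff by (simp add: arr_def)
    next
      fix f assume f: "f \<in> Ar ?R \<and> src ?R f = w \<and> tgt ?R f = (y, z, \<alpha>')"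
      then have "arr ?R w (y, z, \<alpha>') (bmap ?R f) f" by (simp add: arr_def)
      then obtain c1 b1 where f': "f = (w, (c1, b1), (y, z, \<alpha>'))" "arr ?R w (y, z, \<alpha>') (bmap ?R f) (w, (c1, b1), (y, z, \<alpha>'))"
        unfolding we fiber_product_arr by blast
      then have "arr \<P> (z1, y1, \<delta>) (z, y, \<alpha>) (bmap ?R f) ((z1, y1, \<delta>), (b1, c1), (z, y, \<alpha>))" unfolding iff by blast
      from ex1_unique[OF ex, of "((z1, y1, \<delta>), (b1, c1), (z, y, \<alpha>))" "((z1, y1, \<delta>), (b, c), (z, y, \<alpha>))"] arrD[OF this] arrD[OF e]
      show "f = (w, (c, b), (y, z, \<alpha>'))" using f'(1) by simp
    qed
  qed
  then show ?thesis by blast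
qed

end

lemma fib_morphism_id:
  assumes S: "sitecat \<X>"
  shows "fib_morphism \<X> \<X> (fib_id \<X>)"
  by (rule fib_morphismI[OF S])
    (auto simp: fib_id_def arrD(1) arrD(1)[OF arr_ident[OF S]] arrD(1)[OF arr_cmp[OF S]] arr_ob[OF S])

text \<open>
  A category fibered in groupoids is equivalent to a space exactly when it has a terminal object,
  namely the universal point.
\<close>

lemma equivalence_imp_terminal:
  fixes Z :: "'u topology"
  assumes P: "fibered_in_groupoids \<P>" and Z: "cg Z" and E: "fib_equivalence (space_stack Z) \<P> E"
  shows "terminal \<P> (fst E (Z, idmap Z))"
proof -
  let ?S = "space_stack Z :: ('u, _, _) fibcat" and ?d = "(Z, idmap Z)"
  note S = sitecat_space_stack[of Z] and SP = fibered_sitecat[OF P] and d = terminal_space_stack[OF Z]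
  obtain G \<epsilon> \<eta> where Em: "fib_morphism ?S \<P> E" and G: "fib_morphism \<P> ?S G"
    and e: "two_morphism ?S ?S (fib_comp ?S G E) (fib_id ?S) \<epsilon>"
    and n: "two_morphism \<P> \<P> (fib_comp \<P> E G) (fib_id \<P>) \<eta>"
    using E unfolding fib_equivalence_def isomorphic_morphisms_def by blast
  let ?u = "fst E ?d"
  have u: "?u \<in> Ob \<P>" using fm_ob[OF Em terminal_ob[OF d]] .
  have nw: "arr \<P> (fst E (fst G w)) w (idmap (base \<P> w)) (\<eta> w)" if w: "w \<in> Ob \<P>" for w
    using tm_arr[OF n w] w by (simp add: fib_comp_def fib_id_def)
  have bEG: "base \<P> (fst E (fst G w)) = base \<P> w" if w: "w \<in> Ob \<P>" for w
    using fm_base[OF Em fm_ob[OF G w]] fm_base[OF G w] by simp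
  have ed: "arr ?S (fst G ?u) ?d (idmap Z) (\<epsilon> ?d)"
    using tm_arr[OF e terminal_ob[OF d]] terminal_ob[OF d] by (simp add: fib_comp_def fib_id_def)
  show ?thesis
    unfolding terminal_def
  proof (intro conjI ballI u)
    fix w assume w: "w \<in> Ob \<P>"
    have "arr \<P> (fst E (fst G w)) w (idmap (base \<P> (fst E (fst G w)))) (\<eta> w)" using nw[OF w] bEG[OF w] by simp
    from fib_inverse[OF P this] bEG[OF w]
    obtain b where b: "arr \<P> w (fst E (fst G w)) (idmap (base \<P> w)) b" by auto
    from arr_cmp[OF SP b fm_arr[OF Em bang_arr[OF d fm_ob[OF G w]]]]
    obtain a where "a \<in> Ar \<P> \<and> src \<P> a = w \<and> tgt \<P> a = ?u" by (auto simp: arr_def)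
    moreover have "a = a'" if a: "a \<in> Ar \<P> \<and> src \<P> a = w \<and> tgt \<P> a = ?u" and a': "a' \<in> Ar \<P> \<and> src \<P> a' = w \<and> tgt \<P> a' = ?u" for a a'
    proof -
      have A: "arr \<P> w ?u (bmap \<P> a) a" "arr \<P> w ?u (bmap \<P> a') a'" using a a' by (simp_all add: arr_def)
      note GA = fm_arr[OF G A(1)] fm_arr[OF G A(2)]
      have "fst G ?u = ?d"
        using ed compmap_idmap_left[OF idmap_cmaps, of Z] fm_base[OF G u] fm_base[OF Em terminal_ob[OF d]]
        by (simp add: space_stack_arr prod_eq_iff)
      then have GA': "arr ?S (fst G w) ?d (bmap \<P> a) (snd G a)" "arr ?S (fst G w) ?d (bmap \<P> a') (snd G a')" using GA by simp_all
      have "snd G a = snd G a'" by (rule trans[OF bang_unique[OF d S GA'(1)] bang_unique[OF d S GA'(2), symmetric]])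
      moreover have "cmp \<P> (\<eta> ?u) (snd E (snd G a)) = cmp \<P> a (\<eta> w)" "cmp \<P> (\<eta> ?u) (snd E (snd G a')) = cmp \<P> a' (\<eta> w)"
        using tm_natural[OF n A(1)] tm_natural[OF n A(2)] a a' by (simp_all add: fib_comp_def fib_id_def)
      ultimately have "cmp \<P> a (\<eta> w) = cmp \<P> a' (\<eta> w)" by simp
      moreover have "arr \<P> (fst E (fst G w)) w (idmap (base \<P> (fst E (fst G w)))) (\<eta> w)" using nw[OF w] bEG[OF w] by simp
      ultimately show "a = a'" using fib_cancel_right[OF P _ _ A] bEG[OF w] by metis
    qed
    ultimately show "\<exists>!a. a \<in> Ar \<P> \<and> src \<P> a = w \<and> tgt \<P> a = ?u" by (intro ex1I) blast+
  qed
qed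

text \<open>
  Both sides have terminal objects over \<open>Z\<close>; the Yoneda lemma gives functors matching them, and the
  transformations between the composites and the identities.
\<close>

lemma terminal_imp_equivalence:
  fixes Z :: "'u topology"
  assumes P: "fibered_in_groupoids \<P>" and u: "terminal \<P> u" and bu: "base \<P> u = Z"
  shows "\<exists>E. fib_equivalence (space_stack Z) \<P> E \<and> fst E (Z, idmap Z) = u"
proof -
  let ?S = "space_stack Z :: ('u, _, _) fibcat" and ?d = "(Z, idmap Z)"
  note SP = fibered_sitecat[OF P] and S = sitecat_space_stack[of Z] and FS = fibered_space_stack[of Z]
  note uO = terminal_ob[OF u]
  have Z: "cg Z" using cg_base[OF SP uO] bu by simp
  note d = terminal_space_stack[OF Z] and dO = terminal_ob[OF terminal_space_stack[OF Z]]
  obtain E where E: "fib_morphism ?S \<P> E" "fst E ?d = u" using yoneda_functor[OF S d P uO] bu by auto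
  obtain G where G: "fib_morphism \<P> ?S G" "fst G u = ?d" using yoneda_functor[OF SP u FS dO] bu by auto
  have "isomorphic_morphisms ?S ?S (fib_comp ?S G E) (fib_id ?S)"
    using ex1_implies_ex[OF yoneda_transformation[OF S d FS fib_morphism_comp[OF S E(1) G(1)] fib_morphism_id[OF S], of "ident ?S ?d"]]
      arr_ident[OF S dO] dO E(2) G(2) unfolding isomorphic_morphisms_def by (auto simp: fib_comp_def fib_id_def)
  moreover have "isomorphic_morphisms \<P> \<P> (fib_comp \<P> E G) (fib_id \<P>)"
    using ex1_implies_ex[OF yoneda_transformation[OF SP u P fib_morphism_comp[OF SP G(1) E(1)] fib_morphism_id[OF SP], of "ident \<P> u"]]
      arr_ident[OF SP uO] uO E(2) G(2) unfolding isomorphic_morphisms_def by (auto simp: fib_comp_def fib_id_def)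
  ultimately show ?thesis using E G(1) unfolding fib_equivalence_def by blast
qed

lemma space_morphism_fib:
  fixes Z :: "'a topology"
  assumes q: "continuous_map Z T q"
  shows "fib_morphism (space_stack Z :: ('u, _, _) fibcat) (space_stack T) (space_morphism Z q)"
proof -
  let ?S = "space_stack Z :: ('u, _, _) fibcat" and ?T = "space_stack T :: ('u, _, _) fibcat"
  let ?F = "\<lambda>x :: ('u, 'a) sobj. (fst x, compmap (fst x) q (snd x))"
  have fst: "fst (space_morphism Z q) x = ?F x" if "x \<in> Ob ?S" for x
    using that by (simp add: space_morphism_def compmap_def case_prod_beta Let_def)
  have snd: "snd (space_morphism Z q) (x, h, y) = (?F x, h, ?F y)" if "(x, h, y) \<in> Ar ?S" for x h y
    using that by (simp add: space_morphism_def compmap_def case_prod_beta Let_def)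
  have FO: "?F x \<in> Ob ?T" if "x \<in> Ob ?S" for x
  proof -
    have "continuous_map (fst x) T (q \<circ> snd x)"
      using that q by (intro continuous_map_compose) (auto simp: space_stack_Ob cmaps_def)
    then have "compmap (fst x) q (snd x) \<in> cmaps (fst x) T"
      unfolding compmap_def compose_def using restrict_cmaps by (auto simp: comp_def)
    then show ?thesis using that by (simp add: space_stack_Ob)
  qed
  show ?thesis
  proof (rule fib_morphismI[OF sitecat_space_stack])
    fix x assume x: "x \<in> Ob ?S"
    have "(x, idmap (fst x), x) \<in> Ar ?S" using arrD(1)[OF arr_ident[OF sitecat_space_stack x]] by (simp add: space_stack_ident)
    then show "fst (space_morphism Z q) x \<in> Ob ?T \<and> base ?T (fst (space_morphism Z q) x) = base ?S x \<and>
        snd (space_morphism Z q) (ident ?S x) = ident ?T (fst (space_morphism Z q) x)"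
      using FO[OF x] by (simp add: fst[OF x] snd space_stack_ident)
  next
    fix x y h a assume a: "arr ?S x y h a"
    then have a': "a = (x, h, y)" "x \<in> Ob ?S" "y \<in> Ob ?S" "h \<in> cmaps (fst x) (fst y)" "compmap (fst x) (snd y) h = snd x"
      "(x, h, y) \<in> Ar ?S" using arrD(1)[OF a] by (auto simp: space_stack_arr)
    have "compmap (fst x) (compmap (fst y) q (snd y)) h = compmap (fst x) q (snd x)"
      using compmap_assoc[OF a'(4), of q "snd y"] a'(5) by simp
    then show "arr ?T (fst (space_morphism Z q) x) (fst (space_morphism Z q) y) h (snd (space_morphism Z q) a)"
      using a' FO by (simp add: fst snd space_stack_arr)
  next
    fix x y z h k a b assume a: "arr ?S x y h a" and b: "arr ?S y z k b"
    have A: "(x, h, y) \<in> Ar ?S" "(y, k, z) \<in> Ar ?S" "a = (x, h, y)" "b = (y, k, z)"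
      using arrD(1)[OF a] arrD(1)[OF b] a b by (auto simp: space_stack_arr)
    moreover have "(x, compmap (fst x) k h, z) \<in> Ar ?S"
      using arrD(1)[OF arr_cmp[OF sitecat_space_stack a b]] A by (simp add: space_stack_cmp)
    ultimately show "snd (space_morphism Z q) (cmp ?S b a) = cmp ?T (snd (space_morphism Z q) b) (snd (space_morphism Z q) a)"
      by (simp add: space_stack_cmp snd)
  qed (simp_all add: space_morphism_def Let_def)
qed

context
  fixes \<X> :: "('u, 'o, 'm) fibcat" and \<Y> :: "('u, 'p, 'n) fibcat"
    and F :: "('o, 'm, 'p, 'n) fibfun"
  assumes X: "fibered_in_groupoids \<X>" and Y: "fibered_in_groupoids \<Y>" and F: "fib_morphism \<X> \<Y> F"
begin

context
  fixes T :: "'u topology" and p :: "(('u, 'u) sobj, ('u, 'u) sarr, 'p, 'n) fibfun"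
  assumes T: "cg T" and p: "fib_morphism (space_stack T) \<Y> p"
begin

private abbreviation "\<S> \<equiv> space_stack T :: ('u, _, _) fibcat"
private abbreviation "\<F> \<equiv> fiber_product \<S> \<X> \<Y> p F"
private abbreviation "\<t> \<equiv> (T, idmap T)"
private abbreviation "\<pi> z \<equiv> snd p (bang \<S> \<t> z)"

lemma point_arr: "z \<in> Ob \<S> \<Longrightarrow> arr \<Y> (fst p z) (fst p \<t>) (snd z) (\<pi> z)"
  using fm_arr[OF p bang_arr[OF terminal_space_stack[OF T]]] by (simp add: bang_space_stack[OF T])

lemma point_to_arrow:
  assumes s: "(z, y, \<alpha>) \<in> Ob \<F>"
  shows "\<exists>\<beta>. arr \<Y> (fst F y) (fst p \<t>) (snd z) \<beta> \<and> cmp \<Y> \<beta> \<alpha> = \<pi> z"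
proof -
  note SY = fibered_sitecat[OF Y]
  have s': "z \<in> Ob \<S>" "y \<in> Ob \<X>" "base \<X> y = fst z" "arr \<Y> (fst p z) (fst F y) (idmap (fst z)) \<alpha>"
    using s by (simp_all add: fiber_product_Ob)
  have bs: "base \<Y> (fst p z) = fst z" "base \<Y> (fst F y) = fst z" using fm_base[OF p s'(1)] fm_base[OF F s'(2)] s'(3) by simp_all
  obtain c where c: "arr \<Y> (fst F y) (fst p z) (idmap (fst z)) c" "cmp \<Y> c \<alpha> = ident \<Y> (fst p z)"
    using fib_inverse[OF Y, of "fst p z" "fst F y" \<alpha>] s'(4) bs by auto
  have z: "snd z \<in> cmaps (fst z) T" using s'(1) by (simp add: space_stack_Ob)
  have "arr \<Y> (fst F y) (fst p \<t>) (snd z) (cmp \<Y> (\<pi> z) c)"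
    using arr_cmp[OF SY c(1) point_arr[OF s'(1)]] compmap_idmap_right[OF z] bs by simp
  moreover have "cmp \<Y> (cmp \<Y> (\<pi> z) c) \<alpha> = \<pi> z"
    using cmp_assoc[OF SY s'(4) c(1) point_arr[OF s'(1)]] c(2) cmp_ident_right[OF SY point_arr[OF s'(1)]] by simp
  ultimately show ?thesis by blast
qed

lemma arrow_to_point:
  assumes y: "y \<in> Ob \<X>" and b: "arr \<Y> (fst F y) (fst p \<t>) h \<beta>"
  shows "\<exists>\<alpha>. ((base \<X> y, h), y, \<alpha>) \<in> Ob \<F> \<and> cmp \<Y> \<beta> \<alpha> = \<pi> (base \<X> y, h)"
proof -
  note SY = fibered_sitecat[OF Y]
  have h: "h \<in> cmaps (base \<X> y) T"
    using arr_bmap[OF SY b] fm_base[OF F y] fm_base[OF p terminal_ob[OF terminal_space_stack[OF T]]] by simp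
  have z: "(base \<X> y, h) \<in> Ob \<S>" using h cg_base[OF fibered_sitecat[OF X] y] by (simp add: space_stack_Ob)
  have bs: "base \<Y> (fst p (base \<X> y, h)) = base \<X> y" "base \<Y> (fst F y) = base \<X> y"
    using fm_base[OF p z] fm_base[OF F y] by simp_all
  have "arr \<Y> (fst p (base \<X> y, h)) (fst p \<t>) h (\<pi> (base \<X> y, h))" using point_arr[OF z] by simp
  from ex1_implies_ex[OF fib_factor[OF Y b this, of "idmap (base \<X> y)"]]
  obtain \<alpha> where "arr \<Y> (fst p (base \<X> y, h)) (fst F y) (idmap (base \<X> y)) \<alpha>" "cmp \<Y> \<beta> \<alpha> = \<pi> (base \<X> y, h)"
    using compmap_idmap_right[OF h] idmap_cmaps[of "base \<X> y"] bs by auto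
  then show ?thesis using z y by (intro exI[of _ \<alpha>]) (simp add: fiber_product_Ob)
qed

lemma point_morphism_imp:
  assumes e: "arr \<F> (z', y', \<alpha>') (z, y, \<alpha>) h ((z', y', \<alpha>'), (a, b), (z, y, \<alpha>))"
    and be: "arr \<Y> (fst F y) (fst p \<t>) k \<beta>" "cmp \<Y> \<beta> \<alpha> = \<pi> z"
    and be': "arr \<Y> (fst F y') (fst p \<t>) k' \<beta>'" "cmp \<Y> \<beta>' \<alpha>' = \<pi> z'"
  shows "arr \<X> y' y h b \<and> cmp \<Y> \<beta> (snd F b) = \<beta>'"
proof -
  note SY = fibered_sitecat[OF Y]
  have e': "(z', y', \<alpha>') \<in> Ob \<F>" "(z, y, \<alpha>) \<in> Ob \<F>" "arr \<S> z' z h a" "arr \<X> y' y h b"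
    "cmp \<Y> \<alpha> (snd p a) = cmp \<Y> (snd F b) \<alpha>'"
    using e by (auto simp: fiber_product_arr)
  have s: "z \<in> Ob \<S>" "arr \<Y> (fst p z) (fst F y) (idmap (fst z)) \<alpha>" 
    and s': "z' \<in> Ob \<S>" "y' \<in> Ob \<X>" "base \<X> y' = fst z'" "arr \<Y> (fst p z') (fst F y') (idmap (fst z')) \<alpha>'"
    using e'(1,2) by (simp_all add: fiber_product_Ob)
  note pa = fm_arr[OF p e'(3)] and Fb = fm_arr[OF F e'(4)]
  have ba: "cmp \<S> (bang \<S> \<t> z) a = bang \<S> \<t> z'"
    using bang_unique[OF terminal_space_stack[OF T] sitecat_space_stack
        arr_cmp[OF sitecat_space_stack e'(3) bang_arr[OF terminal_space_stack[OF T] s(1)]]] .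
  have "cmp \<Y> (cmp \<Y> \<beta> (snd F b)) \<alpha>' = cmp \<Y> \<beta> (cmp \<Y> \<alpha> (snd p a))"
    using cmp_assoc[OF SY s'(4) Fb be(1)] e'(5) by simp
  also have "\<dots> = cmp \<Y> (\<pi> z) (snd p a)" using cmp_assoc[OF SY pa s(2) be(1)] be(2) by simp
  also have "\<dots> = cmp \<Y> \<beta>' \<alpha>'"
    using fm_cmp[OF p e'(3) bang_arr[OF terminal_space_stack[OF T] s(1)]] ba be'(2) by simp
  finally have eq: "cmp \<Y> (cmp \<Y> \<beta> (snd F b)) \<alpha>' = cmp \<Y> \<beta>' \<alpha>'" .
  have bs: "base \<Y> (fst p z') = fst z'" "base \<Y> (fst F y') = fst z'" using fm_base[OF p s'(1)] fm_base[OF F s'(2)] s'(3) by simp_all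
  have "cmp \<Y> \<beta> (snd F b) = \<beta>'"
    by (rule fib_cancel_right[OF Y, of "fst p z'" "fst F y'", OF _ _ arr_cmp[OF SY Fb be(1)] be'(1) eq]) (use s'(4) bs in simp_all)
  then show ?thesis using e'(4) by blast
qed

lemma point_morphism_if:
  assumes s: "(z, y, \<alpha>) \<in> Ob \<F>" and s': "(z', y', \<alpha>') \<in> Ob \<F>"
    and be: "arr \<Y> (fst F y) (fst p \<t>) (snd z) \<beta>" "cmp \<Y> \<beta> \<alpha> = \<pi> z"
    and be': "arr \<Y> (fst F y') (fst p \<t>) (snd z') \<beta>'" "cmp \<Y> \<beta>' \<alpha>' = \<pi> z'"
    and b: "arr \<X> y' y h b" and eq: "cmp \<Y> \<beta> (snd F b) = \<beta>'"
  shows "arr \<F> (z', y', \<alpha>') (z, y, \<alpha>) h ((z', y', \<alpha>'), ((z', h, z), b), (z, y, \<alpha>))"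
proof -
  note SY = fibered_sitecat[OF Y] and SX = fibered_sitecat[OF X]
  have s1: "z \<in> Ob \<S>" "y \<in> Ob \<X>" "base \<X> y = fst z" "arr \<Y> (fst p z) (fst F y) (idmap (fst z)) \<alpha>" 
    and s2: "z' \<in> Ob \<S>" "y' \<in> Ob \<X>" "base \<X> y' = fst z'" "arr \<Y> (fst p z') (fst F y') (idmap (fst z')) \<alpha>'"
    using s s' by (simp_all add: fiber_product_Ob)
  have bs: "base \<Y> (fst p z') = fst z'" "base \<Y> (fst F y') = fst z'" using fm_base[OF p s2(1)] fm_base[OF F s2(2)] s2(3) by simp_all
  have h: "h \<in> cmaps (fst z') (fst z)" using arr_bmap[OF SX b] s1(3) s2(3) by simp
  note Fb = fm_arr[OF F b]
  have "compmap (fst z') (snd z) h = snd z'"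
    using arr_cmp[OF SY Fb be(1)] be'(1) eq bs by (simp add: arr_def)
  then have a: "arr \<S> z' z h (z', h, z)" using s1(1) s2(1) h by (simp add: space_stack_arr)
  note pa = fm_arr[OF p a]
  have ba: "cmp \<S> (bang \<S> \<t> z) (z', h, z) = bang \<S> \<t> z'"
    using bang_unique[OF terminal_space_stack[OF T] sitecat_space_stack
        arr_cmp[OF sitecat_space_stack a bang_arr[OF terminal_space_stack[OF T] s1(1)]]] .
  have "cmp \<Y> \<beta> (cmp \<Y> \<alpha> (snd p (z', h, z))) = cmp \<Y> (\<pi> z) (snd p (z', h, z))"
    using cmp_assoc[OF SY pa s1(4) be(1)] be(2) by simp
  also have "\<dots> = cmp \<Y> \<beta>' \<alpha>'"
    using fm_cmp[OF p a bang_arr[OF terminal_space_stack[OF T] s1(1)]] ba be'(2) by simp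
  also have "\<dots> = cmp \<Y> \<beta> (cmp \<Y> (snd F b) \<alpha>')" using cmp_assoc[OF SY s2(4) Fb be(1)] eq by simp
  finally have E: "cmp \<Y> \<beta> (cmp \<Y> \<alpha> (snd p (z', h, z))) = cmp \<Y> \<beta> (cmp \<Y> (snd F b) \<alpha>')" .
  have "cmp \<Y> \<alpha> (snd p (z', h, z)) = cmp \<Y> (snd F b) \<alpha>'"
    by (rule fib_cancel[OF Y be(1) _ _ E, of _ h])
      (use arr_cmp[OF SY pa s1(4)] arr_cmp[OF SY s2(4) Fb] compmap_idmap_left[OF h] compmap_idmap_right[OF h] bs in simp_all)
  then show ?thesis using s s' a b by (simp add: fiber_product_arr)
qed

lemma terminal_point_iff:
  assumes s: "(z, y, \<alpha>) \<in> Ob \<F>"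
    and be: "arr \<Y> (fst F y) (fst p \<t>) (snd z) \<beta>" "cmp \<Y> \<beta> \<alpha> = \<pi> z"
  shows "terminal \<F> (z, y, \<alpha>) \<longleftrightarrow> universal_arrow \<X> \<Y> F (fst p \<t>) y \<beta>"
proof
  have y: "y \<in> Ob \<X>" using s by (simp add: fiber_product_Ob)
  note SX = fibered_sitecat[OF X]
  note SP = sitecat_fiber_product[OF fibered_space_stack X Y p F]
  assume trm: "terminal \<F> (z, y, \<alpha>)"
  show "universal_arrow \<X> \<Y> F (fst p \<t>) y \<beta>"
    unfolding universal_arrow_def
  proof (intro conjI allI impI)
    show "arr \<Y> (fst F y) (fst p \<t>) (bmap \<Y> \<beta>) \<beta>" using be(1) by (simp add: arr_def)
    fix y' k b' assume y': "y' \<in> Ob \<X>" and b': "arr \<Y> (fst F y') (fst p \<t>) k b'"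
    obtain \<alpha>' where s': "((base \<X> y', k), y', \<alpha>') \<in> Ob \<F>" and al: "cmp \<Y> b' \<alpha>' = \<pi> (base \<X> y', k)"
      using arrow_to_point[OF y' b'] by blast
    let ?s' = "((base \<X> y', k), y', \<alpha>')"
    have b'': "arr \<Y> (fst F y') (fst p \<t>) (snd (base \<X> y', k)) b'" using b' by simp
    obtain e where e: "arr \<F> ?s' (z, y, \<alpha>) (bmap \<F> e) e" using bang_arr[OF trm s'] by blast
    obtain a b where ab: "e = (?s', (a, b), (z, y, \<alpha>))" using e by (auto simp: fiber_product_arr)
    note b = point_morphism_imp[OF e[unfolded ab] be b'' al]
    show "\<exists>!b. b \<in> Ar \<X> \<and> src \<X> b = y' \<and> tgt \<X> b = y \<and> cmp \<Y> \<beta> (snd F b) = b'"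
    proof (rule ex1I[of _ b])
      show "b \<in> Ar \<X> \<and> src \<X> b = y' \<and> tgt \<X> b = y \<and> cmp \<Y> \<beta> (snd F b) = b'" using b by (simp add: arr_def)
    next
      fix d assume d: "d \<in> Ar \<X> \<and> src \<X> d = y' \<and> tgt \<X> d = y \<and> cmp \<Y> \<beta> (snd F d) = b'"
      then have d': "arr \<X> y' y (bmap \<X> d) d" by (simp add: arr_def)
      have eb: "arr \<X> y' y (bmap \<X> b) b" using b by (simp add: arr_def)
      note E1 = point_morphism_if[OF s s' be b'' al d'] and E2 = point_morphism_if[OF s s' be b'' al eb]
      have "(?s', (((base \<X> y', k), bmap \<X> d, z), d), (z, y, \<alpha>)) = (?s', (((base \<X> y', k), bmap \<X> b, z), b), (z, y, \<alpha>))"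
        using bang_unique[OF trm SP E1] bang_unique[OF trm SP E2] d b by simp
      then show "d = b" by simp
    qed
  qed (rule y)
next
  note SX = fibered_sitecat[OF X]
  assume U: "universal_arrow \<X> \<Y> F (fst p \<t>) y \<beta>"
  show "terminal \<F> (z, y, \<alpha>)"
    unfolding terminal_def
  proof (intro conjI ballI s)
    fix s' assume s': "s' \<in> Ob \<F>"
    obtain z' y' \<alpha>' where [simp]: "s' = (z', y', \<alpha>')" by (cases s')
    have y': "y' \<in> Ob \<X>" using s' by (simp add: fiber_product_Ob)
    obtain \<beta>' where be': "arr \<Y> (fst F y') (fst p \<t>) (snd z') \<beta>'" "cmp \<Y> \<beta>' \<alpha>' = \<pi> z'"
      using point_to_arrow[of z' y' \<alpha>'] s' by auto
    note ex = universal_arrow_ex1[OF U y' be'(1)]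
    obtain b where b: "arr \<X> y' y (bmap \<X> b) b" "cmp \<Y> \<beta> (snd F b) = \<beta>'"
      using universal_arrow_factor[OF U y' be'(1)] .
    have E: "arr \<F> s' (z, y, \<alpha>) (bmap \<X> b) (s', ((z', bmap \<X> b, z), b), (z, y, \<alpha>))"
      using point_morphism_if[OF s _ be be' b] s' by simp
    show "\<exists>!a. a \<in> Ar \<F> \<and> src \<F> a = s' \<and> tgt \<F> a = (z, y, \<alpha>)"
    proof (rule ex1I[of _ "(s', ((z', bmap \<X> b, z), b), (z, y, \<alpha>))"])
      show "(s', ((z', bmap \<X> b, z), b), (z, y, \<alpha>)) \<in> Ar \<F> \<and> src \<F> (s', ((z', bmap \<X> b, z), b), (z, y, \<alpha>)) = s' \<and>
          tgt \<F> (s', ((z', bmap \<X> b, z), b), (z, y, \<alpha>)) = (z, y, \<alpha>)" using E by (simp add: arr_def)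
    next
      fix e assume "e \<in> Ar \<F> \<and> src \<F> e = s' \<and> tgt \<F> e = (z, y, \<alpha>)"
      then have e: "arr \<F> (z', y', \<alpha>') (z, y, \<alpha>) (bmap \<F> e) e" by (simp add: arr_def)
      then obtain a d where ad: "e = (s', (a, d), (z, y, \<alpha>))" "arr \<S> z' z (bmap \<F> e) a" by (auto simp: fiber_product_arr)
      have d: "arr \<X> y' y (bmap \<F> e) d \<and> cmp \<Y> \<beta> (snd F d) = \<beta>'"
        using point_morphism_imp[OF _ be be'] e ad(1) by simp
      have "d = b" by (rule ex1_unique[OF ex]) (use d b in \<open>simp_all add: arr_def\<close>)
      moreover have "a = (z', bmap \<X> d, z)" using ad(2)[unfolded space_stack_arr] arrD(4)[OF conjunct1[OF d]] by simp
      ultimately show "e = (s', ((z', bmap \<X> b, z), b), (z, y, \<alpha>))" using ad(1) by simp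
    qed
  qed
qed

text \<open>
  A base extension of \<open>F\<close> along \<open>p\<close> is a universal arrow from \<open>F\<close> to the object \<open>p (T, id)\<close>.
\<close>

lemma base_extension_iff:
  "base_extension \<X> \<Y> F T p Z q \<longleftrightarrow> cg Z \<and> continuous_map Z T q \<and>
     (\<exists>y \<beta>. universal_arrow \<X> \<Y> F (fst p \<t>) y \<beta> \<and> base \<X> y = Z \<and> bmap \<Y> \<beta> = restrict q (topspace Z))"
proof
  assume B: "base_extension \<X> \<Y> F T p Z q"
  then have Z: "cg Z" and q: "continuous_map Z T q" by (auto simp: base_extension_def)
  obtain E \<eta> where E: "fib_equivalence (space_stack Z) \<F> E"
    and n: "two_morphism (space_stack Z) \<S> (fib_comp (space_stack Z) (fiber_product_fst \<F>) E) (space_morphism Z q) \<eta>"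
    using B unfolding base_extension_def Let_def isomorphic_morphisms_def by blast
  let ?S = "space_stack Z :: ('u, _, _) fibcat" and ?d = "(Z, idmap Z)"
  have Em: "fib_morphism ?S \<F> E" using E by (simp add: fib_equivalence_def)
  have d: "?d \<in> Ob ?S" using terminal_ob[OF terminal_space_stack[OF Z]] .
  obtain z y \<alpha> where zy: "fst E ?d = (z, y, \<alpha>)" by (cases "fst E ?d")
  have trm: "terminal \<F> (z, y, \<alpha>)"
    using equivalence_imp_terminal[OF fibered_fiber_product[OF fibered_space_stack X Y p F] Z E] zy by simp
  have s: "(z, y, \<alpha>) \<in> Ob \<F>" using terminal_ob[OF trm] .
  have bz: "fst z = Z" using fm_base[OF Em d] zy by simp
  have "arr \<S> z (Z, compmap Z q (idmap Z)) (idmap Z) (\<eta> ?d)"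
    using tm_arr[OF n d] d s zy by (simp add: fib_comp_def fiber_product_fst_def space_morphism_def compmap_def Let_def)
  then have "compmap Z (compmap Z q (idmap Z)) (idmap Z) = snd z" using bz by (simp add: space_stack_arr)
  moreover have "compmap Z (compmap Z q (idmap Z)) (idmap Z) = restrict q (topspace Z)"
    by (auto simp: compmap_def compose_def idmap_def fun_eq_iff)
  ultimately have sz: "snd z = restrict q (topspace Z)" by simp
  obtain \<beta> where be: "arr \<Y> (fst F y) (fst p \<t>) (snd z) \<beta>" "cmp \<Y> \<beta> \<alpha> = \<pi> z" using point_to_arrow[OF s] by blast
  have "universal_arrow \<X> \<Y> F (fst p \<t>) y \<beta>" using terminal_point_iff[OF s be] trm by blast
  moreover have "base \<X> y = Z" using s bz by (simp add: fiber_product_Ob)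
  moreover have "bmap \<Y> \<beta> = restrict q (topspace Z)" using be(1) sz by (simp add: arr_def)
  ultimately show "cg Z \<and> continuous_map Z T q \<and>
     (\<exists>y \<beta>. universal_arrow \<X> \<Y> F (fst p \<t>) y \<beta> \<and> base \<X> y = Z \<and> bmap \<Y> \<beta> = restrict q (topspace Z))" using Z q by blast
next
  assume "cg Z \<and> continuous_map Z T q \<and>
     (\<exists>y \<beta>. universal_arrow \<X> \<Y> F (fst p \<t>) y \<beta> \<and> base \<X> y = Z \<and> bmap \<Y> \<beta> = restrict q (topspace Z))"
  then obtain y \<beta> where Z: "cg Z" and q: "continuous_map Z T q"
    and U: "universal_arrow \<X> \<Y> F (fst p \<t>) y \<beta>" and y: "base \<X> y = Z" and bb: "bmap \<Y> \<beta> = restrict q (topspace Z)" by blast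
  let ?S = "space_stack Z :: ('u, _, _) fibcat" and ?d = "(Z, idmap Z)"
  let ?z = "(Z, restrict q (topspace Z))"
  note FP = fibered_fiber_product[OF fibered_space_stack X Y p F]
  note d = terminal_space_stack[OF Z]
  have b: "arr \<Y> (fst F y) (fst p \<t>) (restrict q (topspace Z)) \<beta>" using universal_arrowD(2)[OF U] bb by simp
  obtain \<alpha> where s: "(?z, y, \<alpha>) \<in> Ob \<F>" "cmp \<Y> \<beta> \<alpha> = \<pi> ?z"
    using arrow_to_point[OF universal_arrowD(1)[OF U] b] y by auto
  have trm: "terminal \<F> (?z, y, \<alpha>)" using terminal_point_iff[OF s(1) _ s(2)] b U by simp
  obtain E where E: "fib_equivalence ?S \<F> E" "fst E ?d = (?z, y, \<alpha>)"
    using terminal_imp_equivalence[OF FP trm] by auto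
  have Em: "fib_morphism ?S \<F> E" using E(1) by (simp add: fib_equivalence_def)
  let ?L = "fib_comp ?S (fiber_product_fst \<F>) E"
  have L: "fib_morphism ?S \<S> ?L"
    by (rule fib_morphism_comp[OF sitecat_space_stack Em fiber_product_fst_morphism[OF fibered_space_stack X Y p F]])
  have "fst ?L ?d = ?z" "fst (space_morphism Z q) ?d = ?z"
    using E(2) s(1) terminal_ob[OF d]
    by (simp_all add: fib_comp_def fiber_product_fst_def space_morphism_def Let_def compose_def idmap_def restrict_def fun_eq_iff)
  then have "arr \<S> (fst ?L ?d) (fst (space_morphism Z q) ?d) (idmap (base ?S ?d)) (ident \<S> ?z)"
    using arr_ident[OF sitecat_space_stack fm_ob[OF L terminal_ob[OF d]]] by simp
  from ex1_implies_ex[OF yoneda_transformation[OF sitecat_space_stack d fibered_space_stack L space_morphism_fib[OF q] this]]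
  have "isomorphic_morphisms ?S \<S> ?L (space_morphism Z q)" unfolding isomorphic_morphisms_def by blast
  then show "base_extension \<X> \<Y> F T p Z q"
    unfolding base_extension_def Let_def using Z q E(1) by blast
qed

end

lemma object_morphism:
  assumes x: "x \<in> Ob \<Y>"
  shows "\<exists>p. fib_morphism (space_stack (base \<Y> x)) \<Y> p \<and> fst p (base \<Y> x, idmap (base \<Y> x)) = x"
  using yoneda_functor[OF sitecat_space_stack terminal_space_stack[OF cg_base[OF fibered_sitecat[OF Y] x]] Y x] by simp

lemma representable_iff:
  "representable \<X> \<Y> F \<longleftrightarrow> (\<forall>x\<in>Ob \<Y>. \<exists>y \<beta>. universal_arrow \<X> \<Y> F x y \<beta>)"
proof
  assume R: "representable \<X> \<Y> F"
  show "\<forall>x\<in>Ob \<Y>. \<exists>y \<beta>. universal_arrow \<X> \<Y> F x y \<beta>"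
  proof
    fix x assume x: "x \<in> Ob \<Y>"
    note T = cg_base[OF fibered_sitecat[OF Y] x]
    obtain p where p: "fib_morphism (space_stack (base \<Y> x)) \<Y> p" "fst p (base \<Y> x, idmap (base \<Y> x)) = x"
      using object_morphism[OF x] by blast
    obtain Z q where "base_extension \<X> \<Y> F (base \<Y> x) p Z q" using R T p(1) unfolding representable_def by blast
    then show "\<exists>y \<beta>. universal_arrow \<X> \<Y> F x y \<beta>" using base_extension_iff[OF T p(1)] p(2) by auto
  qed
next
  assume R: "\<forall>x\<in>Ob \<Y>. \<exists>y \<beta>. universal_arrow \<X> \<Y> F x y \<beta>"
  show "representable \<X> \<Y> F"
    unfolding representable_def
  proof (intro conjI allI impI F)
    fix T :: "'u topology" and p assume T: "cg T" and p: "fib_morphism (space_stack T) \<Y> p"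
    let ?x = "fst p (T, idmap T)"
    have t: "(T, idmap T) \<in> Ob (space_stack T)" using terminal_ob[OF terminal_space_stack[OF T]] .
    obtain y \<beta> where U: "universal_arrow \<X> \<Y> F ?x y \<beta>" using R fm_ob[OF p t] by blast
    note y = universal_arrowD[OF U]
    have "bmap \<Y> \<beta> \<in> cmaps (base \<X> y) T"
      using arr_bmap[OF fibered_sitecat[OF Y] y(2)] fm_base[OF F y(1)] fm_base[OF p t] by simp
    then have "base_extension \<X> \<Y> F T p (base \<X> y) (bmap \<Y> \<beta>)"
      using base_extension_iff[OF T p] cg_base[OF fibered_sitecat[OF X] y(1)] U
      by (auto simp: cmaps_def extensional_restrict)
    then show "\<exists>Z q. base_extension \<X> \<Y> F T p Z q" by blast
  qed
qed

lemma universal_arrow_base_extension: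
  assumes U: "universal_arrow \<X> \<Y> F x y \<beta>"
  shows "\<exists>p. fib_morphism (space_stack (base \<Y> x)) \<Y> p \<and> base_extension \<X> \<Y> F (base \<Y> x) p (base \<X> y) (bmap \<Y> \<beta>)"
proof -
  note y = universal_arrowD[OF U]
  have x: "x \<in> Ob \<Y>" using arr_ob(2)[OF fibered_sitecat[OF Y] y(2)] .
  obtain p where p: "fib_morphism (space_stack (base \<Y> x)) \<Y> p" "fst p (base \<Y> x, idmap (base \<Y> x)) = x"
    using object_morphism[OF x] by blast
  have "bmap \<Y> \<beta> \<in> cmaps (base \<X> y) (base \<Y> x)"
    using arr_bmap[OF fibered_sitecat[OF Y] y(2)] fm_base[OF F y(1)] by simp
  then have "base_extension \<X> \<Y> F (base \<Y> x) p (base \<X> y) (bmap \<Y> \<beta>)"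
    using base_extension_iff[OF cg_base[OF fibered_sitecat[OF Y] x] p(1)] cg_base[OF fibered_sitecat[OF X] y(1)] U p(2)
    by (auto simp: cmaps_def extensional_restrict)
  then show ?thesis using p(1) by blast
qed

text \<open>Testing objects suffices, since every object extends to a morphism from its base.\<close>

lemma universal_weak_equivalence_iff:
  "universal_weak_equivalence \<X> \<Y> F \<longleftrightarrow> representable \<X> \<Y> F \<and>
     (\<forall>x y \<beta>. universal_arrow \<X> \<Y> F x y \<beta> \<longrightarrow> weak_equivalence (base \<X> y) (base \<Y> x) (bmap \<Y> \<beta>))"
proof (intro iffI conjI allI impI)
  assume W: "universal_weak_equivalence \<X> \<Y> F"
  then show "representable \<X> \<Y> F" by (simp add: universal_weak_equivalence_def)
  fix x y \<beta> assume U: "universal_arrow \<X> \<Y> F x y \<beta>"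
  have x: "x \<in> Ob \<Y>" using arr_ob(2)[OF fibered_sitecat[OF Y] universal_arrowD(2)[OF U]] .
  then show "weak_equivalence (base \<X> y) (base \<Y> x) (bmap \<Y> \<beta>)"
    using W universal_arrow_base_extension[OF U] cg_base[OF fibered_sitecat[OF Y] x]
    unfolding universal_weak_equivalence_def by blast
next
  assume R: "representable \<X> \<Y> F \<and>
     (\<forall>x y \<beta>. universal_arrow \<X> \<Y> F x y \<beta> \<longrightarrow> weak_equivalence (base \<X> y) (base \<Y> x) (bmap \<Y> \<beta>))"
  show "universal_weak_equivalence \<X> \<Y> F"
    unfolding universal_weak_equivalence_def
  proof (intro conjI allI impI)
    fix T :: "'u topology" and p Z q
    assume T: "cg T" and p: "fib_morphism (space_stack T) \<Y> p" and B: "base_extension \<X> \<Y> F T p Z q"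
    obtain y \<beta> where U: "universal_arrow \<X> \<Y> F (fst p (T, idmap T)) y \<beta>" "base \<X> y = Z" "bmap \<Y> \<beta> = restrict q (topspace Z)"
      using B base_extension_iff[OF T p] by blast
    have "base \<Y> (fst p (T, idmap T)) = T" using fm_base[OF p terminal_ob[OF terminal_space_stack[OF T]]] by simp
    then have "weak_equivalence Z T (restrict q (topspace Z))"
      using conjunct2[OF R, rule_format, OF U(1)] U(2,3) by simp
    then show "weak_equivalence Z T q" by (rule weak_equivalence_compose[OF _ weak_equivalence_homeomorphism[of T T id id]]) (simp_all add: homeomorphic_maps_def)
  qed (use R in blast)
qed

lemma weakly_parashrinkable_sections:
  assumes W: "weakly_parashrinkable \<X> \<Y> F" and U: "universal_arrow \<X> \<Y> F x y \<beta>" and pc: "paracompact_space (base \<Y> x)"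
  shows "topspace (section_space (base \<X> y) (base \<Y> x) (bmap \<Y> \<beta>)) \<noteq> {}"
    "path_connected_space (section_space (base \<X> y) (base \<Y> x) (bmap \<Y> \<beta>))"
proof -
  have x: "x \<in> Ob \<Y>" using arr_ob(2)[OF fibered_sitecat[OF Y] universal_arrowD(2)[OF U]] .
  have "weakly_contractible (section_space (base \<X> y) (base \<Y> x) (bmap \<Y> \<beta>)) \<and>
      topspace (section_space (base \<X> y) (base \<Y> x) (bmap \<Y> \<beta>)) \<noteq> {}"
    using W universal_arrow_base_extension[OF U] cg_base[OF fibered_sitecat[OF Y] x] pc
    unfolding weakly_parashrinkable_def by blast
  then show "topspace (section_space (base \<X> y) (base \<Y> x) (bmap \<Y> \<beta>)) \<noteq> {}"
    "path_connected_space (section_space (base \<X> y) (base \<Y> x) (bmap \<Y> \<beta>))"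
    using weakly_contractible_imp_path_connected by blast+
qed

end

section \<open>Powers of a fibered category by a space\<close>

text \<open>
  \<open>\<M>\<close> is the pullback of \<open>\<X>\<close> along \<open>T \<mapsto> T \<times> Y\<close>, with forgetful functor \<open>U\<close>; the last clause asks for equality
  of objects, not isomorphism.
\<close>

definition is_power ::
  "'u topology \<Rightarrow> ('u, 'o, 'm) fibcat \<Rightarrow> ('u, 'p, 'n) fibcat \<Rightarrow> ('p, 'n, 'o, 'm) fibfun \<Rightarrow> bool" where
  "is_power Y \<X> \<M> U \<longleftrightarrow> sitecat \<M> \<and>
     (\<forall>m\<in>Ob \<M>. fst U m \<in> Ob \<X> \<and> base \<X> (fst U m) = kprod (base \<M> m) Y \<and>
        snd U (ident \<M> m) = ident \<X> (fst U m)) \<and>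
     (\<forall>m m' h a. arr \<M> m m' h a \<longrightarrow>
        arr \<X> (fst U m) (fst U m') (ktimes (base \<M> m) (base \<M> m') Y h) (snd U a)) \<and>
     (\<forall>m m' m'' h k a b. arr \<M> m m' h a \<longrightarrow> arr \<M> m' m'' k b \<longrightarrow>
        snd U (cmp \<M> b a) = cmp \<X> (snd U b) (snd U a)) \<and>
     (\<forall>m\<in>Ob \<M>. \<forall>m'\<in>Ob \<M>. \<forall>h\<in>cmaps (base \<M> m) (base \<M> m'). \<forall>g.
        arr \<X> (fst U m) (fst U m') (ktimes (base \<M> m) (base \<M> m') Y h) g \<longrightarrow>
        (\<exists>!a. arr \<M> m m' h a \<and> snd U a = g)) \<and>
     (\<forall>T x. cg T \<longrightarrow> x \<in> Ob \<X> \<longrightarrow> base \<X> x = kprod T Y \<longrightarrow>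
        (\<exists>m\<in>Ob \<M>. base \<M> m = T \<and> fst U m = x))"

context
  fixes Y :: "'u topology" and \<X> :: "('u, 'o, 'm) fibcat" and \<M> :: "('u, 'p, 'n) fibcat"
    and U :: "('p, 'n, 'o, 'm) fibfun"
  assumes P: "is_power Y \<X> \<M> U"
begin

lemma power_sitecat: "sitecat \<M>"
  using P unfolding is_power_def by (rule conjunct1)

lemma power_ob: "m \<in> Ob \<M> \<Longrightarrow> fst U m \<in> Ob \<X>" "m \<in> Ob \<M> \<Longrightarrow> base \<X> (fst U m) = kprod (base \<M> m) Y"
  "m \<in> Ob \<M> \<Longrightarrow> snd U (ident \<M> m) = ident \<X> (fst U m)"
  using P unfolding is_power_def by (simp_all only: simp_thms)

lemma power_arr: "arr \<M> m m' h a \<Longrightarrow> arr \<X> (fst U m) (fst U m') (ktimes (base \<M> m) (base \<M> m') Y h) (snd U a)"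
  by (rule P[unfolded is_power_def, THEN conjunct2, THEN conjunct2, THEN conjunct1, rule_format])

lemma power_cmp: "arr \<M> m m' h a \<Longrightarrow> arr \<M> m' m'' k b \<Longrightarrow> snd U (cmp \<M> b a) = cmp \<X> (snd U b) (snd U a)"
  by (rule P[unfolded is_power_def, THEN conjunct2, THEN conjunct2, THEN conjunct2, THEN conjunct1, rule_format])

lemma power_full:
  assumes "m \<in> Ob \<M>" "m' \<in> Ob \<M>" "h \<in> cmaps (base \<M> m) (base \<M> m')"
    "arr \<X> (fst U m) (fst U m') (ktimes (base \<M> m) (base \<M> m') Y h) g"
  shows "\<exists>!a. arr \<M> m m' h a \<and> snd U a = g"
  by (rule P[unfolded is_power_def, THEN conjunct2, THEN conjunct2, THEN conjunct2, THEN conjunct2, THEN conjunct1,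
    rule_format, OF assms])

lemma power_object:
  assumes "cg T" "x \<in> Ob \<X>" "base \<X> x = kprod T Y"
  shows "\<exists>m\<in>Ob \<M>. base \<M> m = T \<and> fst U m = x"
  by (rule P[unfolded is_power_def, THEN conjunct2, THEN conjunct2, THEN conjunct2, THEN conjunct2, THEN conjunct2,
    rule_format, OF assms])

lemma power_faithful:
  assumes "arr \<M> m m' h a" "arr \<M> m m' h a'" "snd U a = snd U a'"
  shows "a = a'"
  by (rule ex1_unique[OF power_full[OF arr_ob[OF power_sitecat assms(1)] arr_bmap[OF power_sitecat assms(1)] power_arr[OF assms(1)]]])
    (use assms in simp_all)

end

definition kgraph :: "'u topology \<Rightarrow> 'u topology \<Rightarrow> ('u \<Rightarrow> 'u) \<Rightarrow> 'u \<Rightarrow> 'u" where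
  "kgraph S Y b = (\<lambda>s\<in>topspace S. kpt S Y s (b s))"

lemma full_subfib_simps [simp]:
  "base (full_subfib \<X> Q) = base \<X>" "cmp (full_subfib \<X> Q) = cmp \<X>" "ident (full_subfib \<X> Q) = ident \<X>"
  "src (full_subfib \<X> Q) = src \<X>" "tgt (full_subfib \<X> Q) = tgt \<X>" "bmap (full_subfib \<X> Q) = bmap \<X>"
  "Ob (full_subfib \<X> Q) = Ob \<X> \<inter> Q"
  by (simp_all add: full_subfib_def)

lemma full_subfib_arr: "arr (full_subfib \<X> Q) x y h a \<longleftrightarrow> arr \<X> x y h a \<and> x \<in> Q \<and> y \<in> Q"
  by (auto simp: arr_def full_subfib_def)

lemma sitecat_full_subfib:
  assumes S: "sitecat \<X>"
  shows "sitecat (full_subfib \<X> Q)"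
proof (rule sitecatI)
  fix a assume "a \<in> Ar (full_subfib \<X> Q)"
  then have a: "a \<in> Ar \<X>" "src \<X> a \<in> Q" "tgt \<X> a \<in> Q" by (simp_all add: full_subfib_def)
  show "src (full_subfib \<X> Q) a \<in> Ob (full_subfib \<X> Q) \<and> tgt (full_subfib \<X> Q) a \<in> Ob (full_subfib \<X> Q) \<and>
      bmap (full_subfib \<X> Q) a \<in> cmaps (base (full_subfib \<X> Q) (src (full_subfib \<X> Q) a)) (base (full_subfib \<X> Q) (tgt (full_subfib \<X> Q) a))"
    using a arr_ob[OF S arrI[OF a(1)]] arr_bmap[OF S arrI[OF a(1)]] by simp
next
  fix x y h a assume "arr (full_subfib \<X> Q) x y h a"
  then have "arr \<X> x y h a" by (simp add: full_subfib_arr)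
  then show "cmp (full_subfib \<X> Q) a (ident (full_subfib \<X> Q) x) = a \<and> cmp (full_subfib \<X> Q) (ident (full_subfib \<X> Q) y) a = a"
    using cmp_ident_left[OF S] cmp_ident_right[OF S] by simp
next
  fix x y z w h k l a b c
  assume "arr (full_subfib \<X> Q) x y h a" "arr (full_subfib \<X> Q) y z k b" "arr (full_subfib \<X> Q) z w l c"
  then show "cmp (full_subfib \<X> Q) c (cmp (full_subfib \<X> Q) b a) = cmp (full_subfib \<X> Q) (cmp (full_subfib \<X> Q) c b) a"
    using cmp_assoc[OF S] by (simp add: full_subfib_arr) blast
next
  fix x y z h k a b
  assume "arr (full_subfib \<X> Q) x y h a" "arr (full_subfib \<X> Q) y z k b"
  then show "arr (full_subfib \<X> Q) x z (compmap (base (full_subfib \<X> Q) x) k h) (cmp (full_subfib \<X> Q) b a)"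
    using arr_cmp[OF S] by (simp add: full_subfib_arr) blast
qed (use arr_ident[OF S] cg_base[OF S] in \<open>simp add: full_subfib_arr\<close>)

lemma full_subfib_UNIV: "full_subfib \<X> UNIV = \<X>"
  by (simp add: full_subfib_def)

lemma full_subfib_cong:
  assumes S: "sitecat \<X>" and Q: "\<And>x. x \<in> Ob \<X> \<Longrightarrow> x \<in> Q \<longleftrightarrow> x \<in> Q'"
  shows "full_subfib \<X> Q = full_subfib \<X> Q'"
proof -
  have "{a \<in> Ar \<X>. src \<X> a \<in> Q \<and> tgt \<X> a \<in> Q} = {a \<in> Ar \<X>. src \<X> a \<in> Q' \<and> tgt \<X> a \<in> Q'}"
    using Q arr_ob[OF S arrI] by blast
  moreover have "Ob \<X> \<inter> Q = Ob \<X> \<inter> Q'" using Q by blast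
  ultimately show ?thesis by (simp add: full_subfib_def)
qed

lemma fib_morphism_restrict:
  assumes S: "sitecat \<D>" and F: "fib_morphism \<D> \<X> F"
  shows "fib_morphism (full_subfib \<D> Q) \<X> (fib_restrict (full_subfib \<D> Q) F)"
proof (rule fib_morphismI[OF sitecat_full_subfib[OF S]])
  let ?A = "full_subfib \<D> Q"
  have o: "fst (fib_restrict ?A F) x = fst F x" if "x \<in> Ob ?A" for x using that by (simp add: fib_restrict_def)
  have s: "snd (fib_restrict ?A F) a = snd F a" if "arr ?A x y h a" for x y h a
    using arrD(1)[OF that] by (simp add: fib_restrict_def)
  note SA = sitecat_full_subfib[OF S, of Q]
  {
    fix x assume x: "x \<in> Ob ?A"
    then show "fst (fib_restrict ?A F) x \<in> Ob \<X> \<and> base \<X> (fst (fib_restrict ?A F) x) = base ?A x \<and>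
        snd (fib_restrict ?A F) (ident ?A x) = ident \<X> (fst (fib_restrict ?A F) x)"
      using o[OF x] s[OF arr_ident[OF SA x]] fm_ob[OF F] fm_base[OF F] fm_ident[OF F] by simp
  next
    fix x y h a assume a: "arr ?A x y h a"
    then have "arr \<D> x y h a" by (simp add: full_subfib_arr)
    then show "arr \<X> (fst (fib_restrict ?A F) x) (fst (fib_restrict ?A F) y) h (snd (fib_restrict ?A F) a)"
      using o[OF arr_ob(1)[OF SA a]] o[OF arr_ob(2)[OF SA a]] s[OF a] fm_arr[OF F] by simp
  next
    fix x y z h k a b assume a: "arr ?A x y h a" and b: "arr ?A y z k b"
    then have "arr \<D> x y h a" "arr \<D> y z k b" by (simp_all add: full_subfib_arr)
    then show "snd (fib_restrict ?A F) (cmp ?A b a) = cmp \<X> (snd (fib_restrict ?A F) b) (snd (fib_restrict ?A F) a)"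
      using s[OF arr_cmp[OF SA a b]] s[OF a] s[OF b] fm_cmp[OF F] by simp
  }
qed (simp_all add: fib_restrict_def)

lemma two_morphism_restrict:
  assumes S: "sitecat \<D>" and t: "two_morphism \<D> \<X> F G \<eta>"
  shows "two_morphism (full_subfib \<D> Q) \<X> (fib_restrict (full_subfib \<D> Q) F) (fib_restrict (full_subfib \<D> Q) G)
    (restrict \<eta> (Ob (full_subfib \<D> Q)))"
    (is "two_morphism ?A \<X> ?F ?G ?\<eta>")
proof (rule two_morphismI)
  fix x assume "x \<in> Ob ?A"
  then show "arr \<X> (fst ?F x) (fst ?G x) (idmap (base ?A x)) (?\<eta> x)"
    using tm_arr[OF t] by (simp add: fib_restrict_def)
next
  fix x y h a assume a: "arr ?A x y h a"
  then have "arr \<D> x y h a" by (simp add: full_subfib_arr)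
  then show "cmp \<X> (?\<eta> y) (snd ?F a) = cmp \<X> (snd ?G a) (?\<eta> x)"
    using tm_natural[OF t] arr_ob[OF sitecat_full_subfib[OF S] a] arrD(1)[OF a] by (simp add: fib_restrict_def)
qed simp

context universe begin

context
  fixes Y :: "'u topology"
  assumes Y: "cg Y"
begin

lemma kgraph_cmap:
  fixes S :: "'u topology"
  assumes S: "cg S" and b: "b \<in> cmaps S Y"
  shows "kgraph S Y b \<in> cmaps S (kprod S Y)"
  unfolding kgraph_def using b
  by (intro restrict_cmaps continuous_map_kpt[OF S Y S] continuous_map_id[unfolded id_def]) (simp add: cmaps_def)

lemma ktimes_compmap:
  fixes S S' :: "'u topology"
  assumes S: "cg S" and h: "h \<in> cmaps S S'" and S': "cg S'"
  shows "ktimes S S'' Y (compmap S k h) = compmap (kprod S Y :: 'u topology) (ktimes S' S'' Y k) (ktimes S S' Y h)"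
  by (rule kprod_eqI[OF S Y])
    (use cmaps_image[OF h] in \<open>simp_all add: ktimes_extensional compmap_extensional compmap_apply ktimes_kpt[OF S Y] ktimes_kpt[OF S' Y] kpt_in[OF S Y]\<close>)

lemma ktimes_idmap:
  fixes S :: "'u topology"
  assumes S: "cg S"
  shows "ktimes S S Y (idmap S) = idmap (kprod S Y :: 'u topology)"
  by (rule kprod_eqI[OF S Y]) (simp_all add: ktimes_extensional idmap_def ktimes_kpt[OF S Y] kpt_in[OF S Y])

end

end

lemma (in universe) fibered_power:
  fixes Y :: "'u topology"
  assumes Y: "cg Y" and X: "fibered_in_groupoids \<X>" and P: "is_power Y \<X> \<M> U"
  shows "fibered_in_groupoids \<M>"
proof (rule fibered_in_groupoidsI[OF power_sitecat[OF P]])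
  note SM = power_sitecat[OF P] and SX = fibered_sitecat[OF X]
  fix m and T :: "'u topology" and f
  assume m: "m \<in> Ob \<M>" and T: "cg T" and f: "f \<in> cmaps T (base \<M> m)"
  note B = cg_base[OF SM m]
  have "ktimes T (base \<M> m) Y f \<in> cmaps (kprod T Y) (base \<X> (fst U m))"
    using ktimes_cmap[OF T B Y f] power_ob(2)[OF P m] by simp
  from fib_lift[OF X power_ob(1)[OF P m] cg_kprod[OF T Y] this]
  obtain x g where g: "arr \<X> x (fst U m) (ktimes T (base \<M> m) Y f) g" "base \<X> x = kprod T Y" by blast
  obtain m' where m': "m' \<in> Ob \<M>" "base \<M> m' = T" "fst U m' = x"
    using power_object[OF P T arr_ob(1)[OF SX g(1)] g(2)] by blast
  show "\<exists>w a. arr \<M> w m f a \<and> base \<M> w = T"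
    using ex1_implies_ex[OF power_full[OF P m'(1) m, of f g]] f g(1) m' by auto
next
  note SM = power_sitecat[OF P] and SX = fibered_sitecat[OF X]
  fix x y z h k g a b
  assume a: "arr \<M> x z h a" and b: "arr \<M> y z k b" and g: "g \<in> cmaps (base \<M> y) (base \<M> x)"
    and eq: "compmap (base \<M> y) h g = k"
  have ob: "x \<in> Ob \<M>" "y \<in> Ob \<M>" "z \<in> Ob \<M>" using arr_ob[OF SM a] arr_ob[OF SM b] by auto
  note B = cg_base[OF SM ob(1)] cg_base[OF SM ob(2)] cg_base[OF SM ob(3)]
  have "ktimes (base \<M> y) (base \<M> x) Y g \<in> cmaps (base \<X> (fst U y)) (base \<X> (fst U x))"
    using ktimes_cmap[OF B(2,1) Y g] power_ob(2)[OF P ob(1)] power_ob(2)[OF P ob(2)] by simp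
  moreover have "compmap (base \<X> (fst U y)) (ktimes (base \<M> x) (base \<M> z) Y h) (ktimes (base \<M> y) (base \<M> x) Y g) = ktimes (base \<M> y) (base \<M> z) Y k"
    using ktimes_compmap[OF Y B(2) g B(1)] eq power_ob(2)[OF P ob(2)] by metis
  ultimately have ex: "\<exists>!c. arr \<X> (fst U y) (fst U x) (ktimes (base \<M> y) (base \<M> x) Y g) c \<and> cmp \<X> (snd U a) c = snd U b"
    by (rule fib_factor[OF X power_arr[OF P a] power_arr[OF P b]])
  then obtain c' where c': "arr \<X> (fst U y) (fst U x) (ktimes (base \<M> y) (base \<M> x) Y g) c'" "cmp \<X> (snd U a) c' = snd U b" by blast
  note full = power_full[OF P ob(2,1) g c'(1)]
  obtain c where c: "arr \<M> y x g c" "snd U c = c'" using ex1_implies_ex[OF full] by blast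
  have ac: "arr \<M> y z k (cmp \<M> a c)" using arr_cmp[OF SM c(1) a] eq by simp
  show "\<exists>!c. arr \<M> y x g c \<and> cmp \<M> a c = b"
  proof (rule ex1I[of _ c])
    have "cmp \<M> a c = b"
      by (rule power_faithful[OF P ac b]) (simp add: power_cmp[OF P c(1) a] c(2) c'(2))
    then show "arr \<M> y x g c \<and> cmp \<M> a c = b" using c(1) by blast
  next
    fix d assume d: "arr \<M> y x g d \<and> cmp \<M> a d = b"
    then have "cmp \<X> (snd U a) (snd U d) = snd U b" using power_cmp[OF P conjunct1[OF d] a] by simp
    then have "snd U d = c'" using ex1_unique[OF ex, of "snd U d" c'] power_arr[OF P conjunct1[OF d]] c' by blast
    then show "d = c" using ex1_unique[OF full, of d c] d c by blast
  qed
qed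

subsection \<open>Functors into a power\<close>

definition sieve :: "'u topology \<Rightarrow> ('u, 'u) sobj set \<Rightarrow> bool" where
  "sieve T Q \<longleftrightarrow> (\<forall>(x :: ('u, 'u) sobj)\<in>Ob (space_stack T) \<inter> Q. \<forall>(S :: 'u topology) h. cg S \<longrightarrow> h \<in> cmaps S (fst x) \<longrightarrow>
     (S, compmap S (snd x) h) \<in> Q)"

definition pre_sieve :: "'u topology \<Rightarrow> 'u topology \<Rightarrow> ('u, 'u) sobj set \<Rightarrow> ('u, 'u) sobj set" where
  "pre_sieve T Y Q = {w. (fst w, compmap (fst w) (kpr1 T Y) (snd w)) \<in> Q}"

text \<open>
  \<open>down\<close>, composition with the projection, is left adjoint to \<open>up\<close>, base change along it. The unit is the
  graph \<open>sgraph\<close>.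
\<close>

definition down :: "'u topology \<Rightarrow> 'u topology \<Rightarrow> ('u, 'u) sobj \<Rightarrow> ('u, 'u) sobj" where
  "down T Y w = (fst w, compmap (fst w) (kpr1 T Y) (snd w))"

definition up :: "'u topology \<Rightarrow> 'u topology \<Rightarrow> ('u, 'u) sobj \<Rightarrow> ('u, 'u) sobj" where
  "up T Y z = (kprod (fst z) Y, ktimes (fst z) T Y (snd z))"

lemma fst_down [simp]: "fst (down T Y w) = fst w" by (simp add: down_def)

lemma fst_up [simp]: "fst (up T Y z) = kprod (fst z) Y" by (simp add: up_def)

definition sgraph :: "'u topology \<Rightarrow> 'u topology \<Rightarrow> ('u, 'u) sobj \<Rightarrow> 'u \<Rightarrow> 'u" where
  "sgraph T Y w = kgraph (fst w) Y (compmap (fst w) (kpr2 T Y) (snd w))"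

definition down_arr :: "'u topology \<Rightarrow> 'u topology \<Rightarrow> ('u, 'u) sarr \<Rightarrow> ('u, 'u) sarr" where
  "down_arr T Y e = (down T Y (fst e), fst (snd e), down T Y (snd (snd e)))"

text \<open>
  \<open>F'\<close> is the functor on spaces over \<open>T \<times> Y\<close> adjoint to \<open>F\<close>: at \<open>(c, b) : S \<rightarrow> T \<times> Y\<close> it is the pullback of \<open>U (F c)\<close>
  along the graph of \<open>b\<close>.
\<close>

definition adjunct ::
  "'u topology \<Rightarrow> 'u topology \<Rightarrow> ('u, 'u) sobj set \<Rightarrow> ('u, 'o, 'm) fibcat \<Rightarrow> ('p, 'n, 'o, 'm) fibfun \<Rightarrow>
   (('u, 'u) sobj, ('u, 'u) sarr, 'p, 'n) fibfun \<Rightarrow> (('u, 'u) sobj, ('u, 'u) sarr, 'o, 'm) fibfun \<Rightarrow>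
   (('u, 'u) sobj \<Rightarrow> 'm) \<Rightarrow> bool" where
  "adjunct T Y Q \<X> U F F' \<kappa> \<longleftrightarrow>
     fib_morphism (full_subfib (space_stack (kprod T Y)) (pre_sieve T Y Q)) \<X> F' \<and>
     (\<forall>w\<in>Ob (full_subfib (space_stack (kprod T Y)) (pre_sieve T Y Q)).
        arr \<X> (fst F' w) (fst U (fst F (down T Y w))) (sgraph T Y w) (\<kappa> w)) \<and>
     (\<forall>w w' h a. arr (full_subfib (space_stack (kprod T Y)) (pre_sieve T Y Q)) w w' h a \<longrightarrow>
        cmp \<X> (\<kappa> w') (snd F' a) = cmp \<X> (snd U (snd F (down_arr T Y a))) (\<kappa> w))"

context universe begin

context
  fixes Y T :: "'u topology" and Q :: "('u, 'u) sobj set"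
  assumes Y: "cg Y" and T: "cg T" and Q: "sieve T Q"
begin

private abbreviation "\<A> \<equiv> full_subfib (space_stack T :: ('u, _, _) fibcat) Q"
private abbreviation "\<B> \<equiv> full_subfib (space_stack (kprod T Y) :: ('u, _, _) fibcat) (pre_sieve T Y Q)"

declare full_subfib_simps(7) [simp del]

lemma sub_arr:
  "arr \<A> x y h a \<longleftrightarrow> a = (x, h, y) \<and> x \<in> Ob \<A> \<and> y \<in> Ob \<A> \<and> h \<in> cmaps (fst x) (fst y) \<and> compmap (fst x) (snd y) h = snd x"
  "arr \<B> x y h a \<longleftrightarrow> a = (x, h, y) \<and> x \<in> Ob \<B> \<and> y \<in> Ob \<B> \<and> h \<in> cmaps (fst x) (fst y) \<and> compmap (fst x) (snd y) h = snd x"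
  by (auto simp: full_subfib_arr space_stack_arr full_subfib_simps(7))

lemma sub_sitecat: "sitecat \<A>" "sitecat \<B>"
  by (rule sitecat_full_subfib[OF sitecat_space_stack])+

lemma sub_Ob: "x \<in> Ob \<A> \<longleftrightarrow> cg (fst x) \<and> snd x \<in> cmaps (fst x) T \<and> x \<in> Q"
  "w \<in> Ob \<B> \<longleftrightarrow> cg (fst w) \<and> snd w \<in> cmaps (fst w) (kprod T Y) \<and> down T Y w \<in> Q"
  by (auto simp: space_stack_Ob pre_sieve_def down_def full_subfib_simps(7))


lemma down_Ob: "w \<in> Ob \<B> \<Longrightarrow> down T Y w \<in> Ob \<A>"
  using compmap_cmaps[OF _ kpr1_cmap[OF T Y], of "snd w" "fst w"] unfolding sub_Ob by (simp add: down_def)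

lemma down_arr_arr: "arr \<B> w w' h a \<Longrightarrow> arr \<A> (down T Y w) (down T Y w') h (down_arr T Y a)"
proof -
  assume a: "arr \<B> w w' h a"
  then have w: "w \<in> Ob \<B>" "w' \<in> Ob \<B>" "a = (w, h, w')" and h: "h \<in> cmaps (fst w) (fst w')" "compmap (fst w) (snd w') h = snd w"
    unfolding sub_arr by auto
  have "compmap (fst w) (compmap (fst w') (kpr1 T Y) (snd w')) h = compmap (fst w) (kpr1 T Y) (snd w)"
    using compmap_assoc[OF h(1), of "kpr1 T Y" "snd w'"] h(2) by simp
  then show ?thesis
    using down_Ob[OF w(1)] down_Ob[OF w(2)] h(1) w(3) unfolding sub_arr by (simp add: down_arr_def) (simp add: down_def)
qed

lemma sgraph_cmap: "w \<in> Ob \<B> \<Longrightarrow> sgraph T Y w \<in> cmaps (fst w) (kprod (fst w) Y)"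
  unfolding sgraph_def using kgraph_cmap[OF Y, of "fst w"] compmap_cmaps[OF _ kpr2_cmap[OF T Y], of "snd w" "fst w"]
  unfolding sub_Ob by blast

lemma sgraph_apply: "w \<in> Ob \<B> \<Longrightarrow> s \<in> topspace (fst w) \<Longrightarrow> sgraph T Y w s = kpt (fst w) Y s (kpr2 T Y (snd w s))"
  by (simp add: sgraph_def kgraph_def compmap_apply)

lemma snd_w_in: "w \<in> Ob \<B> \<Longrightarrow> s \<in> topspace (fst w) \<Longrightarrow> snd w s \<in> topspace (kprod T Y :: 'u topology)"
  unfolding sub_Ob by (elim conjE) (rule cmaps_image)

lemma sgraph_natural:
  assumes a: "arr \<B> w w' h a"
  shows "compmap (fst w) (sgraph T Y w') h = compmap (fst w) (ktimes (fst w) (fst w') Y h) (sgraph T Y w)"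
proof (rule extensionalityI[OF compmap_extensional compmap_extensional])
  fix s assume s: "s \<in> topspace (fst w)"
  have w: "w \<in> Ob \<B>" "w' \<in> Ob \<B>" and h: "h \<in> cmaps (fst w) (fst w')" and c: "compmap (fst w) (snd w') h = snd w"
    using a unfolding sub_arr by auto
  have "snd w' (h s) = snd w s" using fun_cong[OF c, of s] s by (simp add: compmap_apply)
  then show "compmap (fst w) (sgraph T Y w') h s = compmap (fst w) (ktimes (fst w) (fst w') Y h) (sgraph T Y w) s"
    using s cmaps_image[OF h s] w kpr2_in[OF T Y snd_w_in[OF w(1) s]]
    by (simp add: compmap_apply sgraph_apply ktimes_kpt[OF _ Y] sub_Ob(2))
qed

lemma down_up: "z \<in> Ob \<A> \<Longrightarrow> down T Y (up T Y z) = (kprod (fst z) Y, compmap (kprod (fst z) Y) (snd z) (kpr1 (fst z) Y))"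
proof -
  assume z: "z \<in> Ob \<A>"
  then have S: "cg (fst z)" and zc: "snd z \<in> cmaps (fst z) T" by (simp_all add: sub_Ob)
  have "compmap (kprod (fst z) Y :: 'u topology) (kpr1 T Y) (ktimes (fst z) T Y (snd z)) = compmap (kprod (fst z) Y) (snd z) (kpr1 (fst z) Y)"
    by (rule kprod_eqI[OF S Y])
      (use cmaps_image[OF zc] in \<open>simp_all add: compmap_extensional compmap_apply kpt_in[OF S Y] ktimes_kpt[OF S Y] kpr1_kpt[OF T Y] kpr1_kpt[OF S Y]\<close>)
  then show ?thesis by (simp add: down_def up_def)
qed

lemma up_Ob:
  assumes z: "z \<in> Ob \<A>"
  shows "up T Y z \<in> Ob \<B>"
proof -
  have S: "cg (fst z)" and zc: "snd z \<in> cmaps (fst z) T" and zQ: "z \<in> Q" using z by (simp_all add: sub_Ob)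
  have "z \<in> Ob (space_stack T) \<inter> Q" using S zc zQ by (simp add: space_stack_Ob)
  then have "(kprod (fst z) Y, compmap (kprod (fst z) Y) (snd z) (kpr1 (fst z) Y)) \<in> Q"
    using Q cg_kprod[OF S Y] kpr1_cmap[OF S Y] unfolding sieve_def by blast
  then show ?thesis
    using cg_kprod[OF S Y] ktimes_cmap[OF S T Y zc] down_up[OF z] by (simp add: sub_Ob(2)) (simp add: up_def)
qed

lemma counit_arr:
  assumes z: "z \<in> Ob \<A>"
  shows "arr \<A> (down T Y (up T Y z)) z (kpr1 (fst z) Y) (down T Y (up T Y z), kpr1 (fst z) Y, z)"
  using z down_Ob[OF up_Ob[OF z]] down_up[OF z] kpr1_cmap[of "fst z" Y] Y unfolding sub_arr(1)
  by (simp add: sub_Ob(1))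

lemma up_arr:
  assumes a: "arr \<A> z z' h a"
  shows "arr \<B> (up T Y z) (up T Y z') (ktimes (fst z) (fst z') Y h) (up T Y z, ktimes (fst z) (fst z') Y h, up T Y z')"
proof -
  have z: "z \<in> Ob \<A>" "z' \<in> Ob \<A>" and h: "h \<in> cmaps (fst z) (fst z')" and c: "compmap (fst z) (snd z') h = snd z"
    using a unfolding sub_arr by auto
  have S: "cg (fst z)" "cg (fst z')" using z by (simp_all add: sub_Ob)
  have "compmap (kprod (fst z) Y :: 'u topology) (ktimes (fst z') T Y (snd z')) (ktimes (fst z) (fst z') Y h) = ktimes (fst z) T Y (snd z)"
    using ktimes_compmap[OF Y S(1) h S(2), of T "snd z'"] c by simp
  then show ?thesis unfolding sub_arr using up_Ob[OF z(1)] up_Ob[OF z(2)] ktimes_cmap[OF S Y h] by (simp add: up_def)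
qed

lemma unit_arr:
  assumes w: "w \<in> Ob \<B>"
  shows "arr \<B> w (up T Y (down T Y w)) (sgraph T Y w) (w, sgraph T Y w, up T Y (down T Y w))"
proof -
  have S: "cg (fst w)" and wc: "snd w \<in> cmaps (fst w) (kprod T Y)" using w by (simp_all add: sub_Ob)
  have "compmap (fst w) (ktimes (fst w) T Y (compmap (fst w) (kpr1 T Y) (snd w))) (sgraph T Y w) = snd w"
  proof (rule extensionalityI[OF compmap_extensional])
    show "snd w \<in> extensional (topspace (fst w))" using wc by (simp add: cmaps_def)
    fix s assume s: "s \<in> topspace (fst w)"
    show "compmap (fst w) (ktimes (fst w) T Y (compmap (fst w) (kpr1 T Y) (snd w))) (sgraph T Y w) s = snd w s"
      using s w kpr2_in[OF T Y snd_w_in[OF w s]]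
      by (simp add: compmap_apply sgraph_apply ktimes_kpt[OF S Y] kpt_kpr[OF T Y snd_w_in[OF w s]])
  qed
  then show ?thesis unfolding sub_arr using w up_Ob[OF down_Ob[OF w]] sgraph_cmap[OF w] by (simp add: up_def down_def)
qed

lemma sub_arr_eq: "arr \<A> x y h a \<Longrightarrow> arr \<A> x y h b \<Longrightarrow> a = b"
  unfolding sub_arr by blast

context
  fixes \<X> :: "('u, 'o, 'm) fibcat" and \<M> :: "('u, 'p, 'n) fibcat" and U :: "('p, 'n, 'o, 'm) fibfun"
  assumes X: "fibered_in_groupoids \<X>" and P: "is_power Y \<X> \<M> U"
begin

lemma adjunct_exists:
  assumes F: "fib_morphism \<A> \<M> F"
  shows "\<exists>F' \<kappa>. adjunct T Y Q \<X> U F F' \<kappa>"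
proof -
  have FO: "fst F (down T Y w) \<in> Ob \<M>" "base \<M> (fst F (down T Y w)) = fst w" if "w \<in> Ob \<B>" for w
    using fm_ob[OF F down_Ob[OF that]] fm_base[OF F down_Ob[OF that]] by simp_all
  have "\<exists>l \<kappa>. arr \<X> l (fst U (fst F (down T Y w))) (sgraph T Y w) \<kappa> \<and> base \<X> l = fst w" if w: "w \<in> Ob \<B>" for w
  proof (rule fib_lift[OF X power_ob(1)[OF P FO(1)[OF w]]])
    show "sgraph T Y w \<in> cmaps (fst w) (base \<X> (fst U (fst F (down T Y w))))"
      using sgraph_cmap[OF w] power_ob(2)[OF P FO(1)[OF w]] FO(2)[OF w] by simp
  qed (use w in \<open>simp add: sub_Ob\<close>)
  then obtain L \<kappa> where L: "\<And>w. w \<in> Ob \<B> \<Longrightarrow> arr \<X> (L w) (fst U (fst F (down T Y w))) (sgraph T Y w) (\<kappa> w)"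
      "\<And>w. w \<in> Ob \<B> \<Longrightarrow> base \<X> (L w) = fst w" by metis
  let ?Qa = "\<lambda>a. snd U (snd F (down_arr T Y a))"
  have "\<exists>F'. fib_morphism \<B> \<X> F' \<and> fst F' = restrict L (Ob \<B>) \<and>
      (\<forall>w w' h a. arr \<B> w w' h a \<longrightarrow> cmp \<X> (\<kappa> w') (snd F' a) = cmp \<X> (?Qa a) (\<kappa> w))"
  proof (rule pulled_functor[OF sub_sitecat(2) X, where Qo = "\<lambda>w. fst U (fst F (down T Y w))" and k = "sgraph T Y"
        and B = "\<lambda>e. ktimes (fst (fst e)) (fst (snd (snd e))) Y (fst (snd e))"])
    fix w assume w: "w \<in> Ob \<B>"
    have "down_arr T Y (ident \<B> w) = ident \<A> (down T Y w)"
      by (simp add: down_arr_def space_stack_ident)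
    then show "?Qa (ident \<B> w) = ident \<X> (fst U (fst F (down T Y w)))"
      using fm_ident[OF F down_Ob[OF w]] power_ob(3)[OF P FO(1)[OF w]] by simp
  next
    fix w w' h a assume a: "arr \<B> w w' h a"
    have w: "w \<in> Ob \<B>" "w' \<in> Ob \<B>" using arr_ob[OF sub_sitecat(2) a] by auto
    have "a = (w, h, w')" using a unfolding sub_arr by blast
    then show "arr \<X> (fst U (fst F (down T Y w))) (fst U (fst F (down T Y w')))
        (ktimes (fst (fst a)) (fst (snd (snd a))) Y (fst (snd a))) (?Qa a)"
      using power_arr[OF P fm_arr[OF F down_arr_arr[OF a]]] FO(2) w by simp
    show "compmap (base \<B> w) (sgraph T Y w') h = compmap (base \<B> w) (ktimes (fst (fst a)) (fst (snd (snd a))) Y (fst (snd a))) (sgraph T Y w)"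
      using sgraph_natural[OF a] \<open>a = (w, h, w')\<close> by simp
  next
    fix w w' w'' h k a b assume a: "arr \<B> w w' h a" and b: "arr \<B> w' w'' k b"
    have "down_arr T Y (cmp \<B> b a) = cmp \<A> (down_arr T Y b) (down_arr T Y a)"
      using a b unfolding sub_arr by (auto simp: down_arr_def space_stack_cmp)
    then show "?Qa (cmp \<B> b a) = cmp \<X> (?Qa b) (?Qa a)"
      using fm_cmp[OF F down_arr_arr[OF a] down_arr_arr[OF b]]
        power_cmp[OF P fm_arr[OF F down_arr_arr[OF a]] fm_arr[OF F down_arr_arr[OF b]]] by simp
  qed (use L in auto)
  then obtain F' where "fib_morphism \<B> \<X> F'" "fst F' = restrict L (Ob \<B>)"
    "\<And>w w' h a. arr \<B> w w' h a \<Longrightarrow> cmp \<X> (\<kappa> w') (snd F' a) = cmp \<X> (?Qa a) (\<kappa> w)" by blast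
  then have "adjunct T Y Q \<X> U F F' \<kappa>" unfolding adjunct_def using L(1) by simp
  then show ?thesis by blast
qed

lemma adjunct_fib: "adjunct T Y Q \<X> U F F' \<kappa> \<Longrightarrow> fib_morphism \<B> \<X> F'"
  by (simp add: adjunct_def)

lemma adjunct_arr: "adjunct T Y Q \<X> U F F' \<kappa> \<Longrightarrow> w \<in> Ob \<B> \<Longrightarrow>
    arr \<X> (fst F' w) (fst U (fst F (down T Y w))) (sgraph T Y w) (\<kappa> w)"
  by (simp add: adjunct_def)

lemma adjunct_natural: "adjunct T Y Q \<X> U F F' \<kappa> \<Longrightarrow> arr \<B> w w' h a \<Longrightarrow>
    cmp \<X> (\<kappa> w') (snd F' a) = cmp \<X> (snd U (snd F (down_arr T Y a))) (\<kappa> w)"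
  unfolding adjunct_def by blast

text \<open>
  The comparison of \<open>F'\<close> at \<open>z \<times> Y\<close> with \<open>U (F z)\<close>, an isomorphism.
\<close>

definition counit :: "(('u, 'u) sobj, ('u, 'u) sarr, 'p, 'n) fibfun \<Rightarrow> (('u, 'u) sobj \<Rightarrow> 'm) \<Rightarrow> ('u, 'u) sobj \<Rightarrow> 'm" where
  "counit F \<kappa> z = cmp \<X> (snd U (snd F (down T Y (up T Y z), kpr1 (fst z) Y, z))) (\<kappa> (up T Y z))"

context
  fixes F F' \<kappa>
  assumes F: "fib_morphism \<A> \<M> F" and adj: "adjunct T Y Q \<X> U F F' \<kappa>"
begin

lemma counit_iso:
  assumes z: "z \<in> Ob \<A>"
  shows "arr \<X> (fst F' (up T Y z)) (fst U (fst F z)) (idmap (kprod (fst z) Y)) (counit F \<kappa> z)"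
    "base \<X> (fst F' (up T Y z)) = kprod (fst z) Y" "base \<X> (fst U (fst F z)) = kprod (fst z) Y"
proof -
  note SX = fibered_sitecat[OF X]
  have S: "cg (fst z)" using z by (simp add: sub_Ob)
  note uO = up_Ob[OF z] and P' = cg_kprod[OF S Y]
  show b: "base \<X> (fst F' (up T Y z)) = kprod (fst z) Y" using fm_base[OF adjunct_fib[OF adj] uO] by simp
  show "base \<X> (fst U (fst F z)) = kprod (fst z) Y" using power_ob(2)[OF P fm_ob[OF F z]] fm_base[OF F z] by simp
  have "compmap (kprod (fst z) Y :: 'u topology) (ktimes (kprod (fst z) Y :: 'u topology) (fst z) Y (kpr1 (fst z) Y)) (sgraph T Y (up T Y z)) = idmap (kprod (fst z) Y)"
  proof (rule kprod_eqI[OF S Y])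
    fix s y assume s: "s \<in> topspace (fst z)" and y: "y \<in> topspace Y"
    have zs: "snd z s \<in> topspace T" using z s by (auto simp: sub_Ob cmaps_image)
    have p: "kpt (fst z) Y s y \<in> topspace (kprod (fst z) Y :: 'u topology)" using kpt_in[OF S Y s y] .
    have "snd (up T Y z) (kpt (fst z) Y s y) = kpt T Y (snd z s) y" using ktimes_kpt[OF S Y s y] by (simp add: up_def)
    then show "compmap (kprod (fst z) Y) (ktimes (kprod (fst z) Y :: 'u topology) (fst z) Y (kpr1 (fst z) Y)) (sgraph T Y (up T Y z)) (kpt (fst z) Y s y) =
        idmap (kprod (fst z) Y) (kpt (fst z) Y s y)"
      using p s y zs by (simp add: compmap_apply sgraph_apply[OF uO] kpr2_kpt[OF T Y] ktimes_kpt[OF P' Y p y] kpr1_kpt[OF S Y] idmap_def)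
  qed (simp_all add: compmap_extensional idmap_def)
  then show "arr \<X> (fst F' (up T Y z)) (fst U (fst F z)) (idmap (kprod (fst z) Y)) (counit F \<kappa> z)"
    using arr_cmp[OF SX adjunct_arr[OF adj uO] power_arr[OF P fm_arr[OF F counit_arr[OF z]]]] b
      fm_base[OF F z] fm_base[OF F down_Ob[OF uO]] by (simp add: counit_def)
qed

lemma counit_natural:
  assumes a: "arr \<A> z z' h a"
  shows "cmp \<X> (counit F \<kappa> z') (snd F' (up T Y z, ktimes (fst z) (fst z') Y h, up T Y z')) = cmp \<X> (snd U (snd F a)) (counit F \<kappa> z)"
proof -
  note SX = fibered_sitecat[OF X]
  have z: "z \<in> Ob \<A>" "z' \<in> Ob \<A>" using arr_ob[OF sub_sitecat(1) a] by auto
  have S: "cg (fst z)" "cg (fst z')" using z by (simp_all add: sub_Ob)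
  have h: "h \<in> cmaps (fst z) (fst z')" using a unfolding sub_arr by blast
  let ?e = "(up T Y z, ktimes (fst z) (fst z') Y h, up T Y z')"
  let ?c = "(down T Y (up T Y z), kpr1 (fst z) Y, z)" and ?c' = "(down T Y (up T Y z'), kpr1 (fst z') Y, z')"
  note e = up_arr[OF a]
  note c = counit_arr[OF z(1)] and c' = counit_arr[OF z(2)] and d = down_arr_arr[OF e]
  note k = adjunct_arr[OF adj up_Ob[OF z(1)]] and k' = adjunct_arr[OF adj up_Ob[OF z(2)]]
  have maps: "compmap (kprod (fst z) Y :: 'u topology) (kpr1 (fst z') Y) (ktimes (fst z) (fst z') Y h) = compmap (kprod (fst z) Y) h (kpr1 (fst z) Y)"
    by (rule kprod_eqI[OF S(1) Y])
      (use cmaps_image[OF h] in \<open>simp_all add: compmap_extensional compmap_apply kpt_in[OF S(1) Y] ktimes_kpt[OF S(1) Y] kpr1_kpt[OF S(1) Y] kpr1_kpt[OF S(2) Y]\<close>)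
  have sq: "cmp \<A> ?c' (down_arr T Y ?e) = cmp \<A> a ?c"
    by (rule sub_arr_eq[OF arr_cmp[OF sub_sitecat(1) d c']]) (use arr_cmp[OF sub_sitecat(1) c a] maps in simp)
  note Uc = power_arr[OF P fm_arr[OF F c]] and Uc' = power_arr[OF P fm_arr[OF F c']] and Ud = power_arr[OF P fm_arr[OF F d]]
    and Ua = power_arr[OF P fm_arr[OF F a]]
  have "cmp \<X> (snd U (snd F ?c')) (snd U (snd F (down_arr T Y ?e))) = cmp \<X> (snd U (snd F a)) (snd U (snd F ?c))"
    using arg_cong[OF sq, of "\<lambda>v. snd U (snd F v)"] fm_cmp[OF F d c'] power_cmp[OF P fm_arr[OF F d] fm_arr[OF F c']]
      fm_cmp[OF F c a] power_cmp[OF P fm_arr[OF F c] fm_arr[OF F a]] by simp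
  from paste_squares[OF SX fm_arr[OF adjunct_fib[OF adj] e] k' Uc' k Uc Ud Ua adjunct_natural[OF adj e] this]
  show ?thesis by (simp add: counit_def)
qed

lemma counit_unit:
  assumes w: "w \<in> Ob \<B>"
  shows "cmp \<X> (counit F \<kappa> (down T Y w)) (snd F' (w, sgraph T Y w, up T Y (down T Y w))) = \<kappa> w"
proof -
  note SX = fibered_sitecat[OF X]
  let ?z = "down T Y w"
  let ?e = "(w, sgraph T Y w, up T Y ?z)" and ?c = "(down T Y (up T Y ?z), kpr1 (fst ?z) Y, ?z)"
  note z = down_Ob[OF w]
  have S: "cg (fst w)" using w by (simp add: sub_Ob)
  note e = unit_arr[OF w] and c = counit_arr[OF z] and d = down_arr_arr[OF unit_arr[OF w]]
  note k = adjunct_arr[OF adj w] and k' = adjunct_arr[OF adj up_Ob[OF z]]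
  note Uc = power_arr[OF P fm_arr[OF F c]] and Ud = power_arr[OF P fm_arr[OF F d]]
  have maps: "compmap (fst w) (kpr1 (fst w) Y) (sgraph T Y w) = idmap (fst w)"
    by (rule extensionalityI[OF compmap_extensional])
      (use w kpr2_in[OF T Y snd_w_in[OF w]] in \<open>simp_all add: idmap_def compmap_apply sgraph_apply kpr1_kpt[OF S Y]\<close>)
  have tri: "cmp \<A> ?c (down_arr T Y ?e) = ident \<A> ?z"
    by (rule sub_arr_eq[OF arr_cmp[OF sub_sitecat(1) d c]]) (use arr_ident[OF sub_sitecat(1) z] maps in simp)
  have "cmp \<X> (snd U (snd F ?c)) (snd U (snd F (down_arr T Y ?e))) = ident \<X> (fst U (fst F ?z))"
    using arg_cong[OF tri, of "\<lambda>v. snd U (snd F v)"] fm_cmp[OF F d c] power_cmp[OF P fm_arr[OF F d] fm_arr[OF F c]]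
      fm_ident[OF F z] power_ob(3)[OF P fm_ob[OF F z]] by simp
  then show ?thesis
    using cmp_assoc[OF SX fm_arr[OF adjunct_fib[OF adj] e] k' Uc] cmp_assoc[OF SX k Ud Uc] adjunct_natural[OF adj e] cmp_ident_left[OF SX k]
    by (simp add: counit_def)
qed

end

context
  fixes F F' \<kappa> G G' \<mu>
  assumes F: "fib_morphism \<A> \<M> F" and adjF: "adjunct T Y Q \<X> U F F' \<kappa>"
    and G: "fib_morphism \<A> \<M> G" and adjG: "adjunct T Y Q \<X> U G G' \<mu>"
begin

lemma adjunct_transformation:
  assumes t: "two_morphism \<A> \<M> F G \<theta>"
  shows "\<exists>!\<omega>. two_morphism \<B> \<X> F' G' \<omega> \<and>
    (\<forall>w\<in>Ob \<B>. cmp \<X> (\<mu> w) (\<omega> w) = cmp \<X> (snd U (\<theta> (down T Y w))) (\<kappa> w))"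
proof (rule pulled_transformation[OF sub_sitecat(2) X adjunct_fib[OF adjF] adjunct_fib[OF adjG] adjunct_arr[OF adjF] adjunct_arr[OF adjG],
      where Aa = "\<lambda>a. snd U (snd F (down_arr T Y a))" and Ca = "\<lambda>a. snd U (snd G (down_arr T Y a))"
        and B = "\<lambda>e. ktimes (fst (fst e)) (fst (snd (snd e))) Y (fst (snd e))"])
  fix w w' h a assume a: "arr \<B> w w' h a"
  have w: "w \<in> Ob \<B>" "w' \<in> Ob \<B>" using arr_ob[OF sub_sitecat(2) a] by auto
  have ae: "a = (w, h, w')" using a unfolding sub_arr by blast
  note d = down_arr_arr[OF a]
  show "arr \<X> (fst U (fst F (down T Y w))) (fst U (fst F (down T Y w')))
      (ktimes (fst (fst a)) (fst (snd (snd a))) Y (fst (snd a))) (snd U (snd F (down_arr T Y a))) \<and>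
      cmp \<X> (\<kappa> w') (snd F' a) = cmp \<X> (snd U (snd F (down_arr T Y a))) (\<kappa> w)"
    using power_arr[OF P fm_arr[OF F d]] adjunct_natural[OF adjF a] fm_base[OF F down_Ob[OF w(1)]] fm_base[OF F down_Ob[OF w(2)]] ae by simp
  show "arr \<X> (fst U (fst G (down T Y w))) (fst U (fst G (down T Y w')))
      (ktimes (fst (fst a)) (fst (snd (snd a))) Y (fst (snd a))) (snd U (snd G (down_arr T Y a))) \<and>
      cmp \<X> (\<mu> w') (snd G' a) = cmp \<X> (snd U (snd G (down_arr T Y a))) (\<mu> w)"
    using power_arr[OF P fm_arr[OF G d]] adjunct_natural[OF adjG a] fm_base[OF G down_Ob[OF w(1)]] fm_base[OF G down_Ob[OF w(2)]] ae by simp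
  show "cmp \<X> (snd U (\<theta> (down T Y w'))) (snd U (snd F (down_arr T Y a))) = cmp \<X> (snd U (snd G (down_arr T Y a))) (snd U (\<theta> (down T Y w)))"
    using tm_natural[OF t d] power_cmp[OF P fm_arr[OF F d] tm_arr[OF t down_Ob[OF w(2)]]]
      power_cmp[OF P tm_arr[OF t down_Ob[OF w(1)]] fm_arr[OF G d]] by simp
next
  fix w assume w: "w \<in> Ob \<B>"
  have S: "cg (fst w)" using w by (simp add: sub_Ob)
  note z = down_Ob[OF w]
  show "arr \<X> (fst U (fst F (down T Y w))) (fst U (fst G (down T Y w))) (idmap (base \<X> (fst U (fst F (down T Y w))))) (snd U (\<theta> (down T Y w)))"
    using power_arr[OF P tm_arr[OF t z]] power_ob(2)[OF P fm_ob[OF F z]] fm_base[OF F z] fm_base[OF G z] ktimes_idmap[OF Y S] by simp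
qed

text \<open>
  The counit forces the component at \<open>z\<close> from that of \<open>\<omega>\<close> at \<open>z \<times> Y\<close>, as \<open>U\<close> is full and faithful.
\<close>

lemma transformation_of_adjunct:
  assumes o: "two_morphism \<B> \<X> F' G' \<omega>"
  shows "\<exists>!\<theta>. two_morphism \<A> \<M> F G \<theta> \<and>
    (\<forall>w\<in>Ob \<B>. cmp \<X> (\<mu> w) (\<omega> w) = cmp \<X> (snd U (\<theta> (down T Y w))) (\<kappa> w))"
proof -
  note SX = fibered_sitecat[OF X] and SM = power_sitecat[OF P]
  note F'm = adjunct_fib[OF adjF] and G'm = adjunct_fib[OF adjG]
  note eF = counit_iso[OF F adjF] and eG = counit_iso[OF G adjG]
  have ex: "\<exists>!a. arr \<M> (fst F z) (fst G z) (idmap (fst z)) a \<and>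
      cmp \<X> (snd U a) (counit F \<kappa> z) = cmp \<X> (counit G \<mu> z) (\<omega> (up T Y z))" if z: "z \<in> Ob \<A>" for z
  proof -
    have S: "cg (fst z)" using z by (simp add: sub_Ob)
    let ?P = "kprod (fst z) Y :: 'u topology"
    note ow = tm_arr[OF o up_Ob[OF z]]
    have b: "base \<M> (fst F z) = fst z" "base \<M> (fst G z) = fst z" using fm_base[OF F z] fm_base[OF G z] by simp_all
    have ow': "arr \<X> (fst F' (up T Y z)) (fst U (fst G z)) (idmap ?P) (cmp \<X> (counit G \<mu> z) (\<omega> (up T Y z)))"
      using arr_cmp[OF SX ow eG(1)[OF z]] eF(2)[OF z] by (simp add: compmap_idmap_left[OF idmap_cmaps])
    have "arr \<X> (fst F' (up T Y z)) (fst U (fst F z)) (idmap (base \<X> (fst F' (up T Y z)))) (counit F \<kappa> z)"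
      using eF(1,2)[OF z] by simp
    from fib_inverse[OF X this] eF(2,3)[OF z]
    obtain i where i: "arr \<X> (fst U (fst F z)) (fst F' (up T Y z)) (idmap ?P) i"
        "cmp \<X> i (counit F \<kappa> z) = ident \<X> (fst F' (up T Y z))" by auto
    let ?g = "cmp \<X> (cmp \<X> (counit G \<mu> z) (\<omega> (up T Y z))) i"
    have g: "arr \<X> (fst U (fst F z)) (fst U (fst G z)) (idmap ?P) ?g"
      using arr_cmp[OF SX i(1) ow'] eF(3)[OF z] by (simp add: compmap_idmap_left[OF idmap_cmaps])
    have gU: "cmp \<X> ?g (counit F \<kappa> z) = cmp \<X> (counit G \<mu> z) (\<omega> (up T Y z))"
      using cmp_assoc[OF SX eF(1)[OF z] i(1) ow'] i(2) cmp_ident_right[OF SX ow'] by simp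
    have kt: "ktimes (base \<M> (fst F z)) (base \<M> (fst G z)) Y (idmap (fst z)) = idmap ?P"
      using b ktimes_idmap[OF Y S] by simp
    have "\<exists>!a. arr \<M> (fst F z) (fst G z) (idmap (fst z)) a \<and> snd U a = ?g"
      by (rule power_full[OF P fm_ob[OF F z] fm_ob[OF G z]]) (use g kt b idmap_cmaps in simp_all)
    moreover have "snd U a = ?g \<longleftrightarrow> cmp \<X> (snd U a) (counit F \<kappa> z) = cmp \<X> (counit G \<mu> z) (\<omega> (up T Y z))"
      if a: "arr \<M> (fst F z) (fst G z) (idmap (fst z)) a" for a
    proof
      assume "cmp \<X> (snd U a) (counit F \<kappa> z) = cmp \<X> (counit G \<mu> z) (\<omega> (up T Y z))"
      then have "cmp \<X> (snd U a) (counit F \<kappa> z) = cmp \<X> ?g (counit F \<kappa> z)" using gU by simp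
      with fib_cancel_right[OF X _ _ power_arr[OF P a] g, of "fst F' (up T Y z)" "counit F \<kappa> z"] eF[OF z]
      show "snd U a = ?g" by simp
    qed (use gU in simp)
    ultimately show ?thesis by (metis (no_types, lifting))
  qed
  define \<theta> where "\<theta> = (\<lambda>z\<in>Ob \<A>. THE a. arr \<M> (fst F z) (fst G z) (idmap (fst z)) a \<and>
      cmp \<X> (snd U a) (counit F \<kappa> z) = cmp \<X> (counit G \<mu> z) (\<omega> (up T Y z)))"
  have th: "arr \<M> (fst F z) (fst G z) (idmap (fst z)) (\<theta> z) \<and>
      cmp \<X> (snd U (\<theta> z)) (counit F \<kappa> z) = cmp \<X> (counit G \<mu> z) (\<omega> (up T Y z))" if z: "z \<in> Ob \<A>" for z
    using theI'[OF ex[OF z]] z by (simp add: \<theta>_def)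
  note th1 = conjunct1[OF th] and th2 = conjunct2[OF th]
  have "two_morphism \<A> \<M> F G \<theta>"
  proof (rule two_morphismI)
    fix z z' h a assume a: "arr \<A> z z' h a"
    have z: "z \<in> Ob \<A>" "z' \<in> Ob \<A>" using arr_ob[OF sub_sitecat(1) a] by auto
    let ?e = "(up T Y z, ktimes (fst z) (fst z') Y h, up T Y z')"
    note e = up_arr[OF a]
    note UF = power_arr[OF P fm_arr[OF F a]] and UG = power_arr[OF P fm_arr[OF G a]]
    note Ut = power_arr[OF P th1[OF z(1)]] and Ut' = power_arr[OF P th1[OF z(2)]]
    note F'e = fm_arr[OF F'm e] and G'e = fm_arr[OF G'm e]
    note ow = tm_arr[OF o up_Ob[OF z(1)]] and ow' = tm_arr[OF o up_Ob[OF z(2)]]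
    have h: "h \<in> cmaps (fst z) (fst z')" using a unfolding sub_arr by blast
    have "cmp \<X> (cmp \<X> (snd U (\<theta> z')) (snd U (snd F a))) (counit F \<kappa> z) = cmp \<X> (cmp \<X> (counit G \<mu> z') (\<omega> (up T Y z'))) (snd F' ?e)"
      using cmp_assoc[OF SX eF(1)[OF z(1)] UF Ut'] cmp_assoc[OF SX F'e eF(1)[OF z(2)] Ut'] th2[OF z(2)] counit_natural[OF F adjF a] by simp
    also have "\<dots> = cmp \<X> (snd U (snd G a)) (cmp \<X> (counit G \<mu> z) (\<omega> (up T Y z)))"
      by (rule paste_squares[OF SX F'e ow' eG(1)[OF z(2)] ow eG(1)[OF z(1)] G'e UG tm_natural[OF o e] counit_natural[OF G adjG a]])
    finally have eq: "cmp \<X> (cmp \<X> (snd U (\<theta> z')) (snd U (snd F a))) (counit F \<kappa> z) = cmp \<X> (cmp \<X> (snd U (snd G a)) (snd U (\<theta> z))) (counit F \<kappa> z)"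
      using cmp_assoc[OF SX eF(1)[OF z(1)] Ut UG] th2[OF z(1)] by simp
    have "cmp \<X> (snd U (\<theta> z')) (snd U (snd F a)) = cmp \<X> (snd U (snd G a)) (snd U (\<theta> z))"
      by (rule fib_cancel_right[OF X, of "fst F' (up T Y z)", OF _ _ arr_cmp[OF SX UF Ut'] arr_cmp[OF SX Ut UG] eq])
        (use eF[OF z(1)] in simp_all)
    then have "snd U (cmp \<M> (\<theta> z') (snd F a)) = snd U (cmp \<M> (snd G a) (\<theta> z))"
      by (simp only: power_cmp[OF P fm_arr[OF F a] th1[OF z(2)]] power_cmp[OF P th1[OF z(1)] fm_arr[OF G a]])
    moreover have "arr \<M> (fst F z) (fst G z') h (cmp \<M> (\<theta> z') (snd F a))"
      using arr_cmp[OF SM fm_arr[OF F a] th1[OF z(2)]] compmap_idmap_left[OF h] fm_base[OF F z(1)] by simp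
    moreover have "arr \<M> (fst F z) (fst G z') h (cmp \<M> (snd G a) (\<theta> z))"
      using arr_cmp[OF SM th1[OF z(1)] fm_arr[OF G a]] compmap_idmap_right[OF h] fm_base[OF F z(1)] by simp
    ultimately show "cmp \<M> (\<theta> z') (snd F a) = cmp \<M> (snd G a) (\<theta> z)" using power_faithful[OF P] by blast
  qed (use th1 in \<open>auto simp: \<theta>_def\<close>)
  moreover have "cmp \<X> (\<mu> w) (\<omega> w) = cmp \<X> (snd U (\<theta> (down T Y w))) (\<kappa> w)" if w: "w \<in> Ob \<B>" for w
  proof -
    let ?z = "down T Y w"
    let ?e = "(w, sgraph T Y w, up T Y ?z)"
    note z = down_Ob[OF w] and e = unit_arr[OF w]
    note ow = tm_arr[OF o w] and ow' = tm_arr[OF o up_Ob[OF z]]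
    note F'e = fm_arr[OF F'm e] and G'e = fm_arr[OF G'm e] and Ut = power_arr[OF P th1[OF z]]
    have "cmp \<X> (snd U (\<theta> ?z)) (\<kappa> w) = cmp \<X> (cmp \<X> (counit G \<mu> ?z) (\<omega> (up T Y ?z))) (snd F' ?e)"
      using cmp_assoc[OF SX F'e eF(1)[OF z] Ut] counit_unit[OF F adjF w] th2[OF z] by simp
    also have "\<dots> = cmp \<X> (\<mu> w) (\<omega> w)"
      using cmp_assoc[OF SX F'e ow' eG(1)[OF z]] cmp_assoc[OF SX ow G'e eG(1)[OF z]] tm_natural[OF o e] counit_unit[OF G adjG w] by simp
    finally show ?thesis by (rule sym)
  qed
  moreover have "\<theta>' = \<theta>" if t': "two_morphism \<A> \<M> F G \<theta>' \<and>
    (\<forall>w\<in>Ob \<B>. cmp \<X> (\<mu> w) (\<omega> w) = cmp \<X> (snd U (\<theta>' (down T Y w))) (\<kappa> w))" for \<theta>'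
  proof (rule extensionalityI[of _ "Ob \<A>"])
    note t1 = conjunct1[OF t']
    show "\<theta>' \<in> extensional (Ob \<A>)" using tm_extensional[OF t1] .
    show "\<theta> \<in> extensional (Ob \<A>)" by (simp add: \<theta>_def)
    fix z assume z: "z \<in> Ob \<A>"
    note u = up_Ob[OF z]
    let ?c = "(down T Y (up T Y z), kpr1 (fst z) Y, z)"
    note c = counit_arr[OF z] and dO = down_Ob[OF up_Ob[OF z]]
    note tz = tm_arr[OF t1 z] and td = tm_arr[OF t1 dO]
    note kF = adjunct_arr[OF adjF u] and kG = adjunct_arr[OF adjG u] and ow = tm_arr[OF o u]
    note UFc = power_arr[OF P fm_arr[OF F c]] and UGc = power_arr[OF P fm_arr[OF G c]]
      and Utz = power_arr[OF P tz] and Utd = power_arr[OF P td]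
    have "cmp \<X> (snd U (\<theta>' z)) (snd U (snd F ?c)) = cmp \<X> (snd U (snd G ?c)) (snd U (\<theta>' (down T Y (up T Y z))))"
      using tm_natural[OF t1 c] power_cmp[OF P fm_arr[OF F c] tz] power_cmp[OF P td fm_arr[OF G c]] by simp
    then have "cmp \<X> (snd U (\<theta>' z)) (counit F \<kappa> z) = cmp \<X> (counit G \<mu> z) (\<omega> (up T Y z))"
      using cmp_assoc[OF SX kF UFc Utz] cmp_assoc[OF SX kF Utd UGc] cmp_assoc[OF SX ow kG UGc] bspec[OF conjunct2[OF t'] u]
      by (simp add: counit_def)
    then show "\<theta>' z = \<theta> z" using ex1_unique[OF ex[OF z], of "\<theta>' z" "\<theta> z"] tz th[OF z] by simp
  qed
  ultimately show ?thesis by (intro ex1I[of _ \<theta>]) simp_all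
qed

end

end

end

end

context universe begin

lemma sieve_UNIV: "sieve T UNIV"
  by (simp add: sieve_def)

lemma pre_sieve_UNIV: "pre_sieve T Y UNIV = UNIV"
  by (simp add: pre_sieve_def)

definition cover_pre :: "'u topology \<Rightarrow> 'u topology \<Rightarrow> 'u set set \<Rightarrow> 'u set set" where
  "cover_pre T Y \<U> = (\<lambda>V. {p \<in> topspace (kprod T Y). kpr1 T Y p \<in> V}) ` \<U>"

lemma open_cover_pre:
  assumes T: "cg T" and Y: "cg Y" and U: "open_cover T \<U>"
  shows "open_cover (kprod T Y) (cover_pre T Y \<U>)"
  unfolding open_cover_def
proof
  have "continuous_map (kprod T Y :: 'u topology) T (kpr1 T Y)" using kpr1_cmap[OF T Y] by (simp add: cmaps_def)
  then show "\<forall>V\<in>cover_pre T Y \<U>. openin (kprod T Y) V"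
    using U by (auto simp: cover_pre_def open_cover_def intro: openin_continuous_map_preimage)
  have "\<Union>\<U> = topspace T" using U by (simp add: open_cover_def)
  then show "\<Union>(cover_pre T Y \<U>) = topspace (kprod T Y)"
    using kpr1_in[OF T Y] by (auto simp: cover_pre_def)
qed

definition cover_set :: "'u set set \<Rightarrow> ('u, 'u) sobj set" where
  "cover_set \<U> = {(S, f). \<exists>U\<in>\<U>. f ` topspace S \<subseteq> U}"

lemma cover_sieve_alt: "cover_sieve T \<U> = full_subfib (space_stack T) (cover_set \<U>)"
  by (simp add: cover_sieve_def cover_set_def)

lemma sieve_cover_set: "sieve T (cover_set \<U>)"
  unfolding sieve_def
proof (intro ballI allI impI)
  fix x :: "('u, 'u) sobj" and S :: "'u topology" and h
  assume x: "x \<in> Ob (space_stack T) \<inter> cover_set \<U>" and h: "h \<in> cmaps S (fst x)"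
  then obtain U where U: "U \<in> \<U>" "snd x ` topspace (fst x) \<subseteq> U" by (auto simp: cover_set_def)
  have "compmap S (snd x) h ` topspace S \<subseteq> U" using U(2) cmaps_image[OF h] by (auto simp: compmap_apply)
  then show "(S, compmap S (snd x) h) \<in> cover_set \<U>" using U(1) by (auto simp: cover_set_def)
qed

lemma cover_sieve_pre:
  assumes T: "cg T" and Y: "cg Y"
  shows "cover_sieve (kprod T Y) (cover_pre T Y \<U>) = full_subfib (space_stack (kprod T Y)) (pre_sieve T Y (cover_set \<U>))"
  unfolding cover_sieve_alt
proof (rule full_subfib_cong[OF sitecat_space_stack])
  fix w :: "('u, 'u) sobj" assume w: "w \<in> Ob (space_stack (kprod T Y) :: ('u, _, _) fibcat)"
  have "snd w s \<in> topspace (kprod T Y :: 'u topology)" if "s \<in> topspace (fst w)" for s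
    using w that cmaps_image unfolding space_stack_Ob by metis
  then have "snd w ` topspace (fst w) \<subseteq> {p \<in> topspace (kprod T Y). kpr1 T Y p \<in> V} \<longleftrightarrow>
      compmap (fst w) (kpr1 T Y) (snd w) ` topspace (fst w) \<subseteq> V" for V
    by (auto simp: compmap_apply image_subset_iff)
  then show "w \<in> cover_set (cover_pre T Y \<U>) \<longleftrightarrow> w \<in> pre_sieve T Y (cover_set \<U>)"
    by (cases w) (auto simp: cover_set_def pre_sieve_def cover_pre_def)
qed

context
  fixes Y T :: "'u topology" and \<X> :: "('u, 'o, 'm) fibcat" and \<M> :: "('u, 'p, 'n) fibcat" and U :: "('p, 'n, 'o, 'm) fibfun"
  assumes Y: "cg Y" and T: "cg T"
    and X: "fibered_in_groupoids \<X>" and P: "is_power Y \<X> \<M> U"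
begin

private abbreviation "\<S> \<equiv> space_stack T :: ('u, _, _) fibcat"
private abbreviation "\<R> \<equiv> space_stack (kprod T Y :: 'u topology) :: ('u, _, _) fibcat"

lemma adjunct_restrict:
  assumes Q: "sieve T Q" and F: "fib_morphism \<S> \<M> F" and adj: "adjunct T Y UNIV \<X> U F F' \<kappa>"
  shows "adjunct T Y Q \<X> U (fib_restrict (full_subfib \<S> Q) F) (fib_restrict (full_subfib \<R> (pre_sieve T Y Q)) F') \<kappa>"
proof -
  let ?A = "full_subfib \<S> Q" and ?B = "full_subfib \<R> (pre_sieve T Y Q)"
  have F': "fib_morphism \<R> \<X> F'" using adjunct_fib[OF Y T sieve_UNIV X P adj] by (simp add: pre_sieve_UNIV full_subfib_UNIV)
  have s: "snd (fib_restrict ?A F) (down_arr T Y a) = snd F (down_arr T Y a)" "snd (fib_restrict ?B F') a = snd F' a"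
    if "arr ?B w w' h a" for w w' h a
    using arrD(1)[OF that] arrD(1)[OF down_arr_arr[OF Y T Q that]] by (simp_all add: fib_restrict_def)
  have o: "fst (fib_restrict ?A F) (down T Y w) = fst F (down T Y w)" "fst (fib_restrict ?B F') w = fst F' w" if "w \<in> Ob ?B" for w
    using that down_Ob[OF Y T Q that] by (simp_all add: fib_restrict_def)
  have B: "w \<in> Ob \<R>" if "w \<in> Ob ?B" for w using that by (simp add: full_subfib_simps(7))
  have Ba: "arr \<R> w w' h a" if "arr ?B w w' h a" for w w' h a using that by (simp add: full_subfib_arr)
  show ?thesis
    unfolding adjunct_def
  proof (intro conjI ballI allI impI)
    show "fib_morphism ?B \<X> (fib_restrict ?B F')" by (rule fib_morphism_restrict[OF sitecat_space_stack F'])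
    fix w assume w: "w \<in> Ob ?B"
    show "arr \<X> (fst (fib_restrict ?B F') w) (fst U (fst (fib_restrict ?A F) (down T Y w))) (sgraph T Y w) (\<kappa> w)"
      using adjunct_arr[OF Y T sieve_UNIV X P adj, unfolded pre_sieve_UNIV full_subfib_UNIV, OF B[OF w]] o[OF w] by simp
  next
    fix w w' h a assume a: "arr ?B w w' h a"
    show "cmp \<X> (\<kappa> w') (snd (fib_restrict ?B F') a) = cmp \<X> (snd U (snd (fib_restrict ?A F) (down_arr T Y a))) (\<kappa> w)"
      using adjunct_natural[OF Y T sieve_UNIV X P adj, unfolded pre_sieve_UNIV full_subfib_UNIV, OF Ba[OF a]] s[OF a] by simp
  qed
qed

text \<open>The functor into the power whose adjoint is a given functor.\<close>

lemma coadjunct_exists: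
  assumes K: "fib_morphism \<R> \<X> K"
  shows "\<exists>F \<kappa>. fib_morphism \<S> \<M> F \<and> adjunct T Y UNIV \<X> U F K \<kappa>"
proof -
  note SM = power_sitecat[OF P]
  note Q = sieve_UNIV[of T]
  note uO = up_Ob[OF Y T Q, unfolded pre_sieve_UNIV full_subfib_UNIV]
    and uA = up_arr[OF Y T Q, unfolded pre_sieve_UNIV full_subfib_UNIV]
    and dO = down_Ob[OF Y T Q, unfolded pre_sieve_UNIV full_subfib_UNIV]
    and dA = down_arr_arr[OF Y T Q, unfolded pre_sieve_UNIV full_subfib_UNIV]
    and unit = unit_arr[OF Y T Q, unfolded pre_sieve_UNIV full_subfib_UNIV]
    and nat = sgraph_natural[OF Y T Q, unfolded pre_sieve_UNIV full_subfib_UNIV]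
  have S: "cg (fst z)" if "z \<in> Ob \<S>" for z using that by (simp add: space_stack_Ob)
  have "\<exists>m\<in>Ob \<M>. base \<M> m = fst z \<and> fst U m = fst K (up T Y z)" if z: "z \<in> Ob \<S>" for z
    by (rule power_object[OF P S[OF z] fm_ob[OF K uO[OF z]]]) (simp add: fm_base[OF K uO[OF z]])
  then obtain m where m: "\<And>z. z \<in> Ob \<S> \<Longrightarrow> m z \<in> Ob \<M>" "\<And>z. z \<in> Ob \<S> \<Longrightarrow> base \<M> (m z) = fst z"
      "\<And>z. z \<in> Ob \<S> \<Longrightarrow> fst U (m z) = fst K (up T Y z)" by metis
  let ?u = "\<lambda>a :: ('u, 'u) sarr. (up T Y (fst a), ktimes (fst (fst a)) (fst (snd (snd a))) Y (fst (snd a)), up T Y (snd (snd a)))"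
  have ex: "\<exists>!b. arr \<M> (m z) (m z') h b \<and> snd U b = snd K (?u a)" if a: "arr \<S> z z' h a" for z z' h a
  proof -
    have z: "z \<in> Ob \<S>" "z' \<in> Ob \<S>" "h \<in> cmaps (fst z) (fst z')" "a = (z, h, z')" using a by (auto simp: space_stack_arr)
    show ?thesis
      by (rule power_full[OF P m(1)[OF z(1)] m(1)[OF z(2)]])
        (use fm_arr[OF K uA[OF a]] m(2,3)[OF z(1)] m(2,3)[OF z(2)] z(3,4) in simp_all)
  qed
  define Fa where "Fa = (\<lambda>a\<in>Ar \<S>. THE b. arr \<M> (m (src \<S> a)) (m (tgt \<S> a)) (bmap \<S> a) b \<and> snd U b = snd K (?u a))"
  have Fa: "arr \<M> (m z) (m z') h (Fa a)" "snd U (Fa a) = snd K (?u a)" if a: "arr \<S> z z' h a" for z z' h a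
    using theI'[OF ex[OF a]] arrD[OF a] by (simp_all add: Fa_def)
  let ?F = "(restrict m (Ob \<S>), Fa)"
  have F: "fib_morphism \<S> \<M> ?F"
  proof (rule fib_morphismI[OF sitecat_space_stack])
    fix z assume z: "z \<in> Ob \<S>"
    note i = arr_ident[OF sitecat_space_stack z]
    have "?u (ident \<S> z) = ident \<R> (up T Y z)"
      using ktimes_idmap[OF Y S[OF z]] by (simp add: space_stack_ident up_def)
    then have "snd U (Fa (ident \<S> z)) = snd U (ident \<M> (m z))"
      using Fa(2)[OF i] fm_ident[OF K uO[OF z]] power_ob(3)[OF P m(1)[OF z]] m(3)[OF z] by simp
    moreover have "arr \<M> (m z) (m z) (idmap (base \<S> z)) (ident \<M> (m z))" using arr_ident[OF SM m(1)[OF z]] m(2)[OF z] by simp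
    ultimately have "Fa (ident \<S> z) = ident \<M> (m z)" using power_faithful[OF P Fa(1)[OF i]] by blast
    then show "fst ?F z \<in> Ob \<M> \<and> base \<M> (fst ?F z) = base \<S> z \<and> snd ?F (ident \<S> z) = ident \<M> (fst ?F z)"
      using z m by simp
  next
    fix z z' h a assume a: "arr \<S> z z' h a"
    then show "arr \<M> (fst ?F z) (fst ?F z') h (snd ?F a)" using Fa(1)[OF a] arr_ob[OF sitecat_space_stack a] by simp
  next
    fix z z' z'' h k a b assume a: "arr \<S> z z' h a" and b: "arr \<S> z' z'' k b"
    have z: "z \<in> Ob \<S>" "z' \<in> Ob \<S>" "z'' \<in> Ob \<S>" "a = (z, h, z')" "b = (z', k, z'')" and h: "h \<in> cmaps (fst z) (fst z')"
      using a b by (auto simp: space_stack_arr)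
    note ab = arr_cmp[OF sitecat_space_stack a b]
    have "?u (cmp \<S> b a) = cmp \<R> (?u b) (?u a)"
      using ktimes_compmap[OF Y S[OF z(1)] h S[OF z(2)], of "fst z''" k] z(4,5) by (simp add: space_stack_cmp)
    then have "snd K (?u (cmp \<S> b a)) = cmp \<X> (snd K (?u b)) (snd K (?u a))"
      using fm_cmp[OF K uA[OF a] uA[OF b]] z(4,5) by simp
    then have e: "snd U (Fa (cmp \<S> b a)) = snd U (cmp \<M> (Fa b) (Fa a))"
      using Fa(2)[OF ab] Fa(2)[OF a] Fa(2)[OF b] power_cmp[OF P Fa(1)[OF a] Fa(1)[OF b]] by simp
    have "arr \<M> (m z) (m z'') (compmap (base \<S> z) k h) (cmp \<M> (Fa b) (Fa a))"
      using arr_cmp[OF SM Fa(1)[OF a] Fa(1)[OF b]] m(2)[OF z(1)] by simp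
    from power_faithful[OF P Fa(1)[OF ab] this e]
    show "snd ?F (cmp \<S> b a) = cmp \<M> (snd ?F b) (snd ?F a)" by simp
  qed (simp_all add: Fa_def)
  let ?\<kappa> = "\<lambda>w. snd K (w, sgraph T Y w, up T Y (down T Y w))"
  have "adjunct T Y UNIV \<X> U ?F K ?\<kappa>"
    unfolding adjunct_def pre_sieve_UNIV full_subfib_UNIV
  proof (intro conjI ballI allI impI K)
    fix w assume w: "w \<in> Ob \<R>"
    show "arr \<X> (fst K w) (fst U (fst ?F (down T Y w))) (sgraph T Y w) (?\<kappa> w)"
      using fm_arr[OF K unit[OF w]] m(3)[OF dO[OF w]] dO[OF w] by simp
  next
    fix w w' h a assume a: "arr \<R> w w' h a"
    have w: "w \<in> Ob \<R>" "w' \<in> Ob \<R>" "a = (w, h, w')" using a by (auto simp: space_stack_arr)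
    note d = dA[OF a]
    define v :: "('u, 'u) sarr" where "v = (up T Y (down T Y w), ktimes (fst (down T Y w)) (fst (down T Y w')) Y h, up T Y (down T Y w'))"
    have de: "?u (down_arr T Y a) = v" using w(3) by (simp add: down_arr_def v_def)
    have "cmp \<R> (w', sgraph T Y w', up T Y (down T Y w')) a = cmp \<R> v (w, sgraph T Y w, up T Y (down T Y w))"
      unfolding v_def w(3) space_stack_cmp using nat[OF a] by simp
    then have "cmp \<X> (?\<kappa> w') (snd K a) = cmp \<X> (snd K v) (?\<kappa> w)"
      using fm_cmp[OF K a unit[OF w(2)]] fm_cmp[OF K unit[OF w(1)] uA[OF d, folded v_def]] by simp
    then have "cmp \<X> (?\<kappa> w') (snd K a) = cmp \<X> (snd K (?u (down_arr T Y a))) (?\<kappa> w)" by (simp only: de)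
    then show "cmp \<X> (?\<kappa> w') (snd K a) = cmp \<X> (snd U (snd ?F (down_arr T Y a))) (?\<kappa> w)"
      using Fa(2)[OF d] by simp
  qed
  then show ?thesis using F by blast
qed

end

text \<open>
  Descent for the power along a cover of \<open>T\<close> is descent for \<open>\<X>\<close> along the induced cover of \<open>T \<times> Y\<close>.
\<close>

theorem stack_power:
  fixes Y :: "'u topology"
  assumes Y: "cg Y" and St: "is_stack \<X>" and P: "is_power Y \<X> \<M> U"
  shows "is_stack \<M>"
proof -
  have X: "fibered_in_groupoids \<X>" using St by (simp add: is_stack_def)
  note M = fibered_power[OF Y X P]
  have main: "(\<forall>F G \<eta>. fib_morphism (space_stack T) \<M> F \<longrightarrow> fib_morphism (space_stack T) \<M> G \<longrightarrow>
              two_morphism (cover_sieve T \<U>) \<M> (fib_restrict (cover_sieve T \<U>) F) (fib_restrict (cover_sieve T \<U>) G) \<eta> \<longrightarrow>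
              (\<exists>!\<theta>. two_morphism (space_stack T) \<M> F G \<theta> \<and> restrict \<theta> (Ob (cover_sieve T \<U>)) = \<eta>)) \<and>
           (\<forall>H. fib_morphism (cover_sieve T \<U>) \<M> H \<longrightarrow>
              (\<exists>F. fib_morphism (space_stack T) \<M> F \<and>
                 isomorphic_morphisms (cover_sieve T \<U>) \<M> (fib_restrict (cover_sieve T \<U>) F) H))"
    if T: "cg (T :: 'u topology)" and U: "open_cover T \<U>" for T \<U>
  proof -
    let ?S = "space_stack T :: ('u, _, _) fibcat"
    let ?R = "space_stack (kprod T Y :: 'u topology) :: ('u, _, _) fibcat"
    define Q where "Q = cover_set \<U>"
    note Qs = sieve_cover_set[of T \<U>, folded Q_def]
    let ?A = "full_subfib ?S Q" and ?B = "full_subfib ?R (pre_sieve T Y Q)"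
    have A: "cover_sieve T \<U> = ?A" by (simp add: cover_sieve_alt Q_def)
    have B: "cover_sieve (kprod T Y) (cover_pre T Y \<U>) = ?B" using cover_sieve_pre[OF T Y] by (simp add: Q_def)
    have desc: "(\<forall>F G \<eta>. fib_morphism ?R \<X> F \<longrightarrow> fib_morphism ?R \<X> G \<longrightarrow>
              two_morphism ?B \<X> (fib_restrict ?B F) (fib_restrict ?B G) \<eta> \<longrightarrow>
              (\<exists>!\<theta>. two_morphism ?R \<X> F G \<theta> \<and> restrict \<theta> (Ob ?B) = \<eta>)) \<and>
           (\<forall>H. fib_morphism ?B \<X> H \<longrightarrow>
              (\<exists>F. fib_morphism ?R \<X> F \<and> isomorphic_morphisms ?B \<X> (fib_restrict ?B F) H))"
      using St[unfolded is_stack_def, THEN conjunct2, rule_format, OF cg_kprod[OF T Y] open_cover_pre[OF T Y U]]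
      unfolding Let_def B .
    note desc1 = conjunct1[OF desc, rule_format] and desc2 = conjunct2[OF desc, rule_format]
    note QU = sieve_UNIV[of T]
    note adjU = adjunct_exists[OF Y T QU X P, unfolded pre_sieve_UNIV full_subfib_UNIV]
      and atU = adjunct_transformation[OF Y T QU X P, unfolded pre_sieve_UNIV full_subfib_UNIV]
      and taU = transformation_of_adjunct[OF Y T QU X P, unfolded pre_sieve_UNIV full_subfib_UNIV]
      and at = adjunct_transformation[OF Y T Qs X P]
      and ta = transformation_of_adjunct[OF Y T Qs X P]
    have dA: "down T Y w \<in> Ob ?A" if "w \<in> Ob ?B" for w using down_Ob[OF Y T Qs that] .
    have BR: "w \<in> Ob ?R" if "w \<in> Ob ?B" for w using that by (simp add: full_subfib_simps(7))
    show ?thesis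
      unfolding A
    proof (intro conjI allI impI)
      fix F G \<eta>
      assume F: "fib_morphism ?S \<M> F" and G: "fib_morphism ?S \<M> G"
        and e: "two_morphism ?A \<M> (fib_restrict ?A F) (fib_restrict ?A G) \<eta>"
      obtain F' \<kappa> where aF: "adjunct T Y UNIV \<X> U F F' \<kappa>" using adjU[OF F] by blast
      obtain G' \<mu> where aG: "adjunct T Y UNIV \<X> U G G' \<mu>" using adjU[OF G] by blast
      have F'm: "fib_morphism ?R \<X> F'" and G'm: "fib_morphism ?R \<X> G'"
        using adjunct_fib[OF Y T QU X P aF] adjunct_fib[OF Y T QU X P aG] by (simp_all add: pre_sieve_UNIV full_subfib_UNIV)
      note rF = fib_morphism_restrict[OF sitecat_space_stack F, of Q] and rG = fib_morphism_restrict[OF sitecat_space_stack G, of Q]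
      note raF = adjunct_restrict[OF Y T X P Qs F aF] and raG = adjunct_restrict[OF Y T X P Qs G aG]
      note at' = at[OF rF raF rG raG e]
      obtain \<omega>0 where o0: "two_morphism ?B \<X> (fib_restrict ?B F') (fib_restrict ?B G') \<omega>0"
          "\<forall>w\<in>Ob ?B. cmp \<X> (\<mu> w) (\<omega>0 w) = cmp \<X> (snd U (\<eta> (down T Y w))) (\<kappa> w)"
        using ex1_implies_ex[OF at'] by blast
      note ta' = ta[OF rF raF rG raG o0(1)]
      note d1 = desc1[OF F'm G'm o0(1)]
      obtain \<omega> where o: "two_morphism ?R \<X> F' G' \<omega>" "restrict \<omega> (Ob ?B) = \<omega>0" using ex1_implies_ex[OF d1] by blast
      note taU' = taU[OF F aF G aG o(1)]
      obtain \<theta> where t: "two_morphism ?S \<M> F G \<theta>"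
          "\<forall>w\<in>Ob ?R. cmp \<X> (\<mu> w) (\<omega> w) = cmp \<X> (snd U (\<theta> (down T Y w))) (\<kappa> w)"
        using ex1_implies_ex[OF taU'] by blast
      show "\<exists>!\<theta>. two_morphism ?S \<M> F G \<theta> \<and> restrict \<theta> (Ob ?A) = \<eta>"
      proof (rule ex1I[of _ \<theta>])
        have "\<forall>w\<in>Ob ?B. cmp \<X> (\<mu> w) (\<omega>0 w) = cmp \<X> (snd U (restrict \<theta> (Ob ?A) (down T Y w))) (\<kappa> w)"
        proof
          fix w assume w: "w \<in> Ob ?B"
          have "\<omega>0 w = \<omega> w" using w o(2) by (metis restrict_apply')
          then show "cmp \<X> (\<mu> w) (\<omega>0 w) = cmp \<X> (snd U (restrict \<theta> (Ob ?A) (down T Y w))) (\<kappa> w)"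
            using bspec[OF t(2) BR[OF w]] dA[OF w] by simp
        qed
        then have "restrict \<theta> (Ob ?A) = \<eta>"
          using ex1_unique[OF ta', of "restrict \<theta> (Ob ?A)" \<eta>] two_morphism_restrict[OF sitecat_space_stack t(1), of Q] e o0(2) by blast
        then show "two_morphism ?S \<M> F G \<theta> \<and> restrict \<theta> (Ob ?A) = \<eta>" using t(1) by blast
      next
        fix \<theta>' assume t': "two_morphism ?S \<M> F G \<theta>' \<and> restrict \<theta>' (Ob ?A) = \<eta>"
        obtain \<omega>' where o': "two_morphism ?R \<X> F' G' \<omega>'"
            "\<forall>w\<in>Ob ?R. cmp \<X> (\<mu> w) (\<omega>' w) = cmp \<X> (snd U (\<theta>' (down T Y w))) (\<kappa> w)"
          using ex1_implies_ex[OF atU[OF F aF G aG conjunct1[OF t']]] by blast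
        have "\<forall>w\<in>Ob ?B. cmp \<X> (\<mu> w) (restrict \<omega>' (Ob ?B) w) = cmp \<X> (snd U (\<eta> (down T Y w))) (\<kappa> w)"
        proof
          fix w assume w: "w \<in> Ob ?B"
          have "\<eta> (down T Y w) = \<theta>' (down T Y w)" using conjunct2[OF t'] dA[OF w] by (metis restrict_apply')
          then show "cmp \<X> (\<mu> w) (restrict \<omega>' (Ob ?B) w) = cmp \<X> (snd U (\<eta> (down T Y w))) (\<kappa> w)"
            using bspec[OF o'(2) BR[OF w]] w by simp
        qed
        then have "restrict \<omega>' (Ob ?B) = \<omega>0"
          using ex1_unique[OF at', of "restrict \<omega>' (Ob ?B)" \<omega>0] two_morphism_restrict[OF sitecat_space_stack o'(1), of "pre_sieve T Y Q"] o0 by blast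
        then have "\<omega>' = \<omega>" using ex1_unique[OF d1, of \<omega>' \<omega>] o o'(1) by blast
        then show "\<theta>' = \<theta>" using ex1_unique[OF taU', of \<theta>' \<theta>] t conjunct1[OF t'] o'(2) by blast
      qed
    next
      fix H assume H: "fib_morphism ?A \<M> H"
      obtain H' \<kappa> where aH: "adjunct T Y Q \<X> U H H' \<kappa>" using adjunct_exists[OF Y T Qs X P H] by blast
      obtain K \<nu> where K: "fib_morphism ?R \<X> K" "two_morphism ?B \<X> (fib_restrict ?B K) H' \<nu>"
        using desc2[OF adjunct_fib[OF Y T Qs X P aH]] unfolding isomorphic_morphisms_def by blast
      obtain F \<mu> where F: "fib_morphism ?S \<M> F" "adjunct T Y UNIV \<X> U F K \<mu>"
        using coadjunct_exists[OF Y T X P K(1)] by blast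
      have "\<exists>\<theta>. two_morphism ?A \<M> (fib_restrict ?A F) H \<theta>"
        using ex1_implies_ex[OF ta[OF fib_morphism_restrict[OF sitecat_space_stack F(1)]
          adjunct_restrict[OF Y T X P Qs F] H aH K(2)]] by blast
      then show "\<exists>F. fib_morphism ?S \<M> F \<and> isomorphic_morphisms ?A \<M> (fib_restrict ?A F) H"
        using F(1) unfolding isomorphic_morphisms_def by blast
    qed
  qed
  show ?thesis
    unfolding is_stack_def Let_def using M main by blast
qed

section \<open>Universal arrows between powers\<close>

context
  fixes Y :: "'u topology"
    and \<W> :: "('u, 'w, 'l) fibcat" and \<W>' :: "('u, 'v, 'k) fibcat" and V :: "('v, 'k, 'w, 'l) fibfun"
    and \<X> :: "('u, 'o, 'm) fibcat" and \<M> :: "('u, 'p, 'n) fibcat" and U :: "('p, 'n, 'o, 'm) fibfun"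
    and F :: "('w, 'l, 'o, 'm) fibfun" and F' :: "('v, 'k, 'p, 'n) fibfun"
  assumes Y: "cg Y" "Hausdorff_space Y"
    and W: "fibered_in_groupoids \<W>" and X: "fibered_in_groupoids \<X>"
    and PV: "is_power Y \<W> \<W>' V" and PU: "is_power Y \<X> \<M> U"
    and F: "fib_morphism \<W> \<X> F" and F': "fib_morphism \<W>' \<M> F'"
    and comm: "\<And>w. w \<in> Ob \<W>' \<Longrightarrow> fst U (fst F' w) = fst F (fst V w)"
      "\<And>a. a \<in> Ar \<W>' \<Longrightarrow> snd U (snd F' a) = snd F (snd V a)"
begin

text \<open>
  Morphisms from \<open>S\<close> into the power of \<open>w\<close> are morphisms from \<open>S \<times> Y\<close> into \<open>w\<close>; so the base
  of a universal arrow of the power is the Weil restriction of the base of the universal arrow.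
\<close>

lemma power_universal_arrow:
  assumes m: "m \<in> Ob \<M>" and UA: "universal_arrow \<W> \<X> F (fst U m) w \<beta>"
    and WR: "weil_restriction (base \<M> m) Y (base \<W> w) (bmap \<X> \<beta>) Z r ev"
  shows "\<exists>w' \<beta>'. universal_arrow \<W>' \<M> F' m w' \<beta>' \<and> base \<W>' w' = Z \<and> bmap \<M> \<beta>' = r"
proof -
  note SW = fibered_sitecat[OF W] and SX = fibered_sitecat[OF X] and SM = power_sitecat[OF PU] and SW' = power_sitecat[OF PV]
  let ?T = "base \<M> m"
  note T = cg_base[OF SM m]
  have Z: "cg Z" and r: "r \<in> cmaps Z ?T" and ev: "ev \<in> cmaps (kprod Z Y) (base \<W> w)"
    and qev: "compmap (kprod Z Y) (bmap \<X> \<beta>) ev = ktimes Z ?T Y r"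
    using WR by (simp_all add: weil_restriction_def compmap_def)
  have univ: "\<exists>!k. k \<in> cmaps S Z \<and> compmap S r k = h \<and> compmap (kprod S Y) ev (ktimes S Z Y k) = c"
    if "cg S" "h \<in> cmaps S ?T" "c \<in> cmaps (kprod S Y) (base \<W> w)"
      "compmap (kprod S Y) (bmap \<X> \<beta>) c = ktimes S ?T Y h" for S :: "'u topology" and h c
    by (rule WR[unfolded weil_restriction_def compmap_def[symmetric], THEN conjunct2, THEN conjunct2, THEN conjunct2,
      THEN conjunct2, rule_format, OF that])
  note w = universal_arrowD[OF UA]
  obtain w0 e where e: "arr \<W> w0 w ev e" "base \<W> w0 = kprod Z Y"
    using fib_lift[OF W w(1) cg_kprod[OF Z Y(1)] ev] by blast
  obtain w' where w': "w' \<in> Ob \<W>'" "base \<W>' w' = Z" "fst V w' = w0"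
    using power_object[OF PV Z arr_ob(1)[OF SW e(1)] e(2)] by blast
  have UF: "fst U (fst F' w') = fst F w0" using comm(1)[OF w'(1)] w'(3) by simp
  have w0: "w0 \<in> Ob \<W>" using arr_ob(1)[OF SW e(1)] .
  have "arr \<X> (fst F w0) (fst U m) (ktimes Z ?T Y r) (cmp \<X> \<beta> (snd F e))"
    using arr_cmp[OF SX fm_arr[OF F e(1)] w(2)] qev fm_base[OF F w0] e(2) by simp
  then have "\<exists>!a. arr \<M> (fst F' w') m r a \<and> snd U a = cmp \<X> \<beta> (snd F e)"
    using fm_base[OF F' w'(1)] w'(2) r UF by (intro power_full[OF PU fm_ob[OF F' w'(1)] m]) simp_all
  then obtain \<beta>' where b': "arr \<M> (fst F' w') m r \<beta>'" "snd U \<beta>' = cmp \<X> \<beta> (snd F e)" by blast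
  have "universal_arrow \<W>' \<M> F' m w' \<beta>'"
    unfolding universal_arrow_def
  proof (intro conjI allI impI)
    show "arr \<M> (fst F' w') m (bmap \<M> \<beta>') \<beta>'" using b'(1) arrD(4)[OF b'(1)] by simp
    fix v h \<gamma> assume v: "v \<in> Ob \<W>'" and g: "arr \<M> (fst F' v) m h \<gamma>"
    let ?S = "base \<W>' v"
    note S = cg_base[OF SW' v]
    have h: "h \<in> cmaps ?S ?T" using arr_bmap[OF SM g] fm_base[OF F' v] by simp
    note Vv = power_ob[OF PV v]
    have Ug: "arr \<X> (fst F (fst V v)) (fst U m) (ktimes ?S ?T Y h) (snd U \<gamma>)"
      using power_arr[OF PU g] comm(1)[OF v] fm_base[OF F' v] by simp
    note fac = universal_arrow_ex1[OF UA Vv(1) Ug]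
    obtain b where b: "arr \<W> (fst V v) w (bmap \<W> b) b" "cmp \<X> \<beta> (snd F b) = snd U \<gamma>"
      using universal_arrow_factor[OF UA Vv(1) Ug] .
    let ?c = "bmap \<W> b"
    have c: "?c \<in> cmaps (kprod ?S Y) (base \<W> w)" using arr_bmap[OF SW b(1)] Vv(2) by simp
    have qc: "compmap (kprod ?S Y) (bmap \<X> \<beta>) ?c = ktimes ?S ?T Y h"
      using universal_arrow_bmap[OF UA SX F SW b(1) Ug b(2)] Vv(2) by simp
    note un = univ[OF S h c qc]
    obtain k where k: "k \<in> cmaps ?S Z" "compmap ?S r k = h" "compmap (kprod ?S Y) ev (ktimes ?S Z Y k) = ?c"
      using ex1_implies_ex[OF un] by blast
    have kt: "ktimes ?S Z Y k \<in> cmaps (base \<W> (fst V v)) (base \<W> w0)"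
      using ktimes_cmap[OF S Z Y(1) k(1)] Vv(2) e(2) by simp
    have ke: "compmap (base \<W> (fst V v)) ev (ktimes ?S Z Y k) = ?c" using k(3) Vv(2) by simp
    note fac0 = fib_factor[OF W e(1) b(1) kt ke]
    obtain b0 where b0: "arr \<W> (fst V v) w0 (ktimes ?S Z Y k) b0" "cmp \<W> e b0 = b" using ex1_implies_ex[OF fac0] by blast
    have full: "\<exists>!a. arr \<W>' v w' k a \<and> snd V a = b0"
      by (rule power_full[OF PV v w'(1)]) (use k(1) b0(1) w'(2,3) in simp_all)
    obtain a where a: "arr \<W>' v w' k a" "snd V a = b0" using ex1_implies_ex[OF full] by blast
    have U_of: "snd U (cmp \<M> \<beta>' (snd F' d)) = cmp \<X> \<beta> (snd F (cmp \<W> e (snd V d)))" if d: "arr \<W>' v w' l d" for d l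
    proof -
      have Vd: "arr \<W> (fst V v) w0 (ktimes ?S Z Y l) (snd V d)" using power_arr[OF PV d] w'(2,3) by simp
      show ?thesis
        using power_cmp[OF PU fm_arr[OF F' d] b'(1)] b'(2) comm(2)[OF arrD(1)[OF d]]
          cmp_assoc[OF SX fm_arr[OF F Vd] fm_arr[OF F e(1)] w(2)] fm_cmp[OF F Vd e(1)] by simp
    qed
    show "\<exists>!a. a \<in> Ar \<W>' \<and> src \<W>' a = v \<and> tgt \<W>' a = w' \<and> cmp \<M> \<beta>' (snd F' a) = \<gamma>"
    proof (rule ex1I[of _ a])
      have "arr \<M> (fst F' v) m h (cmp \<M> \<beta>' (snd F' a))"
        using arr_cmp[OF SM fm_arr[OF F' a(1)] b'(1)] k(2) fm_base[OF F' v] by simp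
      moreover have "snd U (cmp \<M> \<beta>' (snd F' a)) = snd U \<gamma>" using U_of[OF a(1)] a(2) b0(2) b(2) by simp
      ultimately have "cmp \<M> \<beta>' (snd F' a) = \<gamma>" using power_faithful[OF PU _ g] by blast
      then show "a \<in> Ar \<W>' \<and> src \<W>' a = v \<and> tgt \<W>' a = w' \<and> cmp \<M> \<beta>' (snd F' a) = \<gamma>" using a(1) by (simp add: arr_def)
    next
      fix d assume d: "d \<in> Ar \<W>' \<and> src \<W>' d = v \<and> tgt \<W>' d = w' \<and> cmp \<M> \<beta>' (snd F' d) = \<gamma>"
      let ?l = "bmap \<W>' d"
      have da: "arr \<W>' v w' ?l d" using d by (simp add: arr_def)
      have l: "?l \<in> cmaps ?S Z" using arr_bmap[OF SW' da] w'(2) by simp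
      have Vd: "arr \<W> (fst V v) w0 (ktimes ?S Z Y ?l) (snd V d)" using power_arr[OF PV da] w'(2,3) by simp
      note ed = arr_cmp[OF SW Vd e(1)]
      have "cmp \<X> \<beta> (snd F (cmp \<W> e (snd V d))) = snd U \<gamma>" using U_of[OF da] d by simp
      then have edb: "cmp \<W> e (snd V d) = b"
        using ex1_unique[OF fac, of "cmp \<W> e (snd V d)" b] ed b by (simp add: arr_def)
      have "compmap ?S r ?l = h"
        using arr_cmp[OF SM fm_arr[OF F' da] b'(1)] g d fm_base[OF F' v] by (simp add: arr_def)
      moreover have "compmap (kprod ?S Y) ev (ktimes ?S Z Y ?l) = ?c"
        using arrD(4)[OF ed] edb Vv(2) by simp
      ultimately have lk: "?l = k" using ex1_unique[OF un, of ?l k] l k by blast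
      have "snd V d = b0" using ex1_unique[OF fac0, of "snd V d" b0] Vd lk edb b0 by simp
      then show "d = a" using ex1_unique[OF full, of d a] da lk a by simp
    qed
  qed (rule w'(1))
  then show ?thesis using w'(2) arrD(4)[OF b'(1)] by blast
qed

lemma power_universal_arrow_exists:
  assumes R: "representable \<W> \<X> F" and m: "m \<in> Ob \<M>"
  shows "\<exists>w \<beta> Z r ev w' \<beta>'. universal_arrow \<W> \<X> F (fst U m) w \<beta> \<and>
    weil_restriction (base \<M> m) Y (base \<W> w) (bmap \<X> \<beta>) Z r ev \<and>
    universal_arrow \<W>' \<M> F' m w' \<beta>' \<and> base \<W>' w' = Z \<and> bmap \<M> \<beta>' = r"
proof -
  obtain w \<beta> where U: "universal_arrow \<W> \<X> F (fst U m) w \<beta>"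
    using R[unfolded representable_iff[OF W X F]] power_ob(1)[OF PU m] by blast
  note w = universal_arrowD[OF U]
  have q: "bmap \<X> \<beta> \<in> cmaps (base \<W> w) (kprod (base \<M> m) Y)"
    using arr_bmap[OF fibered_sitecat[OF X] w(2)] fm_base[OF F w(1)] power_ob(2)[OF PU m] by simp
  obtain Z r ev where "weil_restriction (base \<M> m) Y (base \<W> w) (bmap \<X> \<beta>) Z r ev"
    using weil_restriction_exists[OF cg_base[OF power_sitecat[OF PU] m] Y cg_base[OF fibered_sitecat[OF W] w(1)] q] by blast
  then show ?thesis using U power_universal_arrow[OF m U] by blast
qed

lemma representable_power:
  assumes R: "representable \<W> \<X> F"
  shows "representable \<W>' \<M> F'"
  unfolding representable_iff[OF fibered_power[OF Y(1) W PV] fibered_power[OF Y(1) X PU] F']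
  using power_universal_arrow_exists[OF R] by blast

text \<open>
  Pull \<open>x\<close> back to \<open>y\<close> along \<open>a \<times> Y\<close>: the base \<open>J\<close> of a universal arrow to \<open>y\<close> is the base change of that
  to \<open>x\<close>, and parashrinkability applies over the paracompact space \<open>K \<times> Y\<close>.
\<close>

lemma lift_model_exists:
  assumes R: "weakly_parashrinkable \<W> \<X> F" and pY: "paracompact_space Y"
    and T: "cg T" and x: "base \<X> x = kprod T Y" and U: "universal_arrow \<W> \<X> F x w \<beta>"
    and K: "test_space K" and a: "a \<in> cmaps K T"
  shows "\<exists>J qJ j. lift_model T Y (base \<W> w) (bmap \<X> \<beta>) K a J qJ j"
proof -
  note SW = fibered_sitecat[OF W] and SX = fibered_sitecat[OF X]
  note w = universal_arrowD[OF U]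
  note Kc = test_space_imp_cg[OF K] and KY = cg_kprod[OF test_space_imp_cg[OF K] Y(1)]
  have xO: "x \<in> Ob \<X>" using arr_ob(2)[OF SX w(2)] .
  let ?P = "kprod K Y :: 'u topology"
  have ka: "ktimes K T Y a \<in> cmaps ?P (base \<X> x)" using ktimes_cmap[OF Kc T Y(1) a] x by simp
  obtain y \<kappa> where k: "arr \<X> y x (ktimes K T Y a) \<kappa>" "base \<X> y = ?P" using fib_lift[OF X xO KY ka] by blast
  have yO: "y \<in> Ob \<X>" using arr_ob(1)[OF SX k(1)] .
  have "representable \<W> \<X> F" using R by (simp add: weakly_parashrinkable_def)
  then obtain v \<gamma> where V: "universal_arrow \<W> \<X> F y v \<gamma>" unfolding representable_iff[OF W X F] using yO by blast
  note v = universal_arrowD[OF V]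
  let ?J = "base \<W> v" and ?qJ = "bmap \<X> \<gamma>"
  have kg: "arr \<X> (fst F v) x (compmap ?J (ktimes K T Y a) ?qJ) (cmp \<X> \<kappa> \<gamma>)"
    using arr_cmp[OF SX v(2) k(1)] fm_base[OF F v(1)] by simp
  obtain b where b: "arr \<W> v w (bmap \<W> b) b" "cmp \<X> \<beta> (snd F b) = cmp \<X> \<kappa> \<gamma>"
    using universal_arrow_factor[OF U v(1) kg] .
  have qj: "compmap ?J (bmap \<X> \<beta>) (bmap \<W> b) = compmap ?J (ktimes K T Y a) ?qJ"
    by (rule universal_arrow_bmap[OF U SX F SW b(1) kg b(2)])
  have qJ: "?qJ \<in> cmaps ?J ?P" using arr_bmap[OF SX v(2)] fm_base[OF F v(1)] k(2) by simp
  have sec: "\<exists>\<sigma>\<in>cmaps ?P ?J. compmap ?P ?qJ \<sigma> = idmap ?P \<and> compmap ?P (bmap \<W> b) \<sigma> = c"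
    if c: "c \<in> cmaps ?P (base \<W> w)" and qc: "compmap ?P (bmap \<X> \<beta>) c = ktimes K T Y a" for c
  proof -
    obtain u e where e: "arr \<W> u w c e" "base \<W> u = ?P" using fib_lift[OF W w(1) KY c] by blast
    have uO: "u \<in> Ob \<W>" using arr_ob(1)[OF SW e(1)] .
    have be: "arr \<X> (fst F u) x (ktimes K T Y a) (cmp \<X> \<beta> (snd F e))"
      using arr_cmp[OF SX fm_arr[OF F e(1)] w(2)] qc fm_base[OF F uO] e(2) by simp
    have id: "idmap ?P \<in> cmaps (base \<X> (fst F u)) (base \<X> y)" using idmap_cmaps fm_base[OF F uO] e(2) k(2) by simp
    have ci: "compmap (base \<X> (fst F u)) (ktimes K T Y a) (idmap ?P) = ktimes K T Y a"
      using compmap_idmap_right[OF ka] fm_base[OF F uO] e(2) by simp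
    obtain d where d: "arr \<X> (fst F u) y (idmap ?P) d" "cmp \<X> \<kappa> d = cmp \<X> \<beta> (snd F e)"
      using ex1_implies_ex[OF fib_factor[OF X k(1) be id ci]] by blast
    obtain s where s: "arr \<W> u v (bmap \<W> s) s" "cmp \<X> \<gamma> (snd F s) = d" using universal_arrow_factor[OF V uO d(1)] .
    have 1: "compmap ?P ?qJ (bmap \<W> s) = idmap ?P" using universal_arrow_bmap[OF V SX F SW s(1) d(1) s(2)] e(2) by simp
    note bs = arr_cmp[OF SW s(1) b(1)]
    have "cmp \<X> \<beta> (snd F (cmp \<W> b s)) = cmp \<X> \<beta> (snd F e)"
      using cmp_assoc[OF SX fm_arr[OF F s(1)] fm_arr[OF F b(1)] w(2)] cmp_assoc[OF SX fm_arr[OF F s(1)] v(2) k(1)]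
        fm_cmp[OF F s(1) b(1)] b(2) s(2) d(2) by simp
    then have "cmp \<W> b s = e" by (rule universal_arrow_eq[OF U SW SX F bs e(1)])
    then have 2: "compmap ?P (bmap \<W> b) (bmap \<W> s) = c" using arrD(4)[OF bs] arrD(4)[OF e(1)] e(2) by simp
    have "bmap \<W> s \<in> cmaps ?P ?J" using arr_bmap[OF SW s(1)] e(2) by simp
    then show ?thesis using 1 2 by blast
  qed
  have "paracompact_space (base \<X> y)" using paracompact_kprod[OF K Y(1) pY] k(2) by simp
  note S = weakly_parashrinkable_sections[OF W X F R V this, unfolded k(2)]
  have "lift_model T Y (base \<W> w) (bmap \<X> \<beta>) K a ?J ?qJ (bmap \<W> b)"
    unfolding lift_model_def
  proof (intro conjI ballI impI)
    show "cg ?J" using cg_base[OF SW v(1)] .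
    show "bmap \<W> b \<in> cmaps ?J (base \<W> w)" using arr_bmap[OF SW b(1)] .
  qed (use qJ qj sec S in \<open>simp_all add: compmap_def\<close>)
  then show ?thesis by blast
qed

theorem weak_equivalence_power:
  assumes R: "weakly_parashrinkable \<W> \<X> F" and pY: "paracompact_space Y"
    and V: "universal_arrow \<W>' \<M> F' m v \<gamma>"
  shows "weak_equivalence (base \<W>' v) (base \<M> m) (bmap \<M> \<gamma>)"
proof -
  note SM = power_sitecat[OF PU]
  have m: "m \<in> Ob \<M>" using arr_ob(2)[OF SM universal_arrowD(2)[OF V]] .
  note T = cg_base[OF SM m]
  have "representable \<W> \<X> F" using R by (simp add: weakly_parashrinkable_def)
  from power_universal_arrow_exists[OF this m] obtain w \<beta> Z r ev w' \<beta>' where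
    U: "universal_arrow \<W> \<X> F (fst U m) w \<beta>" and WR: "weil_restriction (base \<M> m) Y (base \<W> w) (bmap \<X> \<beta>) Z r ev"
    and w': "universal_arrow \<W>' \<M> F' m w' \<beta>'" "base \<W>' w' = Z" "bmap \<M> \<beta>' = r" by blast
  have "weak_equivalence Z (base \<M> m) r"
    by (rule weil_weak_equivalence[OF WR T Y(1) pY lift_model_exists[OF R pY T power_ob(2)[OF PU m] U]])
  moreover obtain i j where ij: "homeomorphic_maps (base \<W>' v) (base \<W>' w') i j" "compmap (base \<W>' v) (bmap \<M> \<beta>') i = bmap \<M> \<gamma>"
    using universal_arrow_homeomorphic[OF w'(1) V power_sitecat[OF PV] SM F'] by blast
  moreover have "r (i x) = bmap \<M> \<gamma> x" if "x \<in> topspace (base \<W>' v)" for x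
    using fun_cong[OF ij(2), of x] w'(3) that by (simp add: compmap_apply)
  ultimately show ?thesis
    using weak_equivalence_compose[OF weak_equivalence_homeomorphism[OF ij(1)]] w'(2) by blast
qed

theorem universal_weak_equivalence_power:
  assumes R: "weakly_parashrinkable \<W> \<X> F" and pY: "paracompact_space Y"
    and W': "fibered_in_groupoids \<W>'" and M: "fibered_in_groupoids \<M>"
  shows "universal_weak_equivalence \<W>' \<M> F'"
  unfolding universal_weak_equivalence_iff[OF W' M F']
  using representable_power weak_equivalence_power[OF R pY] R[unfolded weakly_parashrinkable_def] by blast

end

end

section \<open>Products and diagonals\<close>

lemma fib_prod_Ob: "p \<in> Ob (fib_prod \<X> \<Y>) \<longleftrightarrow> fst p \<in> Ob \<X> \<and> snd p \<in> Ob \<Y> \<and> base \<X> (fst p) = base \<Y> (snd p)"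
  by (cases p) (simp add: fib_prod_def)

lemma fib_prod_base [simp]: "base (fib_prod \<X> \<Y>) p = base \<X> (fst p)"
  by (cases p) (simp add: fib_prod_def)

lemma fib_prod_cmp: "cmp (fib_prod \<X> \<Y>) b a = (cmp \<X> (fst b) (fst a), cmp \<Y> (snd b) (snd a))"
  by (cases a; cases b) (simp add: fib_prod_def)

lemma fib_prod_ident: "ident (fib_prod \<X> \<Y>) p = (ident \<X> (fst p), ident \<Y> (snd p))"
  by (cases p) (simp add: fib_prod_def)

lemma fib_prod_arr:
  "arr (fib_prod \<X> \<Y>) p p' h e \<longleftrightarrow> arr \<X> (fst p) (fst p') h (fst e) \<and> arr \<Y> (snd p) (snd p') h (snd e) \<and>
     base \<X> (fst p) = base \<Y> (snd p) \<and> base \<X> (fst p') = base \<Y> (snd p')"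
  by (cases p; cases p'; cases e) (auto simp: fib_prod_def arr_def)

lemma fib_prod_src_tgt: "src (fib_prod \<X> \<Y>) e = (src \<X> (fst e), src \<Y> (snd e))"
  "tgt (fib_prod \<X> \<Y>) e = (tgt \<X> (fst e), tgt \<Y> (snd e))" "bmap (fib_prod \<X> \<Y>) e = bmap \<X> (fst e)"
  by (cases e; simp add: fib_prod_def)+

lemma sitecat_fib_prod:
  fixes \<X> :: "('u, 'o, 'm) fibcat" and \<Y> :: "('u, 'p, 'n) fibcat"
  assumes X: "sitecat \<X>" and Y: "sitecat \<Y>"
  shows "sitecat (fib_prod \<X> \<Y>)"
proof (rule sitecatI)
  let ?P = "fib_prod \<X> \<Y>"
  fix e assume "e \<in> Ar ?P"
  then have e: "arr ?P (src ?P e) (tgt ?P e) (bmap ?P e) e" by (rule arrI)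
  then have a: "arr \<X> (src \<X> (fst e)) (tgt \<X> (fst e)) (bmap \<X> (fst e)) (fst e)"
    and b: "arr \<Y> (src \<Y> (snd e)) (tgt \<Y> (snd e)) (bmap \<X> (fst e)) (snd e)"
    and c: "base \<X> (src \<X> (fst e)) = base \<Y> (src \<Y> (snd e))" "base \<X> (tgt \<X> (fst e)) = base \<Y> (tgt \<Y> (snd e))"
    by (simp_all add: fib_prod_arr fib_prod_src_tgt)
  then show "src ?P e \<in> Ob ?P \<and> tgt ?P e \<in> Ob ?P \<and> bmap ?P e \<in> cmaps (base ?P (src ?P e)) (base ?P (tgt ?P e))"
    using arr_ob[OF X a] arr_ob[OF Y b] arr_bmap[OF X a] by (simp add: fib_prod_Ob fib_prod_src_tgt)
next
  let ?P = "fib_prod \<X> \<Y>"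
  fix p assume "p \<in> Ob ?P"
  then have p: "fst p \<in> Ob \<X>" "snd p \<in> Ob \<Y>" "base \<X> (fst p) = base \<Y> (snd p)" by (simp_all add: fib_prod_Ob)
  then show "cg (base ?P p) \<and> arr ?P p p (idmap (base ?P p)) (ident ?P p)"
    using arr_ident[OF X p(1)] arr_ident[OF Y p(2)] cg_base[OF X p(1)] by (simp add: fib_prod_arr fib_prod_ident)
next
  let ?P = "fib_prod \<X> \<Y>"
  fix p q r h k a b assume ab: "arr ?P p q h a" "arr ?P q r k b"
  then have "arr \<X> (fst p) (fst q) h (fst a)" "arr \<X> (fst q) (fst r) k (fst b)"
    "arr \<Y> (snd p) (snd q) h (snd a)" "arr \<Y> (snd q) (snd r) k (snd b)" by (simp_all add: fib_prod_arr)
  from arr_cmp[OF X this(1,2)] arr_cmp[OF Y this(3,4)]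
  show "arr ?P p r (compmap (base ?P p) k h) (cmp ?P b a)" using ab by (simp add: fib_prod_arr fib_prod_cmp)
next
  let ?P = "fib_prod \<X> \<Y>"
  fix p q r s h k l a b c assume "arr ?P p q h a" "arr ?P q r k b" "arr ?P r s l c"
  then show "cmp ?P c (cmp ?P b a) = cmp ?P (cmp ?P c b) a"
    using cmp_assoc[OF X, of "fst p" "fst q" h "fst a" "fst r" k "fst b" "fst s" l "fst c"]
      cmp_assoc[OF Y, of "snd p" "snd q" h "snd a" "snd r" k "snd b" "snd s" l "snd c"] by (simp add: fib_prod_arr fib_prod_cmp)
next
  let ?P = "fib_prod \<X> \<Y>"
  fix p q h a assume "arr ?P p q h a"
  then show "cmp ?P a (ident ?P p) = a \<and> cmp ?P (ident ?P q) a = a"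
    using cmp_ident_left[OF X, of "fst p" "fst q" h "fst a"] cmp_ident_left[OF Y, of "snd p" "snd q" h "snd a"]
      cmp_ident_right[OF X, of "fst p" "fst q" h "fst a"] cmp_ident_right[OF Y, of "snd p" "snd q" h "snd a"]
    by (simp add: fib_prod_arr fib_prod_cmp fib_prod_ident)
qed

lemma fibered_fib_prod:
  fixes \<X> :: "('u, 'o, 'm) fibcat" and \<Y> :: "('u, 'p, 'n) fibcat"
  assumes X: "fibered_in_groupoids \<X>" and Y: "fibered_in_groupoids \<Y>"
  shows "fibered_in_groupoids (fib_prod \<X> \<Y>)"
proof (rule fibered_in_groupoidsI[OF sitecat_fib_prod[OF fibered_sitecat[OF X] fibered_sitecat[OF Y]]])
  fix p and T :: "'u topology" and f assume p: "p \<in> Ob (fib_prod \<X> \<Y>)" and T: "cg T"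
    and f: "f \<in> cmaps T (base (fib_prod \<X> \<Y>) p)"
  then have p': "fst p \<in> Ob \<X>" "snd p \<in> Ob \<Y>" "base \<X> (fst p) = base \<Y> (snd p)"
    and f': "f \<in> cmaps T (base \<X> (fst p))" "f \<in> cmaps T (base \<Y> (snd p))" by (simp_all add: fib_prod_Ob)
  obtain x a where a: "arr \<X> x (fst p) f a" "base \<X> x = T" using fib_lift[OF X p'(1) T f'(1)] by blast
  obtain y b where b: "arr \<Y> y (snd p) f b" "base \<Y> y = T" using fib_lift[OF Y p'(2) T f'(2)] by blast
  have "arr (fib_prod \<X> \<Y>) (x, y) p f (a, b)" using a b p' by (simp add: fib_prod_arr)
  then show "\<exists>w a. arr (fib_prod \<X> \<Y>) w p f a \<and> base (fib_prod \<X> \<Y>) w = T" using a(2) by fastforce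
next
  fix p q r h k g a b
  assume a: "arr (fib_prod \<X> \<Y>) p r h a" and b: "arr (fib_prod \<X> \<Y>) q r k b"
    and g: "g \<in> cmaps (base (fib_prod \<X> \<Y>) q) (base (fib_prod \<X> \<Y>) p)"
    and eq: "compmap (base (fib_prod \<X> \<Y>) q) h g = k"
  have a': "arr \<X> (fst p) (fst r) h (fst a)" "arr \<Y> (snd p) (snd r) h (snd a)" "base \<X> (fst p) = base \<Y> (snd p)"
    and b': "arr \<X> (fst q) (fst r) k (fst b)" "arr \<Y> (snd q) (snd r) k (snd b)" "base \<X> (fst q) = base \<Y> (snd q)"
    using a b by (simp_all add: fib_prod_arr)
  have e1: "\<exists>!c. arr \<X> (fst q) (fst p) g c \<and> cmp \<X> (fst a) c = fst b"
    by (rule fib_factor[OF X a'(1) b'(1)]) (use g eq in simp_all)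
  have e2: "\<exists>!c. arr \<Y> (snd q) (snd p) g c \<and> cmp \<Y> (snd a) c = snd b"
    by (rule fib_factor[OF Y a'(2) b'(2)]) (use g eq a'(3) b'(3) in simp_all)
  obtain c where c: "arr \<X> (fst q) (fst p) g c" "cmp \<X> (fst a) c = fst b" using ex1_implies_ex[OF e1] by blast
  obtain d where d: "arr \<Y> (snd q) (snd p) g d" "cmp \<Y> (snd a) d = snd b" using ex1_implies_ex[OF e2] by blast
  show "\<exists>!c. arr (fib_prod \<X> \<Y>) q p g c \<and> cmp (fib_prod \<X> \<Y>) a c = b"
  proof (rule ex1I[of _ "(c, d)"])
    show "arr (fib_prod \<X> \<Y>) q p g (c, d) \<and> cmp (fib_prod \<X> \<Y>) a (c, d) = b"
      using c d a'(3) b'(3) by (simp add: fib_prod_arr fib_prod_cmp)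
  next
    fix v assume "arr (fib_prod \<X> \<Y>) q p g v \<and> cmp (fib_prod \<X> \<Y>) a v = b"
    then have v: "arr \<X> (fst q) (fst p) g (fst v)" "arr \<Y> (snd q) (snd p) g (snd v)"
      "cmp \<X> (fst a) (fst v) = fst b" "cmp \<Y> (snd a) (snd v) = snd b" by (auto simp: fib_prod_arr fib_prod_cmp)
    show "v = (c, d)"
      using ex1_unique[OF e1, of "fst v" c] ex1_unique[OF e2, of "snd v" d] v c d by (simp add: prod_eq_iff)
  qed
qed

lemma diagonal_morphism:
  assumes S: "sitecat \<X>"
  shows "fib_morphism \<X> (fib_prod \<X> \<X>) (diagonal \<X>)"
proof (rule fib_morphismI[OF S])
  fix x assume x: "x \<in> Ob \<X>"
  then show "fst (diagonal \<X>) x \<in> Ob (fib_prod \<X> \<X>) \<and> base (fib_prod \<X> \<X>) (fst (diagonal \<X>) x) = base \<X> x \<and>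
      snd (diagonal \<X>) (ident \<X> x) = ident (fib_prod \<X> \<X>) (fst (diagonal \<X>) x)"
    using arrD(1)[OF arr_ident[OF S x]] by (simp add: diagonal_def fib_prod_Ob fib_prod_ident)
next
  fix x y h a assume a: "arr \<X> x y h a"
  then show "arr (fib_prod \<X> \<X>) (fst (diagonal \<X>) x) (fst (diagonal \<X>) y) h (snd (diagonal \<X>) a)"
    using arr_ob[OF S a] arrD(1)[OF a] by (simp add: diagonal_def fib_prod_arr)
next
  fix x y z h k a b assume a: "arr \<X> x y h a" and b: "arr \<X> y z k b"
  then show "snd (diagonal \<X>) (cmp \<X> b a) = cmp (fib_prod \<X> \<X>) (snd (diagonal \<X>) b) (snd (diagonal \<X>) a)"
    using arrD(1)[OF a] arrD(1)[OF b] arrD(1)[OF arr_cmp[OF S a b]] by (simp add: diagonal_def fib_prod_cmp)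
qed (simp_all add: diagonal_def)

lemma is_powerI:
  fixes Y :: "'u topology" and \<X> :: "('u, 'o, 'm) fibcat" and \<M> :: "('u, 'p, 'n) fibcat"
  assumes "sitecat \<M>"
    and "\<And>m. m \<in> Ob \<M> \<Longrightarrow> fst U m \<in> Ob \<X> \<and> base \<X> (fst U m) = kprod (base \<M> m) Y \<and> snd U (ident \<M> m) = ident \<X> (fst U m)"
    and "\<And>m m' h a. arr \<M> m m' h a \<Longrightarrow> arr \<X> (fst U m) (fst U m') (ktimes (base \<M> m) (base \<M> m') Y h) (snd U a)"
    and "\<And>m m' m'' h k a b. arr \<M> m m' h a \<Longrightarrow> arr \<M> m' m'' k b \<Longrightarrow> snd U (cmp \<M> b a) = cmp \<X> (snd U b) (snd U a)"
    and "\<And>m m' h g. m \<in> Ob \<M> \<Longrightarrow> m' \<in> Ob \<M> \<Longrightarrow> h \<in> cmaps (base \<M> m) (base \<M> m') \<Longrightarrow>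
       arr \<X> (fst U m) (fst U m') (ktimes (base \<M> m) (base \<M> m') Y h) g \<Longrightarrow> \<exists>!a. arr \<M> m m' h a \<and> snd U a = g"
    and "\<And>T x. cg T \<Longrightarrow> x \<in> Ob \<X> \<Longrightarrow> base \<X> x = kprod T Y \<Longrightarrow> \<exists>m\<in>Ob \<M>. base \<M> m = T \<and> fst U m = x"
  shows "is_power Y \<X> \<M> U"
  unfolding is_power_def
  by (intro conjI ballI allI impI) (fact assms(1), use assms(2) in blast, use assms(2) in blast, use assms(2) in blast,
    fact assms(3), fact assms(4), fact assms(5), fact assms(6))

definition square_functor :: "('p, 'n, 'o, 'm) fibfun \<Rightarrow> ('p \<times> 'p, 'n \<times> 'n, 'o \<times> 'o, 'm \<times> 'm) fibfun" where
  "square_functor U = (map_prod (fst U) (fst U), map_prod (snd U) (snd U))"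

lemma square_functor_simps [simp]:
  "fst (square_functor U) m = (fst U (fst m), fst U (snd m))" "snd (square_functor U) a = (snd U (fst a), snd U (snd a))"
  by (cases m; simp add: square_functor_def) (cases a; simp add: square_functor_def)

lemma power_prod:
  fixes Y :: "'u topology" and \<X> :: "('u, 'o, 'm) fibcat" and \<M> :: "('u, 'p, 'n) fibcat"
  assumes P: "is_power Y \<X> \<M> U"
  shows "is_power Y (fib_prod \<X> \<X>) (fib_prod \<M> \<M>) (square_functor U)"
proof (rule is_powerI)
  show "sitecat (fib_prod \<M> \<M>)" using sitecat_fib_prod power_sitecat[OF P] by blast
next
  fix m assume "m \<in> Ob (fib_prod \<M> \<M>)"
  then have m: "fst m \<in> Ob \<M>" "snd m \<in> Ob \<M>" "base \<M> (fst m) = base \<M> (snd m)" by (simp_all add: fib_prod_Ob)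
  then show "fst (square_functor U) m \<in> Ob (fib_prod \<X> \<X>) \<and>
      base (fib_prod \<X> \<X>) (fst (square_functor U) m) = kprod (base (fib_prod \<M> \<M>) m) Y \<and>
      snd (square_functor U) (ident (fib_prod \<M> \<M>) m) =
        ident (fib_prod \<X> \<X>) (fst (square_functor U) m)"
    using power_ob[OF P m(1)] power_ob[OF P m(2)] by (cases m) (simp add: fib_prod_Ob fib_prod_ident)
next
  fix m m' h a assume "arr (fib_prod \<M> \<M>) m m' h a"
  then have a: "arr \<M> (fst m) (fst m') h (fst a)" "arr \<M> (snd m) (snd m') h (snd a)"
    "base \<M> (fst m) = base \<M> (snd m)" "base \<M> (fst m') = base \<M> (snd m')" by (simp_all add: fib_prod_arr)
  note ob = arr_ob[OF power_sitecat[OF P] a(1)] arr_ob[OF power_sitecat[OF P] a(2)]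
  show "arr (fib_prod \<X> \<X>) (fst (square_functor U) m)
      (fst (square_functor U) m')
      (ktimes (base (fib_prod \<M> \<M>) m) (base (fib_prod \<M> \<M>) m') Y h) (snd (square_functor U) a)"
    using power_arr[OF P a(1)] power_arr[OF P a(2)] a(3,4) power_ob(2)[OF P ob(1)] power_ob(2)[OF P ob(2)]
      power_ob(2)[OF P ob(3)] power_ob(2)[OF P ob(4)]
    by (cases m; cases m'; cases a) (simp add: fib_prod_arr)
next
  fix m m' m'' h k a b assume "arr (fib_prod \<M> \<M>) m m' h a" "arr (fib_prod \<M> \<M>) m' m'' k b"
  then have "arr \<M> (fst m) (fst m') h (fst a)" "arr \<M> (fst m') (fst m'') k (fst b)"
    "arr \<M> (snd m) (snd m') h (snd a)" "arr \<M> (snd m') (snd m'') k (snd b)" by (simp_all add: fib_prod_arr)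
  from power_cmp[OF P this(1,2)] power_cmp[OF P this(3,4)]
  show "snd (square_functor U) (cmp (fib_prod \<M> \<M>) b a) =
      cmp (fib_prod \<X> \<X>) (snd (square_functor U) b) (snd (square_functor U) a)"
    by (cases a; cases b) (simp add: fib_prod_cmp)
next
  fix m m' h g assume m: "m \<in> Ob (fib_prod \<M> \<M>)" "m' \<in> Ob (fib_prod \<M> \<M>)" and h: "h \<in> cmaps (base (fib_prod \<M> \<M>) m) (base (fib_prod \<M> \<M>) m')"
    and g: "arr (fib_prod \<X> \<X>) (fst (square_functor U) m) (fst (square_functor U) m')
      (ktimes (base (fib_prod \<M> \<M>) m) (base (fib_prod \<M> \<M>) m') Y h) g"
  have m': "fst m \<in> Ob \<M>" "snd m \<in> Ob \<M>" "base \<M> (fst m) = base \<M> (snd m)"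
    "fst m' \<in> Ob \<M>" "snd m' \<in> Ob \<M>" "base \<M> (fst m') = base \<M> (snd m')" using m by (simp_all add: fib_prod_Ob)
  have e1: "\<exists>!a. arr \<M> (fst m) (fst m') h a \<and> snd U a = fst g"
    by (rule power_full[OF P m'(1,4)]) (use h g in \<open>cases m; cases m'; simp add: fib_prod_arr\<close>)+
  have e2: "\<exists>!a. arr \<M> (snd m) (snd m') h a \<and> snd U a = snd g"
    by (rule power_full[OF P m'(2,5)]) (use h g m' in \<open>cases m; cases m'; simp add: fib_prod_arr\<close>)+
  obtain a where a: "arr \<M> (fst m) (fst m') h a" "snd U a = fst g" using ex1_implies_ex[OF e1] by blast
  obtain b where b: "arr \<M> (snd m) (snd m') h b" "snd U b = snd g" using ex1_implies_ex[OF e2] by blast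
  show "\<exists>!a. arr (fib_prod \<M> \<M>) m m' h a \<and> snd (square_functor U) a = g"
  proof (rule ex1I[of _ "(a, b)"])
    show "arr (fib_prod \<M> \<M>) m m' h (a, b) \<and> snd (square_functor U) (a, b) = g"
      using a b m' by (simp add: fib_prod_arr)
  next
    fix v assume v: "arr (fib_prod \<M> \<M>) m m' h v \<and> snd (square_functor U) v = g"
    obtain c d where [simp]: "v = (c, d)" by (cases v)
    have "arr \<M> (fst m) (fst m') h c" "snd U c = fst g" "arr \<M> (snd m) (snd m') h d" "snd U d = snd g"
      using v by (auto simp: fib_prod_arr)
    then show "v = (a, b)" using ex1_unique[OF e1, of c a] ex1_unique[OF e2, of d b] a b by simp
  qed
next
  fix T :: "'u topology" and x assume T: "cg T" and x: "x \<in> Ob (fib_prod \<X> \<X>)" and bx: "base (fib_prod \<X> \<X>) x = kprod T Y"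
  have x': "fst x \<in> Ob \<X>" "snd x \<in> Ob \<X>" "base \<X> (fst x) = kprod T Y" "base \<X> (snd x) = kprod T Y"
    using x bx by (simp_all add: fib_prod_Ob)
  obtain m where m: "m \<in> Ob \<M>" "base \<M> m = T" "fst U m = fst x" using power_object[OF P T x'(1,3)] by blast
  obtain n where n: "n \<in> Ob \<M>" "base \<M> n = T" "fst U n = snd x" using power_object[OF P T x'(2,4)] by blast
  show "\<exists>m\<in>Ob (fib_prod \<M> \<M>). base (fib_prod \<M> \<M>) m = T \<and> fst (square_functor U) m = x"
    using m n by (intro bexI[of _ "(m, n)"]) (simp_all add: fib_prod_Ob)
qed

text \<open>Used to replace the mapping space by its copy in the universe.\<close>

lemma power_isomorphic:
  fixes \<A> :: "('u, 'v, 'k) fibcat" and Y :: "'u topology"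
  assumes P: "is_power Y \<X> \<M> U" and A: "sitecat \<A>" and G: "fib_morphism \<A> \<M> G"
    and surj: "\<And>m. m \<in> Ob \<M> \<Longrightarrow> \<exists>a\<in>Ob \<A>. fst G a = m"
    and full: "\<And>a a' h b. a \<in> Ob \<A> \<Longrightarrow> a' \<in> Ob \<A> \<Longrightarrow> arr \<M> (fst G a) (fst G a') h b \<Longrightarrow> \<exists>!c. arr \<A> a a' h c \<and> snd G c = b"
  shows "is_power Y \<X> \<A> (fst U \<circ> fst G, snd U \<circ> snd G)" (is "is_power _ _ _ ?V")
proof (rule is_powerI[OF A])
  fix a assume a: "a \<in> Ob \<A>"
  show "fst ?V a \<in> Ob \<X> \<and> base \<X> (fst ?V a) = kprod (base \<A> a) Y \<and>
      snd ?V (ident \<A> a) = ident \<X> (fst ?V a)"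
    using power_ob[OF P fm_ob[OF G a]] fm_base[OF G a] fm_ident[OF G a] by simp
next
  fix a a' h c assume c: "arr \<A> a a' h c"
  show "arr \<X> (fst ?V a) (fst ?V a')
      (ktimes (base \<A> a) (base \<A> a') Y h) (snd ?V c)"
    using power_arr[OF P fm_arr[OF G c]] fm_base[OF G arr_ob(1)[OF A c]] fm_base[OF G arr_ob(2)[OF A c]] by simp
next
  fix a a' a'' h k c d assume c: "arr \<A> a a' h c" and d: "arr \<A> a' a'' k d"
  show "snd ?V (cmp \<A> d c) =
      cmp \<X> (snd ?V d) (snd ?V c)"
    using fm_cmp[OF G c d] power_cmp[OF P fm_arr[OF G c] fm_arr[OF G d]] by simp
next
  fix a a' h g assume a: "a \<in> Ob \<A>" "a' \<in> Ob \<A>" and h: "h \<in> cmaps (base \<A> a) (base \<A> a')"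
    and g: "arr \<X> (fst ?V a) (fst ?V a') (ktimes (base \<A> a) (base \<A> a') Y h) g"
  have e1: "\<exists>!b. arr \<M> (fst G a) (fst G a') h b \<and> snd U b = g"
    by (rule power_full[OF P fm_ob[OF G a(1)] fm_ob[OF G a(2)]]) (use h g fm_base[OF G] a in simp_all)
  obtain b where b: "arr \<M> (fst G a) (fst G a') h b" "snd U b = g" using ex1_implies_ex[OF e1] by blast
  note e2 = full[OF a b(1)]
  obtain c where c: "arr \<A> a a' h c" "snd G c = b" using ex1_implies_ex[OF e2] by blast
  show "\<exists>!c. arr \<A> a a' h c \<and> snd ?V c = g"
  proof (rule ex1I[of _ c])
    fix d assume d: "arr \<A> a a' h d \<and> snd ?V d = g"
    then have "snd G d = b" using ex1_unique[OF e1, of "snd G d" b] fm_arr[OF G conjunct1[OF d]] b by simp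
    then show "d = c" using ex1_unique[OF e2, of d c] d c by simp
  qed (use b c in simp)
next
  fix T :: "'u topology" and x assume T: "cg T" and x: "x \<in> Ob \<X>" "base \<X> x = kprod T Y"
  obtain m where m: "m \<in> Ob \<M>" "base \<M> m = T" "fst U m = x" using power_object[OF P T x] by blast
  obtain a where a: "a \<in> Ob \<A>" "fst G a = m" using surj[OF m(1)] by blast
  show "\<exists>a\<in>Ob \<A>. base \<A> a = T \<and> fst ?V a = x"
    using a m fm_base[OF G a(1)] by (intro bexI[OF _ a(1)]) simp
qed

text \<open>A functor into a power is determined by its composite with the forgetful functor.\<close>

lemma power_functorI:
  assumes P: "is_power Y \<X> \<M> U" and D: "sitecat \<D>"
    and ext: "fst \<Phi> \<in> extensional (Ob \<D>)" "snd \<Phi> \<in> extensional (Ar \<D>)"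
    and ob: "\<And>x. x \<in> Ob \<D> \<Longrightarrow> fst \<Phi> x \<in> Ob \<M> \<and> base \<M> (fst \<Phi> x) = base \<D> x"
    and ar: "\<And>x y h a. arr \<D> x y h a \<Longrightarrow> arr \<M> (fst \<Phi> x) (fst \<Phi> y) h (snd \<Phi> a)"
    and id: "\<And>x. x \<in> Ob \<D> \<Longrightarrow> snd U (snd \<Phi> (ident \<D> x)) = ident \<X> (fst U (fst \<Phi> x))"
    and cm: "\<And>x y z h k a b. arr \<D> x y h a \<Longrightarrow> arr \<D> y z k b \<Longrightarrow>
       snd U (snd \<Phi> (cmp \<D> b a)) = cmp \<X> (snd U (snd \<Phi> b)) (snd U (snd \<Phi> a))"
  shows "fib_morphism \<D> \<M> \<Phi>"
proof (rule fib_morphismI[OF D ext])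
  note SM = power_sitecat[OF P]
  fix x assume x: "x \<in> Ob \<D>"
  note m = conjunct1[OF ob[OF x]]
  have "snd \<Phi> (ident \<D> x) = ident \<M> (fst \<Phi> x)"
    by (rule power_faithful[OF P ar[OF arr_ident[OF D x]]])
      (use arr_ident[OF SM m] ob[OF x] id[OF x] power_ob(3)[OF P m] in simp_all)
  then show "fst \<Phi> x \<in> Ob \<M> \<and> base \<M> (fst \<Phi> x) = base \<D> x \<and> snd \<Phi> (ident \<D> x) = ident \<M> (fst \<Phi> x)" using ob[OF x] by simp
next
  note SM = power_sitecat[OF P]
  fix x y z h k a b assume a: "arr \<D> x y h a" and b: "arr \<D> y z k b"
  show "snd \<Phi> (cmp \<D> b a) = cmp \<M> (snd \<Phi> b) (snd \<Phi> a)"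
    by (rule power_faithful[OF P ar[OF arr_cmp[OF D a b]]])
      (use arr_cmp[OF SM ar[OF a] ar[OF b]] ob[OF arr_ob(1)[OF D a]] cm[OF a b] power_cmp[OF P ar[OF a] ar[OF b]] in simp_all)
qed (fact ar)

section \<open>The mapping space as a power\<close>

text \<open>A map to the mapping space goes to its uncurried form.\<close>

definition space_power ::
  "'u topology \<Rightarrow> (('u, 'u \<Rightarrow> 'b) sobj, ('u, 'u \<Rightarrow> 'b) sarr, ('u, 'b) sobj, ('u, 'b) sarr) fibfun" where
  "space_power Y = (let V = \<lambda>x. (kprod (fst x) Y, kuncurry (fst x) Y (snd x)) in
     (V, \<lambda>(x, h, y). (V x, ktimes (fst x) (fst y) Y h, V y)))"

lemma space_power_simps:
  "fst (space_power Y) x = (kprod (fst x) Y, kuncurry (fst x) Y (snd x))"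
  "snd (space_power Y) (x, h, y) = (fst (space_power Y) x, ktimes (fst x) (fst y) Y h, fst (space_power Y) y)"
  by (simp_all add: space_power_def Let_def)

lemma (in universe) power_mapping_space:
  fixes Y :: "'u topology" and X :: "'b topology"
  assumes Y: "cg Y" "Hausdorff_space Y"
  shows "is_power Y (space_stack X) (space_stack (mapping_space Y X)) (space_power Y)"
proof -
  let ?X = "space_stack X :: ('u, _, _) fibcat" and ?M = "space_stack (mapping_space Y X) :: ('u, _, _) fibcat"
  have ku: "kuncurry S Y f (kpt S Y s y) = f s y"
    if "cg S" "s \<in> topspace S" "y \<in> topspace Y" for S :: "'u topology" and f :: "'u \<Rightarrow> 'u \<Rightarrow> 'b" and s y
    using that by (simp add: kuncurry_def kpt_in[OF _ Y(1)] kpr1_kpt[OF _ Y(1)] kpr2_kpt[OF _ Y(1)])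
  have VO: "fst (space_power Y) x \<in> Ob ?X" if "x \<in> Ob ?M" for x
  proof -
    have S: "cg (fst x)" "snd x \<in> cmaps (fst x) (mapping_space Y X)" using that by (simp_all add: space_stack_Ob)
    show ?thesis using cg_kprod[OF S(1) Y(1)] kuncurry_cmap[OF S(1) Y(1) S(2)] by (simp add: space_stack_Ob space_power_simps)
  qed
  have key: "compmap (kprod S Y) (kuncurry S' Y g') (ktimes S S' Y h) = kuncurry S Y g \<longleftrightarrow> compmap S g' h = g"
    if S: "cg S" "cg S'" and g: "g \<in> cmaps S (mapping_space Y X)" "g' \<in> cmaps S' (mapping_space Y X)"
      and h: "h \<in> cmaps S S'" for S S' :: "'u topology" and g g' h
  proof
    assume e: "compmap S g' h = g"
    show "compmap (kprod S Y) (kuncurry S' Y g') (ktimes S S' Y h) = kuncurry S Y g"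
    proof (rule kprod_eqI[OF S(1) Y(1)])
      fix s y assume s: "s \<in> topspace S" "y \<in> topspace Y"
      then show "compmap (kprod S Y) (kuncurry S' Y g') (ktimes S S' Y h) (kpt S Y s y) = kuncurry S Y g (kpt S Y s y)"
        using fun_cong[OF e, of s] cmaps_image[OF h s(1)]
        by (simp add: compmap_apply kpt_in[OF S(1) Y(1)] ktimes_kpt[OF S(1) Y(1)] ku S)
    qed (simp_all add: compmap_extensional kuncurry_def)
  next
    assume e: "compmap (kprod S Y) (kuncurry S' Y g') (ktimes S S' Y h) = kuncurry S Y g"
    show "compmap S g' h = g"
    proof (rule cmaps_ext[OF compmap_cmaps[OF h g(2)] g(1)])
      fix s assume s: "s \<in> topspace S"
      have c: "g' (h s) \<in> cmaps Y X" "g s \<in> cmaps Y X" using cmaps_image[OF g(2) cmaps_image[OF h s]] cmaps_image[OF g(1) s] by simp_all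
      have "g' (h s) = g s"
      proof (rule cmaps_ext[OF c])
        fix y assume y: "y \<in> topspace Y"
        show "g' (h s) y = g s y"
          using fun_cong[OF e, of "kpt S Y s y"] s y cmaps_image[OF h s]
          by (simp add: compmap_apply kpt_in[OF S(1) Y(1)] ktimes_kpt[OF S(1) Y(1)] ku S)
      qed
      then show "compmap S g' h s = g s" using s by (simp add: compmap_apply)
    qed
  qed
  show ?thesis
  proof (rule is_powerI[OF sitecat_space_stack])
    fix m assume m: "m \<in> Ob ?M"
    then show "fst (space_power Y) m \<in> Ob ?X \<and> base ?X (fst (space_power Y) m) = kprod (base ?M m) Y \<and>
        snd (space_power Y) (ident ?M m) = ident ?X (fst (space_power Y) m)"
      using VO[OF m] ktimes_idmap[OF Y(1), of "fst m"] by (simp add: space_stack_Ob space_stack_ident space_power_simps)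
  next
    fix m m' h a assume a: "arr ?M m m' h a"
    then have a': "a = (m, h, m')" "m \<in> Ob ?M" "m' \<in> Ob ?M" "h \<in> cmaps (fst m) (fst m')" "compmap (fst m) (snd m') h = snd m"
      by (simp_all add: space_stack_arr)
    have S: "cg (fst m)" "cg (fst m')" "snd m \<in> cmaps (fst m) (mapping_space Y X)"
      "snd m' \<in> cmaps (fst m') (mapping_space Y X)" using a'(2,3) by (simp_all add: space_stack_Ob)
    show "arr ?X (fst (space_power Y) m) (fst (space_power Y) m') (ktimes (base ?M m) (base ?M m') Y h) (snd (space_power Y) a)"
      using VO[OF a'(2)] VO[OF a'(3)] ktimes_cmap[OF S(1,2) Y(1) a'(4)] key[OF S a'(4)] a'(1,5)
      by (simp add: space_stack_arr space_power_simps)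
  next
    fix m m' m'' h k a b assume a: "arr ?M m m' h a" and b: "arr ?M m' m'' k b"
    have ab: "a = (m, h, m')" "b = (m', k, m'')" "h \<in> cmaps (fst m) (fst m')" "cg (fst m)" "cg (fst m')"
      using a b by (auto simp: space_stack_arr space_stack_Ob)
    show "snd (space_power Y) (cmp ?M b a) = cmp ?X (snd (space_power Y) b) (snd (space_power Y) a)"
      using ktimes_compmap[OF Y(1) ab(4,3,5), of "fst m''" k] ab(1,2) by (simp add: space_stack_cmp space_power_simps)
  next
    fix m m' h g assume m: "m \<in> Ob ?M" "m' \<in> Ob ?M" and h: "h \<in> cmaps (base ?M m) (base ?M m')"
      and g: "arr ?X (fst (space_power Y) m) (fst (space_power Y) m') (ktimes (base ?M m) (base ?M m') Y h) g"
    have S: "cg (fst m)" "cg (fst m')" "snd m \<in> cmaps (fst m) (mapping_space Y X)"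
      "snd m' \<in> cmaps (fst m') (mapping_space Y X)" using m by (simp_all add: space_stack_Ob)
    have h': "h \<in> cmaps (fst m) (fst m')" using h by simp
    have "compmap (fst m) (snd m') h = snd m" using g key[OF S h'] by (simp add: space_stack_arr space_power_simps)
    then have "arr ?M m m' h (m, h, m')" using m h' by (simp add: space_stack_arr)
    moreover have "snd (space_power Y) (m, h, m') = g" using g by (simp add: space_stack_arr space_power_simps)
    ultimately show "\<exists>!a. arr ?M m m' h a \<and> snd (space_power Y) a = g"
      by (intro ex1I[of _ "(m, h, m')"]) (auto simp: space_stack_arr)
  next
    fix T :: "'u topology" and x assume T: "cg T" and x: "x \<in> Ob ?X" and bx: "base ?X x = kprod T Y"
    have c: "snd x \<in> cmaps (kprod T Y) X" using x bx by (simp add: space_stack_Ob)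
    have "(T, kcurry T Y (snd x)) \<in> Ob ?M" using T kcurry_cmap[OF T Y c] by (simp add: space_stack_Ob)
    moreover have "kuncurry T Y (kcurry T Y (snd x)) = snd x"
      using kuncurry_kcurry[OF T Y(1), of "snd x"] c by (simp add: cmaps_def)
    ultimately show "\<exists>m\<in>Ob ?M. base ?M m = T \<and> fst (space_power Y) m = x"
      using bx by (intro bexI[of _ "(T, kcurry T Y (snd x))"]) (simp_all add: space_power_simps prod_eq_iff)
  qed
qed

section \<open>The mapping stack as a power\<close>

text \<open>The universal point of \<open>T \<times> Y\<close> is its pair of projections.\<close>

definition prod_point :: "'u topology \<Rightarrow> 'u topology \<Rightarrow> ('u, 'u) sobj \<times> ('u, 'u) sobj" where
  "prod_point T Y = ((kprod T Y, kpr1 T Y), (kprod T Y, kpr2 T Y))"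

text \<open>
  The arrow over \<open>h \<times> Y\<close> from the image of the universal point of \<open>T \<times> Y\<close> to that of \<open>S \<times> Y\<close>.
\<close>

definition point_change ::
  "'u topology \<Rightarrow> 'u topology \<Rightarrow> 'u topology \<Rightarrow> ('u \<Rightarrow> 'u) \<Rightarrow> ('u, 'u) sarr \<times> ('u, 'u) sarr" where
  "point_change T S Y h =
     (((kprod T Y, compmap (kprod T Y) h (kpr1 T Y)), ktimes T S Y h, (kprod S Y, kpr1 S Y)),
      ((kprod T Y, kpr2 T Y), ktimes T S Y h, (kprod S Y, kpr2 S Y)))"

abbreviation space_prod :: "'u topology \<Rightarrow> 'u topology \<Rightarrow> ('u, ('u, 'u) sobj \<times> ('u, 'u) sobj, ('u, 'u) sarr \<times> ('u, 'u) sarr) fibcat" where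
  "space_prod T Y \<equiv> fib_prod (space_stack T) (space_stack Y)"

abbreviation "times_id T Y h \<equiv> prod_with_id T h (space_stack Y :: ('u, ('u, 'u) sobj, ('u, 'u) sarr) fibcat)"

lemma space_prod_Ob:
  "w \<in> Ob (space_prod T Y) \<longleftrightarrow> cg (fst (fst w)) \<and>
     snd (fst w) \<in> cmaps (fst (fst w)) T \<and> snd (snd w) \<in> cmaps (fst (fst w)) Y \<and> fst (snd w) = fst (fst w)"
  by (auto simp: fib_prod_Ob space_stack_Ob)

lemma space_prod_arr:
  "arr (space_prod T Y) w w' k e \<longleftrightarrow>
     e = ((fst w, k, fst w'), (snd w, k, snd w')) \<and>
     w \<in> Ob (space_prod T Y) \<and> w' \<in> Ob (space_prod T Y) \<and> k \<in> cmaps (fst (fst w)) (fst (fst w')) \<and>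
     compmap (fst (fst w)) (snd (fst w')) k = snd (fst w) \<and> compmap (fst (fst w)) (snd (snd w')) k = snd (snd w)"
  by (auto simp: fib_prod_arr space_stack_arr fib_prod_Ob prod_eq_iff)

lemma sitecat_space_prod: "sitecat (space_prod T Y)"
  by (rule sitecat_fib_prod[OF sitecat_space_stack sitecat_space_stack])

lemma prod_with_id_ob:
  "w \<in> Ob (space_prod T Y) \<Longrightarrow>
     fst (times_id T Y h) w = ((fst (fst w), compmap (fst (fst w)) h (snd (fst w))), snd w)"
  by (cases w) (auto simp: prod_with_id_def space_morphism_def fib_prod_Ob compmap_def Let_def split: prod.splits)

lemma prod_with_id_arr:
  fixes T Y :: "'u topology"
  assumes e: "arr (space_prod T Y) w w' k e"
  shows "snd (times_id T Y h) e =
     ((fst (fst (times_id T Y h) w), k, fst (fst (times_id T Y h) w')), (snd w, k, snd w'))"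
proof -
  have s: "e = ((fst w, k, fst w'), (snd w, k, snd w'))" "w \<in> Ob (space_prod T Y)" "w' \<in> Ob (space_prod T Y)"
    using e by (simp_all add: space_prod_arr)
  have "arr (space_stack T :: ('u, _, _) fibcat) (fst w) (fst w') k (fst w, k, fst w')" using e unfolding fib_prod_arr s by simp
  from arrD(1)[OF this] show ?thesis using arrD(1)[OF e] s(2,3) unfolding s(1)
    by (simp add: prod_with_id_ob) (simp add: prod_with_id_def space_morphism_def compmap_def Let_def split: prod.splits)
qed

lemma prod_with_id_morphism:
  fixes T S Y :: "'u topology"
  assumes h: "h \<in> cmaps T S"
  shows "fib_morphism (space_prod T Y) (space_prod S Y) (times_id T Y h)"
proof -
  let ?D = "space_prod T Y"
  let ?E = "space_prod S Y"
  let ?P = "times_id T Y h"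
  have ob: "fst ?P w \<in> Ob ?E" if "w \<in> Ob ?D" for w
    using that by (simp add: prod_with_id_ob space_prod_Ob compmap_cmaps[OF _ h])
  have ar: "arr ?E (fst ?P w) (fst ?P w') k (snd ?P e)" if e: "arr ?D w w' k e" for w w' k e
  proof -
    have w: "w \<in> Ob ?D" "w' \<in> Ob ?D" "k \<in> cmaps (fst (fst w)) (fst (fst w'))"
      "compmap (fst (fst w)) (snd (fst w')) k = snd (fst w)" "compmap (fst (fst w)) (snd (snd w')) k = snd (snd w)"
      using e by (simp_all add: space_prod_arr)
    show ?thesis unfolding prod_with_id_arr[OF e] space_prod_arr
      using ob[OF w(1)] ob[OF w(2)] w compmap_assoc[OF w(3), of h "snd (fst w')"] by (simp add: prod_with_id_ob)
  qed
  show ?thesis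
  proof (rule fib_morphismI[OF sitecat_space_prod])
    show "fst ?P \<in> extensional (Ob ?D)" "snd ?P \<in> extensional (Ar ?D)" by (simp_all add: prod_with_id_def)
    fix w assume w: "w \<in> Ob ?D"
    have "base ?E (fst ?P w) = base ?D w" using w by (simp add: prod_with_id_ob)
    moreover have "snd ?P (ident ?D w) = ident ?E (fst ?P w)"
      using prod_with_id_arr[OF arr_ident[OF sitecat_space_prod w], of h] w
      by (simp add: prod_with_id_ob fib_prod_ident space_stack_ident space_prod_Ob)
    ultimately show "fst ?P w \<in> Ob ?E \<and> base ?E (fst ?P w) = base ?D w \<and> snd ?P (ident ?D w) = ident ?E (fst ?P w)"
      using ob[OF w] by simp
  next
    fix w w' w'' k l e f assume e: "arr ?D w w' k e" and f: "arr ?D w' w'' l f"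
    have w: "w \<in> Ob ?D" "w' \<in> Ob ?D" "e = ((fst w, k, fst w'), (snd w, k, snd w'))" "f = ((fst w', l, fst w''), (snd w', l, snd w''))"
      using e f by (simp_all add: space_prod_arr)
    show "snd ?P (cmp ?D f e) = cmp ?E (snd ?P f) (snd ?P e)"
      unfolding prod_with_id_arr[OF arr_cmp[OF sitecat_space_prod e f]] prod_with_id_arr[OF e] prod_with_id_arr[OF f]
      using w(1,2) by (simp add: fib_prod_cmp space_stack_cmp prod_with_id_ob space_prod_Ob)
  qed (rule ar)
qed

context universe begin

context
  fixes Y :: "'u topology"
  assumes Y: "cg Y"
begin

private abbreviation "\<D> T \<equiv> space_prod T Y"
private abbreviation "\<Q> T h \<equiv> times_id T Y h"

lemma pair_cmap:
  fixes T S :: "'u topology"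
  assumes T: "cg T" and S: "cg S" and a: "a \<in> cmaps S T" and b: "b \<in> cmaps S Y"
  shows "(\<lambda>s\<in>topspace S. kpt T Y (a s) (b s)) \<in> cmaps S (kprod T Y :: 'u topology)"
proof -
  have "continuous_map S (kprod T Y :: 'u topology) (\<lambda>s. kpt T Y (a s) (b s))"
    using a b by (intro continuous_map_kpt[OF T Y S]) (simp_all add: cmaps_def)
  then have "continuous_map S (kprod T Y :: 'u topology) (\<lambda>s\<in>topspace S. kpt T Y (a s) (b s))"
    by (rule continuous_map_eq) simp
  then show ?thesis by (simp add: cmaps_def)
qed

lemma prod_point_Ob: "cg T \<Longrightarrow> prod_point T Y \<in> Ob (\<D> T)"
  using cg_kprod[of T Y] kpr1_cmap[of T Y] kpr2_cmap[of T Y] Y by (simp add: prod_point_def space_prod_Ob)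

lemma terminal_space_prod:
  assumes T: "cg T"
  shows "terminal (\<D> T) (prod_point T Y)"
  unfolding terminal_def
proof (intro conjI ballI)
  fix w assume w: "w \<in> Ob (\<D> T)"
  let ?S = "fst (fst w)" let ?h = "\<lambda>s\<in>topspace ?S. kpt T Y (snd (fst w) s) (snd (snd w) s)"
  have w': "cg ?S" "snd (fst w) \<in> cmaps ?S T" "snd (snd w) \<in> cmaps ?S Y" using w by (simp_all add: space_prod_Ob)
  note h = pair_cmap[OF T w']
  note im = cmaps_image[OF w'(2)] cmaps_image[OF w'(3)]
  have "compmap ?S (kpr1 T Y :: 'u \<Rightarrow> 'u) ?h = snd (fst w)"
    by (rule cmaps_ext[OF compmap_cmaps[OF h kpr1_cmap[OF T Y]] w'(2)]) (simp add: compmap_apply im kpr1_kpt[OF T Y])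
  moreover have "compmap ?S (kpr2 T Y :: 'u \<Rightarrow> 'u) ?h = snd (snd w)"
    by (rule cmaps_ext[OF compmap_cmaps[OF h kpr2_cmap[OF T Y]] w'(3)]) (simp add: compmap_apply im kpr2_kpt[OF T Y])
  ultimately have A: "arr (\<D> T) w (prod_point T Y) ?h ((fst w, ?h, fst (prod_point T Y)), (snd w, ?h, snd (prod_point T Y)))"
    using w h prod_point_Ob[OF T] unfolding space_prod_arr by (simp add: prod_point_def)
  show "\<exists>!a. a \<in> Ar (\<D> T) \<and> src (\<D> T) a = w \<and> tgt (\<D> T) a = prod_point T Y"
  proof (rule ex1I[of _ "((fst w, ?h, fst (prod_point T Y)), (snd w, ?h, snd (prod_point T Y)))"])
    show "((fst w, ?h, fst (prod_point T Y)), (snd w, ?h, snd (prod_point T Y))) \<in> Ar (\<D> T) \<and>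
      src (\<D> T) ((fst w, ?h, fst (prod_point T Y)), (snd w, ?h, snd (prod_point T Y))) = w \<and>
      tgt (\<D> T) ((fst w, ?h, fst (prod_point T Y)), (snd w, ?h, snd (prod_point T Y))) = prod_point T Y"
      using arrD[OF A] by simp
  next
    fix a assume "a \<in> Ar (\<D> T) \<and> src (\<D> T) a = w \<and> tgt (\<D> T) a = prod_point T Y"
    then have a: "arr (\<D> T) w (prod_point T Y) (bmap (\<D> T) a) a" by (simp add: arr_def)
    let ?k = "bmap (\<D> T) a"
    have k: "?k \<in> cmaps ?S (kprod T Y)" "compmap ?S (kpr1 T Y) ?k = snd (fst w)" "compmap ?S (kpr2 T Y) ?k = snd (snd w)"
      "a = ((fst w, ?k, fst (prod_point T Y)), (snd w, ?k, snd (prod_point T Y)))"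
      using a unfolding space_prod_arr by (simp_all add: prod_point_def)
    have "?k = ?h"
    proof (rule cmaps_ext[OF k(1) h])
      fix s assume s: "s \<in> topspace ?S"
      then show "?k s = ?h s"
        using kpt_kpr[OF T Y cmaps_image[OF k(1) s]] fun_cong[OF k(2), of s] fun_cong[OF k(3), of s] by (simp add: compmap_apply)
    qed
    then show "a = ((fst w, ?h, fst (prod_point T Y)), (snd w, ?h, snd (prod_point T Y)))" using k(4) by simp
  qed
qed (rule prod_point_Ob[OF T])

lemma point_change_arr:
  assumes T: "cg T" and S: "cg S" and h: "h \<in> cmaps T S"
  shows "arr (\<D> S) (fst (\<Q> T h) (prod_point T Y)) (prod_point S Y) (ktimes T S Y h) (point_change T S Y h)"
proof -
  note pp = prod_point_Ob[OF T]
  note kt = ktimes_cmap[OF T S Y h]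
  have "compmap (kprod T Y :: 'u topology) (kpr1 S Y :: 'u \<Rightarrow> 'u) (ktimes T S Y h) = compmap (kprod T Y :: 'u topology) h (kpr1 T Y)"
    by (rule kprod_eqI[OF T Y])
      (use cmaps_image[OF h] in \<open>simp_all add: compmap_extensional compmap_apply kpt_in[OF T Y] ktimes_kpt[OF T Y] kpr1_kpt[OF T Y] kpr1_kpt[OF S Y]\<close>)
  moreover have "compmap (kprod T Y :: 'u topology) (kpr2 S Y :: 'u \<Rightarrow> 'u) (ktimes T S Y h) = kpr2 T Y"
    by (rule kprod_eqI[OF T Y])
      (use cmaps_image[OF h] kpr2_cmap[OF T Y] in \<open>simp_all add: cmaps_def compmap_extensional compmap_apply kpt_in[OF T Y] ktimes_kpt[OF T Y] kpr2_kpt[OF T Y] kpr2_kpt[OF S Y]\<close>)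
  ultimately show ?thesis
    using fm_ob[OF prod_with_id_morphism[OF h] pp] prod_point_Ob[OF S] kt pp
    unfolding space_prod_arr by (simp add: prod_with_id_ob) (simp add: prod_point_def point_change_def)
qed


context
  fixes \<X> :: "('u, 'o, 'm) fibcat"
  assumes X: "fibered_in_groupoids \<X>"
begin

private abbreviation "\<M> \<equiv> map_stack (space_stack Y :: ('u, _, _) fibcat) \<X>"

definition map_arrow where
  "map_arrow m n h \<eta> \<longleftrightarrow> two_morphism (\<D> (fst m)) \<X> (snd m) (fib_comp (\<D> (fst m)) (snd n) (\<Q> (fst m) h)) \<eta>"

lemma map_stack_Ob: "m \<in> Ob \<M> \<longleftrightarrow> cg (fst m) \<and> fib_morphism (\<D> (fst m)) \<X> (snd m)"
  by (cases m) (simp add: map_stack_def Let_def)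

lemma map_stack_base [simp]: "base \<M> m = fst m"
  by (simp add: map_stack_def Let_def)

lemma map_stack_arr: "arr \<M> m n h e \<longleftrightarrow> m \<in> Ob \<M> \<and> n \<in> Ob \<M> \<and> h \<in> cmaps (fst m) (fst n) \<and>
    (\<exists>\<eta>. e = (m, (h, \<eta>), n) \<and> map_arrow m n h \<eta>)"
  by (cases m; cases n; cases e) (auto simp: map_stack_Ob arr_def map_arrow_def map_stack_def Let_def)

lemma map_stack_ident: "ident \<M> m = (m, (idmap (fst m), \<lambda>w\<in>Ob (\<D> (fst m)). ident \<X> (fst (snd m) w)), m)"
  by (cases m) (simp add: map_stack_def Let_def)

lemma map_stack_cmp: "cmp \<M> (n', (k, \<theta>), r) (m, (h, \<eta>), n) =
    (m, (compmap (fst m) k h, \<lambda>w\<in>Ob (\<D> (fst m)). cmp \<X> (\<theta> (fst (\<Q> (fst m) h) w)) (\<eta> w)), r)"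
  by (cases m) (simp add: map_stack_def Let_def compmap_def)

lemma map_arrow_at:
  assumes "map_arrow m n h \<eta>" "w \<in> Ob (\<D> (fst m))"
  shows "arr \<X> (fst (snd m) w) (fst (snd n) (fst (\<Q> (fst m) h) w)) (idmap (fst (fst w))) (\<eta> w)"
  using tm_arr[OF assms(1)[unfolded map_arrow_def] assms(2)] assms(2) by (simp add: fib_comp_simps)

lemma map_arrow_natural:
  assumes "map_arrow m n h \<eta>" "arr (\<D> (fst m)) w w' k a"
  shows "cmp \<X> (\<eta> w') (snd (snd m) a) = cmp \<X> (snd (snd n) (snd (\<Q> (fst m) h) a)) (\<eta> w)"
  using tm_natural[OF assms(1)[unfolded map_arrow_def] assms(2)] arrD(1)[OF assms(2)] by (simp add: fib_comp_simps)

lemma map_arrowI: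
  assumes "\<eta> \<in> extensional (Ob (\<D> (fst m)))"
    and "\<And>w. w \<in> Ob (\<D> (fst m)) \<Longrightarrow> arr \<X> (fst (snd m) w) (fst (snd n) (fst (\<Q> (fst m) h) w)) (idmap (fst (fst w))) (\<eta> w)"
    and "\<And>w w' k a. arr (\<D> (fst m)) w w' k a \<Longrightarrow>
      cmp \<X> (\<eta> w') (snd (snd m) a) = cmp \<X> (snd (snd n) (snd (\<Q> (fst m) h) a)) (\<eta> w)"
  shows "map_arrow m n h \<eta>"
  unfolding map_arrow_def
proof (rule two_morphismI[OF assms(1)])
  fix w assume "w \<in> Ob (\<D> (fst m))"
  then show "arr \<X> (fst (snd m) w) (fst (fib_comp (\<D> (fst m)) (snd n) (\<Q> (fst m) h)) w) (idmap (base (\<D> (fst m)) w)) (\<eta> w)"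
    using assms(2)[of w] by (simp add: fib_comp_simps)
next
  fix w w' k a assume "arr (\<D> (fst m)) w w' k a"
  from assms(3)[OF this] arrD(1)[OF this]
  show "cmp \<X> (\<eta> w') (snd (snd m) a) = cmp \<X> (snd (fib_comp (\<D> (fst m)) (snd n) (\<Q> (fst m) h)) a) (\<eta> w)"
    by (simp add: fib_comp_simps)
qed

lemma prod_with_id_idmap:
  "w \<in> Ob (\<D> T) \<Longrightarrow> fst (\<Q> T (idmap T)) w = w"
  "arr (\<D> T) w w' k a \<Longrightarrow> snd (\<Q> T (idmap T)) a = a"
proof -
  show o: "fst (\<Q> T (idmap T)) w = w" if "w \<in> Ob (\<D> T)" for w
    using that compmap_idmap_left[of "snd (fst w)" "fst (fst w)" T] by (simp add: prod_with_id_ob space_prod_Ob prod_eq_iff)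
  assume a: "arr (\<D> T) w w' k a"
  then have "w \<in> Ob (\<D> T)" "w' \<in> Ob (\<D> T)" "a = ((fst w, k, fst w'), (snd w, k, snd w'))" by (simp_all add: space_prod_arr)
  then show "snd (\<Q> T (idmap T)) a = a" using prod_with_id_arr[OF a, of "idmap T"] o by simp
qed

lemma prod_with_id_compmap:
  assumes h: "h \<in> cmaps T S"
  shows "w \<in> Ob (\<D> T) \<Longrightarrow> fst (\<Q> T (compmap T k h)) w = fst (\<Q> S k) (fst (\<Q> T h) w)"
    "arr (\<D> T) w w' l a \<Longrightarrow> snd (\<Q> T (compmap T k h)) a = snd (\<Q> S k) (snd (\<Q> T h) a)"
proof -
  show o: "fst (\<Q> T (compmap T k h)) w = fst (\<Q> S k) (fst (\<Q> T h) w)" if w: "w \<in> Ob (\<D> T)" for w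
    using w fm_ob[OF prod_with_id_morphism[OF h] w] compmap_assoc[of "snd (fst w)" "fst (fst w)" T k h]
    by (simp add: prod_with_id_ob) (simp add: space_prod_Ob)
  assume a: "arr (\<D> T) w w' l a"
  have w: "w \<in> Ob (\<D> T)" "w' \<in> Ob (\<D> T)" using a by (simp_all add: space_prod_arr)
  have s: "snd (fst (\<Q> S k) (fst (\<Q> T h) w)) = snd w" "snd (fst (\<Q> T h) w) = snd w" if "w \<in> Ob (\<D> T)" for w
    using that fm_ob[OF prod_with_id_morphism[OF h] that] by (simp_all add: prod_with_id_ob)
  show "snd (\<Q> T (compmap T k h)) a = snd (\<Q> S k) (snd (\<Q> T h) a)"
    unfolding prod_with_id_arr[OF fm_arr[OF prod_with_id_morphism[OF h] a]] unfolding prod_with_id_arr[OF a] o[OF w(1)] o[OF w(2)]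
    using s[OF w(1)] s[OF w(2)] by simp
qed

lemma map_arrow_cmp:
  assumes m: "m \<in> Ob \<M>" and n: "n \<in> Ob \<M>" and r: "r \<in> Ob \<M>" and h: "h \<in> cmaps (fst m) (fst n)" and k: "k \<in> cmaps (fst n) (fst r)"
    and e: "map_arrow m n h \<eta>" and t: "map_arrow n r k \<theta>"
  shows "map_arrow m r (compmap (fst m) k h) (\<lambda>w\<in>Ob (\<D> (fst m)). cmp \<X> (\<theta> (fst (\<Q> (fst m) h) w)) (\<eta> w))"
proof (rule map_arrowI)
  note SX = fibered_sitecat[OF X] and Q = prod_with_id_morphism[OF h, of Y]
  have mF: "fib_morphism (\<D> (fst m)) \<X> (snd m)" and nF: "fib_morphism (\<D> (fst n)) \<X> (snd n)" and rF: "fib_morphism (\<D> (fst r)) \<X> (snd r)"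
    using m n r by (simp_all add: map_stack_Ob)
  have th: "arr \<X> (fst (snd n) (fst (\<Q> (fst m) h) w)) (fst (snd r) (fst (\<Q> (fst m) (compmap (fst m) k h)) w)) (idmap (fst (fst w))) (\<theta> (fst (\<Q> (fst m) h) w))"
    if w: "w \<in> Ob (\<D> (fst m))" for w
    using map_arrow_at[OF t fm_ob[OF Q w]] fm_base[OF Q w] prod_with_id_compmap(1)[OF h w, of k] by simp
  fix w assume w: "w \<in> Ob (\<D> (fst m))"
  have bw: "base \<X> (fst (snd m) w) = fst (fst w)" using fm_base[OF mF w] by simp
  from arr_cmp[OF SX map_arrow_at[OF e w] th[OF w]] w
  show "arr \<X> (fst (snd m) w) (fst (snd r) (fst (\<Q> (fst m) (compmap (fst m) k h)) w)) (idmap (fst (fst w)))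
      ((\<lambda>w\<in>Ob (\<D> (fst m)). cmp \<X> (\<theta> (fst (\<Q> (fst m) h) w)) (\<eta> w)) w)"
    using compmap_idmap_left[of "idmap (fst (fst w))" "fst (fst w)" "fst (fst w)"] by (simp add: bw idmap_cmaps)
next
  note SX = fibered_sitecat[OF X] and Q = prod_with_id_morphism[OF h, of Y]
  have mF: "fib_morphism (\<D> (fst m)) \<X> (snd m)" and nF: "fib_morphism (\<D> (fst n)) \<X> (snd n)" and rF: "fib_morphism (\<D> (fst r)) \<X> (snd r)"
    using m n r by (simp_all add: map_stack_Ob)
  fix w w' l a assume a: "arr (\<D> (fst m)) w w' l a"
  have w: "w \<in> Ob (\<D> (fst m))" "w' \<in> Ob (\<D> (fst m))" using a by (simp_all add: space_prod_arr)
  note Qa = fm_arr[OF Q a]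
  note th = map_arrow_at[OF t fm_ob[OF Q w(1)]] map_arrow_at[OF t fm_ob[OF Q w(2)]]
  note et = map_arrow_at[OF e w(1)] map_arrow_at[OF e w(2)]
  note ma = fm_arr[OF mF a] and na = fm_arr[OF nF Qa] and ra = fm_arr[OF rF fm_arr[OF prod_with_id_morphism[OF k] Qa]]
  have "cmp \<X> (cmp \<X> (\<theta> (fst (\<Q> (fst m) h) w')) (\<eta> w')) (snd (snd m) a)
    = cmp \<X> (\<theta> (fst (\<Q> (fst m) h) w')) (cmp \<X> (snd (snd n) (snd (\<Q> (fst m) h) a)) (\<eta> w))"
    using cmp_assoc[OF SX ma et(2) th(2)] map_arrow_natural[OF e a] by simp
  also have "\<dots> = cmp \<X> (cmp \<X> (snd (snd r) (snd (\<Q> (fst n) k) (snd (\<Q> (fst m) h) a))) (\<theta> (fst (\<Q> (fst m) h) w))) (\<eta> w)"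
    using cmp_assoc[OF SX et(1) na th(2)] map_arrow_natural[OF t Qa] by simp
  also have "\<dots> = cmp \<X> (snd (snd r) (snd (\<Q> (fst m) (compmap (fst m) k h)) a)) (cmp \<X> (\<theta> (fst (\<Q> (fst m) h) w)) (\<eta> w))"
    using cmp_assoc[OF SX et(1) th(1) ra] prod_with_id_compmap(2)[OF h a, of k] by simp
  finally show "cmp \<X> ((\<lambda>w\<in>Ob (\<D> (fst m)). cmp \<X> (\<theta> (fst (\<Q> (fst m) h) w)) (\<eta> w)) w') (snd (snd m) a) =
      cmp \<X> (snd (snd r) (snd (\<Q> (fst m) (compmap (fst m) k h)) a)) ((\<lambda>w\<in>Ob (\<D> (fst m)). cmp \<X> (\<theta> (fst (\<Q> (fst m) h) w)) (\<eta> w)) w)"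
    using w by simp
qed simp

lemma map_arrow_identity:
  assumes F: "fib_morphism (\<D> (fst m)) \<X> (snd m)"
    and ob: "\<And>w. w \<in> Ob (\<D> (fst m)) \<Longrightarrow> fst (snd n) (fst (\<Q> (fst m) h) w) = fst (snd m) w"
    and ar: "\<And>w w' k a. arr (\<D> (fst m)) w w' k a \<Longrightarrow> snd (snd n) (snd (\<Q> (fst m) h) a) = snd (snd m) a"
  shows "map_arrow m n h (\<lambda>w\<in>Ob (\<D> (fst m)). ident \<X> (fst (snd m) w))"
proof (rule map_arrowI)
  note SX = fibered_sitecat[OF X]
  show "arr \<X> (fst (snd m) w) (fst (snd n) (fst (\<Q> (fst m) h) w)) (idmap (fst (fst w))) ((\<lambda>w\<in>Ob (\<D> (fst m)). ident \<X> (fst (snd m) w)) w)"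
    if w: "w \<in> Ob (\<D> (fst m))" for w
    using arr_ident[OF SX fm_ob[OF F w]] fm_base[OF F w] w ob[OF w] by simp
  fix w w' k a assume a: "arr (\<D> (fst m)) w w' k a"
  then have "w \<in> Ob (\<D> (fst m))" "w' \<in> Ob (\<D> (fst m))" by (simp_all add: space_prod_arr)
  then show "cmp \<X> ((\<lambda>w\<in>Ob (\<D> (fst m)). ident \<X> (fst (snd m) w)) w') (snd (snd m) a) =
      cmp \<X> (snd (snd n) (snd (\<Q> (fst m) h) a)) ((\<lambda>w\<in>Ob (\<D> (fst m)). ident \<X> (fst (snd m) w)) w)"
    using cmp_ident_left[OF SX fm_arr[OF F a]] cmp_ident_right[OF SX fm_arr[OF F a]] ar[OF a] by simp
qed simp

lemma map_arrow_ident: "m \<in> Ob \<M> \<Longrightarrow> map_arrow m m (idmap (fst m)) (\<lambda>w\<in>Ob (\<D> (fst m)). ident \<X> (fst (snd m) w))"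
  by (rule map_arrow_identity) (simp_all add: map_stack_Ob prod_with_id_idmap)

lemma map_arrow_extensional: "map_arrow m n h \<eta> \<Longrightarrow> \<eta> \<in> extensional (Ob (\<D> (fst m)))"
  unfolding map_arrow_def by (rule tm_extensional)

lemma sitecat_map_stack: "sitecat \<M>"
proof (rule sitecatI)
  fix e assume "e \<in> Ar \<M>"
  then have "arr \<M> (src \<M> e) (tgt \<M> e) (bmap \<M> e) e" by (rule arrI)
  then show "src \<M> e \<in> Ob \<M> \<and> tgt \<M> e \<in> Ob \<M> \<and> bmap \<M> e \<in> cmaps (base \<M> (src \<M> e)) (base \<M> (tgt \<M> e))"
    by (simp add: map_stack_arr)
next
  fix m assume m: "m \<in> Ob \<M>"
  then show "cg (base \<M> m) \<and> arr \<M> m m (idmap (base \<M> m)) (ident \<M> m)"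
    using map_arrow_ident[OF m] by (simp add: map_stack_arr map_stack_ident idmap_cmaps) (simp add: map_stack_Ob)
next
  fix m n r h k a b assume a: "arr \<M> m n h a" and b: "arr \<M> n r k b"
  from a obtain \<eta> where a': "a = (m, (h, \<eta>), n)" "map_arrow m n h \<eta>" "m \<in> Ob \<M>" "n \<in> Ob \<M>" "h \<in> cmaps (fst m) (fst n)"
    unfolding map_stack_arr by blast
  from b obtain \<theta> where b': "b = (n, (k, \<theta>), r)" "map_arrow n r k \<theta>" "r \<in> Ob \<M>" "k \<in> cmaps (fst n) (fst r)"
    unfolding map_stack_arr by blast
  show "arr \<M> m r (compmap (base \<M> m) k h) (cmp \<M> b a)"
    using map_arrow_cmp[OF a'(3,4) b'(3) a'(5) b'(4) a'(2) b'(2)] a' b' compmap_cmaps[OF a'(5) b'(4)]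
    by (simp add: map_stack_arr map_stack_cmp)
next
  fix m n r s h k l a b c assume a: "arr \<M> m n h a" and b: "arr \<M> n r k b" and c: "arr \<M> r s l c"
  from a obtain \<eta> where a': "a = (m, (h, \<eta>), n)" "map_arrow m n h \<eta>" "m \<in> Ob \<M>" "n \<in> Ob \<M>" "h \<in> cmaps (fst m) (fst n)"
    unfolding map_stack_arr by blast
  from b obtain \<theta> where b': "b = (n, (k, \<theta>), r)" "map_arrow n r k \<theta>" "r \<in> Ob \<M>" "k \<in> cmaps (fst n) (fst r)"
    unfolding map_stack_arr by blast
  from c obtain \<mu> where c': "c = (r, (l, \<mu>), s)" "map_arrow r s l \<mu>" "s \<in> Ob \<M>"
    unfolding map_stack_arr by blast
  have "cmp \<X> (\<mu> (fst (\<Q> (fst n) k) (fst (\<Q> (fst m) h) w))) (cmp \<X> (\<theta> (fst (\<Q> (fst m) h) w)) (\<eta> w)) =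
      cmp \<X> (cmp \<X> (\<mu> (fst (\<Q> (fst n) k) (fst (\<Q> (fst m) h) w))) (\<theta> (fst (\<Q> (fst m) h) w))) (\<eta> w)"
    if w: "w \<in> Ob (\<D> (fst m))" for w
  proof -
    note w1 = fm_ob[OF prod_with_id_morphism[OF a'(5)] w]
    note w2 = fm_ob[OF prod_with_id_morphism[OF b'(4)] w1]
    show ?thesis
      by (rule cmp_assoc[OF fibered_sitecat[OF X] map_arrow_at[OF a'(2) w] map_arrow_at[OF b'(2) w1] map_arrow_at[OF c'(2) w2]])
  qed
  then show "cmp \<M> c (cmp \<M> b a) = cmp \<M> (cmp \<M> c b) a"
    unfolding a'(1) b'(1) c'(1)
    using fm_ob[OF prod_with_id_morphism[OF a'(5)]] prod_with_id_compmap(1)[OF a'(5), of _ k] compmap_assoc[OF a'(5), of l k]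
    by (simp add: map_stack_cmp restrict_def fun_eq_iff)
next
  fix m n h a assume a: "arr \<M> m n h a"
  from a obtain \<eta> where a': "a = (m, (h, \<eta>), n)" "map_arrow m n h \<eta>" "m \<in> Ob \<M>" "n \<in> Ob \<M>" "h \<in> cmaps (fst m) (fst n)"
    unfolding map_stack_arr by blast
  note SX = fibered_sitecat[OF X]
  have "(\<lambda>w\<in>Ob (\<D> (fst m)). cmp \<X> (\<eta> w) (ident \<X> (fst (snd m) w))) = \<eta>"
    by (rule extensionalityI[OF _ map_arrow_extensional[OF a'(2)]]) (simp_all add: cmp_ident_right[OF SX map_arrow_at[OF a'(2)]])
  moreover have "(\<lambda>w\<in>Ob (\<D> (fst m)). cmp \<X> (ident \<X> (fst (snd n) (fst (\<Q> (fst m) h) w))) (\<eta> w)) = \<eta>"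
    by (rule extensionalityI[OF _ map_arrow_extensional[OF a'(2)]]) (simp_all add: cmp_ident_left[OF SX map_arrow_at[OF a'(2)]])
  ultimately show "cmp \<M> a (ident \<M> m) = a \<and> cmp \<M> (ident \<M> n) a = a"
    using compmap_idmap_left[OF a'(5)] compmap_idmap_right[OF a'(5)] fm_ob[OF prod_with_id_morphism[OF a'(5)]]
    by (simp add: a'(1) map_stack_ident map_stack_cmp prod_with_id_idmap cong: restrict_cong)
qed

text \<open>Evaluation at the universal point of \<open>T \<times> Y\<close>.\<close>

definition map_power :: "(('u, ('u, 'u) sobj, ('u, 'u) sarr, 'o, 'm) mobj, ('u, ('u, 'u) sobj, ('u, 'u) sarr, 'o, 'm) marr, 'o, 'm) fibfun" where
  "map_power = (\<lambda>m. fst (snd m) (prod_point (fst m) Y),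
     \<lambda>(m, (h, \<eta>), n). cmp \<X> (snd (snd n) (point_change (fst m) (fst n) Y h)) (\<eta> (prod_point (fst m) Y)))"

lemma map_power_simps:
  "fst map_power m = fst (snd m) (prod_point (fst m) Y)"
  "snd map_power (m, (h, \<eta>), n) = cmp \<X> (snd (snd n) (point_change (fst m) (fst n) Y h)) (\<eta> (prod_point (fst m) Y))"
  by (simp_all add: map_power_def)

lemma map_power_pieces:
  assumes m: "m \<in> Ob \<M>" and n: "n \<in> Ob \<M>" and h: "h \<in> cmaps (fst m) (fst n)"
  shows "arr \<X> (fst (snd n) (fst (\<Q> (fst m) h) (prod_point (fst m) Y))) (fst map_power n) (ktimes (fst m) (fst n) Y h)
      (snd (snd n) (point_change (fst m) (fst n) Y h))"
    "base \<X> (fst (snd n) (fst (\<Q> (fst m) h) (prod_point (fst m) Y))) = kprod (fst m) Y"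
    "base \<X> (fst map_power m) = kprod (fst m) Y" "fst map_power m \<in> Ob \<X>"
    "base (\<D> (fst m)) (prod_point (fst m) Y) = kprod (fst m) Y"
proof -
  have m': "cg (fst m)" "fib_morphism (\<D> (fst m)) \<X> (snd m)" and n': "cg (fst n)" "fib_morphism (\<D> (fst n)) \<X> (snd n)"
    using m n by (simp_all add: map_stack_Ob)
  note pp = prod_point_Ob[OF m'(1)]
  show d: "base (\<D> (fst m)) (prod_point (fst m) Y) = kprod (fst m) Y" by (simp add: prod_point_def)
  show "arr \<X> (fst (snd n) (fst (\<Q> (fst m) h) (prod_point (fst m) Y))) (fst map_power n) (ktimes (fst m) (fst n) Y h)
      (snd (snd n) (point_change (fst m) (fst n) Y h))"
    using fm_arr[OF n'(2) point_change_arr[OF m'(1) n'(1) h]] by (simp add: map_power_simps)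
  show "base \<X> (fst (snd n) (fst (\<Q> (fst m) h) (prod_point (fst m) Y))) = kprod (fst m) Y"
    using fm_base[OF n'(2) fm_ob[OF prod_with_id_morphism[OF h] pp]] fm_base[OF prod_with_id_morphism[OF h] pp] d by simp
  show "base \<X> (fst map_power m) = kprod (fst m) Y" "fst map_power m \<in> Ob \<X>"
    using fm_base[OF m'(2) pp] fm_ob[OF m'(2) pp] d by (simp_all add: map_power_simps)
qed

lemma map_power_arr:
  assumes m: "m \<in> Ob \<M>" and n: "n \<in> Ob \<M>" and h: "h \<in> cmaps (fst m) (fst n)"
    and g: "arr \<X> (fst map_power m) (fst (snd n) (fst (\<Q> (fst m) h) (prod_point (fst m) Y))) (idmap (kprod (fst m) Y)) \<gamma>"
  shows "arr \<X> (fst map_power m) (fst map_power n) (ktimes (fst m) (fst n) Y h)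
     (cmp \<X> (snd (snd n) (point_change (fst m) (fst n) Y h)) \<gamma>)"
proof -
  note p = map_power_pieces[OF m n h]
  show ?thesis
    using arr_cmp[OF fibered_sitecat[OF X] g p(1)] compmap_idmap_right[OF arr_bmap[OF fibered_sitecat[OF X] p(1)]] p(2,3) by simp
qed

lemma map_arrow_at_point:
  assumes m: "m \<in> Ob \<M>" and e: "map_arrow m n h \<eta>"
  shows "arr \<X> (fst map_power m) (fst (snd n) (fst (\<Q> (fst m) h) (prod_point (fst m) Y))) (idmap (kprod (fst m) Y)) (\<eta> (prod_point (fst m) Y))"
  using map_arrow_at[OF e prod_point_Ob] m by (simp add: map_stack_Ob map_power_simps) (simp add: prod_point_def)

text \<open>The universal point is terminal, so evaluation there is the Yoneda correspondence.\<close>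

lemma power_map_stack: "is_power Y \<X> \<M> map_power"
proof (rule is_powerI[OF sitecat_map_stack])
  note SX = fibered_sitecat[OF X]
  fix m assume m: "m \<in> Ob \<M>"
  then have m': "cg (fst m)" "fib_morphism (\<D> (fst m)) \<X> (snd m)" by (simp_all add: map_stack_Ob)
  note pp = prod_point_Ob[OF m'(1)]
  note i = idmap_cmaps[of "fst m"]
  note p = map_power_pieces[OF m m i]
  have "point_change (fst m) (fst m) Y (idmap (fst m)) = ident (\<D> (fst m)) (prod_point (fst m) Y)"
    using kpr1_cmap[OF m'(1) Y]
    by (simp add: point_change_def prod_point_def fib_prod_ident space_stack_ident ktimes_idmap[OF Y m'(1)] compmap_idmap_left)
  then have "snd map_power (ident \<M> m) = ident \<X> (fst map_power m)"
    using pp fm_ident[OF m'(2) pp] cmp_ident_left[OF SX arr_ident[OF SX p(4)]] by (simp add: map_stack_ident map_power_simps)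
  then show "fst map_power m \<in> Ob \<X> \<and> base \<X> (fst map_power m) = kprod (base \<M> m) Y \<and>
      snd map_power (ident \<M> m) = ident \<X> (fst map_power m)" using p by simp
next
  fix m n h a assume a: "arr \<M> m n h a"
  from a obtain \<eta> where a': "a = (m, (h, \<eta>), n)" "map_arrow m n h \<eta>" "m \<in> Ob \<M>" "n \<in> Ob \<M>" "h \<in> cmaps (fst m) (fst n)"
    unfolding map_stack_arr by blast
  show "arr \<X> (fst map_power m) (fst map_power n) (ktimes (base \<M> m) (base \<M> n) Y h) (snd map_power a)"
    using map_power_arr[OF a'(3-5) map_arrow_at_point[OF a'(3,2)]] by (simp add: a'(1) map_power_simps(2))
next
  note SX = fibered_sitecat[OF X]
  fix m n r h k a b assume a: "arr \<M> m n h a" and b: "arr \<M> n r k b"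
  from a obtain \<eta> where a': "a = (m, (h, \<eta>), n)" "map_arrow m n h \<eta>" "m \<in> Ob \<M>" "n \<in> Ob \<M>" "h \<in> cmaps (fst m) (fst n)"
    unfolding map_stack_arr by blast
  from b obtain \<theta> where b': "b = (n, (k, \<theta>), r)" "map_arrow n r k \<theta>" "r \<in> Ob \<M>" "k \<in> cmaps (fst n) (fst r)"
    unfolding map_stack_arr by blast
  have T: "cg (fst m)" "cg (fst n)" "cg (fst r)"
    and F: "fib_morphism (\<D> (fst n)) \<X> (snd n)" "fib_morphism (\<D> (fst r)) \<X> (snd r)"
    using a'(3,4) b'(3) by (simp_all add: map_stack_Ob)
  let ?d = "prod_point (fst m) Y" and ?e = "prod_point (fst n) Y"
  let ?Qd = "fst (\<Q> (fst m) h) ?d" and ?c = "point_change (fst m) (fst n) Y h" and ?c' = "point_change (fst n) (fst r) Y k"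
  note pp = prod_point_Ob[OF T(1)]
  note Q = prod_with_id_morphism[OF a'(5), of Y] and Q' = prod_with_id_morphism[OF b'(4), of Y]
  note c = point_change_arr[OF T(1,2) a'(5)] and c' = point_change_arr[OF T(2,3) b'(4)]
  note Gc = fm_arr[OF F(1) c] and Hc' = fm_arr[OF F(2) c'] and HQc = fm_arr[OF F(2) fm_arr[OF Q' c]]
  note ed = map_arrow_at[OF a'(2) pp] and te = map_arrow_at[OF b'(2) prod_point_Ob[OF T(2)]] and tQ = map_arrow_at[OF b'(2) fm_ob[OF Q pp]]
  have cc: "cmp (\<D> (fst r)) ?c' (snd (\<Q> (fst n) k) ?c) = point_change (fst m) (fst r) Y (compmap (fst m) k h)"
  proof -
    have "compmap (kprod (fst m) Y :: 'u topology) (kpr1 (fst n) Y :: 'u \<Rightarrow> 'u) (ktimes (fst m) (fst n) Y h) = compmap (kprod (fst m) Y :: 'u topology) h (kpr1 (fst m) Y)"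
      using c by (simp add: space_prod_arr prod_with_id_ob[OF pp]) (simp add: prod_point_def)
    moreover have qd: "?Qd = ((kprod (fst m) Y, compmap (kprod (fst m) Y) h (kpr1 (fst m) Y)), (kprod (fst m) Y, kpr2 (fst m) Y))"
      using prod_with_id_ob[OF pp, of h] by (simp add: prod_point_def)
    moreover have qq: "fst (\<Q> (fst n) k) ?Qd =
        ((kprod (fst m) Y, compmap (kprod (fst m) Y) (compmap (fst m) k h) (kpr1 (fst m) Y)), (kprod (fst m) Y, kpr2 (fst m) Y))"
      using prod_with_id_ob[OF fm_ob[OF Q pp], of k] compmap_assoc[OF kpr1_cmap[OF T(1) Y], of k h] qd by simp
    ultimately show ?thesis
      using compmap_assoc[OF kpr1_cmap[OF T(1) Y], of k h] qd
      unfolding prod_with_id_arr[OF c] qq prod_with_id_ob[OF prod_point_Ob[OF T(2)]]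
      by (simp add: point_change_def prod_point_def fib_prod_cmp space_stack_cmp ktimes_compmap[OF Y T(1) a'(5) T(2)])
  qed
  have "cmp \<X> (snd map_power b) (snd map_power a) = cmp \<X> (cmp \<X> (snd (snd r) ?c') (\<theta> ?e)) (cmp \<X> (snd (snd n) ?c) (\<eta> ?d))"
    by (simp add: a'(1) b'(1) map_power_simps)
  also have "\<dots> = cmp \<X> (snd (snd r) ?c') (cmp \<X> (cmp \<X> (\<theta> ?e) (snd (snd n) ?c)) (\<eta> ?d))"
    using cmp_assoc[OF SX arr_cmp[OF SX ed Gc] te Hc'] cmp_assoc[OF SX ed Gc te] by simp
  also have "\<dots> = cmp \<X> (snd (snd r) ?c') (cmp \<X> (cmp \<X> (snd (snd r) (snd (\<Q> (fst n) k) ?c)) (\<theta> ?Qd)) (\<eta> ?d))"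
    using map_arrow_natural[OF b'(2) c] by simp
  also have "\<dots> = cmp \<X> (cmp \<X> (snd (snd r) ?c') (snd (snd r) (snd (\<Q> (fst n) k) ?c))) (cmp \<X> (\<theta> ?Qd) (\<eta> ?d))"
    using cmp_assoc[OF SX ed tQ HQc] cmp_assoc[OF SX arr_cmp[OF SX ed tQ] HQc Hc'] by simp
  also have "\<dots> = snd map_power (cmp \<M> b a)"
    using fm_cmp[OF F(2) fm_arr[OF Q' c] c'] cc pp by (simp add: a'(1) b'(1) map_stack_cmp map_power_simps)
  finally show "snd map_power (cmp \<M> b a) = cmp \<X> (snd map_power b) (snd map_power a)" by simp
next
  note SX = fibered_sitecat[OF X]
  fix m n h g assume m: "m \<in> Ob \<M>" and n: "n \<in> Ob \<M>" and h0: "h \<in> cmaps (base \<M> m) (base \<M> n)"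
    and g0: "arr \<X> (fst map_power m) (fst map_power n) (ktimes (base \<M> m) (base \<M> n) Y h) g"
  have h: "h \<in> cmaps (fst m) (fst n)" and g: "arr \<X> (fst map_power m) (fst map_power n) (ktimes (fst m) (fst n) Y h) g"
    using h0 g0 by simp_all
  have T: "cg (fst m)" "fib_morphism (\<D> (fst m)) \<X> (snd m)" "fib_morphism (\<D> (fst n)) \<X> (snd n)"
    using m n by (simp_all add: map_stack_Ob)
  note p = map_power_pieces[OF m n h]
  let ?d = "prod_point (fst m) Y" and ?G = "fib_comp (\<D> (fst m)) (snd n) (\<Q> (fst m) h)"
  note pp = prod_point_Ob[OF T(1)]
  have ex: "\<exists>!c. arr \<X> (fst map_power m) (fst (snd n) (fst (\<Q> (fst m) h) ?d)) (idmap (kprod (fst m) Y)) c \<and>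
      cmp \<X> (snd (snd n) (point_change (fst m) (fst n) Y h)) c = g"
    by (rule fib_factor[OF X p(1) g])
      (use p(2,3) compmap_idmap_right[OF arr_bmap[OF SX p(1)]] in \<open>simp_all add: idmap_cmaps\<close>)
  obtain \<gamma> where \<gamma>: "arr \<X> (fst map_power m) (fst (snd n) (fst (\<Q> (fst m) h) ?d)) (idmap (kprod (fst m) Y)) \<gamma>"
    "cmp \<X> (snd (snd n) (point_change (fst m) (fst n) Y h)) \<gamma> = g" using ex1_implies_ex[OF ex] by blast
  have ex2: "\<exists>!\<theta>. two_morphism (\<D> (fst m)) \<X> (snd m) ?G \<theta> \<and> \<theta> ?d = \<gamma>"
    by (rule yoneda_transformation[OF sitecat_space_prod terminal_space_prod[OF T(1)] X T(2)
          fib_morphism_comp[OF sitecat_space_prod prod_with_id_morphism[OF h] T(3)]])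
      (use \<gamma>(1) pp p(5) in \<open>simp add: fib_comp_simps map_power_simps\<close>)
  obtain \<theta> where \<theta>: "map_arrow m n h \<theta>" "\<theta> ?d = \<gamma>" using ex1_implies_ex[OF ex2] unfolding map_arrow_def by blast
  show "\<exists>!a. arr \<M> m n h a \<and> snd map_power a = g"
  proof (rule ex1I[of _ "(m, (h, \<theta>), n)"])
    show "arr \<M> m n h (m, (h, \<theta>), n) \<and> snd map_power (m, (h, \<theta>), n) = g"
      using m n h \<theta> \<gamma>(2) by (simp add: map_stack_arr map_power_simps)
  next
    fix a assume a: "arr \<M> m n h a \<and> snd map_power a = g"
    then obtain \<mu> where u: "a = (m, (h, \<mu>), n)" "map_arrow m n h \<mu>" unfolding map_stack_arr by blast
    have "\<mu> ?d = \<gamma>"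
      by (rule ex1_unique[OF ex]) (use map_arrow_at_point[OF m u(2)] \<gamma> a u(1) in \<open>simp_all add: map_power_simps(2)\<close>)
    then have "\<mu> = \<theta>" using ex1_unique[OF ex2, of \<mu> \<theta>] u(2) \<theta> unfolding map_arrow_def by simp
    then show "a = (m, (h, \<theta>), n)" using u(1) by simp
  qed
next
  fix T :: "'u topology" and x assume T: "cg T" and x: "x \<in> Ob \<X>" "base \<X> x = kprod T Y"
  have "base \<X> x = base (\<D> T) (prod_point T Y)" using x(2) by (simp add: prod_point_def)
  then obtain F where F: "fib_morphism (\<D> T) \<X> F" "fst F (prod_point T Y) = x"
    using yoneda_functor[OF sitecat_space_prod terminal_space_prod[OF T] X x(1)] by blast
  then show "\<exists>m\<in>Ob \<M>. base \<M> m = T \<and> fst map_power m = x"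
    using T by (intro bexI[of _ "(T, F)"]) (simp_all add: map_stack_Ob map_power_simps)
qed
end
end
end

section \<open>The pushforward of a morphism to mapping stacks\<close>

context universe begin

context
  fixes Y :: "'u topology"
  assumes Y: "cg Y" "Hausdorff_space Y"
begin

private abbreviation "\<K> T \<equiv> space_prod T Y"
private abbreviation "\<L> T h \<equiv> times_id T Y h"

context
  fixes X :: "'b topology"
begin

private abbreviation "\<J> \<equiv> space_stack X :: ('u, _, _) fibcat"
private abbreviation "\<N> \<equiv> space_stack (mapping_space Y X) :: ('u, _, _) fibcat"
private abbreviation "\<H> \<equiv> map_stack (space_stack Y :: ('u, _, _) fibcat) \<J>"
private abbreviation "\<E> \<equiv> exponential_law Y X"

lemma uncurried_ob: "w \<in> Ob (\<K> T) \<Longrightarrow>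
    fst (uncurried Y T f) w = (fst (fst w), \<lambda>s\<in>topspace (fst (fst w)). f (snd (fst w) s) (snd (snd w) s))"
  by (cases w) (auto simp: uncurried_def Let_def split: prod.splits)

lemma uncurried_arr: "arr (\<K> T) w w' k e \<Longrightarrow>
    snd (uncurried Y T f) e = (fst (uncurried Y T f) w, k, fst (uncurried Y T f) w')"
proof -
  assume e: "arr (\<K> T) w w' k e"
  have w: "w \<in> Ob (\<K> T)" "w' \<in> Ob (\<K> T)" using e by (simp_all add: space_prod_arr)
  show ?thesis using arrD[OF e] w by (simp add: uncurried_def Let_def)
qed

lemma uncurried_morphism:
  assumes T: "cg T" and f: "f \<in> cmaps T (mapping_space Y X)"
  shows "fib_morphism (\<K> T) \<J> (uncurried Y T f)"
proof -
  have ob: "fst (uncurried Y T f) w \<in> Ob \<J>" if w: "w \<in> Ob (\<K> T)" for w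
  proof -
    have w': "cg (fst (fst w))" "snd (fst w) \<in> cmaps (fst (fst w)) T" "snd (snd w) \<in> cmaps (fst (fst w)) Y"
      using w by (simp_all add: space_prod_Ob)
    note p = pair_cmap[OF Y(1) T w']
    have "(\<lambda>s\<in>topspace (fst (fst w)). f (snd (fst w) s) (snd (snd w) s)) =
        compmap (fst (fst w)) (kuncurry T Y f) (\<lambda>s\<in>topspace (fst (fst w)). kpt T Y (snd (fst w) s) (snd (snd w) s))"
      using cmaps_image[OF w'(2)] cmaps_image[OF w'(3)]
      by (auto simp: fun_eq_iff compmap_def compose_def kuncurry_def kpt_in[OF T Y(1)] kpr1_kpt[OF T Y(1)] kpr2_kpt[OF T Y(1)])
    then show ?thesis using w'(1) compmap_cmaps[OF p kuncurry_cmap[OF T Y(1) f]] by (simp add: uncurried_ob[OF w] space_stack_Ob)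
  qed
  show ?thesis
  proof (rule fib_morphismI[OF sitecat_space_prod])
    show "fst (uncurried Y T f) \<in> extensional (Ob (\<K> T))" "snd (uncurried Y T f) \<in> extensional (Ar (\<K> T))"
      by (simp_all add: uncurried_def Let_def)
  next
    fix w assume w: "w \<in> Ob (\<K> T)"
    have "snd (uncurried Y T f) (ident (\<K> T) w) = ident \<J> (fst (uncurried Y T f) w)"
      using uncurried_arr[OF arr_ident[OF sitecat_space_prod w]] w by (simp add: space_stack_ident uncurried_ob)
    then show "fst (uncurried Y T f) w \<in> Ob \<J> \<and> base \<J> (fst (uncurried Y T f) w) = base (\<K> T) w \<and>
        snd (uncurried Y T f) (ident (\<K> T) w) = ident \<J> (fst (uncurried Y T f) w)"
      using ob[OF w] w by (simp add: uncurried_ob)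
  next
    fix w w' k e assume e: "arr (\<K> T) w w' k e"
    then have w: "w \<in> Ob (\<K> T)" "w' \<in> Ob (\<K> T)" "k \<in> cmaps (fst (fst w)) (fst (fst w'))"
      "compmap (fst (fst w)) (snd (fst w')) k = snd (fst w)" "compmap (fst (fst w)) (snd (snd w')) k = snd (snd w)"
      by (simp_all add: space_prod_arr)
    have "compmap (fst (fst w)) (snd (fst (uncurried Y T f) w')) k = snd (fst (uncurried Y T f) w)"
    proof (rule extensionalityI[OF compmap_extensional])
      show "snd (fst (uncurried Y T f) w) \<in> extensional (topspace (fst (fst w)))" using w(1) by (simp add: uncurried_ob)
      fix s assume s: "s \<in> topspace (fst (fst w))"
      then show "compmap (fst (fst w)) (snd (fst (uncurried Y T f) w')) k s = snd (fst (uncurried Y T f) w) s"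
        using w(1,2) cmaps_image[OF w(3) s] fun_cong[OF w(4), of s] fun_cong[OF w(5), of s]
        by (simp add: uncurried_ob compmap_apply)
    qed
    then show "arr \<J> (fst (uncurried Y T f) w) (fst (uncurried Y T f) w') k (snd (uncurried Y T f) e)"
      using ob[OF w(1)] ob[OF w(2)] w by (simp add: uncurried_arr[OF e] space_stack_arr uncurried_ob)
  next
    fix w w' w'' k l e g assume e: "arr (\<K> T) w w' k e" and g: "arr (\<K> T) w' w'' l g"
    have w: "w \<in> Ob (\<K> T)" using e by (simp add: space_prod_arr)
    show "snd (uncurried Y T f) (cmp (\<K> T) g e) = cmp \<J> (snd (uncurried Y T f) g) (snd (uncurried Y T f) e)"
      using uncurried_arr[OF arr_cmp[OF sitecat_space_prod e g]] w
      by (simp add: uncurried_arr[OF e] uncurried_arr[OF g] space_stack_cmp uncurried_ob)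
  qed
qed

lemma exponential_law_ob: "x \<in> Ob \<N> \<Longrightarrow> fst \<E> x = (fst x, uncurried Y (fst x) (snd x))"
  by (cases x) (simp add: exponential_law_def Let_def)

lemma exponential_law_arr:
  assumes a: "arr \<N> x y h a"
  shows "snd \<E> a = (fst \<E> x, (h, \<lambda>u\<in>Ob (\<K> (fst x)). ident \<J> (fst (uncurried Y (fst x) (snd x)) u)), fst \<E> y)"
proof -
  have a': "a = (x, h, y)" "x \<in> Ob \<N>" "y \<in> Ob \<N>" using a by (simp_all add: space_stack_arr)
  show ?thesis using arrD(1)[OF a] unfolding a'(1) exponential_law_ob[OF a'(2)] exponential_law_ob[OF a'(3)]
    by (cases x; cases y) (simp add: exponential_law_def Let_def)
qed

lemma uncurried_change:
  assumes a: "arr \<N> x y h a"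
  shows "v \<in> Ob (\<K> (fst x)) \<Longrightarrow>
      fst (uncurried Y (fst y) (snd y)) (fst (\<L> (fst x) h) v) = fst (uncurried Y (fst x) (snd x)) v"
    "arr (\<K> (fst x)) v v' k e \<Longrightarrow>
      snd (uncurried Y (fst y) (snd y)) (snd (\<L> (fst x) h) e) = snd (uncurried Y (fst x) (snd x)) e"
proof -
  have a': "h \<in> cmaps (fst x) (fst y)" "compmap (fst x) (snd y) h = snd x" using a by (simp_all add: space_stack_arr)
  note Q = prod_with_id_morphism[OF a'(1), of Y]
  show o: "fst (uncurried Y (fst y) (snd y)) (fst (\<L> (fst x) h) v) = fst (uncurried Y (fst x) (snd x)) v" if v: "v \<in> Ob (\<K> (fst x))" for v
  proof -
    have c: "snd (fst v) \<in> cmaps (fst (fst v)) (fst x)" using v by (simp add: space_prod_Ob)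
    have "snd y (h (snd (fst v) s)) = snd x (snd (fst v) s)" if "s \<in> topspace (fst (fst v))" for s
      using fun_cong[OF a'(2), of "snd (fst v) s"] cmaps_image[OF c that] by (simp add: compmap_apply)
    then show ?thesis using v fm_ob[OF Q v]
      by (simp add: uncurried_ob prod_with_id_ob compmap_apply cong: restrict_cong)
  qed
  assume e: "arr (\<K> (fst x)) v v' k e"
  then have "v \<in> Ob (\<K> (fst x))" "v' \<in> Ob (\<K> (fst x))" by (simp_all add: space_prod_arr)
  then show "snd (uncurried Y (fst y) (snd y)) (snd (\<L> (fst x) h) e) = snd (uncurried Y (fst x) (snd x)) e"
    by (simp add: uncurried_arr[OF e] uncurried_arr[OF fm_arr[OF Q e]] o)
qed

lemma exponential_law_Ob: "x \<in> Ob \<N> \<Longrightarrow> fst \<E> x \<in> Ob \<H>"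
  using uncurried_morphism[of "fst x" "snd x"]
  by (simp add: exponential_law_ob map_stack_Ob[OF Y(1) fibered_space_stack] space_stack_Ob)

lemma exponential_law_Ar:
  assumes a: "arr \<N> x y h a"
  shows "arr \<H> (fst \<E> x) (fst \<E> y) h (snd \<E> a)"
proof -
  have a': "x \<in> Ob \<N>" "y \<in> Ob \<N>" "h \<in> cmaps (fst x) (fst y)" using a by (simp_all add: space_stack_arr)
  have T: "cg (fst x)" "snd x \<in> cmaps (fst x) (mapping_space Y X)" using a'(1) by (simp_all add: space_stack_Ob)
  have "map_arrow Y \<J> (fst \<E> x) (fst \<E> y) h (\<lambda>u\<in>Ob (\<K> (fst x)). ident \<J> (fst (uncurried Y (fst x) (snd x)) u))"
    using map_arrow_identity[OF Y(1) fibered_space_stack, where m = "fst \<E> x" and n = "fst \<E> y" and h = h] uncurried_morphism[OF T] uncurried_change[OF a]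
    by (simp add: exponential_law_ob[OF a'(1)] exponential_law_ob[OF a'(2)])
  then show ?thesis
    using exponential_law_Ob[OF a'(1)] exponential_law_Ob[OF a'(2)] a'(3)
    unfolding map_stack_arr[OF Y(1) fibered_space_stack] exponential_law_arr[OF a]
    by (simp add: exponential_law_ob[OF a'(1)] exponential_law_ob[OF a'(2)])
qed

context
  fixes \<X> :: "('u, 'o, 'm) fibcat" and F :: "(('u, 'b) sobj, ('u, 'b) sarr, 'o, 'm) fibfun"
  assumes X: "fibered_in_groupoids \<X>" and F: "fib_morphism \<J> \<X> F"
begin

private abbreviation "\<M>X \<equiv> map_stack (space_stack Y :: ('u, _, _) fibcat) \<X>"
private abbreviation "\<Phi> \<equiv> map_pushforward Y X F"

lemma map_pushforward_ob: "x \<in> Ob \<N> \<Longrightarrow> fst \<Phi> x = (fst x, fib_comp (\<K> (fst x)) F (uncurried Y (fst x) (snd x)))"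
  using exponential_law_Ob[of x] by (simp add: map_pushforward_def fib_comp_simps map_postcomp_def Let_def exponential_law_ob)

lemma map_pushforward_arr:
  assumes a: "arr \<N> x y h a"
  shows "snd \<Phi> a = (fst \<Phi> x, (h, \<lambda>u\<in>Ob (\<K> (fst x)). ident \<X> (fst (snd (fst \<Phi> x)) u)), fst \<Phi> y)"
proof -
  have a': "x \<in> Ob \<N>" "y \<in> Ob \<N>" using a by (simp_all add: space_stack_arr)
  have T: "cg (fst x)" "snd x \<in> cmaps (fst x) (mapping_space Y X)" using a'(1) by (simp_all add: space_stack_Ob)
  note U = uncurried_morphism[OF T]
  have "(\<lambda>u\<in>Ob (\<K> (fst x)). snd F ((\<lambda>u\<in>Ob (\<K> (fst x)). ident \<J> (fst (uncurried Y (fst x) (snd x)) u)) u)) =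
      (\<lambda>u\<in>Ob (\<K> (fst x)). ident \<X> (fst (snd (fst \<Phi> x)) u))"
    by (rule restrict_ext) (simp add: fm_ident[OF F fm_ob[OF U]] map_pushforward_ob[OF a'(1)] fib_comp_simps)
  moreover have "(fst x, uncurried Y (fst x) (snd x)) \<in> Ob \<H>" "(fst y, uncurried Y (fst y) (snd y)) \<in> Ob \<H>"
    using exponential_law_Ob[OF a'(1)] exponential_law_Ob[OF a'(2)] by (simp_all add: exponential_law_ob[OF a'(1)] exponential_law_ob[OF a'(2)])
  ultimately show ?thesis
    using arrD(1)[OF a] arrD(1)[OF exponential_law_Ar[OF a]]
    by (simp add: map_pushforward_def fib_comp_simps map_postcomp_def Let_def exponential_law_arr[OF a]
        exponential_law_ob[OF a'(1)] exponential_law_ob[OF a'(2)] a')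
qed

text \<open>
  Both sides evaluate \<open>F\<close> on the evaluation map; this is where the exponential law enters.
\<close>

lemma map_pushforward_power:
  "x \<in> Ob \<N> \<Longrightarrow> fst (map_power Y \<X>) (fst \<Phi> x) = fst F (fst (space_power Y) x)"
  "a \<in> Ar \<N> \<Longrightarrow> snd (map_power Y \<X>) (snd \<Phi> a) = snd F (snd (space_power Y) a)"
proof -
  have v: "fst (uncurried Y (fst x) (snd x)) (prod_point (fst x) Y) = fst (space_power Y) x" if x: "x \<in> Ob \<N>" for x
    using x prod_point_Ob[OF Y(1), of "fst x"] by (simp add: space_stack_Ob uncurried_ob space_power_simps)
      (simp add: prod_point_def kuncurry_def)
  show o: "fst (map_power Y \<X>) (fst \<Phi> x) = fst F (fst (space_power Y) x)" if x: "x \<in> Ob \<N>" for x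
    using x prod_point_Ob[OF Y(1), of "fst x"] v[OF x]
    by (simp add: map_pushforward_ob map_power_simps[OF Y(1) X] fib_comp_simps space_stack_Ob)
  assume "a \<in> Ar \<N>"
  from arrI[OF this] obtain x h y where a: "arr \<N> x y h a" by blast
  have a': "a = (x, h, y)" "x \<in> Ob \<N>" "y \<in> Ob \<N>" "h \<in> cmaps (fst x) (fst y)" using a by (simp_all add: space_stack_arr)
  have T: "cg (fst x)" "cg (fst y)" using a'(2,3) by (simp_all add: space_stack_Ob)
  note pc = point_change_arr[OF Y(1) T a'(4)] and pp = prod_point_Ob[OF Y(1) T(1)]
  have "snd (space_power Y) a = (fst (space_power Y) x, ktimes (fst x) (fst y) Y h, fst (space_power Y) y)"
    by (simp add: a'(1) space_power_simps)
  also have "\<dots> = snd (uncurried Y (fst y) (snd y)) (point_change (fst x) (fst y) Y h)"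
    using uncurried_change(1)[OF a pp] by (simp add: uncurried_arr[OF pc] v[OF a'(2)] v[OF a'(3)])
  finally have s: "snd (space_power Y) a = snd (uncurried Y (fst y) (snd y)) (point_change (fst x) (fst y) Y h)" .
  have "arr \<J> (fst (space_power Y) x) (fst (space_power Y) y) (ktimes (fst x) (fst y) Y h) (snd (space_power Y) a)"
    using power_arr[OF power_mapping_space[OF Y, of X] a] by simp
  from cmp_ident_right[OF fibered_sitecat[OF X] fm_arr[OF F this]]
  show "snd (map_power Y \<X>) (snd \<Phi> a) = snd F (snd (space_power Y) a)"
    using pp arrD(1)[OF pc] v[OF a'(2)] s
    by (simp add: map_pushforward_arr[OF a] map_power_simps[OF Y(1) X] map_pushforward_ob[OF a'(2)] map_pushforward_ob[OF a'(3)] fib_comp_simps)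
qed

lemma map_pushforward_morphism: "fib_morphism \<N> \<M>X \<Phi>"
proof (rule power_functorI[OF power_map_stack[OF Y(1) X] sitecat_space_stack])
  note P = power_mapping_space[OF Y, of X] and S = sitecat_space_stack[of "mapping_space Y X"]
  show "fst \<Phi> \<in> extensional (Ob \<N>)" "snd \<Phi> \<in> extensional (Ar \<N>)" by (simp_all add: map_pushforward_def fib_comp_def)
  have U: "fib_morphism (\<K> (fst x)) \<X> (snd (fst \<Phi> x))" if "x \<in> Ob \<N>" for x
    using that fib_morphism_comp[OF sitecat_space_prod uncurried_morphism F, of "fst x" "snd x"] by (simp add: map_pushforward_ob space_stack_Ob)
  show ob: "fst \<Phi> x \<in> Ob \<M>X \<and> base \<M>X (fst \<Phi> x) = base \<N> x" if x: "x \<in> Ob \<N>" for x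
    using x U[OF x] by (simp add: map_pushforward_ob map_stack_Ob[OF Y(1) X] map_stack_base[OF Y(1) X] space_stack_Ob)
  show "arr \<M>X (fst \<Phi> x) (fst \<Phi> y) h (snd \<Phi> a)" if a: "arr \<N> x y h a" for x y h a
  proof -
    have a': "x \<in> Ob \<N>" "y \<in> Ob \<N>" "h \<in> cmaps (fst x) (fst y)" using a by (simp_all add: space_stack_arr)
    note Q = prod_with_id_morphism[OF a'(3), of Y]
    have "map_arrow Y \<X> (fst \<Phi> x) (fst \<Phi> y) h (\<lambda>u\<in>Ob (\<K> (fst (fst \<Phi> x))). ident \<X> (fst (snd (fst \<Phi> x)) u))"
    proof (rule map_arrow_identity[OF Y(1) X])
      show "fib_morphism (\<K> (fst (fst \<Phi> x))) \<X> (snd (fst \<Phi> x))" using U[OF a'(1)] by (simp add: map_pushforward_ob[OF a'(1)])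
    next
      fix w assume "w \<in> Ob (\<K> (fst (fst \<Phi> x)))"
      then have w: "w \<in> Ob (\<K> (fst x))" by (simp add: map_pushforward_ob[OF a'(1)])
      show "fst (snd (fst \<Phi> y)) (fst (\<L> (fst (fst \<Phi> x)) h) w) = fst (snd (fst \<Phi> x)) w"
        using w fm_ob[OF Q w] uncurried_change(1)[OF a w] by (simp add: map_pushforward_ob a'(1,2) fib_comp_simps)
    next
      fix w w' k e assume "arr (\<K> (fst (fst \<Phi> x))) w w' k e"
      then have e: "arr (\<K> (fst x)) w w' k e" by (simp add: map_pushforward_ob[OF a'(1)])
      show "snd (snd (fst \<Phi> y)) (snd (\<L> (fst (fst \<Phi> x)) h) e) = snd (snd (fst \<Phi> x)) e"
        using arrD(1)[OF e] arrD(1)[OF fm_arr[OF Q e]] uncurried_change(2)[OF a e] by (simp add: map_pushforward_ob a'(1,2) fib_comp_simps)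
    qed
    then show ?thesis
      using ob[OF a'(1)] ob[OF a'(2)] a'(3) unfolding map_stack_arr[OF Y(1) X] map_pushforward_arr[OF a]
      by (simp add: map_pushforward_ob a'(1,2))
  qed
  show "snd (map_power Y \<X>) (snd \<Phi> (ident \<N> x)) = ident \<X> (fst (map_power Y \<X>) (fst \<Phi> x))" if x: "x \<in> Ob \<N>" for x
    using map_pushforward_power(2)[OF arrD(1)[OF arr_ident[OF S x]]] power_ob(1,3)[OF P x] fm_ident[OF F] map_pushforward_power(1)[OF x] by simp
  show "snd (map_power Y \<X>) (snd \<Phi> (cmp \<N> b a)) = cmp \<X> (snd (map_power Y \<X>) (snd \<Phi> b)) (snd (map_power Y \<X>) (snd \<Phi> a))"
    if a: "arr \<N> x y h a" and b: "arr \<N> y z k b" for x y z h k a b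
    using map_pushforward_power(2)[OF arrD(1)[OF arr_cmp[OF S a b]]] map_pushforward_power(2)[OF arrD(1)[OF a]]
      map_pushforward_power(2)[OF arrD(1)[OF b]] power_cmp[OF P a b] fm_cmp[OF F power_arr[OF P a] power_arr[OF P b]] by simp
qed

end
end
end
end

section \<open>Change of classifying space\<close>

lemma space_morphism_simps:
  "x \<in> Ob (space_stack Z :: ('u, _, _) fibcat) \<Longrightarrow> fst (space_morphism Z q :: (('u, _) sobj, _, _, _) fibfun) x = (fst x, compmap (fst x) q (snd x))"
  "arr (space_stack Z :: ('u, _, _) fibcat) x y h a \<Longrightarrow>
     snd (space_morphism Z q) a = (fst (space_morphism Z q) x, h, fst (space_morphism Z q) y)"
proof -
  show o: "fst (space_morphism Z q :: (('u, _) sobj, _, _, _) fibfun) x = (fst x, compmap (fst x) q (snd x))"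
    if "x \<in> Ob (space_stack Z :: ('u, _, _) fibcat)" for x
    using that by (cases x) (simp add: space_morphism_def Let_def compmap_def)
  assume a: "arr (space_stack Z :: ('u, _, _) fibcat) x y h a"
  then have a': "a = (x, h, y)" "x \<in> Ob (space_stack Z :: ('u, _, _) fibcat)" "y \<in> Ob (space_stack Z :: ('u, _, _) fibcat)"
    by (simp_all add: space_stack_arr)
  show "snd (space_morphism Z q) a = (fst (space_morphism Z q) x, h, fst (space_morphism Z q) y)"
    using arrD(1)[OF a] unfolding o[OF a'(2)] o[OF a'(3)] a'(1)
    by (cases x; cases y) (simp add: space_morphism_def Let_def compmap_def)
qed

lemma compmap_continuous:
  assumes f: "f \<in> cmaps S P" and q: "continuous_map P Q q"
  shows "compmap S q f \<in> cmaps S Q"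
proof -
  have "compmap S (restrict q (topspace P)) f = compmap S q f"
    using cmaps_image[OF f] by (simp add: compmap_def compose_def cong: restrict_cong)
  moreover have "restrict q (topspace P) \<in> cmaps P Q" using q by (simp add: cmaps_def)
  ultimately show ?thesis using compmap_cmaps[OF f, of "restrict q (topspace P)" Q] by simp
qed

lemma space_morphism_homeomorphism:
  fixes Z :: "'a topology" and Z' :: "'b topology" and j i
  defines "G \<equiv> space_morphism Z j :: (('u, 'a) sobj, ('u, 'a) sarr, ('u, 'b) sobj, ('u, 'b) sarr) fibfun"
  assumes hm: "homeomorphic_maps Z Z' j i"
  shows "b \<in> Ob (space_stack Z') \<Longrightarrow> \<exists>a\<in>Ob (space_stack Z). fst G a = b"
    "a \<in> Ob (space_stack Z) \<Longrightarrow> a' \<in> Ob (space_stack Z) \<Longrightarrow> arr (space_stack Z') (fst G a) (fst G a') h e \<Longrightarrow>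
      \<exists>!c. arr (space_stack Z) a a' h c \<and> snd G c = e"
proof -
  let ?A = "space_stack Z :: ('u, _, _) fibcat" and ?B = "space_stack Z' :: ('u, _, _) fibcat"
  have c: "continuous_map Z Z' j" "continuous_map Z' Z i" "\<And>z. z \<in> topspace Z \<Longrightarrow> i (j z) = z" "\<And>z. z \<in> topspace Z' \<Longrightarrow> j (i z) = z"
    using hm by (simp_all add: homeomorphic_maps_def)
  show "\<exists>a\<in>Ob ?A. fst G a = b" if b: "b \<in> Ob ?B"
  proof -
    have o: "(fst b, compmap (fst b) i (snd b)) \<in> Ob ?A" using b by (simp add: space_stack_Ob compmap_continuous[OF _ c(2)])
    have "compmap (fst b) j (compmap (fst b) i (snd b)) = snd b"
      using b c(4) cmaps_image[of "snd b" "fst b" Z']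
      by (intro extensionalityI[OF compmap_extensional]) (auto simp: space_stack_Ob cmaps_def compmap_apply)
    then show ?thesis using o by (intro bexI[OF _ o]) (simp add: G_def space_morphism_simps(1))
  qed
  show "\<exists>!c. arr ?A a a' h c \<and> snd G c = e" if a: "a \<in> Ob ?A" "a' \<in> Ob ?A" and e: "arr ?B (fst G a) (fst G a') h e"
  proof -
    have B: "e = (fst G a, h, fst G a')" "h \<in> cmaps (fst a) (fst a')"
      "compmap (fst a) (compmap (fst a') j (snd a')) h = compmap (fst a) j (snd a)"
      using e a by (simp_all add: space_stack_arr G_def space_morphism_simps(1))
    have m: "snd a \<in> cmaps (fst a) Z" "snd a' \<in> cmaps (fst a') Z" using a by (simp_all add: space_stack_Ob)
    have "compmap (fst a) (snd a') h = snd a"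
    proof (rule cmaps_ext[OF compmap_cmaps[OF B(2) m(2)] m(1)])
      fix s assume s: "s \<in> topspace (fst a)"
      have "j (snd a' (h s)) = j (snd a s)" using fun_cong[OF B(3), of s] s cmaps_image[OF B(2) s] by (simp add: compmap_apply)
      then have "snd a' (h s) = snd a s"
        using c(3)[OF cmaps_image[OF m(1) s]] c(3)[OF cmaps_image[OF m(2) cmaps_image[OF B(2) s]]] by simp
      then show "compmap (fst a) (snd a') h s = snd a s" using s by (simp add: compmap_apply)
    qed
    then have A: "arr ?A a a' h (a, h, a')" using a B(2) by (simp add: space_stack_arr)
    show ?thesis
    proof (rule ex1I[of _ "(a, h, a')"])
      show "arr ?A a a' h (a, h, a') \<and> snd G (a, h, a') = e" using A B(1) by (simp add: G_def space_morphism_simps(2)[OF A])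
    qed (simp add: space_stack_arr)
  qed
qed

text \<open>
  A universal arrow from \<open>K\<close> to a point of \<open>X'\<close> is the same as one from \<open>X'\<close> to a point of \<open>K\<close>: both
  represent the fiber product of the two morphisms, whose projections they exchange.
\<close>

lemma universal_arrow_swap:
  fixes K X' :: "'u topology" and \<X> :: "('u, 'o, 'm) fibcat"
  assumes X: "fibered_in_groupoids \<X>" and K: "cg K" and X': "cg X'"
    and F: "fib_morphism (space_stack K) \<X> F" and G: "fib_morphism (space_stack X') \<X> G"
    and U: "universal_arrow (space_stack K) \<X> F (fst G (X', idmap X')) w \<beta>"
  shows "\<exists>\<gamma>. universal_arrow (space_stack X') \<X> G (fst F (K, idmap K)) (fst w, bmap \<X> \<beta>) \<gamma>"
proof -
  note FK = fibered_space_stack[of K] and FX = fibered_space_stack[of X']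
  obtain \<alpha> where a: "((fst w, bmap \<X> \<beta>), w, \<alpha>) \<in> Ob (fiber_product (space_stack X') (space_stack K) \<X> G F)"
    "cmp \<X> \<beta> \<alpha> = snd G (bang (space_stack X') (X', idmap X') (fst w, bmap \<X> \<beta>))"
    using arrow_to_point[OF FK X F X' G universal_arrowD[OF U]] by auto
  have "terminal (fiber_product (space_stack X') (space_stack K) \<X> G F) ((fst w, bmap \<X> \<beta>), w, \<alpha>)"
    using terminal_point_iff[OF FK X F X' G a(1), of \<beta>] universal_arrowD(2)[OF U] a(2) U by simp
  from terminal_fiber_product_swap[OF FX FK X G F this]
  obtain \<alpha>' where t: "terminal (fiber_product (space_stack K) (space_stack X') \<X> F G) (w, (fst w, bmap \<X> \<beta>), \<alpha>')" by blast
  from point_to_arrow[OF FX X G K F terminal_ob[OF t]] terminal_point_iff[OF FX X G K F terminal_ob[OF t]] t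
  show ?thesis by blast
qed

text \<open>The span is the fiber product of the two morphisms.\<close>

lemma classifying_spaces_equivalent:
  fixes K X' :: "'u topology" and \<X> :: "('u, 'o, 'm) fibcat"
  assumes K: "classifying_space \<X> K F" and X': "classifying_space \<X> X' G"
  shows "\<exists>(W :: 'u topology) p q. cg W \<and> weak_equivalence W K p \<and> weak_equivalence W X' q"
proof -
  let ?A = "space_stack K :: ('u, _, _) fibcat" and ?B = "space_stack X' :: ('u, _, _) fibcat"
  let ?k = "(K, idmap K)" and ?x = "(X', idmap X')"
  have X: "fibered_in_groupoids \<X>" and c: "cg K" "cg X'"
    and uF: "universal_weak_equivalence ?A \<X> F" and uG: "universal_weak_equivalence ?B \<X> G"
    using K X' by (simp_all add: classifying_space_def is_stack_def)
  have F: "fib_morphism ?A \<X> F" and G: "fib_morphism ?B \<X> G"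
    using uF uG by (simp_all add: universal_weak_equivalence_def representable_def)
  note uF' = uF[unfolded universal_weak_equivalence_iff[OF fibered_space_stack X F] representable_iff[OF fibered_space_stack X F]]
    and uG' = uG[unfolded universal_weak_equivalence_iff[OF fibered_space_stack X G]]
  have k: "?k \<in> Ob ?A" "?x \<in> Ob ?B" using c by (simp_all add: space_stack_Ob idmap_cmaps)
  obtain w \<beta> where U: "universal_arrow ?A \<X> F (fst G ?x) w \<beta>" using conjunct1[OF uF'] fm_ob[OF G k(2)] by blast
  obtain \<gamma> where V: "universal_arrow ?B \<X> G (fst F ?k) (fst w, bmap \<X> \<beta>) \<gamma>"
    using universal_arrow_swap[OF X c F G U] by blast
  have "weak_equivalence (fst w) X' (bmap \<X> \<beta>)"
    using conjunct2[OF uF', rule_format, OF U] fm_base[OF G k(2)] by simp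
  moreover have "weak_equivalence (fst w) K (bmap \<X> \<gamma>)"
    using conjunct2[OF uG', rule_format, OF V] fm_base[OF F k(1)] by simp
  moreover have "cg (fst w)" using universal_arrowD(1)[OF U] by (simp add: space_stack_Ob)
  ultimately show ?thesis by blast
qed


section \<open>Mapping stacks into paratopological stacks\<close>

theorem corollary6p5:
  fixes Y X :: "'u topology"
    and \<X> :: "('u, 'o, 'm) fibcat"
    and \<phi> :: "(('u, 'u) sobj, ('u, 'u) sarr, 'o, 'm) fibfun"
  assumes "grothendieck_universe TYPE('u)"
    and "cg_space TYPE('u) Y" and "paracompact_space Y"
    and "paratopological \<X>"
    and "classifying_space \<X> X \<phi>"
    and "weakly_parashrinkable (space_stack X) \<X> \<phi>"
  shows "classifying_space (map_stack (space_stack Y) \<X>) (mapping_space Y X)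
           (map_pushforward Y X \<phi>) \<and>
         represents_weak_homotopy_type (map_stack (space_stack Y) \<X>) (mapping_space Y X)"
proof -
  interpret universe "TYPE('u)" by (unfold_locales) (rule assms(1))
  note Y = assms(2) and HY = paracompact_imp_Hausdorff[OF assms(3)]
  have St: "is_stack \<X>" and D: "representable \<X> (fib_prod \<X> \<X>) (diagonal \<X>)" and cX: "cg_space TYPE('u) X"
    using assms(5) by (simp_all add: classifying_space_def has_representable_diagonal_def)
  have X: "fibered_in_groupoids \<X>" using St by (simp add: is_stack_def)
  let ?M = "map_stack (space_stack Y) \<X>" and ?N = "space_stack (mapping_space Y X) :: ('u, _, _) fibcat" and ?S = "space_stack X :: ('u, _, _) fibcat"
  let ?U = "map_power Y \<X>" and ?F = "map_pushforward Y X \<phi>"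
  note P = power_map_stack[OF Y X]
  have M: "fibered_in_groupoids ?M" by (rule fibered_power[OF Y X P])
  have \<phi>: "fib_morphism ?S \<X> \<phi>"
    using assms(6) by (simp_all add: weakly_parashrinkable_def representable_def)
  note Fm = map_pushforward_morphism[OF Y HY X \<phi>]
  note comm = map_pushforward_power[OF Y HY X \<phi>]
  note PN = power_mapping_space[OF Y HY, of X]
  have D': "representable ?M (fib_prod ?M ?M) (diagonal ?M)"
    by (rule representable_power[OF Y HY X fibered_fib_prod[OF X X] P power_prod[OF P] diagonal_morphism[OF fibered_sitecat[OF X]]
          diagonal_morphism[OF fibered_sitecat[OF M]] _ _ D])
      (use power_ob(1)[OF P] arrD(1)[OF power_arr[OF P arrI]] in \<open>simp_all add: diagonal_def\<close>)
  note cN = cg_mapping_space[OF Y cX]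
  have C: "classifying_space ?M (mapping_space Y X) ?F"
    using stack_power[OF Y St P] D' cN
      universal_weak_equivalence_power[OF Y HY fibered_space_stack X PN P \<phi> Fm comm assms(6,3) fibered_space_stack M]
    unfolding classifying_space_def has_representable_diagonal_def by blast
  let ?Z = "ucopy (mapping_space Y X) :: 'u topology" and ?j = "udec (topspace (mapping_space Y X)) :: 'u \<Rightarrow> 'u \<Rightarrow> 'u"
  let ?K = "space_stack ?Z :: ('u, _, _) fibcat" and ?G = "space_morphism ?Z ?j :: (('u, _) sobj, _, _, _) fibfun"
  let ?F' = "fib_comp ?K ?F ?G"
  have hm: "homeomorphic_maps ?Z (mapping_space Y X) ?j (uenc (topspace (mapping_space Y X)))"
    by (rule homeomorphic_maps_sym[THEN iffD1, OF homeomorphic_maps_ucopy[OF cg_small[OF cN]]])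
  have G: "fib_morphism ?K ?N ?G" using hm by (intro space_morphism_fib) (simp add: homeomorphic_maps_def)
  let ?V = "(fst (space_power Y) \<circ> fst ?G, snd (space_power Y) \<circ> snd ?G)"
  note PK = power_isomorphic[OF PN sitecat_space_stack G space_morphism_homeomorphism[OF hm]]
  have c1: "fst ?U (fst ?F' w) = fst \<phi> (fst ?V w)" if "w \<in> Ob ?K" for w
    using comm(1)[OF fm_ob[OF G that]] that by (simp add: fib_comp_simps)
  have c2: "snd ?U (snd ?F' a) = snd \<phi> (snd ?V a)" if "a \<in> Ar ?K" for a
    using comm(2)[OF arrD(1)[OF fm_arr[OF G arrI[OF that]]]] that by (simp add: fib_comp_simps)
  have "universal_weak_equivalence ?K ?M ?F'"
    by (rule universal_weak_equivalence_power[OF Y HY fibered_space_stack X PK P \<phi> fib_morphism_comp[OF sitecat_space_stack G Fm]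
          c1 c2 assms(6,3) fibered_space_stack M])
  then have CK: "classifying_space ?M ?Z ?F'"
    using C cg_space_ucopy[OF cN] unfolding classifying_space_def by blast
  have "same_weak_homotopy_type TYPE('u) (mapping_space Y X) X'" if X': "classifying_space ?M X' \<psi>" for X' :: "'u topology" and \<psi>
  proof -
    obtain W :: "'u topology" and p q where w: "cg_space TYPE('u) W" "weak_equivalence W ?Z p" "weak_equivalence W X' q"
      using classifying_spaces_equivalent[OF CK X'] by blast
    from weak_equivalence_compose[OF w(2) weak_equivalence_homeomorphism[OF hm] refl] w(1,3)
    show ?thesis unfolding same_weak_homotopy_type_def by blast
  qed
  then show ?thesis using C CK unfolding represents_weak_homotopy_type_def by blast
qed

end
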